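(* Let $X$ be a $2\times n$ matrix with linear entries in a polynomial ring $S$ over a field $K$ (with $n\ge 2$). Assume that $I_2(X)$ has height $n-1$. Then $I_2(X)$ has linear powers. In particular, the defining ideal of any rational normal scroll has linear powers.
   Context: $I_2(X)$ denotes the ideal generated by the $2$-minors of $X$; linear entries means that the entries are linear forms (zero allowed). A homogeneous ideal $I$ in a polynomial ring $S$ has linear powers if all its powers have a linear resolution, i.e. all minimal generators of $I$ have the same degree $d$ and the Castelnuovo-Mumford regularity satisfies $\operatorname{reg}(I^k)=kd$ for all integers $k\ge1$ (the zero ideal is regarded as trivially having linear powers). A projective variety has linear powers when its defining ideal does. The rational normal scroll associated with a sequence of positive integers $a_1,\dots,a_r$ is the variety in $\mathbf P^{a_1+\cdots+a_r+r-1}$ with homogeneous coordinates $x_{i,j}$ ($1\le i\le r$, $0\le j\le a_i$) whose defining ideal is generated by the $2$-minors of the $2\times(a_1+\cdots+a_r)$ matrix obtained by concatenating the blocks $\begin{pmatrix} x_{i,0}&x_{i,1}&\cdots&x_{i,a_i-1}\\ x_{i,1}&x_{i,2}&\cdots&x_{i,a_i}\end{pmatrix}$, $i=1,\dots,r$. *)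

theory Defs
  imports
    "HOL-Library.Poly_Mapping"
    "HOL-Library.Extended_Nat"
    "HOL-Algebra.Ideal_Product"
    "Jordan_Normal_Form.Determinant"
    "Jordan_Normal_Form.DL_Submatrix"
begin

section \<open>Standard graded polynomial rings\<close>

type_synonym ('v, 'k) mpoly = "('v \<Rightarrow>\<^sub>0 nat) \<Rightarrow>\<^sub>0 'k"

text \<open>
  The polynomial ring \<open>K[V]\<close> is the subring of all polynomials with indeterminates in the type
  \<open>'v\<close> that involve only indeterminates from the set \<open>V\<close>. The number of indeterminates is
  thus an ordinary term-level quantity rather than the cardinality of a type.
\<close>

definition mpoly_ring :: "'v set \<Rightarrow> ('v, 'k::field) mpoly ring" where
  "mpoly_ring V = \<lparr> carrier = {p. \<forall>m \<in> Poly_Mapping.keys p. Poly_Mapping.keys m \<subseteq> V},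
     monoid.mult = (*), one = 1, zero = 0, add = (+) \<rparr>"

definition Var :: "'v \<Rightarrow> ('v, 'k::field) mpoly" where
  "Var v = Poly_Mapping.single (Poly_Mapping.single v 1) 1"

definition monom_deg :: "('v \<Rightarrow>\<^sub>0 nat) \<Rightarrow> nat" where
  "monom_deg m = (\<Sum>v \<in> Poly_Mapping.keys m. Poly_Mapping.lookup m v)"

text \<open>The zero polynomial is homogeneous of every degree, and the only one of negative degree.\<close>

definition homogeneous :: "int \<Rightarrow> ('v, 'k::field) mpoly \<Rightarrow> bool" where
  "homogeneous d p \<longleftrightarrow> (\<forall>m \<in> Poly_Mapping.keys p. int (monom_deg m) = d)"

definition linear_form :: "'v set \<Rightarrow> ('v, 'k::field) mpoly \<Rightarrow> bool" where
  "linear_form V p \<longleftrightarrow> p \<in> carrier (mpoly_ring V) \<and> homogeneous 1 p"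

lemma mpoly_ring_simps [simp]:
  "p \<in> carrier (mpoly_ring V) \<longleftrightarrow> (\<forall>m \<in> Poly_Mapping.keys p. Poly_Mapping.keys m \<subseteq> V)"
  "monoid.mult (mpoly_ring V) = (*)" "one (mpoly_ring V) = 1"
  "zero (mpoly_ring V) = 0" "add (mpoly_ring V) = (+)"
  by (auto simp: mpoly_ring_def)

lemma cring_mpoly_ring: "cring (mpoly_ring V :: ('v, 'k::field) mpoly ring)"
proof -
  have add: "p + q \<in> carrier (mpoly_ring V)"
    if "p \<in> carrier (mpoly_ring V)" "q \<in> carrier (mpoly_ring V)" for p q :: "('v, 'k) mpoly"
    using that Poly_Mapping.keys_add[of p q] by auto
  have mult: "p * q \<in> carrier (mpoly_ring V)"
    if "p \<in> carrier (mpoly_ring V)" "q \<in> carrier (mpoly_ring V)" for p q :: "('v, 'k) mpoly"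
  proof -
    have "Poly_Mapping.keys m \<subseteq> V" if m: "m \<in> Poly_Mapping.keys (p * q)" for m
    proof -
      obtain a b where "m = a + b" "a \<in> Poly_Mapping.keys p" "b \<in> Poly_Mapping.keys q"
        using m Poly_Mapping.keys_mult[of p q] by auto
      then show ?thesis
        using \<open>p \<in> _\<close> \<open>q \<in> _\<close> Poly_Mapping.keys_add[of a b] by fastforce
    qed
    then show ?thesis by auto
  qed
  have neg: "\<exists>q \<in> carrier (mpoly_ring V). q + p = 0"
    if "p \<in> carrier (mpoly_ring V)" for p :: "('v, 'k) mpoly"
    using that by (intro bexI[of _ "- p"]) (auto simp: Poly_Mapping.in_keys_iff)
  have zero: "0 \<in> carrier (mpoly_ring V)" and one: "1 \<in> carrier (mpoly_ring V)"
    by (simp_all add: keys_one)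
  show ?thesis
  proof (rule cringI)
    show "abelian_group (mpoly_ring V :: ('v, 'k) mpoly ring)"
      by (rule abelian_groupI; simp only: mpoly_ring_simps(2-))
        (rule add zero neg ab_semigroup_add_class.add_ac add_0_left | assumption)+
    show "comm_monoid (mpoly_ring V :: ('v, 'k) mpoly ring)"
      by (rule comm_monoidI; simp only: mpoly_ring_simps(2-))
        (rule mult one ab_semigroup_mult_class.mult_ac mult_1_left | assumption)+
  qed (simp only: mpoly_ring_simps(2-) distrib_right)
qed

section \<open>Height\<close>

definition prime_height :: "('a, 'b) ring_scheme \<Rightarrow> 'a set \<Rightarrow> enat" where
  "prime_height R P = (SUP k \<in> {k. \<exists>C. (\<forall>i\<le>k. primeideal (C i) R) \<and>
     (\<forall>i<k. C i \<subset> C (Suc i)) \<and> C k = P}. enat k)"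

definition ideal_height :: "('a, 'b) ring_scheme \<Rightarrow> 'a set \<Rightarrow> enat" where
  "ideal_height R I = (INF P \<in> {P. primeideal P R \<and> I \<subseteq> P}. prime_height R P)"

section \<open>Minimal graded free resolutions and regularity\<close>

definition free_module :: "'v set \<Rightarrow> nat \<Rightarrow> ('v, 'k::field) mpoly vec set" where
  "free_module V m = {v \<in> carrier_vec m. set\<^sub>v v \<subseteq> carrier (mpoly_ring V)}"

text \<open>
  The list \<open>b i\<close> of shifts encodes the graded free module \<open>F\<^sub>i\<close>, the direct sum of the
  \<open>S(- b i ! q)\<close> for \<open>q < length (b i)\<close>; the matrix \<open>\<phi> i\<close> represents the differential
  \<open>F\<^sub>i \<rightarrow> F\<^sub>i\<^sub>-\<^sub>1\<close>. Here \<open>F\<^sub>-\<^sub>1 = S\<close>, so that \<open>\<phi> 0\<close> is the augmentation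
  \<open>F\<^sub>0 \<rightarrow> I \<subseteq> S\<close>. The resolution may end at any point, by \<open>b i = []\<close>.
\<close>

definition target_shifts :: "(nat \<Rightarrow> int list) \<Rightarrow> nat \<Rightarrow> int list" where
  "target_shifts b i = (case i of 0 \<Rightarrow> [0] | Suc j \<Rightarrow> b j)"

definition graded_free_resolution ::
  "'v set \<Rightarrow> ('v, 'k::field) mpoly set \<Rightarrow> (nat \<Rightarrow> int list) \<Rightarrow> (nat \<Rightarrow> ('v, 'k) mpoly mat) \<Rightarrow> bool" where
  "graded_free_resolution V I b \<phi> \<longleftrightarrow>
     (\<forall>i. \<phi> i \<in> carrier_mat (length (target_shifts b i)) (length (b i)) \<and>
          elements_mat (\<phi> i) \<subseteq> carrier (mpoly_ring V) \<and>
          (\<forall>p < length (target_shifts b i). \<forall>q < length (b i).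
             homogeneous (b i ! q - target_shifts b i ! p) (\<phi> i $$ (p, q)))) \<and>
     (\<lambda>v. (\<phi> 0 *\<^sub>v v) $ 0) ` free_module V (length (b 0)) = I \<and>
     (\<forall>i. {v \<in> free_module V (length (b i)). \<phi> i *\<^sub>v v = 0\<^sub>v (length (target_shifts b i))} =
          (\<lambda>v. \<phi> (Suc i) *\<^sub>v v) ` free_module V (length (b (Suc i))))"

text \<open>
  Minimality: the differentials \<open>F\<^sub>i \<rightarrow> F\<^sub>i\<^sub>-\<^sub>1\<close> with \<open>i \<ge> 1\<close> have entries in the
  homogeneous maximal ideal, that is, entries without constant term. The augmentation is exempt.
\<close>

definition minimal_graded_free_resolution ::
  "'v set \<Rightarrow> ('v, 'k::field) mpoly set \<Rightarrow> (nat \<Rightarrow> int list) \<Rightarrow> (nat \<Rightarrow> ('v, 'k) mpoly mat) \<Rightarrow> bool" where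
  "minimal_graded_free_resolution V I b \<phi> \<longleftrightarrow> graded_free_resolution V I b \<phi> \<and>
     (\<forall>i \<ge> 1. \<forall>e \<in> elements_mat (\<phi> i). Poly_Mapping.lookup e 0 = 0)"

text \<open>
  The regularity is the maximum of \<open>j - i\<close> over all generator degrees \<open>j\<close> of \<open>F\<^sub>i\<close>.
  It is stated as a relation: the minimal graded free resolution is unique up to isomorphism, so it
  does not matter which one is chosen, and the zero ideal has no (finite) regularity.
\<close>

definition has_regularity :: "'v set \<Rightarrow> ('v, 'k::field) mpoly set \<Rightarrow> int \<Rightarrow> bool" where
  "has_regularity V I r \<longleftrightarrow> (\<exists>b \<phi>. minimal_graded_free_resolution V I b \<phi> \<and>
     (\<exists>i. \<exists>j \<in> set (b i). r = j - int i) \<and>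
     (\<forall>i. \<forall>j \<in> set (b i). j - int i \<le> r))"

section \<open>Linear powers\<close>

definition minimal_homogeneous_generators ::
  "'v set \<Rightarrow> ('v, 'k::field) mpoly set \<Rightarrow> ('v, 'k) mpoly set \<Rightarrow> bool" where
  "minimal_homogeneous_generators V I G \<longleftrightarrow>
     G \<subseteq> carrier (mpoly_ring V) \<and> (\<forall>g \<in> G. \<exists>d. homogeneous d g) \<and>
     genideal (mpoly_ring V) G = I \<and> (\<forall>G'. G' \<subset> G \<longrightarrow> genideal (mpoly_ring V) G' \<noteq> I)"

definition has_linear_powers :: "'v set \<Rightarrow> ('v, 'k::field) mpoly set \<Rightarrow> bool" where
  "has_linear_powers V I \<longleftrightarrow> I = {0} \<or>
     (\<exists>d::nat. (\<forall>G. minimal_homogeneous_generators V I G \<longrightarrow> (\<forall>g \<in> G. homogeneous (int d) g)) \<and>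
        (\<forall>k::nat \<ge> 1. has_regularity V (I [^]\<^bsub>ideals_set (mpoly_ring V)\<^esub> k) (int (k * d))))"

section \<open>Ideals of minors and rational normal scrolls\<close>

definition minors :: "nat \<Rightarrow> 'a::comm_ring_1 mat \<Rightarrow> 'a set" where
  "minors t X = {det (submatrix X A B) | A B. A \<subseteq> {..<dim_row X} \<and> B \<subseteq> {..<dim_col X} \<and>
     card A = t \<and> card B = t}"

definition minors_ideal :: "'v set \<Rightarrow> nat \<Rightarrow> ('v, 'k::field) mpoly mat \<Rightarrow> ('v, 'k) mpoly set" where
  "minors_ideal V t X = genideal (mpoly_ring V) (minors t X)"

text \<open>
  The sequence \<open>a\<^sub>1, \<dots>, a\<^sub>r\<close> is given as a list, and \<open>x\<^sub>i\<^sub>,\<^sub>j\<close> is \<open>Var (i - 1, j)\<close>,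
  because list positions start at 0. The second index \<open>j\<close> runs from 0 as usual.
\<close>

definition scroll_vars :: "nat list \<Rightarrow> (nat \<times> nat) set" where
  "scroll_vars a = {(i, j). i < length a \<and> j \<le> a ! i}"

definition scroll_matrix :: "nat list \<Rightarrow> (nat \<times> nat, 'k::field) mpoly mat" where
  "scroll_matrix a = mat_of_cols_list 2
     (concat (map (\<lambda>i. map (\<lambda>j. [Var (i, j), Var (i, Suc j)]) [0..<a ! i]) [0..<length a]))"

definition scroll_ideal :: "nat list \<Rightarrow> (nat \<times> nat, 'k::field) mpoly set" where
  "scroll_ideal a = minors_ideal (scroll_vars a) 2 (scroll_matrix a)"

end

theory Submission
  imports Defs "HOL-Algebra.Algebraic_Closure_Type" "HOL-Library.Function_Algebras"
begin

text \<open>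
  Castelnuovo-Mumford regularity is measured by Koszul homology: an ideal generated in degree \<open>d\<close>
  has a linear resolution once the Koszul homology of its residue class ring vanishes in coefficient
  degrees at least \<open>d\<close> (\<open>Reg\<close> below), and the resolution is then obtained by taking kernels.

  For the \<open>k\<close>-th power of the ideal \<open>I\<close> of 2-minors of the generic \<open>2 \<times> n\<close> matrix, the initial
  ideal is an intersection of \<open>k\<close>-th powers of ideals generated by variables. For such monomial ideals
  the bound \<open>2 k\<close> follows by splitting off one variable at a time, and it passes from the initial ideal
  to the ideal itself.

  Every matrix of linear forms is, up to additional variables, a section of the generic one by linear
  forms \<open>\<theta>\<close>. If the minors have height \<open>n - 1\<close>, then over the algebraic closure \<open>n + 1\<close> linear forms,
  the given ones among them, cut out the origin on the locus of matrices of rank at most one. Because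
  that locus has minimal multiplicity, its coordinate ring is free over the subalgebra generated by
  these \<open>n + 1\<close> forms, and they form a regular sequence modulo \<open>I\<close>. Modulo the powers of \<open>I\<close> they are
  regular only up to torsion with respect to the variables; but the bound on the Koszul homology
  excludes this torsion in degrees at least \<open>2 k\<close>, which suffices to transfer the bound to the section.
\<close>

text \<open>This notation would capture the name of the matrix in the theorem.\<close>

no_notation Polynomials.var (\<open>X\<index>\<close>)

text \<open>The locus of 2 x n matrices of rank at most one has dimension n + 1 and degree n; this
  fixes the number of parameters. Modulo them the n - 1 complementary linear forms have vanishing
  products, and freeness becomes a count of standard monomials. For powers of I no such count is
  possible: their residue class rings are in general not Cohen-Macaulay, so the parameters cannot
  stay regular on them. But once any variable of the matrix is inverted, I is generated by n - 1
  independent elements, the modules I^k/I^(k+1) become free, and regularity modulo I carries over to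
  I^k. What fails is therefore torsion with respect to every variable, and such torsion would
  produce a socle element, that is, a top Koszul cycle. The bound 2 k arises for monomial ideals as
  the sum of the two largest exponents in an intersection of powers of primes. The height enters
  only through linear sections: the growth of Hilbert functions along a chain of primes turns a bad
  section into a prime of small height, while scrolls satisfy the section condition
  directly.\<close>

abbreviation supp :: "('a \<Rightarrow>\<^sub>0 'b::zero) \<Rightarrow> 'a set" where "supp \<equiv> Poly_Mapping.keys"
abbreviation cf :: "('a \<Rightarrow>\<^sub>0 'b::zero) \<Rightarrow> 'a \<Rightarrow> 'b" where "cf \<equiv> Poly_Mapping.lookup"

section \<open>Monomials, coefficients and forms\<close>

definition Const :: "'k \<Rightarrow> ('v, 'k::field) mpoly" where
  "Const c = Poly_Mapping.single 0 c"

definition mon :: "('v \<Rightarrow>\<^sub>0 nat) \<Rightarrow> ('v, 'k::field) mpoly" where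
  "mon m = Poly_Mapping.single m 1"

definition expo :: "'v \<Rightarrow> ('v \<Rightarrow>\<^sub>0 nat)" where
  "expo v = Poly_Mapping.single v 1"

definition polys :: "'v set \<Rightarrow> ('v, 'k::field) mpoly set" where
  "polys A = {p. \<forall>m \<in> supp p. supp m \<subseteq> A}"

definition H :: "'v set \<Rightarrow> nat \<Rightarrow> ('v, 'k::field) mpoly set" where
  "H A d = {p. \<forall>m \<in> supp p. supp m \<subseteq> A \<and> monom_deg m = d}"

lemma carrier_mpoly_ring: "carrier (mpoly_ring A) = polys A"
  unfolding mpoly_ring_def polys_def by simp

lemma H_iff: "p \<in> H A d \<longleftrightarrow> p \<in> polys A \<and> homogeneous (int d) p"
  by (auto simp: H_def polys_def homogeneous_def)

lemma supp_add_nat: "supp (a + b) = supp a \<union> supp (b :: 'v \<Rightarrow>\<^sub>0 nat)"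
  by (auto simp: in_keys_iff lookup_add)

lemma monom_deg_superset:
  assumes "finite A" "supp m \<subseteq> A"
  shows "monom_deg m = (\<Sum>v\<in>A. cf m v)" unfolding monom_deg_def using assms
  by (intro sum.mono_neutral_left) (auto simp: in_keys_iff)

lemma monom_deg_add [simp]: "monom_deg (a + b) = monom_deg a + monom_deg b"
proof -
  have "monom_deg (a + b) = (\<Sum>v\<in>supp a \<union> supp b. cf (a + b) v)"
    by (rule monom_deg_superset) (auto simp: supp_add_nat)
  also have "\<dots> = (\<Sum>v\<in>supp a \<union> supp b. cf a v) + (\<Sum>v\<in>supp a \<union> supp b. cf b v)"
    by (simp add: lookup_add sum.distrib)
  also have "\<dots> = monom_deg a + monom_deg b"
    by (subst (1 2) monom_deg_superset[of "supp a \<union> supp b"]) auto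
  finally show ?thesis .
qed

lemma monom_deg_0 [simp]: "monom_deg 0 = 0"
  by (simp add: monom_deg_def)

lemma monom_deg_expo [simp]: "monom_deg (expo v) = 1"
  by (simp add: monom_deg_def expo_def)

lemma supp_expo [simp]: "supp (expo v) = {v}"
  by (simp add: expo_def)

lemma lookup_expo: "cf (expo v) u = (if u = v then 1 else 0)"
  by (simp add: expo_def lookup_single when_def)

lemma monom_deg_eq_0_iff [simp]: "monom_deg m = 0 \<longleftrightarrow> m = 0"
  by (auto simp: monom_deg_def poly_mapping_eq_iff in_keys_iff fun_eq_iff)

lemma Var_mon: "Var v = mon (expo v)"
  by (simp add: Var_def mon_def expo_def)

lemma mon_mult: "mon (a + b) = mon a * mon b"
  by (simp add: mon_def mult_single)

lemma mon_0 [simp]: "mon 0 = 1"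
  by (simp add: mon_def)

lemma Const_0 [simp]: "Const 0 = 0" and Const_1 [simp]: "Const 1 = 1"
  by (simp_all add: Const_def)

lemma Const_add: "Const (a + b) = Const a + Const b"
  by (simp add: Const_def single_add)

lemma Const_uminus: "Const (- a) = - Const a"
  by (simp add: Const_def single_uminus)

lemma Const_mult: "Const (a * b) = Const a * Const b"
  by (simp add: Const_def mult_single)

lemma Const_eq_0_iff [simp]: "Const c = 0 \<longleftrightarrow> c = 0"
  by (metis Const_0 Const_def inj_single[THEN injD])

lemma single_eq: "Poly_Mapping.single m c = Const c * mon m"
  by (simp add: Const_def mon_def mult_single)

lemma lookup_mult_single:
  "cf (Poly_Mapping.single a c * q) (a + m) = c * cf q (m :: 'v \<Rightarrow>\<^sub>0 nat)"
proof -
  have "cf (Poly_Mapping.single a c * q) (a + m) =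
      (\<Sum>l. (c when a = l) * (\<Sum>r. cf q r when a + m = l + r))"
    by (simp add: lookup_mult lookup_single)
  also have "\<dots> = (\<Sum>l. (c * (\<Sum>r. cf q r when a + m = l + r)) when l = a)"
    by (intro Sum_any.cong) (auto simp: when_def)
  also have "\<dots> = c * (\<Sum>r. cf q r when a + m = a + r)" by simp
  also have "(\<Sum>r. cf q r when a + m = a + r) = (\<Sum>r. cf q r when r = m)"
    by (intro Sum_any.cong) (auto simp: when_def)
  finally show ?thesis by simp
qed

lemma supp_mult_single: "supp (Poly_Mapping.single a c * q) \<subseteq> (\<lambda>m. a + m) ` supp q"
  using keys_mult[of "Poly_Mapping.single a c" q] by (auto split: if_splits)

lemma lookup_mult_single_notin:
  assumes "\<And>m. l \<noteq> a + m"
  shows "cf (Poly_Mapping.single a c * q) l = 0"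
  using supp_mult_single[of a c q] assms by (metis image_iff in_keys_iff subsetD)

lemma lookup_Const_mult [simp]: "cf (Const c * q) m = c * cf q m"
  using lookup_mult_single[of 0 c q m] by (simp add: Const_def)

lemma supp_Const_mult: "supp (Const c * q) \<subseteq> supp q"
  by (auto simp: in_keys_iff)

lemma lookup_mon: "cf (mon a) m = (if a = m then 1 else 0)"
  by (simp add: mon_def lookup_single when_def)

lemma supp_mon [simp]: "supp (mon m :: ('v, 'k::field) mpoly) = {m}"
  by (simp add: mon_def)

lemma mpoly_expand: "p = (\<Sum>m\<in>supp p. Const (cf p m) * mon m)"
proof (rule poly_mapping_eqI)
  fix l
  show "cf p l = cf (\<Sum>m\<in>supp p. Const (cf p m) * mon m) l"
    by (simp add: lookup_sum lookup_mon if_distrib[of "(*) _"] cong: if_cong)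
      (auto simp: in_keys_iff)
qed

lemma supp_sum: "supp (sum f I) \<subseteq> (\<Union>i\<in>I. supp (f i))"
  by (rule keys_sum)

subsection \<open>Forms\<close>

lemma H_0 [simp]: "0 \<in> H A d" by (simp add: H_def)

lemma H_add: "p \<in> H A d \<Longrightarrow> q \<in> H A d \<Longrightarrow> p + q \<in> H A d"
  using keys_add[of p q] by (auto simp: H_def)

lemma H_uminus: "p \<in> H A d \<Longrightarrow> - p \<in> H A d"
  by (auto simp: H_def in_keys_iff)

lemma H_diff: "p \<in> H A d \<Longrightarrow> q \<in> H A d \<Longrightarrow> p - q \<in> H A d"
  using H_add[of p A d "- q"] H_uminus[of q] by simp

lemma H_sum: "(\<And>i. i \<in> I \<Longrightarrow> f i \<in> H A d) \<Longrightarrow> sum f I \<in> H A d"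
  by (induction I rule: infinite_finite_induct) (auto intro: H_add)

lemma H_mult: "p \<in> H A d \<Longrightarrow> q \<in> H A e \<Longrightarrow> p * q \<in> H A (d + e)"
  using keys_mult[of p q] by (fastforce simp: H_def supp_add_nat)

lemma H_Const_mult: "p \<in> H A d \<Longrightarrow> Const c * p \<in> H A d"
  using supp_Const_mult[of c p] by (auto simp: H_def)

lemma H_Const [simp]: "Const c \<in> H A 0"
  by (auto simp: H_def Const_def)

lemma H_one [simp]: "1 \<in> H A 0"
  by (auto simp: H_def)

lemma H_Var: "v \<in> A \<Longrightarrow> Var v \<in> H A 1"
  by (auto simp: H_def Var_mon)

lemma H_mon: "supp m \<subseteq> A \<Longrightarrow> mon m \<in> H A (monom_deg m)"
  by (auto simp: H_def)

lemma H_Var_mult: "v \<in> A \<Longrightarrow> p \<in> H A d \<Longrightarrow> Var v * p \<in> H A (Suc d)"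
  using H_mult[OF H_Var] by fastforce

lemma H_mono: "A \<subseteq> B \<Longrightarrow> H A d \<subseteq> H B d"
  by (auto simp: H_def)

lemma H_power: "p \<in> H A d \<Longrightarrow> p ^ s \<in> H A (s * d)"
  by (induction s) (auto intro: H_mult)

lemma H_prod: "(\<And>i. i \<in> I \<Longrightarrow> f i \<in> H A (d i)) \<Longrightarrow> prod f I \<in> H A (sum d I)"
  by (induction I rule: infinite_finite_induct) (auto intro: H_mult)

lemma H_0_Const: "p \<in> H A 0 \<Longrightarrow> p = Const (cf p 0)"
  by (rule poly_mapping_eqI)
    (use in_keys_iff in \<open>fastforce simp: H_def Const_def lookup_single when_def\<close>)

lemma H_induct [consumes 1, case_names zero add mon]:
  assumes "p \<in> H A d"
    and "P 0"
    and add: "\<And>p q. p \<in> H A d \<Longrightarrow> q \<in> H A d \<Longrightarrow> P p \<Longrightarrow> P q \<Longrightarrow> P (p + q)"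
    and mon: "\<And>c m. supp m \<subseteq> A \<Longrightarrow> monom_deg m = d \<Longrightarrow> P (Const c * mon m)"
  shows "P p"
proof -
  have "P (\<Sum>m\<in>M. Const (cf p m) * mon m) \<and> (\<Sum>m\<in>M. Const (cf p m) * mon m) \<in> H A d"
    if "finite M" "M \<subseteq> supp p" for M using that
  proof (induction M)
    case empty
    show ?case using \<open>P 0\<close> by simp
  next
    case (insert m M)
    have m: "supp m \<subseteq> A" "monom_deg m = d" using insert.prems assms(1) by (auto simp: H_def)
    have "Const (cf p m) * mon m \<in> H A d" using H_Const_mult[OF H_mon[OF m(1)]] m(2) by simp
    then show ?case using insert mon[OF m] by (auto intro!: add H_add)
  qed
  from this[of "supp p"] show ?thesis by (simp flip: mpoly_expand)
qed

lemma expo_split: "v \<in> supp m \<Longrightarrow> m = expo v + (m - expo v)"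
  by (rule poly_mapping_eqI) (auto simp: lookup_add lookup_minus lookup_expo in_keys_iff)

lemma monom_deg_SucE:
  assumes "monom_deg m = Suc d"
  obtains v m' where "v \<in> supp m" "m = expo v + m'" "monom_deg m' = d" "supp m' \<subseteq> supp m"
proof -
  from assms obtain v where v: "v \<in> supp m" by (metis Zero_not_Suc ex_in_conv monom_deg_def sum.empty)
  define m' where "m' = m - expo v"
  have m: "m = expo v + m'" unfolding m'_def by (rule expo_split[OF v])
  show ?thesis
  proof (rule that[OF v m])
    show "monom_deg m' = d" using assms by (subst (asm) m) simp
    show "supp m' \<subseteq> supp m" using supp_add_nat[of "expo v" m'] m by auto
  qed
qed

lemma H_SucE:
  assumes "p \<in> H A (Suc d)" "finite A"
  obtains q where "\<And>v. v \<in> A \<Longrightarrow> q v \<in> H A d" "p = (\<Sum>v\<in>A. Var v * q v)"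
proof -
  have "\<exists>q. (\<forall>v\<in>A. q v \<in> H A d) \<and> p = (\<Sum>v\<in>A. Var v * q v)" using assms(1)
  proof (induction rule: H_induct)
    case zero
    show ?case by (intro exI[of _ "\<lambda>_. 0"]) simp
  next
    case (add p q)
    then obtain f g where "\<forall>v\<in>A. f v \<in> H A d" "p = (\<Sum>v\<in>A. Var v * f v)"
      "\<forall>v\<in>A. g v \<in> H A d" "q = (\<Sum>v\<in>A. Var v * g v)" by blast
    then show ?case by (intro exI[of _ "\<lambda>v. f v + g v"]) (auto simp: H_add distrib_left sum.distrib)
  next
    case (mon c m)
    obtain v m' where v: "v \<in> supp m" "m = expo v + m'" "monom_deg m' = d" "supp m' \<subseteq> supp m"
      using monom_deg_SucE[OF mon(2)] .
    have "Const c * mon m' \<in> H A d"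
      using H_Const_mult[OF H_mon[of m' A], of c] subset_trans[OF v(4) mon(1)] v(3) by simp
    moreover have eq: "(\<Sum>u\<in>A. Var u * (if u = v then Const c * mon m' else 0)) =
        (\<Sum>u\<in>A. if u = v then Var v * (Const c * mon m') else 0)"
      by (rule sum.cong) auto
    then have "Const c * mon m = (\<Sum>u\<in>A. Var u * (if u = v then Const c * mon m' else 0))"
    proof -
      have "Const c * mon m = Var v * (Const c * mon m')"
        by (subst v(2)) (simp only: Var_mon mon_mult mult.left_commute)
      moreover have "v \<in> A" using v(1) mon(1) by blast
      ultimately show ?thesis using eq \<open>finite A\<close> by (simp only: sum.delta if_True)
    qed
    ultimately show ?case by (intro exI[of _ "\<lambda>u. if u = v then Const c * mon m' else 0"]) auto
  qed
  then show ?thesis using that by blast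
qed

subsection \<open>Evaluation homomorphisms\<close>

definition evm :: "('v \<Rightarrow> 'r::comm_ring_1) \<Rightarrow> ('v \<Rightarrow>\<^sub>0 nat) \<Rightarrow> 'r" where
  "evm s m = (\<Prod>v\<in>supp m. s v ^ cf m v)"

text \<open>Coefficient map and values are independent parameters, so the same homomorphism covers
  substitution (\<open>c = Const\<close>), evaluation at a point (\<open>c\<close> the identity) and
  passage to the algebraic closure (\<open>c\<close> built from \<open>to_ac\<close>).\<close>

definition ev :: "('k \<Rightarrow> 'r) \<Rightarrow> ('v \<Rightarrow> 'r) \<Rightarrow> ('v, 'k::field) mpoly \<Rightarrow> 'r::comm_ring_1" where
  "ev c s p = (\<Sum>m\<in>supp p. c (cf p m) * evm s m)"

lemma evm_superset:
  assumes "finite A" "supp m \<subseteq> A"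
  shows "evm s m = (\<Prod>v\<in>A. s v ^ cf m v)" unfolding evm_def using assms
  by (intro prod.mono_neutral_left) (auto simp: in_keys_iff)

lemma evm_0 [simp]: "evm s 0 = 1"
  by (simp add: evm_def)

lemma evm_expo [simp]: "evm s (expo v) = s v"
  by (simp add: evm_def lookup_expo)

lemma evm_add: "evm s (a + b) = evm s a * evm s b"
proof -
  have "evm s (a + b) = (\<Prod>v\<in>supp a \<union> supp b. s v ^ cf (a + b) v)"
    by (rule evm_superset) (auto simp: supp_add_nat)
  also have "\<dots> = (\<Prod>v\<in>supp a \<union> supp b. s v ^ cf a v) * (\<Prod>v\<in>supp a \<union> supp b. s v ^ cf b v)"
    by (simp add: lookup_add power_add prod.distrib)
  also have "\<dots> = evm s a * evm s b" by (subst (1 2) evm_superset[of "supp a \<union> supp b"]) auto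
  finally show ?thesis .
qed

context
  fixes c :: "'k::field \<Rightarrow> 'r::comm_ring_1" and s :: "'v \<Rightarrow> 'r"
  assumes c: "comm_ring_hom c"
begin

interpretation c: comm_ring_hom c by (rule c)

lemma ev_add: "ev c s (p + q) = ev c s p + ev c s q"
  unfolding ev_def by (rule setsum_keys_plus_distrib) (auto simp: c.hom_add distrib_right)

lemma ev_0: "ev c s 0 = 0"
  by (simp add: ev_def)

lemma ev_single: "ev c s (Poly_Mapping.single m a) = c a * evm s m"
  by (auto simp: ev_def)

lemma ev_sum: "ev c s (sum f I) = (\<Sum>i\<in>I. ev c s (f i))"
  by (induction I rule: infinite_finite_induct) (auto simp: ev_add ev_0)

lemma ev_mult: "ev c s (p * q) = ev c s p * ev c s q"
proof -
  have "p * q = (\<Sum>m\<in>supp p. \<Sum>l\<in>supp q. Poly_Mapping.single (m + l) (cf p m * cf q l))"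
    by (subst mpoly_expand[of p], subst mpoly_expand[of q])
      (simp add: sum_product mult_single flip: single_eq)
  then have "ev c s (p * q) = (\<Sum>m\<in>supp p. \<Sum>l\<in>supp q. c (cf p m * cf q l) * evm s (m + l))"
    by (simp add: ev_sum ev_single)
  also have "\<dots> = ev c s p * ev c s q" by (simp add: ev_def sum_product evm_add c.hom_mult mult_ac)
  finally show ?thesis .
qed

lemma ev_1: "ev c s 1 = 1"
  using ev_single[of 0 1] by simp

lemma comm_ring_hom_ev: "comm_ring_hom (ev c s)"
  by unfold_locales (simp_all add: ev_add ev_mult ev_1 ev_0)

lemma ev_Var [simp]: "ev c s (Var v) = s v"
  using ev_single[of "expo v" 1] evm_expo[of s v] by (simp add: Var_mon mon_def del: evm_expo)

lemma ev_Const [simp]: "ev c s (Const a) = c a"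
  by (simp add: Const_def ev_single)

lemma ev_mon [simp]: "ev c s (mon m) = evm s m"
  by (simp add: mon_def ev_single)

end

lemma comm_ring_hom_Const: "comm_ring_hom (Const :: 'k \<Rightarrow> ('v, 'k::field) mpoly)"
  by unfold_locales (simp_all add: Const_add Const_mult)

lemma comm_ring_hom_id: "comm_ring_hom (\<lambda>x :: 'a::comm_ring_1. x)"
  by unfold_locales simp_all

definition subst :: "('v \<Rightarrow> ('w, 'k) mpoly) \<Rightarrow> ('v, 'k::field) mpoly \<Rightarrow> ('w, 'k) mpoly" where
  "subst s = ev Const s"

interpretation subst: comm_ring_hom "subst s"
  unfolding subst_def by (rule comm_ring_hom_ev[OF comm_ring_hom_Const])

lemma subst_Var [simp]: "subst s (Var v) = s v"
  and subst_Const [simp]: "subst s (Const a) = Const a"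
  and subst_mon: "subst s (mon m) = evm s m" by (simp_all add: subst_def comm_ring_hom_Const)

lemma evm_H:
  assumes "\<And>v. v \<in> supp m \<Longrightarrow> s v \<in> H B 1"
  shows "evm s m \<in> H B (monom_deg m)"
proof -
  have "(\<Prod>v\<in>supp m. s v ^ cf m v) \<in> H B (\<Sum>v\<in>supp m. cf m v)"
  proof (rule H_prod)
    fix v assume "v \<in> supp m"
    from H_power[OF assms[OF this]] show "s v ^ cf m v \<in> H B (cf m v)" by (metis mult.right_neutral)
  qed
  then show ?thesis by (simp add: evm_def monom_deg_def)
qed

lemma subst_H:
  assumes "p \<in> H A d" "\<And>v. v \<in> A \<Longrightarrow> s v \<in> H B 1"
  shows "subst s p \<in> H B d" using assms(1)
proof (induction rule: H_induct)
  case (mon c m)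
  then show ?case using evm_H[of m s B] assms(2) by (auto simp: subst.hom_mult subst_mon intro!: H_Const_mult)
qed (auto simp: subst.hom_add intro: H_add)

lemma evm_cong: "(\<And>v. v \<in> supp m \<Longrightarrow> s v = t v) \<Longrightarrow> evm s m = evm t m"
  by (simp add: evm_def)

lemma evm_Var: "evm Var m = (mon m :: ('v, 'k::field) mpoly)"
proof -
  have pw: "(Var v :: ('v, 'k) mpoly) ^ j = Poly_Mapping.single (Poly_Mapping.single v j) 1" for v :: 'v and j
    by (induction j) (auto simp: Var_def mult_single simp flip: single_add)
  have "(\<Prod>v\<in>M. (Var v :: ('v, 'k) mpoly) ^ cf m v) = mon (\<Sum>v\<in>M. Poly_Mapping.single v (cf m v))"
    for M by (induction M rule: infinite_finite_induct) (auto simp: pw mon_mult simp flip: mon_def)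
  moreover have "(\<Sum>v\<in>supp m. Poly_Mapping.single v (cf m v)) = m"
    by (rule poly_mapping_eqI) (auto simp: lookup_sum lookup_single when_def in_keys_iff sum.delta')
  ultimately show ?thesis by (simp add: evm_def)
qed

lemma subst_comp: "subst t (subst s p) = subst (\<lambda>v. subst t (s v)) p"
proof -
  have "subst t (evm s m) = evm (\<lambda>v. subst t (s v)) m" for m
    by (simp add: evm_def subst.hom_prod subst.hom_power)
  then show ?thesis
    by (simp add: subst_def[of s] subst_def[of "\<lambda>v. subst t (s v)"] ev_def subst.hom_sum subst.hom_mult)
qed

lemma subst_id: "subst Var p = p"
  by (subst (2) mpoly_expand) (simp add: subst_def ev_def evm_Var)

lemma subst_cong:
  assumes "p \<in> polys A" "\<And>v. v \<in> A \<Longrightarrow> s v = t v"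
  shows "subst s p = subst t p"
proof -
  have "evm s m = evm t m" if "m \<in> supp p" for m using that assms by (intro evm_cong) (auto simp: polys_def)
  then show ?thesis by (simp add: subst_def ev_def)
qed

lemma H_polys: "p \<in> H A d \<Longrightarrow> p \<in> polys A"
  by (auto simp: H_def polys_def)

subsection \<open>Koszul complexes\<close>

text \<open>A Koszul chain is a function on subsets \<open>F\<close> of \<open>A\<close>, its value
  being the coefficient of the basis vector e_F. \<open>sg v T\<close> is the sign that sorts e_v
  e_T, and \<open>bd\<close> lists the differential by target coefficient, which makes sense for
  chains of mixed homological degree.\<close>

definition sg :: "'v::linorder \<Rightarrow> 'v set \<Rightarrow> 'r::comm_ring_1" where
  "sg v T = (- 1) ^ card {u \<in> T. u < v}"

definition bd :: "('v::linorder \<Rightarrow> 'r::comm_ring_1) \<Rightarrow> 'v set \<Rightarrow> ('v set \<Rightarrow> 'r) \<Rightarrow> 'v set \<Rightarrow> 'r" where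
  "bd a A z T = (\<Sum>v\<in>A - T. sg v T * a v * z (insert v T))"

text \<open>Left exterior multiplication by e_v.\<close>

definition wedge :: "'v::linorder \<Rightarrow> ('v set \<Rightarrow> 'r::comm_ring_1) \<Rightarrow> 'v set \<Rightarrow> 'r" where
  "wedge v u F = (if v \<in> F then sg v (F - {v}) * u (F - {v}) else 0)"

lemma sg_cases: "(sg v T :: 'r::comm_ring_1) = 1 \<or> (sg v T :: 'r) = - 1"
proof -
  have "(- 1) ^ j = (1 :: 'r) \<or> (- 1) ^ j = (- 1 :: 'r)" for j by (induction j) auto
  then show ?thesis unfolding sg_def .
qed

lemma sg_mult_cases: "sg v T * p = p \<or> sg v T * p = - (p :: 'r::comm_ring_1)"
  using sg_cases[of v T, where 'r = 'r] by auto

lemma sg_empty [simp]: "sg v {} = 1"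
  by (simp add: sg_def)

lemma sg_sq [simp]: "sg v T * sg v T = 1" "sg v T * (sg v T * p) = p"
proof -
  show 1: "sg v T * sg v T = 1" by (simp add: sg_def flip: power_mult_distrib)
  show "sg v T * (sg v T * p) = p" by (simp only: 1 mult_1 flip: mult.assoc)
qed

lemma sg_insert:
  assumes "finite T" "u \<notin> T"
  shows "sg v (insert u T) = (if u < v then - sg v T else sg v T)"
proof -
  have "{x \<in> insert u T. x < v} = (if u < v then insert u {x \<in> T. x < v} else {x \<in> T. x < v})" by auto
  then show ?thesis using assms by (simp add: sg_def)
qed

text \<open>Anticommutativity of e_v and e_w in terms of sorting signs.\<close>

lemma sg_swap:
  assumes "finite T" "v \<notin> T" "w \<notin> T" "v \<noteq> w"
  shows "sg v T * sg w (insert v T) = - (sg w T * sg v (insert w T))"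
  using assms by (cases "v < w") (auto simp: sg_insert)

lemma bd_cong:
  assumes "\<And>F. F \<subseteq> A \<Longrightarrow> z F = z' F" "T \<subseteq> A"
  shows "bd a A z T = bd a A z' T"
  unfolding bd_def using assms by (intro sum.cong) (auto intro!: arg_cong2[where f = "(*)"])

lemma bd_add: "bd a A (\<lambda>F. z F + z' F) T = bd a A z T + bd a A z' T"
  by (simp add: bd_def distrib_left sum.distrib)

lemma bd_diff: "bd a A (\<lambda>F. z F - z' F) T = bd a A z T - bd a A z' T"
  by (simp add: bd_def right_diff_distrib sum_subtractf)

lemma bd_mult: "bd a A (\<lambda>F. p * z F) T = p * bd a A z T"
  by (simp add: bd_def sum_distrib_left mult_ac)

lemma bd_zero [simp]: "bd a A (\<lambda>F. 0) T = 0"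
  by (simp add: bd_def)

lemma bd_sum: "bd a A (\<lambda>F. \<Sum>i\<in>I. z i F) T = (\<Sum>i\<in>I. bd a A (z i) T)"
  by (induction I rule: infinite_finite_induct) (auto simp: bd_add)

lemma bd_bd:
  assumes "finite A" "T \<subseteq> A"
  shows "bd a A (bd a A z) T = 0"
proof -
  define f where "f = (\<lambda>(v, w). sg v T * a v * (sg w (insert v T) * a w * z (insert w (insert v T))))"
  let ?S = "SIGMA v:A - T. A - insert v T"
  have fin: "finite ?S" "finite T" using assms by (auto intro: finite_subset)
  have "bd a A (bd a A z) T = (\<Sum>v\<in>A - T. \<Sum>w\<in>A - insert v T. f (v, w))"
    by (simp add: bd_def f_def sum_distrib_left)
  also have "\<dots> = sum f ?S" using assms by (subst sum.Sigma) auto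
  also have "\<dots> = sum f {x \<in> ?S. fst x < snd x} + sum f {x \<in> ?S. snd x < fst x}"
    using fin by (subst sum.union_disjoint[symmetric]) (auto intro!: sum.cong)
  \<comment> \<open>Exchanging the two removed indices matches the two halves with opposite
    signs.\<close>
  also have "sum f {x \<in> ?S. snd x < fst x} = sum (\<lambda>x. - f x) {x \<in> ?S. fst x < snd x}"
  proof (rule sum.reindex_bij_witness[of _ prod.swap prod.swap])
    fix x assume x: "x \<in> {x \<in> ?S. snd x < fst x}"
    obtain v w where [simp]: "x = (v, w)" by (cases x)
    have "sg v T * sg w (insert v T) = - (sg w T * sg v (insert w T) :: 'b)" using x fin by (intro sg_swap) auto
    then have "- f (w, v) = sg v T * sg w (insert v T) * (a v * a w * z (insert w (insert v T)))"
      by (simp add: f_def insert_commute mult_ac)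
    also have "\<dots> = f (v, w)" by (simp add: f_def mult_ac)
    finally show "- f (prod.swap x) = f x" by simp
  qed auto
  finally show ?thesis by (simp add: sum_negf)
qed

text \<open>Exterior multiplication by e_v is a homotopy between multiplication by
  \<open>a v\<close> and zero; hence every element of the sequence annihilates Koszul
  homology.\<close>

lemma bd_wedge:
  assumes "finite A" "T \<subseteq> A" "v \<in> A"
  shows "bd a A (wedge v u) T = a v * u T - wedge v (bd a A u) T"
proof (cases "v \<in> T")
  case False
  have "bd a A (wedge v u) T = (\<Sum>w\<in>A - T. if w = v then a v * u T else 0)" unfolding bd_def
  proof (rule sum.cong[OF refl])
    fix w assume "w \<in> A - T"
    then show "sg w T * a w * wedge v u (insert w T) = (if w = v then a v * u T else 0)"
      using False by (auto simp: wedge_def mult_ac)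
  qed
  then show ?thesis using assms False by (simp add: wedge_def)
next
  case True
  define \<rho> where "\<rho> = T - {v}"
  have T: "T = insert v \<rho>" "v \<notin> \<rho>" "finite \<rho>" "\<rho> \<subseteq> A"
    using True assms by (auto simp: \<rho>_def intro: finite_subset)
  have "A - \<rho> = insert v (A - T)" using T assms by auto
  then have "bd a A u \<rho> = (\<Sum>w\<in>insert v (A - T). sg w \<rho> * a w * u (insert w \<rho>))" by (simp only: bd_def)
  also have "\<dots> = sg v \<rho> * a v * u (insert v \<rho>) + (\<Sum>w\<in>A - T. sg w \<rho> * a w * u (insert w \<rho>))"
    using assms(1) True by (subst sum.insert) auto
  finally have "bd a A u \<rho> = sg v \<rho> * a v * u T + (\<Sum>w\<in>A - T. sg w \<rho> * a w * u (insert w \<rho>))"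
    by (simp only: T(1)[symmetric])
  then have 1: "wedge v (bd a A u) T = a v * u T + (\<Sum>w\<in>A - T. sg v \<rho> * sg w \<rho> * a w * u (insert w \<rho>))"
    using True by (simp add: wedge_def distrib_left sum_distrib_left mult_ac flip: \<rho>_def)
  have "bd a A (wedge v u) T = (\<Sum>w\<in>A - T. - (sg v \<rho> * sg w \<rho> * a w * u (insert w \<rho>)))" unfolding bd_def
  proof (rule sum.cong[OF refl])
    fix w assume w: "w \<in> A - T"
    have "sg w \<rho> * sg v (insert w \<rho>) = - (sg v \<rho> * sg w T :: 'b)" using sg_swap[of \<rho> w v] w T by auto
    moreover have "insert w T - {v} = insert w \<rho>" using w True by (auto simp: \<rho>_def)
    ultimately have "wedge v u (insert w T) = sg v (insert w \<rho>) * u (insert w \<rho>)"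
      using True by (simp add: wedge_def)
    moreover have sgn: "sg w T * sg v (insert w \<rho>) = - (sg v \<rho> * sg w \<rho> :: 'b)"
    proof -
      have "sg w T * sg v (insert w \<rho>) = sg w \<rho> * sg w \<rho> * (sg w T * sg v (insert w \<rho>)) * (sg v \<rho> * sg v \<rho> :: 'b)"
        by simp
      also have "\<dots> = (sg w \<rho> * sg v (insert w \<rho>)) * (sg v \<rho> * sg w T) * (sg v \<rho> * sg w \<rho>)"
        by (simp only: mult_ac)
      also have "\<dots> = - ((sg v \<rho> * sg w T) * (sg v \<rho> * sg w T)) * (sg v \<rho> * sg w \<rho>)"
        using \<open>sg w \<rho> * sg v (insert w \<rho>) = _\<close> by simp
      also have "(sg v \<rho> * sg w T) * (sg v \<rho> * sg w T) = (sg v \<rho> * sg v \<rho>) * (sg w T * sg w T :: 'b)"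
        by (simp only: mult_ac)
      finally show ?thesis by simp
    qed
    ultimately have "sg w T * a w * wedge v u (insert w T) = (sg w T * sg v (insert w \<rho>)) * (a w * u (insert w \<rho>))"
      by (simp only: mult_ac)
    then show "sg w T * a w * wedge v u (insert w T) = - (sg v \<rho> * sg w \<rho> * a w * u (insert w \<rho>))"
      by (simp only: sgn mult_minus_left mult.assoc)
  qed
  then show ?thesis by (simp add: 1 sum_negf)
qed

subsection \<open>Graded ideals and Koszul regularity\<close>

text \<open>A homogeneous ideal is given by the family of its graded components.\<close>

definition gid :: "'v set \<Rightarrow> (nat \<Rightarrow> ('v, 'k::field) mpoly set) \<Rightarrow> bool" where
  "gid A B \<longleftrightarrow> (\<forall>d. B d \<subseteq> H A d \<and> 0 \<in> B d \<and> (\<forall>p\<in>B d. \<forall>q\<in>B d. p + q \<in> B d) \<and>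
     (\<forall>e. \<forall>q\<in>H A e. \<forall>p\<in>B d. q * p \<in> B (e + d)))"

lemma gid_H: "gid A B \<Longrightarrow> p \<in> B d \<Longrightarrow> p \<in> H A d"
  and gid_0: "gid A B \<Longrightarrow> 0 \<in> B d"
  and gid_add: "gid A B \<Longrightarrow> p \<in> B d \<Longrightarrow> q \<in> B d \<Longrightarrow> p + q \<in> B d"
  and gid_mult: "gid A B \<Longrightarrow> r \<in> H A e \<Longrightarrow> p \<in> B d \<Longrightarrow> r * p \<in> B (e + d)" by (auto simp: gid_def)

lemma gid_Const: "gid A B \<Longrightarrow> p \<in> B d \<Longrightarrow> Const c * p \<in> B d"
  using gid_mult[of A B "Const c" 0 p d] by simp

lemma gid_uminus: "gid A B \<Longrightarrow> p \<in> B d \<Longrightarrow> - p \<in> B d"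
  using gid_Const[of A B p d "- 1"] by (simp add: Const_uminus)

lemma gid_diff: "gid A B \<Longrightarrow> p \<in> B d \<Longrightarrow> q \<in> B d \<Longrightarrow> p - q \<in> B d"
  using gid_add[of A B p d "- q"] gid_uminus[of A B q d] by simp

lemma gid_sum: "gid A B \<Longrightarrow> (\<And>i. i \<in> I \<Longrightarrow> f i \<in> B d) \<Longrightarrow> sum f I \<in> B d"
  by (induction I rule: infinite_finite_induct) (auto intro: gid_add gid_0)

lemma gid_sg: "gid A B \<Longrightarrow> p \<in> B d \<Longrightarrow> sg v T * p \<in> B d"
  using sg_mult_cases[of v T p] by (metis gid_uminus)

lemma gid_mult1: "gid A B \<Longrightarrow> r \<in> H A 1 \<Longrightarrow> p \<in> B d \<Longrightarrow> r * p \<in> B (Suc d)"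
  using gid_mult[of A B r 1 p d] by simp

lemma H_sg: "p \<in> H A d \<Longrightarrow> sg v T * p \<in> H A d"
  using sg_mult_cases[of v T p] by (metis H_uminus)

lemma gid_H_self: "gid A (H A)"
  by (auto simp: gid_def intro: H_add H_mult)

lemma gid_bd:
  assumes "gid V B" "\<And>v. v \<in> A \<Longrightarrow> a v \<in> H V 1" "\<And>F. F \<subseteq> A \<Longrightarrow> z F \<in> B d" "T \<subseteq> A"
  shows "bd a A z T \<in> B (Suc d)"
proof -
  have "sg v T * (a v * z (insert v T)) \<in> B (Suc d)" if "v \<in> A - T" for v
    using that assms by (intro gid_sg[OF assms(1)] gid_mult1[OF assms(1)]) auto
  then show ?thesis unfolding bd_def mult.assoc by (intro gid_sum[OF assms(1)])
qed

lemma gid_wedge: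
  assumes "gid V B" "\<And>F. F \<subseteq> A \<Longrightarrow> u F \<in> B d" "T \<subseteq> A"
  shows "wedge v u T \<in> B d"
proof -
  have "u (T - {v}) \<in> B d" using assms(2)[of "T - {v}"] assms(3) by blast
  then show ?thesis by (auto simp: wedge_def intro: gid_0[OF assms(1)] gid_sg[OF assms(1)])
qed

text \<open>The component of degree \<open>d - 1\<close>, with zero standing for degree -1: a
  bounding chain has coefficients one degree lower, and for \<open>d = 0\<close> truncated
  subtraction would wrongly admit constants.\<close>

definition Hp :: "'v set \<Rightarrow> nat \<Rightarrow> ('v, 'k::field) mpoly set" where
  "Hp A d = (if d = 0 then {0} else H A (d - 1))"

lemma Hp_0 [simp]: "Hp A 0 = {0}" and Hp_Suc [simp]: "Hp A (Suc d) = H A d"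
  by (auto simp: Hp_def)

lemma Hp_add: "p \<in> Hp A d \<Longrightarrow> q \<in> Hp A d \<Longrightarrow> p + q \<in> Hp A d"
  by (auto simp: Hp_def intro: H_add)

lemma Hp_mult1: "r \<in> H A 1 \<Longrightarrow> p \<in> Hp A d \<Longrightarrow> r * p \<in> H A d"
  using H_mult[of r A 1 p "d - 1"] by (cases d) auto

text \<open>The residue class ring of the graded ideal \<open>B\<close> has Koszul homology with respect to the
  sequence \<open>a\<close> only in coefficient degrees below \<open>m\<close>. Chains are not required to be homogeneous
  with respect to the homological degree; this loses nothing, because the coefficient degree
  is constant.\<close>

definition Reg :: "('v::linorder \<Rightarrow> ('w, 'k::field) mpoly) \<Rightarrow> 'v set \<Rightarrow> 'w set \<Rightarrow> nat \<Rightarrow>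
    (nat \<Rightarrow> ('w, 'k) mpoly set) \<Rightarrow> bool" where
  "Reg a A V m B \<longleftrightarrow> (\<forall>d\<ge>m. \<forall>z. (\<forall>F\<subseteq>A. z F \<in> H V d) \<longrightarrow> (\<forall>T\<subseteq>A. bd a A z T \<in> B (Suc d)) \<longrightarrow>
     (\<exists>w. (\<forall>F\<subseteq>A. w F \<in> Hp V d) \<and> (\<forall>F\<subseteq>A. z F - bd a A w F \<in> B d)))"

lemma RegD:
  assumes "Reg a A V m B" "d \<ge> m" "\<And>F. F \<subseteq> A \<Longrightarrow> z F \<in> H V d" "\<And>T. T \<subseteq> A \<Longrightarrow> bd a A z T \<in> B (Suc d)"
  obtains w where "\<And>F. F \<subseteq> A \<Longrightarrow> w F \<in> Hp V d" "\<And>F. F \<subseteq> A \<Longrightarrow> z F - bd a A w F \<in> B d"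
proof -
  have "\<exists>w. (\<forall>F\<subseteq>A. w F \<in> Hp V d) \<and> (\<forall>F\<subseteq>A. z F - bd a A w F \<in> B d)"
    by (rule assms(1)[unfolded Reg_def, rule_format, OF assms(2)]) (use assms(3,4) in auto)
  then show ?thesis using that by blast
qed

lemma RegI:
  assumes "\<And>d z. d \<ge> m \<Longrightarrow> (\<And>F. F \<subseteq> A \<Longrightarrow> z F \<in> H V d) \<Longrightarrow> (\<And>T. T \<subseteq> A \<Longrightarrow> bd a A z T \<in> B (Suc d)) \<Longrightarrow>
     \<exists>w. (\<forall>F\<subseteq>A. w F \<in> Hp V d) \<and> (\<forall>F\<subseteq>A. z F - bd a A w F \<in> B d)"
  shows "Reg a A V m B" unfolding Reg_def by (intro allI impI assms) simp_all

definition gplus :: "'v set \<Rightarrow> (nat \<Rightarrow> ('v, 'k::field) mpoly set) \<Rightarrow> ('v, 'k) mpoly \<Rightarrow> nat \<Rightarrow> ('v, 'k) mpoly set" where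
  "gplus V B v d = {b + v * u | b u. b \<in> B d \<and> u \<in> Hp V d}"

definition gcolon :: "'v set \<Rightarrow> (nat \<Rightarrow> ('v, 'k::field) mpoly set) \<Rightarrow> ('v, 'k) mpoly \<Rightarrow> nat \<Rightarrow> ('v, 'k) mpoly set" where
  "gcolon V B v d = {p \<in> H V d. v * p \<in> B (Suc d)}"

lemma gid_gplus:
  fixes B :: "nat \<Rightarrow> ('w, 'k::field) mpoly set"
  assumes "gid V B" "v \<in> H V 1"
  shows "gid V (gplus V B v)" unfolding gid_def
proof (intro allI conjI ballI)
  fix d
  show "gplus V B v d \<subseteq> H V d"
    unfolding gplus_def using Hp_mult1[OF assms(2)] gid_H[OF assms(1)] by (auto intro: H_add)
  have "0 + v * 0 \<in> gplus V B v d" unfolding gplus_def using gid_0[OF assms(1)] by (fastforce simp: Hp_def)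
  then show "0 \<in> gplus V B v d" by simp
  fix p q assume "p \<in> gplus V B v d" "q \<in> gplus V B v d"
  then obtain b u b' u' where "p = b + v * u" "q = b' + v * u'" "b \<in> B d" "b' \<in> B d" "u \<in> Hp V d" "u' \<in> Hp V d"
    by (auto simp: gplus_def)
  then have "p + q = (b + b') + v * (u + u')" "b + b' \<in> B d" "u + u' \<in> Hp V d"
    by (auto simp: algebra_simps intro: gid_add[OF assms(1)] Hp_add)
  then show "p + q \<in> gplus V B v d" unfolding gplus_def by blast
next
  fix d e and q p :: "('w, 'k) mpoly" assume q: "q \<in> H V e" and "p \<in> gplus V B v d"
  then obtain b u where p: "p = b + v * u" "b \<in> B d" "u \<in> Hp V d" by (auto simp: gplus_def)
  have "q * p = q * b + v * (q * u)" by (simp add: p algebra_simps)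
  moreover have "q * b \<in> B (e + d)" using gid_mult[OF assms(1) q p(2)] .
  moreover have "q * u \<in> Hp V (e + d)" using p(3) H_mult[OF q, of u "d - 1"] by (cases d) (auto simp: Hp_def)
  ultimately show "q * p \<in> gplus V B v (e + d)" unfolding gplus_def by blast
qed

lemma gplus_left: "gid V B \<Longrightarrow> b \<in> B d \<Longrightarrow> b \<in> gplus V B v d"
  unfolding gplus_def by (intro CollectI exI[of _ b] exI[of _ 0]) (auto simp: Hp_def)

context
  fixes A :: "'v::linorder set" and V :: "'w set" and a :: "'v \<Rightarrow> ('w, 'k::field) mpoly"
    and B :: "nat \<Rightarrow> ('w, 'k) mpoly set"
  assumes fin: "finite A" and aH: "\<And>v. v \<in> A \<Longrightarrow> a v \<in> H V 1" and B: "gid V B"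
begin

lemma bd_H: "(\<And>F. F \<subseteq> A \<Longrightarrow> z F \<in> H V d) \<Longrightarrow> T \<subseteq> A \<Longrightarrow> bd a A z T \<in> H V (Suc d)"
  by (rule gid_bd[OF gid_H_self aH])

lemma bd_Hp: "(\<And>F. F \<subseteq> A \<Longrightarrow> z F \<in> Hp V d) \<Longrightarrow> T \<subseteq> A \<Longrightarrow> bd a A z T \<in> H V d"
proof (cases d)
  case 0
  assume "\<And>F. F \<subseteq> A \<Longrightarrow> z F \<in> Hp V d" "T \<subseteq> A"
  then have "bd a A z T = bd a A (\<lambda>_. 0) T" using 0 by (intro bd_cong) auto
  then show ?thesis by simp
qed (use bd_H in auto)

lemma Reg_mod:
  assumes R: "Reg a A V m B" "d \<ge> m" "\<And>F. F \<subseteq> A \<Longrightarrow> z F \<in> H V d" "\<And>T. T \<subseteq> A \<Longrightarrow> bd a A z T \<in> B (Suc d)"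
  obtains w b where "\<And>F. F \<subseteq> A \<Longrightarrow> w F \<in> Hp V d" "\<And>F. F \<subseteq> A \<Longrightarrow> b F \<in> B d"
    "\<And>F. F \<subseteq> A \<Longrightarrow> z F = bd a A w F + b F"
proof -
  obtain w where "\<And>F. F \<subseteq> A \<Longrightarrow> w F \<in> Hp V d" "\<And>F. F \<subseteq> A \<Longrightarrow> z F - bd a A w F \<in> B d" using RegD[OF assms] by metis
  then show ?thesis by (intro that[of w "\<lambda>F. z F - bd a A w F"]) auto
qed

lemma gplusE_chain:
  assumes "\<And>F. F \<subseteq> A \<Longrightarrow> z F \<in> gplus V B v d"
  obtains b u where "\<And>F. F \<subseteq> A \<Longrightarrow> b F \<in> B d" "\<And>F. F \<subseteq> A \<Longrightarrow> u F \<in> Hp V d"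
    "\<And>F. F \<subseteq> A \<Longrightarrow> z F = b F + v * u F"
proof -
  have "\<forall>F. \<exists>b u. F \<subseteq> A \<longrightarrow> b \<in> B d \<and> u \<in> Hp V d \<and> z F = b + v * u"
  proof
    fix F
    show "\<exists>b u. F \<subseteq> A \<longrightarrow> b \<in> B d \<and> u \<in> Hp V d \<and> z F = b + v * u" using assms[of F] unfolding gplus_def by blast
  qed
  then show ?thesis using that by metis
qed

text \<open>Colon and sum: \<open>0 \<rightarrow> S/(B : v)(-1) \<rightarrow> S/B \<rightarrow> S/(B + v) \<rightarrow> 0\<close>.\<close>

lemma Reg_colon:
  assumes v: "v \<in> H V 1" and 1: "Reg a A V (Suc m) (gplus V B v)" and 2: "Reg a A V m (gcolon V B v)"
  shows "Reg a A V (Suc m) B"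
proof (rule RegI)
  fix d z assume d: "Suc m \<le> d" and z: "\<And>F. F \<subseteq> A \<Longrightarrow> z F \<in> H V d"
    and bz: "\<And>T. T \<subseteq> A \<Longrightarrow> bd a A z T \<in> B (Suc d)"
  obtain w where w: "\<And>F. F \<subseteq> A \<Longrightarrow> w F \<in> Hp V d" "\<And>F. F \<subseteq> A \<Longrightarrow> z F - bd a A w F \<in> gplus V B v d"
    using RegD[OF 1 d z gplus_left[OF B bz]] by metis
  obtain b u where b: "\<And>F. F \<subseteq> A \<Longrightarrow> b F \<in> B d" and u: "\<And>F. F \<subseteq> A \<Longrightarrow> u F \<in> Hp V d"
    and bu: "\<And>F. F \<subseteq> A \<Longrightarrow> z F - bd a A w F = b F + v * u F"
    using gplusE_chain[of "\<lambda>F. z F - bd a A w F", OF w(2)] by blast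
  obtain e where e: "d = Suc e" "m \<le> e" using d by (cases d) auto
  have u': "u F \<in> H V e" if "F \<subseteq> A" for F using u[OF that] e by simp
  have bdu: "bd a A u T \<in> gcolon V B v (Suc e)" if T: "T \<subseteq> A" for T
  proof -
    have "bd a A z T = bd a A (\<lambda>F. bd a A w F + (b F + v * u F)) T"
      using bu by (intro bd_cong[OF _ T]) (auto simp: diff_eq_eq add_ac)
    also have "\<dots> = bd a A b T + v * bd a A u T" by (simp add: bd_add bd_mult bd_bd[OF fin T])
    finally have "v * bd a A u T = bd a A z T - bd a A b T" by simp
    moreover have "bd a A z T - bd a A b T \<in> B (Suc d)"
      by (rule gid_diff[OF B bz[OF T] gid_bd[OF B aH b T]]) auto
    ultimately show ?thesis using bd_H[OF u' T] by (simp add: gcolon_def e)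
  qed
  \<comment> \<open>The cofactor of \<open>v\<close> is a cycle modulo the colon ideal, one degree
    lower, so the second bound applies to it.\<close>
  obtain w' where w': "\<And>F. F \<subseteq> A \<Longrightarrow> w' F \<in> Hp V e"
    "\<And>F. F \<subseteq> A \<Longrightarrow> u F - bd a A w' F \<in> gcolon V B v e" using RegD[where z = u, OF 2 e(2) u' bdu] by blast
  show "\<exists>w. (\<forall>F\<subseteq>A. w F \<in> Hp V d) \<and> (\<forall>F\<subseteq>A. z F - bd a A w F \<in> B d)"
  proof (intro exI[of _ "\<lambda>F. w F + v * w' F"] conjI allI impI)
    fix F assume F: "F \<subseteq> A"
    show "w F + v * w' F \<in> Hp V d" using w(1)[OF F] Hp_mult1[OF v w'(1)[OF F]] by (auto simp: e intro: H_add)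
    have "v * (u F - bd a A w' F) \<in> B d" using w'(2)[OF F] by (simp add: gcolon_def e)
    then have "b F + v * (u F - bd a A w' F) \<in> B d" by (rule gid_add[OF B b[OF F]])
    moreover have "z F - bd a A (\<lambda>F. w F + v * w' F) F = b F + v * (u F - bd a A w' F)"
      using bu[OF F] by (simp add: bd_add bd_mult algebra_simps)
    ultimately show "z F - bd a A (\<lambda>F. w F + v * w' F) F \<in> B d" by simp
  qed
qed

text \<open>The elements of the sequence act as zero on Koszul homology, so that a nonzerodivisor among
  them can be factored out without changing the bound.\<close>

lemma Reg_regular:
  assumes v: "v \<in> A" and 1: "Reg a A V (Suc m) (gplus V B (a v))"
    and reg: "\<And>d. gcolon V B (a v) d \<subseteq> B d"
  shows "Reg a A V (Suc m) B"
proof (rule RegI)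
  fix d z assume d: "Suc m \<le> d" and z: "\<And>F. F \<subseteq> A \<Longrightarrow> z F \<in> H V d"
    and bz: "\<And>T. T \<subseteq> A \<Longrightarrow> bd a A z T \<in> B (Suc d)"
  obtain w where w: "\<And>F. F \<subseteq> A \<Longrightarrow> w F \<in> Hp V d" "\<And>F. F \<subseteq> A \<Longrightarrow> z F - bd a A w F \<in> gplus V B (a v) d"
    using RegD[OF 1 d z gplus_left[OF B bz]] by metis
  obtain b u where b: "\<And>F. F \<subseteq> A \<Longrightarrow> b F \<in> B d" and u: "\<And>F. F \<subseteq> A \<Longrightarrow> u F \<in> Hp V d"
    and bu: "\<And>F. F \<subseteq> A \<Longrightarrow> z F - bd a A w F = b F + a v * u F"
    using gplusE_chain[of "\<lambda>F. z F - bd a A w F", OF w(2)] by blast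
  obtain e where e: "d = Suc e" using d by (cases d) auto
  have u': "u F \<in> H V e" if "F \<subseteq> A" for F using u[OF that] e by simp
  have bdu: "bd a A u T \<in> B (Suc e)" if T: "T \<subseteq> A" for T
  proof -
    have "bd a A z T = bd a A (\<lambda>F. bd a A w F + (b F + a v * u F)) T"
      using bu by (intro bd_cong[OF _ T]) (auto simp: diff_eq_eq add_ac)
    also have "\<dots> = bd a A b T + a v * bd a A u T" by (simp add: bd_add bd_mult bd_bd[OF fin T])
    finally have "a v * bd a A u T = bd a A z T - bd a A b T" by simp
    moreover have "bd a A z T - bd a A b T \<in> B (Suc d)"
      by (rule gid_diff[OF B bz[OF T] gid_bd[OF B aH b T]]) auto
    ultimately have "bd a A u T \<in> gcolon V B (a v) (Suc e)" using bd_H[OF u' T] by (simp add: gcolon_def e)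
    then show ?thesis using reg by blast
  qed
  show "\<exists>w. (\<forall>F\<subseteq>A. w F \<in> Hp V d) \<and> (\<forall>F\<subseteq>A. z F - bd a A w F \<in> B d)"
  \<comment> \<open>By \<open>bd_wedge\<close> the term \<open>a v * u\<close> is the boundary of
    \<open>wedge v u\<close> up to \<open>wedge v (bd a A u)\<close>, which lies in \<open>B\<close>
    because \<open>a v\<close> is a nonzerodivisor.\<close>
  proof (intro exI[of _ "\<lambda>F. w F + wedge v u F"] conjI allI impI)
    fix F assume F: "F \<subseteq> A"
    show "w F + wedge v u F \<in> Hp V d"
      using w(1)[OF F] gid_wedge[OF gid_H_self u' F] by (auto simp: e intro: H_add)
    have "b F + wedge v (bd a A u) F \<in> B d"
      using gid_wedge[OF B bdu F] by (auto simp: e intro!: gid_add[OF B] b[OF F, unfolded e])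
    moreover have "z F - bd a A (\<lambda>F. w F + wedge v u F) F = b F + wedge v (bd a A u) F"
      using bu[OF F] by (simp add: bd_add bd_wedge[OF fin F v] algebra_simps)
    ultimately show "z F - bd a A (\<lambda>F. w F + wedge v u F) F \<in> B d" by simp
  qed
qed

text \<open>Socle elements are top cycles of the Koszul complex.\<close>

lemma Reg_socle:
  assumes R: "Reg a A V m B" "d \<ge> m" and u: "u \<in> H V d" and uB: "\<And>v. v \<in> A \<Longrightarrow> a v * u \<in> B (Suc d)"
  shows "u \<in> B d"
proof -
  define z where "z F = (if F = A then u else 0)" for F
  have "bd a A z T \<in> B (Suc d)" if "T \<subseteq> A" for T unfolding bd_def
  proof (rule gid_sum[OF B])
    fix v assume "v \<in> A - T"
    then show "sg v T * a v * z (insert v T) \<in> B (Suc d)"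
      using gid_sg[OF B uB[of v]] gid_0[OF B] by (auto simp: z_def mult.assoc)
  qed
  moreover have "z F \<in> H V d" if "F \<subseteq> A" for F using u by (simp add: z_def)
  ultimately obtain w where "\<And>F. F \<subseteq> A \<Longrightarrow> z F - bd a A w F \<in> B d" using RegD[OF R] by metis
  \<comment> \<open>No index is left to insert into \<open>A\<close>, so boundaries have no
    component there.\<close>
  from this[of A] show ?thesis by (simp add: z_def bd_def)
qed

text \<open>Induction on the sum of the annihilating exponents: multiplication by \<open>a v\<close>
  lowers the exponent of \<open>v\<close>, so all products \<open>a v * u\<close> lie in
  \<open>B\<close> and \<open>u\<close> is a socle element. Degrees only grow, so they stay within
  the range of the bound.\<close>

lemma Reg_torsion:
  assumes R: "Reg a A V m B" and "d \<ge> m" and "u \<in> H V d" and "\<And>v. v \<in> A \<Longrightarrow> \<exists>s. a v ^ s * u \<in> B (s + d)"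
  shows "u \<in> B d"
proof -
  have "u \<in> B d" if "N = sum s A" "d \<ge> m" "u \<in> H V d" "\<And>v. v \<in> A \<Longrightarrow> a v ^ s v * u \<in> B (s v + d)" for N s d u
    using that
  proof (induction N arbitrary: s d u rule: less_induct)
    case (less N s d u)
    show ?case
    proof (cases "\<exists>v\<in>A. s v = 0")
      case True
      then show ?thesis using less.prems(4) by fastforce
    next
      case False
      have "a v * u \<in> B (Suc d)" if v: "v \<in> A" for v
      proof (rule less.IH[OF _ refl])
        let ?s = "s(v := s v - 1)"
        show "sum ?s A < N" unfolding less.prems(1) using fin v False by (intro sum_strict_mono_ex1) auto
        show "m \<le> Suc d" using less.prems(2) by simp
        show "a v * u \<in> H V (Suc d)" using H_mult[OF aH[OF v] less.prems(3)] by simp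
        fix x assume x: "x \<in> A"
        show "a x ^ ?s x * (a v * u) \<in> B (?s x + Suc d)"
        proof (cases "x = v")
          case True
          obtain j where "s v = Suc j" using False v not0_implies_Suc by blast
          then show ?thesis using less.prems(4)[OF v] True by (simp add: mult_ac)
        next
          case False
          then show ?thesis using gid_mult1[OF B aH[OF v] less.prems(4)[OF x]] by (simp add: mult_ac)
        qed
      qed
      then show ?thesis by (rule Reg_socle[OF R less.prems(2,3)])
    qed
  qed
  moreover obtain s where "\<And>v. v \<in> A \<Longrightarrow> a v ^ s v * u \<in> B (s v + d)" using assms(4) by metis
  ultimately show ?thesis using assms(2,3) by blast
qed

text \<open>A cycle modulo \<open>B\<close> and \<open>th\<close> has boundary
  \<open>b + th * u\<close>, where \<open>u\<close> is a cycle modulo \<open>B\<close>; writing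
  \<open>u\<close> as a boundary \<open>bd a A w\<close> modulo \<open>B\<close> and subtracting
  \<open>th * w\<close> corrects \<open>z\<close> to a cycle modulo \<open>B\<close>. Regularity is
  asked only in degrees at least \<open>m\<close>, so torsion in low degrees is harmless.\<close>

lemma Reg_gplus:
  assumes R: "Reg a A V m B" and th: "th \<in> H V 1"
    and reg: "\<And>d. d \<ge> m \<Longrightarrow> gcolon V B th d \<subseteq> B d"
  shows "Reg a A V m (gplus V B th)"
proof (rule RegI)
  fix d z assume d: "m \<le> d" and z: "\<And>F. F \<subseteq> A \<Longrightarrow> z F \<in> H V d"
    and bz: "\<And>T. T \<subseteq> A \<Longrightarrow> bd a A z T \<in> gplus V B th (Suc d)"
  obtain b u where b: "\<And>F. F \<subseteq> A \<Longrightarrow> b F \<in> B (Suc d)" and u: "\<And>F. F \<subseteq> A \<Longrightarrow> u F \<in> H V d"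
    and bu: "\<And>F. F \<subseteq> A \<Longrightarrow> bd a A z F = b F + th * u F"
    using gplusE_chain[where z = "bd a A z", OF bz] unfolding Hp_Suc by blast
  have bdu: "bd a A u T \<in> B (Suc d)" if T: "T \<subseteq> A" for T
  proof -
    have "0 = bd a A (bd a A z) T" by (simp add: bd_bd[OF fin T])
    also have "\<dots> = bd a A (\<lambda>F. b F + th * u F) T" using bu by (intro bd_cong[OF _ T])
    finally have "th * bd a A u T = - bd a A b T" by (simp add: bd_add bd_mult eq_neg_iff_add_eq_0 add.commute)
    moreover have "- bd a A b T \<in> B (Suc (Suc d))" by (rule gid_uminus[OF B gid_bd[OF B aH b T]]) auto
    ultimately have "bd a A u T \<in> gcolon V B th (Suc d)" using bd_H[OF u T] by (simp add: gcolon_def)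
    then show ?thesis using reg[of "Suc d"] d by auto
  qed
  obtain w c where w: "\<And>F. F \<subseteq> A \<Longrightarrow> w F \<in> Hp V d" and c: "\<And>F. F \<subseteq> A \<Longrightarrow> c F \<in> B d"
    and uw: "\<And>F. F \<subseteq> A \<Longrightarrow> u F = bd a A w F + c F" using Reg_mod[where z = u, OF R d u bdu] by blast
  have bdz: "bd a A (\<lambda>F. z F - th * w F) T \<in> B (Suc d)" if T: "T \<subseteq> A" for T
  proof -
    have "bd a A (\<lambda>F. z F - th * w F) T = b T + th * c T"
      using bu[OF T] uw[OF T] by (simp add: bd_diff bd_mult algebra_simps)
    then show ?thesis using gid_add[OF B b[OF T] gid_mult1[OF B th c[OF T]]] by simp
  qed
  have zw: "z F - th * w F \<in> H V d" if "F \<subseteq> A" for F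
    using z[OF that] Hp_mult1[OF th w[OF that]] by (rule H_diff)
  obtain w' where w': "\<And>F. F \<subseteq> A \<Longrightarrow> w' F \<in> Hp V d"
    "\<And>F. F \<subseteq> A \<Longrightarrow> z F - th * w F - bd a A w' F \<in> B d"
    using RegD[where z = "\<lambda>F. z F - th * w F", OF R d zw bdz] by blast
  have "z F - bd a A w' F \<in> gplus V B th d" if "F \<subseteq> A" for F unfolding gplus_def
    by (intro CollectI exI[of _ "z F - th * w F - bd a A w' F"] exI[of _ "w F"] conjI w w' that)
      (simp add: algebra_simps)
  then show "\<exists>w. (\<forall>F\<subseteq>A. w F \<in> Hp V d) \<and> (\<forall>F\<subseteq>A. z F - bd a A w F \<in> gplus V B th d)" using w'(1) by blast
qed

end

subsection \<open>Monomial ideals\<close>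

definition mong :: "'v set \<Rightarrow> ('v \<Rightarrow>\<^sub>0 nat) set \<Rightarrow> nat \<Rightarrow> ('v, 'k::field) mpoly set" where
  "mong A E d = {p \<in> H A d. supp p \<subseteq> E}"

lemma gid_mong:
  assumes "\<And>m l. m \<in> E \<Longrightarrow> l + m \<in> E"
  shows "gid A (mong A E :: nat \<Rightarrow> ('v, 'k::field) mpoly set)" unfolding gid_def
proof (intro allI conjI ballI)
  fix d and p q :: "('v, 'k) mpoly" assume "p \<in> mong A E d" "q \<in> mong A E d"
  then show "p + q \<in> mong A E d" using keys_add[of p q] H_add[of p A d q] by (auto simp: mong_def)
next
  fix d e and q p :: "('v, 'k) mpoly" assume "q \<in> H A e" "p \<in> mong A E d"
  then show "q * p \<in> mong A E (e + d)"
    using keys_mult[of q p] H_mult[of q A e p d] assms by (fastforce simp: mong_def)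
qed (auto simp: mong_def)

lemma mong_subsetI:
  assumes "gid A B" "p \<in> mong A E d"
    and "\<And>c m. m \<in> E \<Longrightarrow> supp m \<subseteq> A \<Longrightarrow> monom_deg m = d \<Longrightarrow> Const c * mon m \<in> B d"
  shows "p \<in> B d"
proof -
  have "(\<Sum>m\<in>supp p. Const (cf p m) * mon m) \<in> B d"
    using assms by (intro gid_sum[OF assms(1)]) (auto simp: mong_def H_def)
  then show ?thesis by (simp flip: mpoly_expand)
qed

lemma supp_Var_mult: "supp (Var v * p :: ('v, 'k::field) mpoly) = (\<lambda>m. expo v + m) ` supp p"
proof
  show "supp (Var v * p) \<subseteq> (\<lambda>m. expo v + m) ` supp p"
    using supp_mult_single[of "expo v" 1 p] by (simp add: Var_mon mon_def)
  have "cf (Var v * p) (expo v + m) = cf p m" for m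
    using lookup_mult_single[of "expo v" 1 p m] by (simp add: Var_mon mon_def)
  then show "(\<lambda>m. expo v + m) ` supp p \<subseteq> supp (Var v * p)" by (auto simp: in_keys_iff)
qed

lemma gplus_mong:
  assumes "\<And>m l. m \<in> E \<Longrightarrow> l + m \<in> E" "v \<in> A"
  shows "gplus A (mong A E) (Var v) d = (mong A (E \<union> {m. 0 < cf m v}) d :: ('v, 'k::field) mpoly set)"
proof
  have v: "(Var v :: (_, 'k) mpoly) \<in> H A 1" using H_Var assms(2) .
  have gE: "gid A (mong A E :: nat \<Rightarrow> (_, 'k) mpoly set)" by (rule gid_mong) (fact assms(1))
  show "gplus A (mong A E) (Var v) d \<subseteq> (mong A (E \<union> {m. 0 < cf m v}) d :: ('v, 'k) mpoly set)"
  proof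
    fix p :: "('v, 'k) mpoly" assume "p \<in> gplus A (mong A E) (Var v) d"
    then obtain b u where p: "p = b + Var v * u" "b \<in> mong A E d" "u \<in> Hp A d" by (auto simp: gplus_def)
    have "Var v * u \<in> H A d" using Hp_mult1[OF v p(3)] .
    moreover have "supp (Var v * u) \<subseteq> {m. 0 < cf m v}" by (auto simp: supp_Var_mult lookup_add lookup_expo)
    ultimately show "p \<in> mong A (E \<union> {m. 0 < cf m v}) d"
      using p(2) keys_add[of b "Var v * u"] unfolding p(1) mong_def by (auto intro: H_add)
  qed
  show "(mong A (E \<union> {m. 0 < cf m v}) d :: ('v, 'k) mpoly set) \<subseteq> gplus A (mong A E) (Var v) d"
  proof
    fix p :: "('v, 'k) mpoly" assume "p \<in> mong A (E \<union> {m. 0 < cf m v}) d"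
    then show "p \<in> gplus A (mong A E) (Var v) d"
    proof (rule mong_subsetI[OF gid_gplus[OF gE v]])
      fix c :: 'k and m assume m: "m \<in> E \<union> {m. 0 < cf m v}" "supp m \<subseteq> A" "monom_deg m = d"
      have cm: "Const c * mon m \<in> H A d" using H_Const_mult[OF H_mon[OF m(2)]] m(3) by simp
      show "Const c * mon m \<in> gplus A (mong A E) (Var v) d"
      proof (cases "m \<in> E")
        case True
        have "Const c * mon m \<in> mong A E d" using cm True supp_Const_mult[of c "mon m"] by (auto simp: mong_def)
        then show ?thesis by (rule gplus_left[OF gE])
      next
        case False
        then have "0 < cf m v" using m by simp
        then have m': "m = expo v + (m - expo v)"
          by (intro poly_mapping_eqI) (auto simp: lookup_add lookup_minus lookup_expo)
        define m' where "m' = m - expo v"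
        have mm: "m = expo v + m'" using m' by (simp add: m'_def)
        have "Const c * mon m' \<in> H A (monom_deg m')"
          using m(2) by (intro H_Const_mult H_mon) (simp add: mm supp_add_nat)
        then have "Const c * mon m' \<in> Hp A d" using m(3) by (auto simp: mm Hp_def)
        moreover have "Const c * mon m = 0 + Var v * (Const c * mon m')"
          by (simp add: mm mon_mult Var_mon mult_ac)
        moreover have "0 \<in> mong A E d" by (simp add: mong_def)
        ultimately show ?thesis unfolding gplus_def by blast
      qed
    qed
  qed
qed

lemma gcolon_mong:
  assumes "v \<in> A"
  shows "gcolon A (mong A E) (Var v) d = (mong A {m. expo v + m \<in> E} d :: ('v, 'k::field) mpoly set)"
  using H_Var_mult[OF assms] by (auto simp: gcolon_def mong_def supp_Var_mult)

lemma Reg_unit: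
  fixes B :: "nat \<Rightarrow> (_, 'k::field) mpoly set"
  assumes "gid V B" "\<And>d. d \<ge> m \<Longrightarrow> H V d \<subseteq> B d"
  shows "Reg a A V m B"
proof (rule RegI)
  fix d and z :: "_ \<Rightarrow> (_, 'k) mpoly" assume "m \<le> d" "\<And>F. F \<subseteq> A \<Longrightarrow> z F \<in> H V d"
  then show "\<exists>w. (\<forall>F\<subseteq>A. w F \<in> Hp V d) \<and> (\<forall>F\<subseteq>A. z F - bd a A w F \<in> B d)"
    using assms by (intro exI[of _ "\<lambda>_. 0"]) (auto simp: Hp_def)
qed

subsection \<open>The initial ideal of powers of the generic maximal minors\<close>

text \<open>The generic \<open>2 \<times> n\<close> matrix has first row \<open>Var j\<close> and second row \<open>Var (n + j)\<close>, \<open>j < n\<close>.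
  The initial ideal of its minors is the intersection of the ideals generated by the variables
  in \<open>colU n t\<close>, for \<open>t < n\<close>, and taking powers commutes with this intersection.\<close>

abbreviation gv :: "nat \<Rightarrow> nat set" where "gv n \<equiv> {..<2 * n}"

definition colU :: "nat \<Rightarrow> nat \<Rightarrow> nat set" where
  "colU n t = {..<t} \<union> {n + t<..<2 * n}"

text \<open>An exponent lies in the k-th power of the ideal generated by the variables in
  \<open>colU n t\<close> exactly if this count is at least k.\<close>

definition cnt :: "nat \<Rightarrow> nat \<Rightarrow> (nat \<Rightarrow>\<^sub>0 nat) \<Rightarrow> nat" where
  "cnt n t m = (\<Sum>u\<in>colU n t. cf m u)"

text \<open>The generality is what the induction produces: adding a variable to the ideal enlarges
  \<open>Z\<close>, and the colon by a variable lowers the threshold \<open>k t\<close> only for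
  those \<open>t\<close> whose prime contains it.\<close>

definition MI :: "nat \<Rightarrow> nat set \<Rightarrow> (nat \<Rightarrow> nat) \<Rightarrow> (nat \<Rightarrow>\<^sub>0 nat) set" where
  "MI n Z k = {m. (\<exists>z\<in>Z. 0 < cf m z) \<or> (\<forall>t<n. k t \<le> cnt n t m)}"

lemma finite_colU [simp]: "finite (colU n t)"
  by (simp add: colU_def)

lemma cnt_add: "cnt n t (a + b) = cnt n t a + cnt n t b"
  by (simp add: cnt_def lookup_add sum.distrib)

lemma cnt_expo: "cnt n t (expo v) = (if v \<in> colU n t then 1 else 0)"
  by (simp add: cnt_def lookup_expo)

lemma MI_up: "m \<in> MI n Z k \<Longrightarrow> l + m \<in> MI n Z k"
  by (fastforce simp: MI_def lookup_add cnt_add intro: trans_le_add2)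

lemma gid_MI: "gid A (mong A (MI n Z k))"
  by (rule gid_mong) (rule MI_up)

lemma MI_Un: "MI n Z k \<union> {m. 0 < cf m v} = MI n (insert v Z) k"
  by (auto simp: MI_def)

lemma MI_colon:
  assumes "v \<notin> Z"
  shows "{m. expo v + m \<in> MI n Z k} = MI n Z (\<lambda>t. if v \<in> colU n t then k t - 1 else k t)"
proof -
  have "(0 < cf (expo v + m) z) = (0 < cf m z)" if "z \<in> Z" for z m
    using that assms by (auto simp: lookup_add lookup_expo)
  moreover have "(k t \<le> cnt n t (expo v + m)) = ((if v \<in> colU n t then k t - 1 else k t) \<le> cnt n t m)" for t m
    by (auto simp: cnt_add cnt_expo)
  ultimately show ?thesis by (auto simp: MI_def)
qed

abbreviation RegMI :: "'k::field itself \<Rightarrow> nat \<Rightarrow> nat \<Rightarrow> nat set \<Rightarrow> (nat \<Rightarrow> nat) \<Rightarrow> bool" where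
  "RegMI _ n m Z k \<equiv> Reg Var (gv n) (gv n) m (mong (gv n) (MI n Z k) :: nat \<Rightarrow> (nat, 'k) mpoly set)"

lemma gplus_MI:
  assumes "v < 2 * n"
  shows "gplus (gv n) (mong (gv n) (MI n Z k)) (Var v) = (mong (gv n) (MI n (insert v Z) k) :: _ \<Rightarrow> (_, 'k::field) mpoly set)"
proof
  fix d
  have "gplus (gv n) (mong (gv n) (MI n Z k)) (Var v) d = (mong (gv n) (MI n Z k \<union> {m. 0 < cf m v}) d :: (_, 'k) mpoly set)"
    by (rule gplus_mong) (use assms in \<open>auto intro: MI_up\<close>)
  then show "gplus (gv n) (mong (gv n) (MI n Z k)) (Var v) d = (mong (gv n) (MI n (insert v Z) k) d :: (_, 'k) mpoly set)"
    by (simp add: MI_Un)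
qed

lemma gcolon_MI:
  assumes "v < 2 * n" "v \<notin> Z"
  shows "gcolon (gv n) (mong (gv n) (MI n Z k)) (Var v) =
    (mong (gv n) (MI n Z (\<lambda>t. if v \<in> colU n t then k t - 1 else k t)) :: _ \<Rightarrow> (_, 'k::field) mpoly set)"
proof
  fix d
  have "gcolon (gv n) (mong (gv n) (MI n Z k)) (Var v) d = (mong (gv n) {m. expo v + m \<in> MI n Z k} d :: (_, 'k) mpoly set)"
    by (rule gcolon_mong) (use assms in auto)
  then show "gcolon (gv n) (mong (gv n) (MI n Z k)) (Var v) d =
    (mong (gv n) (MI n Z (\<lambda>t. if v \<in> colU n t then k t - 1 else k t)) d :: (_, 'k) mpoly set)"
    by (simp add: MI_colon[OF assms(2)])
qed

lemma RegMI_colon: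
  assumes "v < 2 * n" "v \<notin> Z" "RegMI TYPE('k::field) n (Suc m) (insert v Z) k"
    "RegMI TYPE('k) n m Z (\<lambda>t. if v \<in> colU n t then k t - 1 else k t)"
  shows "RegMI TYPE('k) n (Suc m) Z k"
proof (rule Reg_colon)
  show "Var v \<in> H (gv n) 1" using assms by (intro H_Var) simp
  show "Reg Var (gv n) (gv n) (Suc m) (gplus (gv n) (mong (gv n) (MI n Z k) :: nat \<Rightarrow> (nat, 'k) mpoly set) (Var v))"
    using assms by (simp add: gplus_MI)
  show "Reg Var (gv n) (gv n) m (gcolon (gv n) (mong (gv n) (MI n Z k) :: nat \<Rightarrow> (nat, 'k) mpoly set) (Var v))"
    using assms by (simp add: gcolon_MI)
qed (use assms in \<open>auto intro: H_Var[unfolded One_nat_def] gid_MI\<close>)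

lemma RegMI_regular:
  assumes "v < 2 * n" "v \<notin> Z" "RegMI TYPE('k::field) n (Suc m) (insert v Z) k"
    "MI n Z (\<lambda>t. if v \<in> colU n t then k t - 1 else k t) \<inter> {m. supp m \<subseteq> gv n} \<subseteq> MI n Z k"
  shows "RegMI TYPE('k) n (Suc m) Z k"
proof (rule Reg_regular)
  show "Reg Var (gv n) (gv n) (Suc m) (gplus (gv n) (mong (gv n) (MI n Z k) :: nat \<Rightarrow> (nat, 'k) mpoly set) (Var v))"
    using assms by (simp add: gplus_MI)
  show "gcolon (gv n) (mong (gv n) (MI n Z k)) (Var v) d \<subseteq> (mong (gv n) (MI n Z k) d :: (nat, 'k) mpoly set)" for d
    using assms by (auto simp: gcolon_MI mong_def H_def)
qed (use assms in \<open>auto intro: H_Var[unfolded One_nat_def] gid_MI\<close>)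

text \<open>Once the first row is in \<open>Z\<close>, the remaining parts of the sets
  \<open>colU n t\<close> shrink as \<open>t\<close> grows. They form a nested family, for which the
  largest threshold suffices as a bound.\<close>

lemma RegMI_y:
  assumes "e \<le> n" "\<And>t. t < n \<Longrightarrow> k t \<le> m"
  shows "RegMI TYPE('k::field) n m ({..<n} \<union> {n + e..<2 * n}) k" using assms
proof (induction e arbitrary: m k)
  case 0
  show ?case
  proof (rule Reg_unit[OF gid_MI])
    fix d assume d: "m \<le> d"
    show "H (gv n) d \<subseteq> (mong (gv n) (MI n ({..<n} \<union> {n + 0..<2 * n}) k) d :: (nat, 'k) mpoly set)"
    \<comment> \<open>All variables lie in \<open>Z\<close>, so only degree 0 can survive; it is in
      question only for \<open>m = 0\<close>, where all thresholds vanish.\<close>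
    proof (cases d)
      case 0
      then have "k t = 0" if "t < n" for t using d 0 "0.prems"(2)[OF that] by simp
      then show ?thesis by (auto simp: mong_def MI_def)
    next
      case (Suc d')
      have "m \<in> MI n ({..<n} \<union> {n + 0..<2 * n}) k" if m: "supp m \<subseteq> gv n" "monom_deg m = Suc d'" for m
      proof -
        obtain v m' where "v \<in> supp m" using monom_deg_SucE[OF m(2)] .
        moreover have "v \<in> {..<n} \<union> {n + 0..<2 * n}" using calculation m(1) by fastforce
        ultimately show ?thesis by (auto simp: MI_def in_keys_iff)
      qed
      then show ?thesis by (auto simp: mong_def H_def Suc)
    qed
  qed
next
  case (Suc e)
  note IH = Suc.IH
  let ?Z = "{..<n} \<union> {n + Suc e..<2 * n}"
  have Z: "insert (n + e) ?Z = {..<n} \<union> {n + e..<2 * n}" using Suc.prems(1) by auto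
  have v: "n + e < 2 * n" "n + e \<notin> ?Z" using Suc.prems(1) by auto
  show ?case
  \<comment> \<open>If some \<open>t \<ge> e\<close> has a positive threshold, its variables are all
    in \<open>Z\<close>, so the intersection contributes nothing beyond \<open>Z\<close> and
    \<open>n + e\<close> is a nonzerodivisor. Otherwise the colon lowers every positive
    threshold.\<close>
  proof (cases "\<exists>t<n. e \<le> t \<and> 0 < k t")
    case True
    then obtain t where t: "t < n" "e \<le> t" "0 < k t" by blast
    then obtain m' where m': "m = Suc m'" using Suc.prems(2)[OF t(1)] by (cases m) auto
    show ?thesis unfolding m'
    proof (rule RegMI_regular[OF v])
      show "RegMI TYPE('k) n (Suc m') (insert (n + e) ?Z) k"
        unfolding Z m'[symmetric] using Suc.prems by (intro IH) auto
      have "\<exists>z\<in>?Z. 0 < cf l z" if l: "l \<in> MI n ?Z (\<lambda>t. if n + e \<in> colU n t then k t - 1 else k t)" for l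
      proof (rule ccontr)
        assume neg: "\<not> (\<exists>z\<in>?Z. 0 < cf l z)"
        have "n + e \<notin> colU n t" using t by (auto simp: colU_def)
        then have "k t \<le> cnt n t l" using l neg t(1) by (auto simp: MI_def split: if_splits)
        moreover have "colU n t \<subseteq> ?Z" using t by (auto simp: colU_def)
        then have "cnt n t l = 0" using neg unfolding cnt_def by (subst sum_eq_0_iff) auto
        ultimately show False using t by simp
      qed
      then show "MI n ?Z (\<lambda>t. if n + e \<in> colU n t then k t - 1 else k t) \<inter> {m. supp m \<subseteq> gv n} \<subseteq> MI n ?Z k"
        unfolding MI_def[of n ?Z k] by blast
    qed
  next
    case False
    show ?thesis using Suc.prems(2) False
    proof (induction m arbitrary: k)
      case 0
      show ?case
      proof (rule Reg_unit[OF gid_MI])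
        have "k t = 0" if "t < n" for t using 0 that by fastforce
        then show "H (gv n) d \<subseteq> (mong (gv n) (MI n ?Z k) d :: (nat, 'k) mpoly set)" for d
          by (auto simp: mong_def MI_def)
      qed
    next
      case (Suc m')
      show ?case
      proof (rule RegMI_colon[OF v])
        show "RegMI TYPE('k) n (Suc m') (insert (n + e) ?Z) k"
          unfolding Z using Suc.prems \<open>Suc e \<le> n\<close> by (intro IH) auto
        have "(if n + e \<in> colU n t then k t - 1 else k t) \<le> m'" if "t < n" for t
        proof (cases "t < e")
          case True
          then show ?thesis using Suc.prems(1)[OF that] v by (auto simp: colU_def)
        next
          case False
          then have "k t = 0" using Suc.prems(2) that by auto
          then show ?thesis by simp
        qed
        then show "RegMI TYPE('k) n m' ?Z (\<lambda>t. if n + e \<in> colU n t then k t - 1 else k t)"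
          using Suc.prems(2) by (intro Suc.IH) auto
      qed
    qed
  qed
qed

text \<open>The bound for thresholds \<open>k\<close> after removing the first \<open>c\<close> variables of the first row: the
  sum of the two largest thresholds, where the thresholds with index at most \<open>c\<close> count as one.\<close>

lemma RegMI_x:
  assumes "c \<le> n" "\<And>t. t < n \<Longrightarrow> k t \<le> m" "\<And>s t. s < t \<Longrightarrow> c < t \<Longrightarrow> t < n \<Longrightarrow> k s + k t \<le> m"
  shows "RegMI TYPE('k::field) n m {..<c} k" using assms
proof (induction c arbitrary: m k rule: inc_induct)
  case base
  then show ?case using RegMI_y[of n n k m, where 'k = 'k] by auto
next
  case (step c)
  note IH = step.IH
  have v: "c < 2 * n" "c \<notin> {..<c}" using step.hyps by auto
  have ins: "insert c {..<c} = {..<Suc c}" by auto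
  have U: "c \<in> colU n t \<longleftrightarrow> c < t" if "t < n" for t using that step.hyps by (auto simp: colU_def)
  show ?case using step.prems
  proof (induction m arbitrary: k)
    case 0
    show ?case
    proof (rule Reg_unit[OF gid_MI])
      have "k t = 0" if "t < n" for t using 0(1) that by fastforce
      then show "H (gv n) d \<subseteq> (mong (gv n) (MI n {..<c} k) d :: (nat, 'k) mpoly set)" for d
        by (auto simp: mong_def MI_def)
    qed
  next
    case (Suc m')
    have next_c: "RegMI TYPE('k) n (Suc m') (insert c {..<c}) k"
      unfolding ins using Suc.prems by (intro IH) auto
    show ?case
    \<comment> \<open>Without such a \<open>t\<close> the variable \<open>c\<close> lies in no prime
      of positive threshold and is a nonzerodivisor.\<close>
    proof (cases "\<exists>t. c < t \<and> t < n \<and> 0 < k t")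
      case False
      show ?thesis
      proof (rule RegMI_regular[OF v next_c])
        have "(if c \<in> colU n t then k t - 1 else k t) = k t" if "t < n" for t
          using False U[OF that] that by fastforce
        then show "MI n {..<c} (\<lambda>t. if c \<in> colU n t then k t - 1 else k t) \<inter> {m. supp m \<subseteq> gv n} \<subseteq> MI n {..<c} k"
          by (auto simp: MI_def)
      qed
    next
      case True
      then obtain t0 where t0: "c < t0" "t0 < n" "0 < k t0" by blast
      let ?k = "\<lambda>t. if c \<in> colU n t then k t - 1 else k t"
      have le: "?k t \<le> m'" if "t < n" for t
      proof (cases "c < t")
        case True
        then show ?thesis using Suc.prems(1)[OF that] U[OF that] by auto
      next
        case False
        \<comment> \<open>The colon leaves this threshold unchanged; pairing it with the positive
          \<open>k t0\<close> still gives the smaller bound.\<close>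
        then have "k t + k t0 \<le> Suc m'" using t0 by (intro Suc.prems(2)) auto
        then show ?thesis using t0 by auto
      qed
      show ?thesis
      proof (rule RegMI_colon[OF v next_c Suc.IH[OF le]])
        fix s t assume st: "s < t" "c < t" "t < n"
        have "k s + k t \<le> Suc m'" using Suc.prems(2) st by blast
        moreover have "?k t = k t - 1" "?k s \<le> k s" using U[of t] st by auto
        moreover have "?k s \<le> m'" using le[of s] st by simp
        ultimately show "?k s + ?k t \<le> m'" by linarith
      qed
    qed
  qed
qed

text \<open>Two equal thresholds \<open>k\<close> add up to \<open>2 * k\<close>, which is the
  generating degree of the k-th power of the ideal of minors.\<close>

lemma RegMI_const: "RegMI TYPE('k::field) n (2 * k) {} (\<lambda>_. k)"
  using RegMI_x[of 0 n "\<lambda>_. k" "2 * k", where 'k = 'k] by simp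

subsection \<open>Graded ideals generated by forms of equal degree\<close>

inductive genp :: "'v set \<Rightarrow> ('v, 'k::field) mpoly set \<Rightarrow> nat \<Rightarrow> nat \<Rightarrow> ('v, 'k) mpoly \<Rightarrow> bool" for A G D where
  zero: "genp A G D d 0"
| add: "genp A G D d p \<Longrightarrow> genp A G D d q \<Longrightarrow> genp A G D d (p + q)"
| mult: "q \<in> H A e \<Longrightarrow> g \<in> G \<Longrightarrow> genp A G D (e + D) (q * g)"

definition gen :: "'v set \<Rightarrow> ('v, 'k::field) mpoly set \<Rightarrow> nat \<Rightarrow> nat \<Rightarrow> ('v, 'k) mpoly set" where
  "gen A G D d = {p. genp A G D d p}"

lemma gen_0: "0 \<in> gen A G D d"
  and gen_add: "p \<in> gen A G D d \<Longrightarrow> q \<in> gen A G D d \<Longrightarrow> p + q \<in> gen A G D d"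
  and gen_mult: "q \<in> H A e \<Longrightarrow> g \<in> G \<Longrightarrow> q * g \<in> gen A G D (e + D)" by (auto simp: gen_def intro: genp.intros)

lemma gen_induct [consumes 1, case_names zero add mult]:
  assumes "p \<in> gen A G D d"
    and "\<And>d. P d 0"
    and "\<And>d p q. p \<in> gen A G D d \<Longrightarrow> q \<in> gen A G D d \<Longrightarrow> P d p \<Longrightarrow> P d q \<Longrightarrow> P d (p + q)"
    and "\<And>e q g. q \<in> H A e \<Longrightarrow> g \<in> G \<Longrightarrow> P (e + D) (q * g)"
  shows "P d p"
proof -
  have "genp A G D d p" using assms(1) by (simp add: gen_def)
  then show ?thesis by (induction rule: genp.induct) (auto simp: gen_def intro: assms(2-))
qed

lemma gid_gen:
  fixes G :: "('v, 'k::field) mpoly set"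
  assumes "G \<subseteq> H A D"
  shows "gid A (gen A G D)" unfolding gid_def
proof (intro allI conjI ballI)
  fix d
  show "gen A G D d \<subseteq> H A d"
  proof
    fix p assume "p \<in> gen A G D d"
    then show "p \<in> H A d" by (induction rule: gen_induct) (use assms in \<open>auto intro: H_add H_mult\<close>)
  qed
next
  fix d e and q p :: "('v, 'k) mpoly" assume q: "q \<in> H A e" and "p \<in> gen A G D d"
  from this(2) show "q * p \<in> gen A G D (e + d)"
  proof (induction rule: gen_induct)
    case (mult e' r g)
    then show ?case using gen_mult[OF H_mult[OF q mult(1)] mult(2), of D] by (simp add: mult_ac add_ac)
  qed (auto simp: distrib_left intro: gen_0 gen_add)
qed (auto intro: gen_0 gen_add)

lemma gen_le:
  assumes "gid A B" "\<And>g. g \<in> G \<Longrightarrow> g \<in> B D"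
  shows "gen A G D d \<subseteq> B d"
proof
  fix p assume "p \<in> gen A G D d"
  then show "p \<in> B d"
    by (induction rule: gen_induct) (use assms in \<open>auto intro: gid_0 gid_add gid_mult\<close>)
qed

subsection \<open>Powers of the ideal of generic minors\<close>

definition gminor :: "nat \<Rightarrow> nat \<Rightarrow> nat \<Rightarrow> (nat, 'k::field) mpoly" where
  "gminor n i j = Var i * Var (n + j) - Var j * Var (n + i)"

text \<open>The column indices are unrestricted, so zero and both signs occur among the factors and
  no order of columns has to be maintained.\<close>

primrec mprods :: "nat \<Rightarrow> nat \<Rightarrow> (nat, 'k::field) mpoly set" where
  "mprods n 0 = {1}"
| "mprods n (Suc k) = {gminor n i j * g | i j g. i < n \<and> j < n \<and> g \<in> mprods n k}"

definition IK :: "nat \<Rightarrow> nat \<Rightarrow> nat \<Rightarrow> (nat, 'k::field) mpoly set" where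
  "IK n k = gen (gv n) (mprods n k) (2 * k)"

lemma gminor_H: "i < n \<Longrightarrow> j < n \<Longrightarrow> gminor n i j \<in> H (gv n) 2"
  unfolding gminor_def numeral_2_eq_2 by (intro H_diff H_Var_mult H_Var[unfolded One_nat_def]) auto

lemma mprods_H: "mprods n k \<subseteq> H (gv n) (2 * k)"
proof (induction k)
  case (Suc k)
  then show ?case using H_mult[OF gminor_H] by (fastforce simp: add.commute)
qed simp

lemma gid_IK: "gid (gv n) (IK n k)"
  unfolding IK_def by (rule gid_gen[OF mprods_H])

lemma IK_0: "IK n 0 d = (H (gv n) d :: (nat, 'k::field) mpoly set)"
proof
  show "(H (gv n) d :: (nat, 'k) mpoly set) \<subseteq> IK n 0 d"
  proof
    fix p :: "(nat, 'k) mpoly" assume "p \<in> H (gv n) d"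
    then show "p \<in> IK n 0 d" using gen_mult[of p "gv n" d 1 "mprods n 0" 0] by (simp add: IK_def)
  qed
qed (use gid_H[OF gid_IK] in blast)

lemma IK_mult:
  assumes "p \<in> IK n k d" "q \<in> IK n l e"
  shows "p * q \<in> IK n (k + l) (d + e)"
proof -
  have prods: "g * h \<in> mprods n (k + l)" if "g \<in> mprods n k" "h \<in> mprods n l" for g h :: "(nat, 'a) mpoly"
    using that
  proof (induction k arbitrary: g)
    case (Suc k)
    then obtain i j g' where "g = gminor n i j * g'" "i < n" "j < n" "g' \<in> mprods n k" by auto
    then show ?case using Suc by (auto simp: mult.assoc)
  qed simp
  from assms(1)[unfolded IK_def] show ?thesis
  proof (induction rule: gen_induct)
    case (mult e' r g)
    note r = mult
    from assms(2)[unfolded IK_def] show ?case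
    proof (induction rule: gen_induct)
      case (mult e'' r' g')
      have "(r * r') * (g * g') \<in> IK n (k + l) (e' + e'' + 2 * (k + l))"
        unfolding IK_def using r mult by (intro gen_mult H_mult prods)
      then show ?case by (simp add: mult_ac add_ac distrib_left)
    qed (auto simp: distrib_left intro: gid_0[OF gid_IK] gid_add[OF gid_IK])
  qed (auto simp: distrib_right intro: gid_0[OF gid_IK] gid_add[OF gid_IK])
qed

lemma gminor_IK: "i < n \<Longrightarrow> j < n \<Longrightarrow> gminor n i j \<in> IK n 1 2"
proof -
  assume ij: "i < n" "j < n"
  then have "gminor n i j \<in> mprods n 1" by auto
  from gen_mult[OF H_one this, of "gv n" 2] show ?thesis by (simp only: IK_def mult_1_right mult_1 add_0)
qed

lemma IK_Suc_le: "IK n (Suc k) d \<subseteq> IK n k d"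
  unfolding IK_def[of n "Suc k"]
proof (rule gen_le[OF gid_IK])
  fix g :: "(nat, 'a) mpoly" assume "g \<in> mprods n (Suc k)"
  then obtain i j h where g: "g = gminor n i j * h" "i < n" "j < n" "h \<in> mprods n k" by auto
  have "gminor n i j * h \<in> gen (gv n) (mprods n k) (2 * k) (2 + 2 * k)" by (intro gen_mult gminor_H g)
  then show "g \<in> IK n k (2 * Suc k)" by (simp add: g IK_def)
qed

subsection \<open>The initial ideal\<close>

definition lin :: "('m \<Rightarrow> 'k::field) \<Rightarrow> ('m \<Rightarrow>\<^sub>0 'k) \<Rightarrow> 'k" where
  "lin W p = (\<Sum>m\<in>supp p. cf p m * W m)"

lemma lin_superset: "finite M \<Longrightarrow> supp p \<subseteq> M \<Longrightarrow> lin W p = (\<Sum>m\<in>M. cf p m * W m)"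
  unfolding lin_def by (intro sum.mono_neutral_left) (auto simp: in_keys_iff)

lemma lin_add: "lin W (p + q) = lin W p + lin W q"
  unfolding lin_def by (rule setsum_keys_plus_distrib) (auto simp: distrib_right)

lemma lin_0 [simp]: "lin W 0 = 0"
  by (simp add: lin_def)

lemma lin_uminus: "lin W (- p) = - lin W p"
  using lin_add[of W p "- p"] by (simp add: eq_neg_iff_add_eq_0 add.commute)

lemma lin_diff: "lin W (p - q) = lin W p - lin W q"
  using lin_add[of W p "- q"] by (simp add: lin_uminus)

lemma lin_single_mult: "lin W (Poly_Mapping.single a 1 * p) = lin (\<lambda>m. W (a + m)) (p :: ('v, 'k::field) mpoly)"
proof -
  have "lin W (Poly_Mapping.single a 1 * p) = (\<Sum>m\<in>(\<lambda>m. a + m) ` supp p. cf (Poly_Mapping.single a 1 * p) m * W m)"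
    using supp_mult_single[of a 1 p] by (intro lin_superset) auto
  also have "\<dots> = (\<Sum>m\<in>supp p. cf p m * W (a + m))" by (subst sum.reindex) (auto simp: lookup_mult_single)
  finally show ?thesis by (simp add: lin_def)
qed

lemma lin_wdiff: "lin (\<lambda>m. W m - W' m) p = lin W p - lin W' p"
  by (simp add: lin_def right_diff_distrib sum_subtractf)

text \<open>The value at the all-ones point of the divided derivative of order \<open>c\<close> in
  the variables of \<open>U\<close>, applied to the monomial \<open>m\<close>. In every
  characteristic it is 1 if \<open>m\<close> has exponents \<open>c\<close> on
  \<open>U\<close>.\<close>

definition binw :: "nat set \<Rightarrow> (nat \<Rightarrow> nat) \<Rightarrow> (nat \<Rightarrow>\<^sub>0 nat) \<Rightarrow> 'k::field" where
  "binw U c m = (\<Prod>u\<in>U. of_nat (cf m u choose c u))"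

text \<open>\<open>C\<close> cannot tell apart the two monomials of a minor, whatever monomial
  multiplies them; multigraded components have this property.\<close>

definition exch :: "nat \<Rightarrow> ((nat \<Rightarrow>\<^sub>0 nat) \<Rightarrow> bool) \<Rightarrow> bool" where
  "exch n C \<longleftrightarrow> (\<forall>i<n. \<forall>j<n. \<forall>m. C (expo i + expo (n + j) + m) = C (expo j + expo (n + i) + m))"

text \<open>Differential operators (in divided power form) of order less than \<open>k\<close> in the variables of
  \<open>U\<close>, evaluated at the point with all coordinates \<open>1\<close>. The predicate \<open>C\<close> restricts them to a
  multigraded component.\<close>

inductive dop :: "nat \<Rightarrow> nat set \<Rightarrow> nat \<Rightarrow> ((nat \<Rightarrow>\<^sub>0 nat) \<Rightarrow> 'k::field) \<Rightarrow> bool" for n U k where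
  base: "exch n C \<Longrightarrow> sum c U < k \<Longrightarrow> dop n U k (\<lambda>m. if C m then binw U c m else 0)"
| zero: "dop n U k (\<lambda>m. 0)"
| add: "dop n U k W \<Longrightarrow> dop n U k W' \<Longrightarrow> dop n U k (\<lambda>m. W m + W' m)"
| diff: "dop n U k W \<Longrightarrow> dop n U k W' \<Longrightarrow> dop n U k (\<lambda>m. W m - W' m)"

text \<open>Pascal's rule, read as the Leibniz rule for multiplication by a variable of value
  1.\<close>

lemma binw_expo:
  assumes "finite U"
  shows "binw U c (expo v + m) = (binw U c m :: 'k::field) +
    (if v \<in> U \<and> 0 < c v then binw U (c(v := c v - 1)) m else 0)"
proof (cases "v \<in> U")
  case False
  then have "binw U c (expo v + m) = (binw U c m :: 'k)"
    unfolding binw_def by (intro prod.cong) (auto simp: lookup_add lookup_expo)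
  then show ?thesis using False by simp
next
  case True
  have split: "binw U c' m' = of_nat (cf m' v choose c' v) * (\<Prod>u\<in>U - {v}. of_nat (cf m' u choose c' u) :: 'k)" for c' m'
    unfolding binw_def using True assms by (simp add: prod.remove)
  have rest: "(\<Prod>u\<in>U - {v}. of_nat (cf (expo v + m) u choose c u)) = (\<Prod>u\<in>U - {v}. of_nat (cf m u choose c u) :: 'k)"
    by (intro prod.cong) (auto simp: lookup_add lookup_expo)
  have rest': "(\<Prod>u\<in>U - {v}. of_nat (cf m u choose (c(v := c v - 1)) u)) = (\<Prod>u\<in>U - {v}. of_nat (cf m u choose c u) :: 'k)"
    by (intro prod.cong) auto
  show ?thesis
  proof (cases "c v")
    case 0
    then show ?thesis using split[of c "expo v + m"] split[of c m] by (simp add: rest)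
  next
    case (Suc b)
    have "of_nat (cf (expo v + m) v choose c v) = (of_nat (cf m v choose c v) + of_nat (cf m v choose b) :: 'k)"
      by (simp add: lookup_add lookup_expo Suc)
    then show ?thesis using split[of c "expo v + m"] split[of c m] split[of "c(v := c v - 1)" m] True
      by (simp add: rest rest' Suc distrib_right)
  qed
qed

text \<open>A minor vanishes at the all-ones point, so composing with multiplication by it turns an
  operator of order at most \<open>k\<close> into one of order less than \<open>k\<close>.\<close>

lemma dop_exchange:
  assumes "dop n U (Suc k) W" "finite U" "i < n" "j < n"
  shows "dop n U k (\<lambda>m. (W (expo i + expo (n + j) + m) :: 'k::field) - W (expo j + expo (n + i) + m))"
  using assms(1)
proof (induction rule: dop.induct)
  case (base C c)
  define C' where "C' m = C (expo i + expo (n + j) + m)" for m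
  have C': "C' m = C (expo j + expo (n + i) + m)" for m using base(1) assms(3,4) by (auto simp: C'_def exch_def)
  have ex: "exch n C'" unfolding exch_def C'_def
  proof (intro allI impI)
    fix i' j' m assume "i' < n" "j' < n"
    then have "C (expo i' + expo (n + j') + (expo i + expo (n + j) + m)) = C (expo j' + expo (n + i') + (expo i + expo (n + j) + m))"
      using base(1) by (simp add: exch_def)
    then show "C (expo i + expo (n + j) + (expo i' + expo (n + j') + m)) = C (expo i + expo (n + j) + (expo j' + expo (n + i') + m))"
      by (simp add: add_ac)
  qed
  define T where "T c v m = (if C' m then (if v \<in> U \<and> 0 < c v then binw U (c(v := c v - 1)) m else 0) else (0 :: 'k))"
    for c :: "nat \<Rightarrow> nat" and v m
  have lower: "sum (c(v := c v - 1)) U < sum c U" if "v \<in> U" "0 < c v" for c :: "nat \<Rightarrow> nat" and v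
    using that \<open>finite U\<close> by (intro sum_strict_mono_ex1) auto
  have T: "dop n U k (T c' v)" if "sum c' U \<le> k" for c' v
  proof (cases "v \<in> U \<and> 0 < c' v")
    case True
    then have "dop n U k (\<lambda>m. if C' m then binw U (c'(v := c' v - 1)) m else (0 :: 'k))"
      using lower[of v c'] that by (intro dop.base ex) auto
    moreover have "T c' v = (\<lambda>m. if C' m then binw U (c'(v := c' v - 1)) m else (0 :: 'k))"
      using True by (auto simp: T_def fun_eq_iff)
    ultimately show ?thesis by simp
  next
    case False
    then have "T c' v = (\<lambda>_. 0)" by (auto simp: T_def fun_eq_iff)
    then show ?thesis by (simp add: dop.zero)
  qed
  \<comment> \<open>The lower-order terms left by multiplication with two variables; the terms of
    full order are the same for both monomials of the minor and cancel.\<close>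
  define T2 where "T2 u v = (\<lambda>m. T c v m + (T c u m + (if u \<in> U \<and> 0 < c u then T (c(u := c u - 1)) v m else 0)))" for u v
  have T2: "dop n U k (T2 u v)" for u v
  proof -
    have c: "sum c U \<le> k" using base(2) by simp
    have "dop n U k (\<lambda>m. if u \<in> U \<and> 0 < c u then T (c(u := c u - 1)) v m else 0)"
    proof (cases "u \<in> U \<and> 0 < c u")
      case True
      then show ?thesis using T[of "c(u := c u - 1)" v] lower[of u c] c by auto
    next
      case False
      then have "(\<lambda>m. if u \<in> U \<and> 0 < c u then T (c(u := c u - 1)) v m else 0) = (\<lambda>_. 0)" by auto
      then show ?thesis by (simp only: dop.zero)
    qed
    then show ?thesis unfolding T2_def by (intro dop.add T c)
  qed
  have two: "(if C' m then binw U c (expo u + expo v + m) else 0) = (if C' m then binw U c m else 0) + T2 u v m" for u v m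
    by (simp add: T2_def T_def binw_expo[OF \<open>finite U\<close>] add.assoc)
  have "(\<lambda>m. (if C (expo i + expo (n + j) + m) then binw U c (expo i + expo (n + j) + m) else 0) -
        (if C (expo j + expo (n + i) + m) then binw U c (expo j + expo (n + i) + m) else (0 :: 'k))) =
      (\<lambda>m. T2 i (n + j) m - T2 j (n + i) m)"
  proof
    fix m
    show "(if C (expo i + expo (n + j) + m) then binw U c (expo i + expo (n + j) + m) else 0) -
        (if C (expo j + expo (n + i) + m) then binw U c (expo j + expo (n + i) + m) else (0 :: 'k)) =
      T2 i (n + j) m - T2 j (n + i) m"
      using two[of m i "n + j"] two[of m j "n + i"] C'[of m] by (simp only: C'_def add_diff_cancel_left)
  qed
  then show ?case using dop.diff[OF T2 T2] by simp
next
  case (add W W')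
  have "dop n U k (\<lambda>m. (W (expo i + expo (n + j) + m) - W (expo j + expo (n + i) + m)) +
      (W' (expo i + expo (n + j) + m) - W' (expo j + expo (n + i) + m)))"
    by (rule dop.add[OF add.IH])
  then show ?case by (simp add: algebra_simps)
next
  case (diff W W')
  have "dop n U k (\<lambda>m. (W (expo i + expo (n + j) + m) - W (expo j + expo (n + i) + m)) -
      (W' (expo i + expo (n + j) + m) - W' (expo j + expo (n + i) + m)))"
    by (rule dop.diff[OF diff.IH])
  then show ?case by (simp add: algebra_simps)
qed (simp add: dop.zero)

lemma gminor_single: "gminor n i j * p = Poly_Mapping.single (expo i + expo (n + j)) 1 * p
    - Poly_Mapping.single (expo j + expo (n + i)) 1 * p"
  by (simp add: gminor_def Var_mon left_diff_distrib flip: mon_mult) (simp add: mon_def)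

lemma dop_mprods:
  assumes "dop n U k W" "finite U" "g \<in> mprods n k"
  shows "lin W (q * g) = (0 :: 'k::field)" using assms(1,3)
proof (induction k arbitrary: W g q)
  case 0
  have "W = (\<lambda>_. 0)" using 0(1) by (induction rule: dop.induct) auto
  then show ?case by (simp add: lin_def)
next
  case (Suc k)
  obtain i j h where g: "g = gminor n i j * h" "i < n" "j < n" "h \<in> mprods n k" using Suc.prems(2) by auto
  have "q * g = gminor n i j * (q * h)" by (simp add: g mult_ac)
  then have "lin W (q * g) = lin (\<lambda>m. W (expo i + expo (n + j) + m) - W (expo j + expo (n + i) + m)) (q * h)"
    by (simp add: gminor_single lin_diff lin_single_mult lin_wdiff)
  also have "\<dots> = 0" by (rule Suc.IH[OF dop_exchange[OF Suc.prems(1) assms(2) g(2,3)] g(4)])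
  finally show ?case .
qed

lemma dop_IK:
  assumes "dop n U k W" "finite U" "p \<in> IK n k d"
  shows "lin W p = (0 :: 'k::field)" using assms(3) unfolding IK_def
  by (induction rule: gen_induct) (auto simp: lin_add dop_mprods[OF assms(1,2)])

text \<open>The order on exponents from the library is lexicographic, with \<open>Var 0\<close> the largest variable.\<close>

lemma less_pm_iff: "(m :: nat \<Rightarrow>\<^sub>0 nat) < m' \<longleftrightarrow> (\<exists>u. cf m u < cf m' u \<and> (\<forall>v<u. cf m v = cf m' v))"
  by transfer (auto simp: less_fun_def)

text \<open>If the leading exponent \<open>\<mu>\<close> fails the count at \<open>t\<close>, the
  divided derivative given by the exponents of \<open>\<mu>\<close> on \<open>colU n t\<close> has
  order less than \<open>k\<close> and annihilates \<open>f\<close>. Restricted to the multidegree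
  of \<open>\<mu>\<close> it sees only the leading term, a contradiction.\<close>

lemma initial_IK:
  assumes f: "(f :: (nat, 'k::field) mpoly) \<in> IK n k d" "f \<noteq> 0"
  shows "Max (supp f) \<in> MI n {} (\<lambda>_. k)"
proof (rule ccontr)
  define \<mu> where "\<mu> = Max (supp f)"
  have \<mu>: "\<mu> \<in> supp f" and max: "\<And>m. m \<in> supp f \<Longrightarrow> m \<le> \<mu>" using f(2) by (auto simp: \<mu>_def intro!: Max_in)
  have supp: "supp m \<subseteq> gv n" if "m \<in> supp f" for m using gid_H[OF gid_IK f(1)] that by (auto simp: H_def)
  assume "Max (supp f) \<notin> MI n {} (\<lambda>_. k)"
  then obtain t where t: "t < n" "cnt n t \<mu> < k" by (auto simp: MI_def \<mu>_def not_le)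
  define U where "U = colU n t"
  \<comment> \<open>The multidegree: the degree in each column and the degree in the first
    row.\<close>
  define C where "C m \<longleftrightarrow> (\<forall>i<n. cf m i + cf m (n + i) = cf \<mu> i + cf \<mu> (n + i)) \<and>
    (\<Sum>i<n. cf m i) = (\<Sum>i<n. cf \<mu> i)" for m
  have "exch n C"
  proof -
    have 1: "cf (expo i + expo (n + j) + m) l + cf (expo i + expo (n + j) + m) (n + l) =
        cf (expo j + expo (n + i) + m) l + cf (expo j + expo (n + i) + m) (n + l)" if "l < n" "i < n" "j < n" for i j l m
      using that by (auto simp: lookup_add lookup_expo)
    have 2: "(\<Sum>l<n. cf (expo i + expo (n + j) + m) l) = Suc (\<Sum>l<n. cf m l)" if "i < n" for i j m
      using that by (simp add: lookup_add lookup_expo sum.distrib)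
    show ?thesis by (simp add: exch_def C_def 1 2)
  qed
  then have "dop n U k (\<lambda>m. if C m then binw U (cf \<mu>) m else (0 :: 'k))"
    using t by (intro dop.base) (auto simp: U_def cnt_def)
  then have "lin (\<lambda>m. if C m then binw U (cf \<mu>) m else (0 :: 'k)) f = 0"
    by (rule dop_IK[OF _ _ f(1)]) (simp add: U_def)
  moreover have "lin (\<lambda>m. if C m then binw U (cf \<mu>) m else (0 :: 'k)) f = (\<Sum>m\<in>supp f. if m = \<mu> then cf f \<mu> else 0)"
    unfolding lin_def
  proof (rule sum.cong[OF refl])
    fix m assume m: "m \<in> supp f"
    show "cf f m * (if C m then binw U (cf \<mu>) m else 0) = (if m = \<mu> then cf f \<mu> else 0)"
    proof (cases "m = \<mu>")
      case True
      then show ?thesis by (simp add: binw_def C_def)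
    next
      case False
      have "binw U (cf \<mu>) m = (0 :: 'k)" if C: "C m"
      proof (rule ccontr)
        assume "binw U (cf \<mu>) m \<noteq> (0 :: 'k)"
        then have ge: "cf \<mu> u \<le> cf m u" if "u \<in> U" for u
          using that by (auto simp: binw_def U_def) (metis binomial_eq_0 leI of_nat_0)
        obtain u where u: "cf m u < cf \<mu> u" "\<And>v. v < u \<Longrightarrow> cf m v = cf \<mu> v"
          using max[OF m] False by (metis less_pm_iff order.not_eq_order_implies_strict)
        have "t \<le> u"
        proof (rule ccontr)
          assume "\<not> t \<le> u"
          then have "u \<in> U" by (simp add: U_def colU_def)
          then show False using ge[of u] u(1) by simp
        qed
        then have low: "cf m i = cf \<mu> i" if "i < t" for i using u(2) that by simp
        have high: "cf m j \<le> cf \<mu> j" if "j \<in> {t<..<n}" for j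
        proof -
          have "cf \<mu> (n + j) \<le> cf m (n + j)" using that by (intro ge) (auto simp: U_def colU_def)
          moreover have "cf m j + cf m (n + j) = cf \<mu> j + cf \<mu> (n + j)" using C that by (auto simp: C_def)
          ultimately show ?thesis by linarith
        qed
        \<comment> \<open>From column \<open>t\<close> on, the first rows of \<open>m\<close> and
          \<open>\<mu>\<close> have equal totals, and after column \<open>t\<close> that of
          \<open>m\<close> is nowhere larger. So \<open>m\<close> is not smaller at
          \<open>t\<close>, the first difference comes later, the entries at \<open>t\<close> agree,
          and equal totals force equality after \<open>t\<close> as well.\<close>
        have split: "(\<Sum>i<n. h i) = (\<Sum>i<t. h i) + (h t + (\<Sum>j\<in>{t<..<n}. h j))" for h :: "nat \<Rightarrow> nat"
        proof -
          have "{..<n} = {..<t} \<union> insert t {t<..<n}" using t by auto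
          moreover have "sum h ({..<t} \<union> insert t {t<..<n}) = sum h {..<t} + sum h (insert t {t<..<n})"
            by (intro sum.union_disjoint) auto
          ultimately show ?thesis by simp
        qed
        have eq: "cf m t + (\<Sum>j\<in>{t<..<n}. cf m j) = cf \<mu> t + (\<Sum>j\<in>{t<..<n}. cf \<mu> j)"
          using C split[of "cf m"] split[of "cf \<mu>"] low by (simp add: C_def)
        have le: "(\<Sum>j\<in>{t<..<n}. cf m j) \<le> (\<Sum>j\<in>{t<..<n}. cf \<mu> j)" by (intro sum_mono high)
        then have "cf \<mu> t \<le> cf m t" using eq by linarith
        then have "u \<noteq> t" using u(1) by auto
        then have tt: "cf m t = cf \<mu> t" using \<open>t \<le> u\<close> u(2) by simp
        then have "(\<Sum>j\<in>{t<..<n}. cf m j) = (\<Sum>j\<in>{t<..<n}. cf \<mu> j)" using eq by simp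
        then have "\<forall>j\<in>{t<..<n}. cf m j = cf \<mu> j" using high by (metis (no_types, lifting) sum_mono_inv finite_greaterThanLessThan)
        then have row: "cf m i = cf \<mu> i" if "i < n" for i
          using low tt that by (metis greaterThanLessThan_iff linorder_neqE_nat)
        have "cf m (n + i) = cf \<mu> (n + i)" if "i < n" for i
        proof -
          have "cf m i + cf m (n + i) = cf \<mu> i + cf \<mu> (n + i)" using C that by (auto simp: C_def)
          then show ?thesis using row[OF that] by simp
        qed
        then have "cf m v = cf \<mu> v" if "v < 2 * n" for v
          using row[of v] that by (metis add_diff_inverse_nat less_diff_conv2 mult_2 not_le_imp_less add_less_cancel_left)
        moreover have "cf m v = cf \<mu> v" if "\<not> v < 2 * n" for v
        proof -
          have "v \<notin> supp m" "v \<notin> supp \<mu>" using supp[OF m] supp[OF \<mu>] that by auto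
          then show ?thesis by (simp add: in_keys_iff)
        qed
        ultimately have "m = \<mu>" by (intro poly_mapping_eqI) blast
        then show False using False by simp
      qed
      then show ?thesis using False by auto
    qed
  qed
  ultimately show False using \<mu> by (simp add: in_keys_iff)
qed

definition lead :: "('v::linorder, 'k::field) mpoly \<Rightarrow> ('v \<Rightarrow>\<^sub>0 nat) \<Rightarrow> bool" where
  "lead f m \<longleftrightarrow> cf f m = 1 \<and> (\<forall>l\<in>supp f. l \<le> m)"

lemma lead_gminor:
  assumes "lead f m" "i < j" "j < n"
  shows "lead (gminor n i j * f :: (nat, 'k::field) mpoly) (expo i + expo (n + j) + m)"
proof -
  let ?a = "expo i + expo (n + j)" and ?b = "expo j + expo (n + i)"
  have ab: "?b < ?a"
    unfolding less_pm_iff using assms(2,3) by (intro exI[of _ i]) (auto simp: lookup_add lookup_expo)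
  have 1: "l \<le> ?a + m" if "l \<in> supp (gminor n i j * f)" for l
  proof -
    have "l \<in> (\<lambda>x. ?a + x) ` supp f \<union> (\<lambda>x. ?b + x) ` supp f"
      using that keys_diff[of "Poly_Mapping.single ?a 1 * f" "Poly_Mapping.single ?b 1 * f"]
        supp_mult_single[of ?a 1 f] supp_mult_single[of ?b 1 f] unfolding gminor_single by blast
    then obtain x where "x \<in> supp f" "l = ?a + x \<or> l = ?b + x" by blast
    moreover have "x \<le> m" using assms(1) calculation(1) by (simp add: lead_def)
    ultimately show ?thesis using add_left_mono[of x m ?a] add_mono[OF less_imp_le[OF ab], of x m] by blast
  qed
  have "cf (Poly_Mapping.single ?b 1 * f) (?a + m) = 0"
  proof (rule ccontr)
    assume "cf (Poly_Mapping.single ?b 1 * f) (?a + m) \<noteq> 0"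
    then obtain x where x: "x \<in> supp f" "?a + m = ?b + x"
      using supp_mult_single[of ?b 1 f] by (auto simp: in_keys_iff subset_iff image_iff)
    have "x \<le> m" using assms(1) x(1) by (simp add: lead_def)
    then have "?b + x < ?a + m" by (rule add_less_le_mono[OF ab])
    then show False using x(2) by simp
  qed
  then have "cf (gminor n i j * f) (?a + m) = 1"
    using assms(1) by (simp add: gminor_single lookup_minus lookup_mult_single lead_def)
  then show ?thesis using 1 by (auto simp: lead_def)
qed

text \<open>Divide \<open>m\<close> by the leading term of a minor and use induction. Taking the
  first column \<open>i\<close> present in the first row, and then the first later column
  \<open>j\<close> present in the second row, keeps all counts at least \<open>k\<close>.\<close>

lemma initial_IK_ex:
  assumes "0 < n" "m \<in> MI n {} (\<lambda>_. k)" "supp m \<subseteq> gv n"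
  shows "\<exists>f\<in>IK n k (monom_deg m). lead (f :: (nat, 'k::field) mpoly) m" using assms(2,3)
proof (induction k arbitrary: m)
  case 0
  have "lead (mon m :: (nat, 'k) mpoly) m" by (auto simp: lead_def lookup_mon)
  then show ?case using H_mon[OF 0(2)] by (auto simp: IK_0)
next
  case (Suc k)
  have cn: "Suc k \<le> cnt n t m" if "t < n" for t using Suc.prems(1) that by (auto simp: MI_def)
  define i where "i = (LEAST i. 0 < cf m i)"
  have ex_i: "\<exists>i<n - 1. 0 < cf m i"
  proof (rule ccontr)
    assume neg: "\<not> (\<exists>i<n - 1. 0 < cf m i)"
    have "colU n (n - 1) = {..<n - 1}" using assms(1) by (auto simp: colU_def)
    then have "cnt n (n - 1) m = 0" using neg by (simp add: cnt_def)
    then show False using cn[of "n - 1"] assms(1) by simp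
  qed
  then have i: "i < n - 1" "0 < cf m i"
    unfolding i_def by (metis (mono_tags, lifting) LeastI Least_le order_le_less_trans)+
  have i_least: "cf m l = 0" if "l < i" for l using not_less_Least[of l "\<lambda>i. 0 < cf m i"] that by (auto simp: i_def)
  have cnt_i: "cnt n i m = (\<Sum>u\<in>{n + i<..<2 * n}. cf m u)"
    unfolding cnt_def colU_def using i_least i by (subst sum.union_disjoint) auto
  have ex_j: "\<exists>j. i < j \<and> j < n \<and> 0 < cf m (n + j)"
  proof (rule ccontr)
    assume neg: "\<not> ?thesis"
    have "cf m u = 0" if "u \<in> {n + i<..<2 * n}" for u using neg that by (auto dest!: spec[of _ "u - n"])
    moreover have "i < n" using i by simp
    ultimately show False using cn[of i] cnt_i by simp
  qed
  define j where "j = (LEAST j. i < j \<and> j < n \<and> 0 < cf m (n + j))"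
  have j: "i < j" "j < n" "0 < cf m (n + j)" using LeastI_ex[OF ex_j] by (auto simp: j_def)
  have j_least: "cf m (n + l) = 0" if "i < l" "l < j" for l
    using not_less_Least[of l "\<lambda>j. i < j \<and> j < n \<and> 0 < cf m (n + j)"] that j(2) by (auto simp: j_def)
  define m' where "m' = m - (expo i + expo (n + j))"
  have m: "m = expo i + expo (n + j) + m'"
    using i j by (intro poly_mapping_eqI) (auto simp: m'_def lookup_add lookup_minus lookup_expo)
  have "m' \<in> MI n {} (\<lambda>_. k)"
  proof -
    have "k \<le> cnt n t m'" if t: "t < n" for t
    proof -
      have cnt_m: "cnt n t m = (if i \<in> colU n t then 1 else 0) + (if n + j \<in> colU n t then 1 else 0) + cnt n t m'"
        by (subst m) (simp only: cnt_add cnt_expo)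
      show ?thesis
      proof (cases "i < t \<and> t < j")
        case False
        then have "\<not> (i \<in> colU n t \<and> n + j \<in> colU n t)" using i j t by (auto simp: colU_def)
        then show ?thesis using cnt_m cn[OF t] by (auto split: if_splits)
      next
        \<comment> \<open>Both factors count here, so the count drops by two. As no second-row
          variable strictly between columns \<open>i\<close> and \<open>j\<close> occurs, everything
          counted at \<open>i\<close>, and the variable \<open>i\<close> itself, is counted at
          \<open>t\<close>: before division the count is at least \<open>k + 2\<close>.\<close>
        case True
        have "insert i {n + i<..<2 * n} \<inter> {u. u \<in> colU n t \<or> cf m u \<noteq> 0} \<subseteq> colU n t"
        proof
          fix u assume u: "u \<in> insert i {n + i<..<2 * n} \<inter> {u. u \<in> colU n t \<or> cf m u \<noteq> 0}"
          show "u \<in> colU n t"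
          proof (cases "u = i \<or> n + t < u")
            case True
            then show ?thesis using u \<open>i < t \<and> t < j\<close> by (auto simp: colU_def)
          next
            case False
            then have "cf m (n + (u - n)) = 0" using u True by (intro j_least) auto
            then show ?thesis using u False by auto
          qed
        qed
        then have "(\<Sum>u\<in>insert i {n + i<..<2 * n}. cf m u) \<le> cnt n t m"
        proof -
          assume sub: "insert i {n + i<..<2 * n} \<inter> {u. u \<in> colU n t \<or> cf m u \<noteq> 0} \<subseteq> colU n t"
          have "(\<Sum>u\<in>insert i {n + i<..<2 * n}. cf m u) = (\<Sum>u\<in>insert i {n + i<..<2 * n} \<inter> colU n t. cf m u)"
            by (intro sum.mono_neutral_right) (use sub in auto)
          also have "\<dots> \<le> cnt n t m" unfolding cnt_def by (intro sum_mono2) auto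
          finally show ?thesis .
        qed
        moreover have "(\<Sum>u\<in>insert i {n + i<..<2 * n}. cf m u) = cf m i + cnt n i m" using i by (simp add: cnt_i)
        moreover have "i < n" using i by simp
        ultimately have "Suc (Suc k) \<le> cnt n t m" using cn[of i] i by linarith
        then show ?thesis using cnt_m by (auto split: if_splits)
      qed
    qed
    then show ?thesis by (simp add: MI_def)
  qed
  moreover have "supp m' \<subseteq> gv n" using Suc.prems(2) m supp_add_nat by (metis le_sup_iff)
  ultimately obtain f where f: "f \<in> IK n k (monom_deg m')" "lead (f :: (nat, 'k) mpoly) m'" using Suc.IH by blast
  have "gminor n i j * f \<in> IK n (1 + k) (2 + monom_deg m')" using i j by (intro IK_mult gminor_IK f) auto
  moreover have "monom_deg m = 2 + monom_deg m'" by (subst m) simp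
  ultimately show ?case using lead_gminor[OF f(2) j(1,2)] m by auto
qed

subsection \<open>Regularity bounds pass from the initial ideal to the ideal\<close>

text \<open>The multidegree of the Koszul basis vector e_F; with it the Koszul complex of the
  variables is multigraded.\<close>

definition chi :: "'v set \<Rightarrow> ('v \<Rightarrow>\<^sub>0 nat)" where
  "chi F = (\<Sum>v\<in>F. expo v)"

lemma chi_insert: "finite F \<Longrightarrow> v \<notin> F \<Longrightarrow> chi (insert v F) = expo v + chi F"
  by (simp add: chi_def)

lemma supp_chi: "finite F \<Longrightarrow> supp (chi F) = F"
proof (induction F rule: finite_induct)
  case empty
  show ?case by (simp add: chi_def)
qed (simp add: chi_insert supp_add_nat)

lemma monom_deg_chi: "finite F \<Longrightarrow> monom_deg (chi F) = card F"
proof (induction F rule: finite_induct)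
  case empty
  show ?case by (simp add: chi_def)
qed (simp add: chi_insert)

definition mpart :: "('v \<Rightarrow>\<^sub>0 nat) \<Rightarrow> 'v set \<Rightarrow> ('v, 'k::field) mpoly \<Rightarrow> ('v, 'k) mpoly" where
  "mpart \<mu> F p = (if \<mu> = (\<mu> - chi F) + chi F then Const (cf p (\<mu> - chi F)) * mon (\<mu> - chi F) else 0)"

lemma lookup_mpart: "cf (mpart \<mu> F p) m = (if m + chi F = \<mu> then cf p m else 0)"
  by (auto simp: mpart_def lookup_mon)

lemma mpart_add: "mpart \<mu> F (p + q) = mpart \<mu> F p + mpart \<mu> F q"
  and mpart_diff: "mpart \<mu> F (p - q) = mpart \<mu> F p - mpart \<mu> F q"
  and mpart_0: "mpart \<mu> F 0 = 0"
  and mpart_mpart: "mpart \<mu> F (mpart \<mu> F p) = mpart \<mu> F p"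
  and mpart_uminus: "mpart \<mu> F (- p) = - mpart \<mu> F p"
  by (rule poly_mapping_eqI; simp add: lookup_mpart lookup_add lookup_minus)+

lemma mpart_sum: "mpart \<mu> F (sum f I) = (\<Sum>i\<in>I. mpart \<mu> F (f i))"
  by (induction I rule: infinite_finite_induct) (auto simp: mpart_0 mpart_add)

lemma supp_mpart: "supp (mpart \<mu> F p) \<subseteq> supp p"
  by (auto simp: in_keys_iff lookup_mpart split: if_splits)

lemma mpart_H: "p \<in> H A d \<Longrightarrow> mpart \<mu> F p \<in> H A d"
  using supp_mpart[of \<mu> F p] by (auto simp: H_def)

lemma mpart_Hp: "p \<in> Hp A d \<Longrightarrow> mpart \<mu> F p \<in> Hp A d"
  by (auto simp: Hp_def mpart_H mpart_0)

lemma mpart_Var: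
  assumes "finite T" "v \<notin> T"
  shows "mpart \<mu> T (Var v * p) = Var v * mpart \<mu> (insert v T) p"
proof (rule poly_mapping_eqI)
  fix m
  show "cf (mpart \<mu> T (Var v * p)) m = cf (Var v * mpart \<mu> (insert v T) p) m"
  proof (cases "\<exists>l. m = expo v + l")
    case True
    then obtain l where l: "m = expo v + l" by blast
    have V: "cf (Var v * q) (expo v + l) = cf q l" for q :: "('a, 'b) mpoly"
      using lookup_mult_single[of "expo v" 1 q l] by (simp add: Var_mon mon_def)
    have "l + (expo v + chi T) = expo v + l + chi T" by (simp add: add_ac)
    then show ?thesis using assms by (simp add: lookup_mpart l V chi_insert)
  next
    case False
    then have "m \<notin> supp (Var v * q)" for q :: "('a, 'b) mpoly" by (auto simp: supp_Var_mult)
    then show ?thesis by (simp add: lookup_mpart in_keys_iff)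
  qed
qed

lemma mpart_sg: "mpart \<mu> T (sg v \<rho> * p) = sg v \<rho> * mpart \<mu> T p"
  using sg_cases[of v \<rho>, where 'r = "('a, 'b) mpoly"] by (auto simp: mpart_uminus)

lemma mpart_bd:
  assumes "finite A" "T \<subseteq> A"
  shows "mpart \<mu> T (bd Var A z T) = bd Var A (\<lambda>F. mpart \<mu> F (z F)) T"
proof -
  have "finite T" using assms finite_subset by blast
  then show ?thesis unfolding bd_def mpart_sum mult.assoc mpart_sg
    by (intro sum.cong refl) (simp add: mpart_Var)
qed

lemma lookup_outside: "supp m \<subseteq> A \<Longrightarrow> v \<notin> A \<Longrightarrow> cf m v = 0"
  by (metis in_keys_iff subsetD)

lemma finite_exponents:
  assumes "finite A"
  shows "finite {m :: 'v \<Rightarrow>\<^sub>0 nat. supp m \<subseteq> A \<and> monom_deg m \<le> d}"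
proof (rule finite_imageD)
  have "cf m v \<le> d" if "supp m \<subseteq> A" "monom_deg m \<le> d" for m :: "'v \<Rightarrow>\<^sub>0 nat" and v
  proof (cases "v \<in> A")
    case True
    have "cf m v \<le> (\<Sum>v\<in>A. cf m v)" using True assms by (intro member_le_sum) auto
    then show ?thesis using monom_deg_superset[OF assms that(1)] that(2) by simp
  next
    case False
    then show ?thesis using lookup_outside[OF that(1)] by simp
  qed
  then have "(\<lambda>m. restrict (cf m) A) ` {m :: 'v \<Rightarrow>\<^sub>0 nat. supp m \<subseteq> A \<and> monom_deg m \<le> d} \<subseteq> (A \<rightarrow>\<^sub>E {..d})" by auto
  then show "finite ((\<lambda>m. restrict (cf m) A) ` {m :: 'v \<Rightarrow>\<^sub>0 nat. supp m \<subseteq> A \<and> monom_deg m \<le> d})"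
    by (rule finite_subset) (use assms in \<open>auto intro: finite_PiE\<close>)
  show "inj_on (\<lambda>m. restrict (cf m) A) {m :: 'v \<Rightarrow>\<^sub>0 nat. supp m \<subseteq> A \<and> monom_deg m \<le> d}"
  proof (rule inj_onI, rule poly_mapping_eqI)
    fix m l :: "'v \<Rightarrow>\<^sub>0 nat" and v
    assume m: "m \<in> {m. supp m \<subseteq> A \<and> monom_deg m \<le> d}" and l: "l \<in> {m. supp m \<subseteq> A \<and> monom_deg m \<le> d}"
      and eq: "restrict (cf m) A = restrict (cf l) A"
    show "cf m v = cf l v"
    proof (cases "v \<in> A")
      case True
      then show ?thesis using fun_cong[OF eq, of v] by simp
    next
      case False
      then show ?thesis using m l lookup_outside[of m A v] lookup_outside[of l A v] by simp
    qed
  qed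
qed

text \<open>The part of a cycle in its largest multidegree is a cycle modulo the initial ideal.
  Solving there, and subtracting a boundary and elements of \<open>J\<close> with prescribed leading
  terms, removes this multidegree; only finitely many multidegrees are possible in a fixed
  degree.\<close>

theorem Reg_initial:
  fixes J :: "nat \<Rightarrow> ('v::linorder, 'k::field) mpoly set"
  assumes A: "finite A" and J: "gid A J"
    and R: "Reg Var A A m0 (mong A E :: nat \<Rightarrow> ('v, 'k) mpoly set)"
    and in1: "\<And>d f. f \<in> J d \<Longrightarrow> f \<noteq> 0 \<Longrightarrow> Max (supp f) \<in> E"
    and in2: "\<And>m. m \<in> E \<Longrightarrow> supp m \<subseteq> A \<Longrightarrow> \<exists>f\<in>J (monom_deg m). lead f m"
  shows "Reg Var A A m0 J"
proof (rule RegI)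
  fix d and z :: "'v set \<Rightarrow> ('v, 'k) mpoly"
  assume d: "m0 \<le> d" and "\<And>F. F \<subseteq> A \<Longrightarrow> z F \<in> H A d"
    and "\<And>T. T \<subseteq> A \<Longrightarrow> bd Var A z T \<in> J (Suc d)"
  define M where "M = {m :: 'v \<Rightarrow>\<^sub>0 nat. supp m \<subseteq> A \<and> monom_deg m \<le> d + card A}"
  define MD where "MD z = {m + chi F | m F. F \<subseteq> A \<and> m \<in> supp (z F)}" for z :: "'v set \<Rightarrow> ('v, 'k) mpoly"
  have finM: "finite M" unfolding M_def by (rule finite_exponents[OF A])
  have fin: "finite F" if "F \<subseteq> A" for F using A that finite_subset by blast
  note aV = H_Var[of _ A]
  have "\<exists>w. (\<forall>F\<subseteq>A. w F \<in> Hp A d) \<and> (\<forall>F\<subseteq>A. z F - bd Var A w F \<in> J d)"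
    if "N = card {\<mu> \<in> M. \<exists>\<mu>'\<in>MD z. \<mu> \<le> \<mu>'}" "\<And>F. F \<subseteq> A \<Longrightarrow> z F \<in> H A d"
      "\<And>T. T \<subseteq> A \<Longrightarrow> bd Var A z T \<in> J (Suc d)" for N z using that
  proof (induction N arbitrary: z rule: less_induct)
    case (less N z)
    note z = less.prems(2) and bz = less.prems(3)
    have MDM: "MD z \<subseteq> M"
    proof
      fix x assume "x \<in> MD z"
      then obtain m F where x: "x = m + chi F" "F \<subseteq> A" "m \<in> supp (z F)" by (auto simp: MD_def)
      have "supp m \<subseteq> A" "monom_deg m = d" using z[OF x(2)] x(3) by (auto simp: H_def)
      then show "x \<in> M"
        using x(2) fin[OF x(2)] card_mono[OF A x(2)] by (simp add: M_def x(1) supp_add_nat supp_chi monom_deg_chi)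
    qed
    show ?case
    proof (cases "MD z = {}")
      case True
      then have "z F = 0" if "F \<subseteq> A" for F
        using that by (auto simp: MD_def) (metis ex_in_conv keys_eq_empty poly_mapping_eqI in_keys_iff lookup_zero)
      then show ?thesis by (intro exI[of _ "\<lambda>_. 0"]) (auto simp: Hp_def gid_0[OF J])
    next
      case False
      define \<mu> where "\<mu> = Max (MD z)"
      have finMD: "finite (MD z)" using MDM finM finite_subset by blast
      have \<mu>: "\<mu> \<in> MD z" unfolding \<mu>_def by (rule Max_in[OF finMD False])
      have max: "m + chi F \<le> \<mu>" if "F \<subseteq> A" "m \<in> supp (z F)" for m F
        unfolding \<mu>_def by (rule Max_ge[OF finMD]) (use that in \<open>auto simp: MD_def\<close>)
      define zm where "zm F = mpart \<mu> F (z F)" for F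
      have zmH: "zm F \<in> H A d" if "F \<subseteq> A" for F using mpart_H[OF z[OF that]] by (simp add: zm_def)
      have bzm: "bd Var A zm T \<in> mong A E (Suc d)" if T: "T \<subseteq> A" for T
      proof -
        have eq: "bd Var A zm T = mpart \<mu> T (bd Var A z T)" by (simp add: mpart_bd[OF A T] zm_def[abs_def])
        have "m \<in> E" if m: "m \<in> supp (mpart \<mu> T (bd Var A z T))" for m
        proof -
          have m': "m \<in> supp (bd Var A z T)" "m + chi T = \<mu>"
            using m by (auto simp: in_keys_iff lookup_mpart split: if_splits)
          \<comment> \<open>After adding \<open>chi T\<close>, the terms of the boundary inherit the
            bound on the multidegrees of \<open>z\<close>, so the extracted term is the leading term
            of an element of \<open>J\<close>.\<close>
          have "l \<le> m" if l: "l \<in> supp (bd Var A z T)" for l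
          proof -
            have "l \<in> (\<Union>v\<in>A - T. supp (sg v T * Var v * z (insert v T)))"
              using l supp_sum[of "\<lambda>v. sg v T * Var v * z (insert v T)" "A - T"] unfolding bd_def by (rule rev_subsetD)
            then obtain v where v: "v \<in> A - T" "l \<in> supp (sg v T * (Var v * z (insert v T)))"
              by (auto simp: mult.assoc)
            then have "l \<in> supp (Var v * z (insert v T))"
              using sg_mult_cases[of v T "Var v * z (insert v T)"] by (auto simp: in_keys_iff)
            then obtain x where x: "x \<in> supp (z (insert v T))" "l = expo v + x" by (auto simp: supp_Var_mult)
            have "x + chi (insert v T) \<le> \<mu>" using v(1) T x(1) by (intro max) auto
            then have "l + chi T \<le> m + chi T" using v(1) fin[OF T] by (simp add: m'(2) x(2) chi_insert add_ac)
            then show ?thesis by simp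
          qed
          then have "Max (supp (bd Var A z T)) = m" using m'(1) by (intro Max_eqI) auto
          moreover have "bd Var A z T \<noteq> 0" using m'(1) by auto
          ultimately show ?thesis using in1[OF bz[OF T]] by simp
        qed
        moreover have "mpart \<mu> T (bd Var A z T) \<in> H A (Suc d)" by (rule mpart_H[OF gid_H[OF J bz[OF T]]])
        ultimately show ?thesis by (auto simp: eq mong_def)
      qed
      obtain w where w: "\<And>F. F \<subseteq> A \<Longrightarrow> w F \<in> Hp A d" "\<And>F. F \<subseteq> A \<Longrightarrow> zm F - bd Var A w F \<in> mong A E d"
        using RegD[where z = zm, OF R d zmH bzm] by blast
      \<comment> \<open>Truncating to multidegree \<open>\<mu>\<close> keeps the boundary of
        \<open>w\<close> from creating larger multidegrees.\<close>
      define w' where "w' F = mpart \<mu> F (w F)" for F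
      have w'H: "w' F \<in> Hp A d" if "F \<subseteq> A" for F using mpart_Hp[OF w(1)[OF that]] by (simp add: w'_def)
      have bw': "bd Var A w' F = mpart \<mu> F (bd Var A w F)" if "F \<subseteq> A" for F
        by (simp add: mpart_bd[OF A that] w'_def[abs_def])
      have "\<exists>j\<in>J d. (\<forall>m\<in>supp j. m + chi F \<le> \<mu>) \<and>
          (\<forall>m. m + chi F = \<mu> \<longrightarrow> cf j m = cf (z F) m - cf (bd Var A w' F) m)" if F: "F \<subseteq> A" for F
      proof (cases "\<exists>m\<in>E. m + chi F = \<mu> \<and> supp m \<subseteq> A \<and> monom_deg m = d")
        case True
        then obtain m where m: "m \<in> E" "m + chi F = \<mu>" "supp m \<subseteq> A" "monom_deg m = d" by blast
        obtain f where f: "f \<in> J d" "lead f m" using in2[OF m(1,3)] m(4) by blast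
        define c where "c = cf (z F) m - cf (bd Var A w' F) m"
        show ?thesis
        proof (intro bexI[of _ "Const c * f"] conjI ballI allI impI)
          show "Const c * f \<in> J d" by (rule gid_Const[OF J f(1)])
          fix l assume "l \<in> supp (Const c * f)"
          then have "l \<le> m" using supp_Const_mult[of c f] f(2) by (auto simp: lead_def)
          then show "l + chi F \<le> \<mu>" using m(2) by (metis add_right_mono)
        next
          fix l assume "l + chi F = \<mu>"
          then have "l = m" using m(2) by (metis add_right_cancel)
          then show "cf (Const c * f) l = cf (z F) l - cf (bd Var A w' F) l"
            using f(2) by (simp add: lead_def c_def)
        qed
      next
        case False
        show ?thesis
        proof (intro bexI[of _ 0] conjI ballI allI impI)
          fix m assume m: "m + chi F = \<mu>"
          have "zm F - bd Var A w F \<in> H A d" "supp (zm F - bd Var A w F) \<subseteq> E"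
            using w(2)[OF F] by (auto simp: mong_def)
          then have "m \<notin> supp (zm F - bd Var A w F)" using False m unfolding H_def by blast
          then show "cf 0 m = cf (z F) m - cf (bd Var A w' F) m"
            using m by (simp add: in_keys_iff lookup_minus zm_def bw'[OF F] lookup_mpart)
        qed (use gid_0[OF J] in auto)
      qed
      then obtain j where j: "\<And>F. F \<subseteq> A \<Longrightarrow> j F \<in> J d" "\<And>F m. F \<subseteq> A \<Longrightarrow> m \<in> supp (j F) \<Longrightarrow> m + chi F \<le> \<mu>"
        "\<And>F m. F \<subseteq> A \<Longrightarrow> m + chi F = \<mu> \<Longrightarrow> cf (j F) m = cf (z F) m - cf (bd Var A w' F) m" by metis
      define z' where "z' F = z F - bd Var A w' F - j F" for F
      have bw'H: "bd Var A w' F \<in> H A d" if "F \<subseteq> A" for F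
        by (rule bd_Hp[OF A aV gid_H_self]) (use w'H that in auto)
      have z'H: "z' F \<in> H A d" if "F \<subseteq> A" for F
        unfolding z'_def using z[OF that] bw'H[OF that] gid_H[OF J j(1)[OF that]] by (intro H_diff)
      have bz': "bd Var A z' T \<in> J (Suc d)" if T: "T \<subseteq> A" for T
      proof -
        have "bd Var A z' T = bd Var A z T - bd Var A j T" unfolding z'_def by (simp add: bd_diff bd_bd[OF A T])
        moreover have "bd Var A j T \<in> J (Suc d)" by (rule gid_bd[OF J aV j(1) T])
        ultimately show ?thesis using gid_diff[OF J bz[OF T]] by simp
      qed
      have less_\<mu>: "x < \<mu>" if x': "x \<in> MD z'" for x
      proof -
        obtain m F where x: "x = m + chi F" "F \<subseteq> A" "m \<in> supp (z' F)" using x' by (auto simp: MD_def)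
        have "m \<in> supp (z F) \<or> m \<in> supp (bd Var A w' F) \<or> m \<in> supp (j F)"
          using x(3) by (auto simp: z'_def in_keys_iff lookup_minus)
        then have "m + chi F \<le> \<mu>"
          using max[OF x(2)] j(2)[OF x(2)] bw'[OF x(2)] by (auto simp: in_keys_iff lookup_mpart split: if_splits)
        moreover have "m + chi F \<noteq> \<mu>" using x(3) j(3)[OF x(2)] by (auto simp: z'_def in_keys_iff lookup_minus)
        ultimately show ?thesis by (simp add: x(1))
      qed
      \<comment> \<open>The measure counts the exponents below some multidegree of the chain;
        \<open>\<mu>\<close> itself no longer contributes.\<close>
      have "card {\<nu> \<in> M. \<exists>\<mu>'\<in>MD z'. \<nu> \<le> \<mu>'} < N" unfolding less.prems(1)
      proof (rule psubset_card_mono)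
        show "{\<nu> \<in> M. \<exists>\<mu>'\<in>MD z'. \<nu> \<le> \<mu>'} \<subset> {\<nu> \<in> M. \<exists>\<mu>'\<in>MD z. \<nu> \<le> \<mu>'}"
        proof
          show "{\<nu> \<in> M. \<exists>\<mu>'\<in>MD z'. \<nu> \<le> \<mu>'} \<subseteq> {\<nu> \<in> M. \<exists>\<mu>'\<in>MD z. \<nu> \<le> \<mu>'}"
            using less_\<mu> \<mu> by (blast intro: less_imp_le order_trans)
          have "\<mu> \<in> {\<nu> \<in> M. \<exists>\<mu>'\<in>MD z. \<nu> \<le> \<mu>'}" using \<mu> MDM by blast
          moreover have "\<mu> \<notin> {\<nu> \<in> M. \<exists>\<mu>'\<in>MD z'. \<nu> \<le> \<mu>'}" using less_\<mu> by (auto simp: not_le)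
          ultimately show "{\<nu> \<in> M. \<exists>\<mu>'\<in>MD z'. \<nu> \<le> \<mu>'} \<noteq> {\<nu> \<in> M. \<exists>\<mu>'\<in>MD z. \<nu> \<le> \<mu>'}" by blast
        qed
      qed (use finM in auto)
      then obtain w'' where w'': "\<And>F. F \<subseteq> A \<Longrightarrow> w'' F \<in> Hp A d" "\<And>F. F \<subseteq> A \<Longrightarrow> z' F - bd Var A w'' F \<in> J d"
        using less.IH[OF _ refl z'H bz'] by blast
      show ?thesis
      proof (intro exI[of _ "\<lambda>F. w' F + w'' F"] conjI allI impI)
        fix F assume F: "F \<subseteq> A"
        show "w' F + w'' F \<in> Hp A d" by (rule Hp_add[OF w'H[OF F] w''(1)[OF F]])
        have "z F - bd Var A (\<lambda>F. w' F + w'' F) F = (z' F - bd Var A w'' F) + j F" by (simp add: z'_def bd_add)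
        then show "z F - bd Var A (\<lambda>F. w' F + w'' F) F \<in> J d"
          using gid_add[OF J w''(2)[OF F] j(1)[OF F]] by simp
      qed
    qed
  qed
  then show "\<exists>w. (\<forall>F\<subseteq>A. w F \<in> Hp A d) \<and> (\<forall>F\<subseteq>A. z F - bd Var A w F \<in> J d)"
    using \<open>\<And>F. F \<subseteq> A \<Longrightarrow> z F \<in> H A d\<close> \<open>\<And>T. T \<subseteq> A \<Longrightarrow> bd Var A z T \<in> J (Suc d)\<close> by blast
qed

theorem Reg_IK:
  assumes "0 < n"
  shows "Reg Var (gv n) (gv n) (2 * k) (IK n k :: nat \<Rightarrow> (nat, 'k::field) mpoly set)"
  using Reg_initial[OF _ gid_IK RegMI_const initial_IK initial_IK_ex[OF assms]] by auto

declare One_nat_def [simp del]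

subsection \<open>Linear algebra\<close>

context vector_space
begin

lemma span_family_mod:
  assumes "subspace J" "finite I" "f \<in> span (x ` I \<union> J)"
  shows "\<exists>c. f - (\<Sum>i\<in>I. scale (c i) (x i)) \<in> J" using assms(3)
proof (induction rule: span_induct_alt)
  case base
  show ?case using subspace_0[OF assms(1)] by (intro exI[of _ "\<lambda>_. 0"]) simp
next
  case (step r y g)
  then obtain c where c: "g - (\<Sum>i\<in>I. scale (c i) (x i)) \<in> J" by blast
  from step(1) show ?case
  proof
    assume "y \<in> x ` I"
    then obtain i0 where i0: "i0 \<in> I" "y = x i0" by blast
    have "(\<Sum>i\<in>I. scale ((c(i0 := c i0 + r)) i) (x i)) =
        (\<Sum>i\<in>I. scale (c i) (x i) + (if i = i0 then scale r y else 0))"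
      by (intro sum.cong) (auto simp: scale_left_distrib i0)
    also have "\<dots> = (\<Sum>i\<in>I. scale (c i) (x i)) + scale r y" using i0 assms(2) by (simp add: sum.distrib)
    finally show ?case using c by (intro exI[of _ "c(i0 := c i0 + r)"]) (simp add: algebra_simps)
  next
    assume "y \<in> J"
    then have "scale r y + (g - (\<Sum>i\<in>I. scale (c i) (x i))) \<in> J"
      by (intro subspace_add[OF assms(1)] subspace_scale[OF assms(1)] c)
    then show ?case by (intro exI[of _ c]) (simp add: algebra_simps)
  qed
qed

text \<open>Steinitz modulo \<open>J\<close>: representatives of the \<open>x i\<close> in the span
  of the \<open>b j\<close> are still independent. Families rather than sets are counted, because
  values of \<open>b\<close> may coincide.\<close>

lemma indep_mod_bound:
  assumes J: "subspace J" and fin: "finite I" "finite B"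
    and gen: "\<And>i. i \<in> I \<Longrightarrow> x i \<in> span (b ` B \<union> J)"
    and indep: "\<And>c. (\<Sum>i\<in>I. scale (c i) (x i)) \<in> J \<Longrightarrow> \<forall>i\<in>I. c i = 0"
  shows "card I \<le> card B"
proof -
  have "\<exists>s. s \<in> span (b ` B) \<and> x i - s \<in> J" if i: "i \<in> I" for i
  proof -
    obtain c where c: "x i - (\<Sum>j\<in>B. scale (c j) (b j)) \<in> J"
      using span_family_mod[OF J fin(2) gen[OF i]] by blast
    have "(\<Sum>j\<in>B. scale (c j) (b j)) \<in> span (b ` B)" by (intro span_sum span_scale span_base) auto
    then show ?thesis using c by blast
  qed
  then obtain s where s: "\<And>i. i \<in> I \<Longrightarrow> s i \<in> span (b ` B)" "\<And>i. i \<in> I \<Longrightarrow> x i - s i \<in> J" by metis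
  have indep_s: "\<forall>i\<in>I. c i = 0" if "(\<Sum>i\<in>I. scale (c i) (s i)) = 0" for c
  proof (rule indep)
    have "(\<Sum>i\<in>I. scale (c i) (x i - s i)) \<in> J" by (intro subspace_sum[OF J] subspace_scale[OF J] s)
    then show "(\<Sum>i\<in>I. scale (c i) (x i)) \<in> J" using that by (simp add: scale_right_diff_distrib sum_subtractf)
  qed
  have inj: "inj_on s I"
  proof (rule inj_onI, rule ccontr)
    fix i j assume ij: "i \<in> I" "j \<in> I" "s i = s j" "i \<noteq> j"
    let ?c = "\<lambda>k. if k = i then 1 else if k = j then - 1 else 0"
    have "(\<Sum>k\<in>I. scale (?c k) (s k)) = (\<Sum>k\<in>I. (if k = i then s i else 0) + (if k = j then - s j else 0))"
      using ij by (intro sum.cong) auto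
    also have "\<dots> = 0" using ij fin by (simp add: sum.distrib)
    finally show False using indep_s ij(1) by fastforce
  qed
  have "independent (s ` I)"
  proof (rule independent_if_scalars_zero)
    fix f y assume f: "(\<Sum>x\<in>s ` I. scale (f x) x) = 0" "y \<in> s ` I"
    have "(\<Sum>i\<in>I. scale (f (s i)) (s i)) = 0" using f(1) by (simp add: sum.reindex[OF inj])
    then show "f y = 0" using indep_s[of "\<lambda>i. f (s i)"] f(2) by auto
  qed (use fin in auto)
  moreover have "s ` I \<subseteq> span (b ` B)" using s by auto
  ultimately have "card (s ` I) \<le> card (b ` B)" using independent_span_bound[of "b ` B" "s ` I"] fin by auto
  also have "\<dots> \<le> card B" by (rule card_image_le[OF fin(2)])
  finally show ?thesis by (simp add: card_image[OF inj])
qed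

lemma indep_mod_extend:
  assumes J: "subspace J" and fin: "finite F" "finite B0" and B0: "\<forall>c. (\<Sum>b\<in>B0. scale (c b) (x b)) \<in> J \<longrightarrow> (\<forall>b\<in>B0. c b = 0)"
  shows "\<exists>B. B0 \<subseteq> B \<and> B \<subseteq> B0 \<union> F \<and> (\<forall>c. (\<Sum>b\<in>B. scale (c b) (x b)) \<in> J \<longrightarrow> (\<forall>b\<in>B. c b = 0)) \<and>
    (\<forall>f\<in>F. x f \<in> span (x ` B \<union> J))"
  using fin(1)
proof (induction F rule: finite_induct)
  case empty
  show ?case using B0 by (intro exI[of _ B0]) auto
next
  case (insert f F)
  then obtain B where B: "B0 \<subseteq> B" "B \<subseteq> B0 \<union> F"
    "\<And>c. (\<Sum>b\<in>B. scale (c b) (x b)) \<in> J \<Longrightarrow> \<forall>b\<in>B. c b = 0" "\<And>f. f \<in> F \<Longrightarrow> x f \<in> span (x ` B \<union> J)" by blast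
  have finB: "finite B" using B(2) insert.hyps fin(2) finite_subset by blast
  show ?case
  proof (cases "x f \<in> span (x ` B \<union> J)")
    case True
    then show ?thesis using B by (intro exI[of _ B]) auto
  next
    case False
    then have fB: "f \<notin> B" using span_base[of "x f" "x ` B \<union> J"] by blast
    have "\<forall>b\<in>insert f B. c b = 0" if c: "(\<Sum>b\<in>insert f B. scale (c b) (x b)) \<in> J" for c
    proof -
      have eq: "(\<Sum>b\<in>insert f B. scale (c b) (x b)) = scale (c f) (x f) + (\<Sum>b\<in>B. scale (c b) (x b))"
        using fB finB by simp
      have "c f = 0"
      proof (rule ccontr)
        assume cf: "c f \<noteq> 0"
        have "scale (c f) (x f) = (\<Sum>b\<in>insert f B. scale (c b) (x b)) - (\<Sum>b\<in>B. scale (c b) (x b))" by (simp add: eq)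
        also have "\<dots> \<in> span (x ` B \<union> J)" using c by (intro span_diff span_sum span_scale span_base) auto
        finally have "scale (inverse (c f)) (scale (c f) (x f)) \<in> span (x ` B \<union> J)" by (rule span_scale)
        then show False using False cf by simp
      qed
      then show ?thesis using B(3)[of c] c eq by simp
    qed
    moreover have "span (x ` B \<union> J) \<subseteq> span (x ` insert f B \<union> J)" by (rule span_mono) auto
    moreover have "x f \<in> span (x ` insert f B \<union> J)" by (intro span_base) auto
    ultimately show ?thesis using B by (intro exI[of _ "insert f B"]) auto
  qed
qed

end

interpretation mp: vector_space "\<lambda>(c :: 'k::field) (p :: ('v, 'k) mpoly). Const c * p"
  by unfold_locales (simp_all add: Const_add Const_mult algebra_simps)

definition indep_mod :: "('v, 'k::field) mpoly set \<Rightarrow> ('i \<Rightarrow> ('v, 'k) mpoly) \<Rightarrow> 'i set \<Rightarrow> bool" where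
  "indep_mod J x I \<longleftrightarrow> (\<forall>c. (\<Sum>i\<in>I. Const (c i) * x i) \<in> J \<longrightarrow> (\<forall>i\<in>I. c i = 0))"

lemmas indep_mod_extend = mp.indep_mod_extend[folded indep_mod_def]

lemma subspace_gid: "gid A B \<Longrightarrow> mp.subspace (B d)"
  by (intro mp.subspaceI) (auto intro: gid_0 gid_add gid_Const)

subsection \<open>Linear systems of parameters on the generic determinantal ring\<close>

text \<open>The graded components of I^k + (th 0, ..., th (i - 1)), where I is the ideal of generic
  minors.\<close>

primrec BK :: "nat \<Rightarrow> nat \<Rightarrow> (nat \<Rightarrow> (nat, 'k::field) mpoly) \<Rightarrow> nat \<Rightarrow> nat \<Rightarrow> (nat, 'k) mpoly set" where
  "BK n k th 0 = IK n k"
| "BK n k th (Suc i) = gplus (gv n) (BK n k th i) (th i)"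

lemma gid_BK: "(\<And>j. j < i \<Longrightarrow> th j \<in> H (gv n) 1) \<Longrightarrow> gid (gv n) (BK n k th i)"
  by (induction i) (auto intro: gid_IK gid_gplus)

lemma BK_mono:
  assumes "\<And>j. j < i \<Longrightarrow> th j \<in> H (gv n) 1" "i' \<le> i"
  shows "BK n k th i' d \<subseteq> BK n k th i d" using assms(2,1)
proof (induction i rule: dec_induct)
  case (step i)
  then have "BK n k th i' d \<subseteq> BK n k th i d" by simp
  also have "\<dots> \<subseteq> BK n k th (Suc i) d" using gplus_left[OF gid_BK[of i th n k]] step.prems by auto
  finally show ?case .
qed simp

lemma BK_th:
  assumes "\<And>j. j < i \<Longrightarrow> th j \<in> H (gv n) 1" "j < i" "u \<in> H (gv n) d"
  shows "th j * u \<in> BK n k th i (Suc d)"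
proof -
  have g: "gid (gv n) (BK n k th j)" using assms by (intro gid_BK) auto
  have "0 + th j * u \<in> BK n k th (Suc j) (Suc d)"
    unfolding BK.simps gplus_def using assms(3) gid_0[OF g] by fastforce
  then show ?thesis using BK_mono[of i th n "Suc j" k "Suc d"] assms by auto
qed

definition sh :: "nat \<Rightarrow> (nat \<Rightarrow>\<^sub>0 nat) \<Rightarrow> (nat \<Rightarrow>\<^sub>0 nat)" where
  "sh l \<alpha> = (\<Sum>j\<in>supp \<alpha>. Poly_Mapping.single (j + l) (cf \<alpha> j))"

lemma lookup_sh: "cf (sh l \<alpha>) u = (if l \<le> u then cf \<alpha> (u - l) else 0)"
proof -
  have "cf (sh l \<alpha>) u = (\<Sum>j\<in>supp \<alpha>. if j + l = u then cf \<alpha> j else 0)"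
    by (simp add: sh_def lookup_sum lookup_single when_def)
  also have "\<dots> = (\<Sum>j\<in>supp \<alpha>. if l \<le> u \<and> j = u - l then cf \<alpha> j else 0)" by (intro sum.cong) auto
  also have "\<dots> = (if l \<le> u then cf \<alpha> (u - l) else 0)" by (auto simp: in_keys_iff)
  finally show ?thesis .
qed

lemma sh_eq_iff: "sh l \<alpha> = sh l \<beta> \<longleftrightarrow> \<alpha> = \<beta>"
proof
  assume eq: "sh l \<alpha> = sh l \<beta>"
  show "\<alpha> = \<beta>"
  proof (rule poly_mapping_eqI)
    fix u show "cf \<alpha> u = cf \<beta> u" using arg_cong[OF eq, of "\<lambda>m. cf m (u + l)"] by (simp add: lookup_sh)
  qed
qed simp

lemma monom_deg_sh: "monom_deg (sh l \<alpha>) = monom_deg \<alpha>"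
proof -
  have "supp (sh l \<alpha>) \<subseteq> (\<lambda>j. j + l) ` supp \<alpha>"
  proof
    fix u assume "u \<in> supp (sh l \<alpha>)"
    then have "l \<le> u" "u - l \<in> supp \<alpha>" by (auto simp: in_keys_iff lookup_sh split: if_splits)
    then show "u \<in> (\<lambda>j. j + l) ` supp \<alpha>" by (intro image_eqI[of _ _ "u - l"]) auto
  qed
  then have "monom_deg (sh l \<alpha>) = (\<Sum>u\<in>(\<lambda>j. j + l) ` supp \<alpha>. cf (sh l \<alpha>) u)" by (intro monom_deg_superset) auto
  also have "\<dots> = monom_deg \<alpha>" by (subst sum.reindex) (auto simp: lookup_sh monom_deg_def)
  finally show ?thesis .
qed

text \<open>Abstract form of minimal multiplicity: the forms \<open>th\<close> and \<open>zf\<close>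
  span the linear forms, and products of two \<open>zf\<close> lie in the ideal of the minors and
  the \<open>th\<close>. So 1 and the \<open>zf l\<close> generate the coordinate ring over the
  algebra of the \<open>th\<close>.\<close>

locale linear_sop =
  fixes n :: nat and th zf :: "nat \<Rightarrow> (nat, 'k::field) mpoly"
  assumes n: "0 < n"
    and thH: "\<And>j. j \<le> n \<Longrightarrow> th j \<in> H (gv n) 1"
    and zfH: "\<And>l. l \<in> {1..<n} \<Longrightarrow> zf l \<in> H (gv n) 1"
    and span1: "\<And>v. v < 2 * n \<Longrightarrow> Var v \<in> mp.span (th ` {..n} \<union> zf ` {1..<n})"
    and quad: "\<And>l l'. l \<in> {1..<n} \<Longrightarrow> l' \<in> {1..<n} \<Longrightarrow> zf l * zf l' \<in> BK n 1 th (Suc n) 2"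
begin

text \<open>Index set in degree \<open>d\<close> of the prospective basis: \<open>l = 0\<close>
  stands for the generator 1 and \<open>l > 0\<close> for \<open>zf l\<close>, of degree one more;
  the second component is an exponent of the \<open>th\<close>.\<close>

definition Ix :: "nat \<Rightarrow> (nat \<times> (nat \<Rightarrow>\<^sub>0 nat)) set" where
  "Ix d = {(l, \<alpha>). l < n \<and> supp \<alpha> \<subseteq> {..n} \<and> monom_deg \<alpha> + (if l = 0 then 0 else 1) = d}"

definition be :: "nat \<times> (nat \<Rightarrow>\<^sub>0 nat) \<Rightarrow> (nat, 'k) mpoly" where
  "be x = (if fst x = 0 then 1 else zf (fst x)) * evm th (snd x)"

lemma finite_Ix: "finite (Ix d)"
proof (rule finite_subset)
  show "Ix d \<subseteq> {..<n} \<times> {m. supp m \<subseteq> {..n} \<and> monom_deg m \<le> d}" by (auto simp: Ix_def)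
qed (auto intro: finite_exponents)

lemma gidJ: "gid (gv n) (BK n 1 th i)" if "i \<le> Suc n"
  using that by (intro gid_BK thH) auto

lemma be_H: "x \<in> Ix d \<Longrightarrow> be x \<in> H (gv n) d"
proof -
  assume x: "x \<in> Ix d"
  obtain l \<alpha> where [simp]: "x = (l, \<alpha>)" by (cases x)
  have "evm th \<alpha> \<in> H (gv n) (monom_deg \<alpha>)" using x by (intro evm_H thH) (auto simp: Ix_def)
  then show ?thesis
    using x H_mult[OF zfH[of l], of "evm th \<alpha>" "monom_deg \<alpha>"] by (auto simp: Ix_def be_def add.commute)
qed

abbreviation SP :: "nat \<Rightarrow> (nat, 'k) mpoly set" where
  "SP d \<equiv> mp.span (be ` Ix d \<union> IK n 1 d)"

lemma th_be: "j \<le> n \<Longrightarrow> (l, \<alpha>) \<in> Ix d \<Longrightarrow> th j * be (l, \<alpha>) = be (l, expo j + \<alpha>) \<and> (l, expo j + \<alpha>) \<in> Ix (Suc d)"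
  by (auto simp: be_def Ix_def evm_add supp_add_nat mult_ac)

lemma zf_be: "l \<in> {1..<n} \<Longrightarrow> (0, \<alpha>) \<in> Ix d \<Longrightarrow> zf l * be (0, \<alpha>) = be (l, \<alpha>) \<and> (l, \<alpha>) \<in> Ix (Suc d)"
  by (auto simp: be_def Ix_def)

lemma th_SP:
  assumes "j \<le> n" "p \<in> SP d"
  shows "th j * p \<in> SP (Suc d)" using assms(2)
proof (induction rule: mp.span_induct_alt)
  case (step c x y)
  have "th j * x \<in> SP (Suc d)"
  proof (cases "x \<in> IK n 1 d")
    case True
    then show ?thesis using gid_mult1[OF gid_IK thH[OF assms(1)] True] by (intro mp.span_base) auto
  next
    case False
    then obtain i where "i \<in> Ix d" "x = be i" using step by blast
    then show ?thesis using th_be[OF assms(1), of "fst i" "snd i" d] by (auto intro!: mp.span_base)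
  qed
  then have "Const c * (th j * x) + th j * y \<in> SP (Suc d)" using step by (intro mp.span_add mp.span_scale)
  then show ?case by (simp add: algebra_simps)
qed (simp add: mp.span_zero)

lemma H1_span:
  assumes "h \<in> H (gv n) 1"
  shows "h \<in> mp.span (th ` {..n} \<union> zf ` {1..<n})"
proof -
  have "h \<in> H (gv n) (Suc 0)" using assms by (simp add: One_nat_def)
  then obtain q where q: "\<And>v. v \<in> gv n \<Longrightarrow> q v \<in> H (gv n) 0" "h = (\<Sum>v\<in>gv n. Var v * q v)"
    using H_SucE[of h "gv n" 0] by auto
  have "Var v * q v = Const (cf (q v) 0) * Var v" if "v \<in> gv n" for v
    using H_0_Const[OF q(1)[OF that]] by (metis mult.commute)
  then have "h = (\<Sum>v\<in>gv n. Const (cf (q v) 0) * Var v)" unfolding q(2) by (rule sum.cong[OF refl])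
  also have "\<dots> \<in> mp.span (th ` {..n} \<union> zf ` {1..<n})" by (intro mp.span_sum mp.span_scale span1) auto
  finally show ?thesis .
qed

lemma H1_be0:
  assumes "h \<in> H (gv n) 1" "(0, \<alpha>) \<in> Ix d"
  shows "h * be (0, \<alpha>) \<in> SP (Suc d)" using H1_span[OF assms(1)]
proof (induction rule: mp.span_induct_alt)
  case (step c x y)
  have "x * be (0, \<alpha>) \<in> SP (Suc d)"
    using step(1) th_be[OF _ assms(2)] zf_be[OF _ assms(2)] by (auto intro!: mp.span_base)
  then have "Const c * (x * be (0, \<alpha>)) + y * be (0, \<alpha>) \<in> SP (Suc d)"
    using step by (intro mp.span_add mp.span_scale)
  then show ?case by (simp add: algebra_simps)
qed (simp add: mp.span_zero)

lemma quad_be: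
  assumes "p \<in> BK n 1 th i 2" "i \<le> Suc n" "(0, \<alpha>) \<in> Ix d"
  shows "p * be (0, \<alpha>) \<in> SP (Suc (Suc d))" using assms(1,2)
proof (induction i arbitrary: p)
  case 0
  have "be (0, \<alpha>) * p \<in> IK n 1 (d + 2)" using 0 by (intro gid_mult[OF gid_IK be_H[OF assms(3)]]) simp
  then show ?case by (intro mp.span_base) (simp add: mult.commute)
next
  case (Suc i)
  then obtain b u where p: "p = b + th i * u" "b \<in> BK n 1 th i 2" "u \<in> H (gv n) 1"
    by (auto simp: gplus_def numeral_2_eq_2 One_nat_def)
  have "p * be (0, \<alpha>) = b * be (0, \<alpha>) + th i * (u * be (0, \<alpha>))" by (simp add: p algebra_simps)
  moreover have "th i * (u * be (0, \<alpha>)) \<in> SP (Suc (Suc d))"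
    using Suc.prems(2) by (intro th_SP H1_be0 p assms(3)) simp
  ultimately show ?case using Suc.IH[OF p(2)] Suc.prems(2) by (auto intro: mp.span_add)
qed

text \<open>The critical case is a product of two \<open>zf\<close>, which \<open>quad\<close>
  rewrites by minors and multiples of the \<open>th\<close>.\<close>

lemma H1_SP:
  assumes h: "h \<in> H (gv n) 1" and p: "p \<in> SP d"
  shows "h * p \<in> SP (Suc d)" using p
proof (induction rule: mp.span_induct_alt)
  case (step c x y)
  have "h * x \<in> SP (Suc d)"
  proof (cases "x \<in> IK n 1 d")
    case True
    then show ?thesis using gid_mult1[OF gid_IK h True] by (intro mp.span_base) auto
  next
    case False
    then obtain l \<alpha> where x: "(l, \<alpha>) \<in> Ix d" "x = be (l, \<alpha>)" using step by auto
    show ?thesis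
    proof (cases "l = 0")
      case True
      then show ?thesis using H1_be0[OF h] x by simp
    next
      case False
      then have l: "l \<in> {1..<n}" using x by (auto simp: Ix_def)
      obtain e where e: "d = Suc e" "(0, \<alpha>) \<in> Ix e" using x False by (auto simp: Ix_def)
      have x': "x = zf l * be (0, \<alpha>)" using x False by (simp add: be_def)
      show ?thesis using H1_span[OF h]
      proof (induction rule: mp.span_induct_alt)
        case (step c y g)
        have "y * x \<in> SP (Suc d)"
        proof (cases "y \<in> th ` {..n}")
          case True
          then show ?thesis using th_SP[OF _ mp.span_base[of x]] x by auto
        next
          case False
          then obtain l' where "l' \<in> {1..<n}" "y = zf l'" using step by auto
          then show ?thesis
            using quad_be[OF quad[OF \<open>l' \<in> _\<close> l] order_refl e(2)] by (simp add: x' e(1) mult_ac)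
        qed
        then have "Const c * (y * x) + g * x \<in> SP (Suc d)" using step by (intro mp.span_add mp.span_scale)
        then show ?case by (simp add: algebra_simps)
      qed (simp add: mp.span_zero)
    qed
  qed
  then have "Const c * (h * x) + h * y \<in> SP (Suc d)" using step by (intro mp.span_add mp.span_scale)
  then show ?case by (simp add: algebra_simps)
qed (simp add: mp.span_zero)

lemma H_SP: "H (gv n) d \<subseteq> SP d"
proof (induction d)
  case 0
  have "(0, 0) \<in> Ix 0" using n by (simp add: Ix_def)
  then have "be (0, 0) \<in> SP 0" by (intro mp.span_base) auto
  then have "Const c * 1 \<in> SP 0" for c by (intro mp.span_scale) (simp add: be_def)
  then have C: "Const c \<in> SP 0" for c by simp
  show ?case
  proof
    fix p :: "(nat, 'k) mpoly" assume "p \<in> H (gv n) 0"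
    then have "p = Const (cf p 0)" by (rule H_0_Const)
    then show "p \<in> SP 0" using C[of "cf p 0"] by simp
  qed
next
  case (Suc d)
  show ?case
  proof
    fix p :: "(nat, 'k) mpoly" assume "p \<in> H (gv n) (Suc d)"
    then obtain q where "\<And>v. v \<in> gv n \<Longrightarrow> q v \<in> H (gv n) d" "p = (\<Sum>v\<in>gv n. Var v * q v)" by (rule H_SucE) auto
    then show "p \<in> SP (Suc d)" using Suc by (auto intro!: mp.span_sum H1_SP H_Var)
  qed
qed

text \<open>Monomials outside the initial ideal: \<open>(l, \<alpha>)\<close> goes to one supported
  on the n + 1 variables from \<open>l\<close> to \<open>n + l\<close>, the complement of
  \<open>colU n l\<close>, and divisible by the last of them if \<open>l > 0\<close>, which keeps
  different \<open>l\<close> apart. They bound the Hilbert function from below.\<close>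

definition std :: "nat \<times> (nat \<Rightarrow>\<^sub>0 nat) \<Rightarrow> (nat \<Rightarrow>\<^sub>0 nat)" where
  "std x = sh (fst x) (snd x) + (if fst x = 0 then 0 else expo (n + fst x))"

lemma lookup_std_outside:
  assumes "(l, \<alpha>) \<in> Ix d" "u \<notin> {l..n + l}"
  shows "cf (std (l, \<alpha>)) u = 0"
proof -
  have "cf \<alpha> (u - l) = 0" if "l \<le> u"
    using assms that by (intro lookup_outside[of \<alpha> "{..n}"]) (auto simp: Ix_def)
  then show ?thesis using assms(2) by (auto simp: std_def lookup_add lookup_sh lookup_expo)
qed

lemma std_props:
  assumes "x \<in> Ix d"
  shows "std x \<notin> MI n {} (\<lambda>_. 1)" "supp (std x) \<subseteq> gv n" "monom_deg (std x) = d"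
proof -
  obtain l \<alpha> where x: "x = (l, \<alpha>)" by (cases x)
  have l: "l < n" using assms x by (simp add: Ix_def)
  have "cf (std x) u = 0" if "u \<in> colU n l" for u
    unfolding x using that assms by (intro lookup_std_outside[of _ _ d]) (auto simp: x colU_def)
  then have "cnt n l (std x) = 0" by (simp add: cnt_def)
  then show "std x \<notin> MI n {} (\<lambda>_. 1)" using l by (auto simp: MI_def)
  show "supp (std x) \<subseteq> gv n"
  proof
    fix u assume "u \<in> supp (std x)"
    then have "u \<in> {l..n + l}" using lookup_std_outside[of l \<alpha> d u] assms x by (auto simp: in_keys_iff)
    then show "u \<in> gv n" using l by auto
  qed
  show "monom_deg (std x) = d" using assms by (auto simp: x std_def Ix_def monom_deg_sh)
qed

lemma inj_std: "inj_on std (Ix d)"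
proof (rule inj_onI)
  have *: "\<not> l < l'" if "(l, \<alpha>) \<in> Ix d" "std (l, \<alpha>) = std (l', \<alpha>')" for l l' \<alpha> \<alpha>'
  proof
    assume "l < l'"
    then have "cf (std (l, \<alpha>)) (n + l') = 0" using that(1) by (intro lookup_std_outside[of _ _ d]) auto
    moreover have "0 < cf (std (l', \<alpha>')) (n + l')" using \<open>l < l'\<close> by (simp add: std_def lookup_add lookup_expo)
    ultimately show False using that(2) by simp
  qed
  fix x y assume "x \<in> Ix d" "y \<in> Ix d" "std x = std y"
  moreover obtain l \<alpha> l' \<alpha>' where "x = (l, \<alpha>)" "y = (l', \<alpha>')" by (metis surj_pair)
  ultimately have "l = l'" "sh l \<alpha> = sh l' \<alpha>'"
    using *[of l \<alpha> l' \<alpha>'] *[of l' \<alpha>' l \<alpha>] by (auto simp: std_def split: if_splits)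
  then show "x = y" using \<open>x = _\<close> \<open>y = _\<close> by (simp add: sh_eq_iff)
qed

lemma std_indep:
  assumes "(\<Sum>x\<in>Ix d. Const (c x) * mon (std x)) \<in> (IK n 1 d :: (nat, 'k) mpoly set)"
  shows "\<forall>x\<in>Ix d. c x = 0"
proof (rule ccontr)
  let ?f = "\<Sum>x\<in>Ix d. Const (c x) * mon (std x) :: (nat, 'k) mpoly"
  have cf: "cf ?f (std y) = c y" if "y \<in> Ix d" for y
  proof -
    have "cf ?f (std y) = (\<Sum>x\<in>Ix d. if x = y then c x else 0)"
      unfolding lookup_sum using inj_onD[OF inj_std, of _ y] that by (intro sum.cong) (auto simp: lookup_mon)
    then show ?thesis using that finite_Ix by simp
  qed
  assume "\<not> (\<forall>x\<in>Ix d. c x = 0)"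
  then have "?f \<noteq> 0" using cf by (metis lookup_zero)
  then have M: "Max (supp ?f) \<in> MI n {} (\<lambda>_. 1)" "Max (supp ?f) \<in> supp ?f"
    using initial_IK[OF assms] by (auto intro: Max_in)
  have "supp ?f \<subseteq> std ` Ix d"
  proof -
    have "supp (Const (c x) * mon (std x) :: (nat, 'k) mpoly) \<subseteq> {std x}" for x
      using supp_Const_mult[of "c x" "mon (std x)"] by simp
    then show ?thesis using supp_sum[of "\<lambda>x. Const (c x) * mon (std x) :: (nat, 'k) mpoly" "Ix d"] by blast
  qed
  with M(2) have "Max (supp ?f) \<in> std ` Ix d" by (rule rev_subsetD)
  then obtain x where "x \<in> Ix d" "Max (supp ?f) = std x" by (rule imageE)
  then show False using M(1) std_props(1) by metis
qed

text \<open>The elements \<open>be x\<close> span, and equally many standard monomials are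
  independent; a relation would let one \<open>be x\<close> be omitted, against the dimension
  count.\<close>

lemma be_indep:
  assumes "(\<Sum>x\<in>Ix d. Const (c x) * be x) \<in> IK n 1 d"
  shows "\<forall>x\<in>Ix d. c x = 0"
proof (rule ccontr)
  assume "\<not> (\<forall>x\<in>Ix d. c x = 0)"
  then obtain x0 where x0: "x0 \<in> Ix d" "c x0 \<noteq> 0" by blast
  let ?S = "mp.span (be ` (Ix d - {x0}) \<union> IK n 1 d)"
  have "Const (c x0) * be x0 = (\<Sum>x\<in>Ix d. Const (c x) * be x) - (\<Sum>x\<in>Ix d - {x0}. Const (c x) * be x)"
    using x0(1) finite_Ix by (simp add: sum.remove)
  also have "\<dots> \<in> ?S" using assms by (intro mp.span_diff mp.span_sum mp.span_scale mp.span_base) auto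
  finally have "Const (inverse (c x0)) * (Const (c x0) * be x0) \<in> ?S" by (rule mp.span_scale)
  then have "be x0 \<in> ?S" using x0(2) by (simp flip: mult.assoc Const_mult)
  then have "be ` Ix d \<union> IK n 1 d \<subseteq> ?S"
  proof -
    assume b: "be x0 \<in> ?S"
    have "be x \<in> ?S" if "x \<in> Ix d" for x using that b by (cases "x = x0") (auto intro!: mp.span_base)
    then show ?thesis by (auto intro: mp.span_base)
  qed
  then have "SP d \<subseteq> ?S" by (metis mp.span_mono mp.span_span)
  then have "mon (std x) \<in> ?S" if "x \<in> Ix d" for x
    using H_SP[of d] H_mon[OF std_props(2)[OF that], where 'b = 'k] std_props(3)[OF that] by auto
  then have "card (Ix d) \<le> card (Ix d - {x0})"
  proof (intro mp.indep_mod_bound[where x = "\<lambda>x. mon (std x)" and b = be and J = "IK n 1 d"])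
    show "mp.subspace (IK n 1 d :: (nat, 'k) mpoly set)" by (rule subspace_gid[OF gid_IK])
    show "\<forall>x\<in>Ix d. c x = 0" if "(\<Sum>x\<in>Ix d. Const (c x) * mon (std x)) \<in> (IK n 1 d :: (nat, 'k) mpoly set)" for c
      by (rule std_indep[OF that])
  qed (use finite_Ix in auto)
  moreover have "card (Ix d - {x0}) < card (Ix d)" by (rule card_Diff1_less[OF finite_Ix x0(1)])
  ultimately show False by simp
qed

definition bad :: "nat \<Rightarrow> nat \<Rightarrow> (nat \<times> (nat \<Rightarrow>\<^sub>0 nat)) set" where
  "bad i d = {x \<in> Ix d. \<exists>j<i. 0 < cf (snd x) j}"

lemma BK_span:
  assumes "i \<le> Suc n"
  shows "BK n 1 th i d = mp.span (be ` bad i d \<union> IK n 1 d)"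
proof
  have sub: "mp.subspace (BK n 1 th i d)" by (rule subspace_gid[OF gidJ[OF assms]])
  show "mp.span (be ` bad i d \<union> IK n 1 d) \<subseteq> BK n 1 th i d"
  proof (rule mp.span_minimal[OF _ sub], rule Un_least)
    show "be ` bad i d \<subseteq> BK n 1 th i d"
    proof
      fix p assume "p \<in> be ` bad i d"
      then obtain l \<alpha> j where p: "p = be (l, \<alpha>)" "(l, \<alpha>) \<in> Ix d" "j < i" "0 < cf \<alpha> j" by (auto simp: bad_def)
      define \<beta> where "\<beta> = \<alpha> - expo j"
      have \<alpha>: "\<alpha> = expo j + \<beta>"
        using p(4) by (intro poly_mapping_eqI) (auto simp: \<beta>_def lookup_add lookup_minus lookup_expo)
      have "d = Suc (d - 1)" "(l, \<beta>) \<in> Ix (d - 1)" using p(2) by (auto simp: Ix_def \<alpha> supp_add_nat)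
      moreover have "p = th j * be (l, \<beta>)" using p(1) by (simp add: be_def \<alpha> evm_add mult_ac)
      ultimately show "p \<in> BK n 1 th i d"
        using BK_th[of i th n j "be (l, \<beta>)" "d - 1" 1] be_H thH p(3) assms by auto
    qed
    show "IK n 1 d \<subseteq> BK n 1 th i d" using BK_mono[of i th n 0 1 d] thH assms by auto
  qed
  show "BK n 1 th i d \<subseteq> mp.span (be ` bad i d \<union> IK n 1 d)" using assms
  proof (induction i)
    case 0
    then show ?case using mp.span_superset[of "be ` bad 0 d \<union> IK n 1 d"] by auto
  next
    case (Suc i)
    show ?case
    proof
      fix p assume "p \<in> BK n 1 th (Suc i) d"
      then obtain b u where p: "p = b + th i * u" "b \<in> BK n 1 th i d" "u \<in> Hp (gv n) d"
        by (auto simp: gplus_def)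
      have "bad i d \<subseteq> bad (Suc i) d" unfolding bad_def using less_SucI by blast
      then have "mp.span (be ` bad i d \<union> IK n 1 d) \<subseteq> mp.span (be ` bad (Suc i) d \<union> IK n 1 d)"
        by (intro mp.span_mono) auto
      then have b: "b \<in> mp.span (be ` bad (Suc i) d \<union> IK n 1 d)" using Suc p(2) by auto
      have "th i * u \<in> mp.span (be ` bad (Suc i) d \<union> IK n 1 d)"
      proof (cases d)
        case 0
        then show ?thesis using p(3) by (simp add: mp.span_zero)
      next
        case (Suc e)
        then have "u \<in> SP e" using H_SP p(3) by auto
        then show ?thesis
        proof (induction rule: mp.span_induct_alt)
          case (step c x y)
          have "th i * x \<in> mp.span (be ` bad (Suc i) d \<union> IK n 1 d)"
          proof (cases "x \<in> IK n 1 e")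
            case True
            then show ?thesis using gid_mult1[OF gid_IK thH True, of i] \<open>Suc i \<le> Suc n\<close>
              by (intro mp.span_base) (auto simp: Suc)
          next
            case False
            then obtain l \<alpha> where x: "(l, \<alpha>) \<in> Ix e" "x = be (l, \<alpha>)" using step by auto
            have "(l, expo i + \<alpha>) \<in> bad (Suc i) d" "th i * x = be (l, expo i + \<alpha>)"
              using th_be[OF _ x(1), of i] \<open>Suc i \<le> Suc n\<close>
              by (auto simp: bad_def Suc x(2) lookup_add lookup_expo intro!: exI[of _ i])
            then show ?thesis by (auto intro: mp.span_base)
          qed
          then have "Const c * (th i * x) + th i * y \<in> mp.span (be ` bad (Suc i) d \<union> IK n 1 d)"
            using step by (intro mp.span_add mp.span_scale)
          then show ?case by (simp add: algebra_simps)
        qed (simp add: mp.span_zero)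
      qed
      then show "p \<in> mp.span (be ` bad (Suc i) d \<union> IK n 1 d)" unfolding p(1) by (intro mp.span_add b)
    qed
  qed
qed

text \<open>Multiplication by \<open>th i\<close> sends basis elements injectively to basis
  elements, and those free of the preceding forms remain so; by \<open>BK_span\<close> the other
  basis elements and the minors span the ideal.\<close>

theorem th_regular:
  assumes i: "i \<le> n" and f: "f \<in> H (gv n) d" "th i * f \<in> BK n 1 th i (Suc d)"
  shows "f \<in> BK n 1 th i d"
proof -
  have sJ: "mp.subspace (IK n 1 d :: (nat, 'k) mpoly set)" for d by (rule subspace_gid[OF gid_IK])
  obtain c where c: "f - (\<Sum>x\<in>Ix d. Const (c x) * be x) \<in> IK n 1 d"
    using mp.span_family_mod[OF sJ[of d] finite_Ix, of f be d] H_SP[of d] f(1) by blast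
  have fin: "finite (bad i d)" "finite (bad i (Suc d))" "bad i d \<subseteq> Ix d" "bad i (Suc d) \<subseteq> Ix (Suc d)"
    using finite_Ix by (auto simp: bad_def)
  define g where "g = (\<Sum>x\<in>Ix d - bad i d. Const (c x) * be x)"
  have gid: "gid (gv n) (BK n 1 th i)" using gidJ i by simp
  have "(\<Sum>x\<in>Ix d. Const (c x) * be x) = g + (\<Sum>x\<in>bad i d. Const (c x) * be x)"
    unfolding g_def using fin finite_Ix by (simp add: sum.subset_diff add.commute)
  then have fg: "f - g = (f - (\<Sum>x\<in>Ix d. Const (c x) * be x)) + (\<Sum>x\<in>bad i d. Const (c x) * be x)" by simp
  have fgB: "f - g \<in> BK n 1 th i d" unfolding fg BK_span[OF le_SucI[OF i]]
    using c by (intro mp.span_add mp.span_sum mp.span_scale mp.span_base) auto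
  have "th i * g = th i * f - th i * (f - g)" by (simp add: algebra_simps)
  also have "\<dots> \<in> BK n 1 th i (Suc d)" by (intro gid_diff[OF gid] f gid_mult1[OF gid thH[OF i]] fgB)
  finally have "th i * g \<in> mp.span (be ` bad i (Suc d) \<union> IK n 1 (Suc d))"
    by (simp add: BK_span[OF le_SucI[OF i]])
  then obtain c' where c': "th i * g - (\<Sum>x\<in>bad i (Suc d). Const (c' x) * be x) \<in> IK n 1 (Suc d)"
    using mp.span_family_mod[OF sJ fin(2)] by blast
  define up where "up x = (fst x, expo i + snd x)" for x :: "nat \<times> (nat \<Rightarrow>\<^sub>0 nat)"
  have inj: "inj_on up S" for S by (auto simp: inj_on_def up_def)
  have up: "up x \<in> Ix (Suc d) - bad i (Suc d) \<and> th i * be x = be (up x)" if "x \<in> Ix d - bad i d" for x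
    using that th_be[OF i, of "fst x" "snd x" d] by (auto simp: up_def bad_def lookup_add lookup_expo)
  have disj: "up ` (Ix d - bad i d) \<subseteq> Ix (Suc d)" "up ` (Ix d - bad i d) \<inter> bad i (Suc d) = {}" using up by auto
  define c'' where "c'' y = (if y \<in> bad i (Suc d) then - c' y else if y \<in> up ` (Ix d - bad i d)
    then c (the_inv_into (Ix d - bad i d) up y) else 0)" for y
  have "th i * g = (\<Sum>x\<in>Ix d - bad i d. Const (c x) * be (up x))"
    unfolding g_def sum_distrib_left using up by (intro sum.cong) (auto simp: mult.left_commute)
  also have "\<dots> = (\<Sum>y\<in>up ` (Ix d - bad i d). Const (c'' y) * be y)"
  proof -
    have "c'' (up x) = c x" if "x \<in> Ix d - bad i d" for x
      using disj that by (auto simp: c''_def the_inv_into_f_f[OF inj])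
    then show ?thesis by (subst sum.reindex[OF inj]) (auto intro!: sum.cong)
  qed
  finally have 1: "th i * g = (\<Sum>y\<in>up ` (Ix d - bad i d). Const (c'' y) * be y)" .
  have 2: "- (\<Sum>x\<in>bad i (Suc d). Const (c' x) * be x) = (\<Sum>y\<in>bad i (Suc d). Const (c'' y) * be y)"
    by (simp add: c''_def Const_uminus sum_negf)
  have "(\<Sum>y\<in>Ix (Suc d). Const (c'' y) * be y) = (\<Sum>y\<in>up ` (Ix d - bad i d) \<union> bad i (Suc d). Const (c'' y) * be y)"
    using disj fin finite_Ix by (intro sum.mono_neutral_right) (auto simp: c''_def)
  also have "\<dots> = (\<Sum>y\<in>up ` (Ix d - bad i d). Const (c'' y) * be y) + (\<Sum>y\<in>bad i (Suc d). Const (c'' y) * be y)"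
    using disj fin finite_Ix by (intro sum.union_disjoint) auto
  also have "\<dots> = th i * g - (\<Sum>x\<in>bad i (Suc d). Const (c' x) * be x)" using 1 2 by simp
  finally have "\<forall>y\<in>Ix (Suc d). c'' y = 0" using be_indep[of c'' "Suc d"] c' by simp
  then have "c x = 0" if "x \<in> Ix d - bad i d" for x
    using up[OF that] that by (auto simp: c''_def the_inv_into_f_f[OF inj])
  then have "g = 0" unfolding g_def by (intro sum.neutral) simp
  then show ?thesis using fgB by simp
qed

end

subsection \<open>Regular elements modulo powers, up to torsion\<close>

lemma BK_Suc_le:
  assumes "\<And>j. j < i \<Longrightarrow> th j \<in> H (gv n) 1"
  shows "BK n (Suc k) th i d \<subseteq> BK n k th i d" using assms
proof (induction i)
  case 0
  then show ?case using IK_Suc_le by auto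
next
  case (Suc i)
  then show ?case by (fastforce simp: gplus_def)
qed

lemma BK_IK_mult:
  assumes "p \<in> IK n k d" "q \<in> BK n l th i e"
  shows "p * q \<in> BK n (k + l) th i (d + e)" using assms(2)
proof (induction i arbitrary: q)
  case 0
  then show ?case using IK_mult[OF assms(1)] by simp
next
  case (Suc i)
  then obtain b u where q: "q = b + th i * u" "b \<in> BK n l th i e" "u \<in> Hp (gv n) e" by (auto simp: gplus_def)
  have "p * u \<in> Hp (gv n) (d + e)"
    using q(3) H_mult[OF gid_H[OF gid_IK assms(1)], of u "e - 1"] by (cases e) (auto simp: Hp_def)
  moreover have "p * q = p * b + th i * (p * u)" by (simp add: q algebra_simps)
  ultimately show ?case using Suc.IH[OF q(2)] by (auto simp: gplus_def)
qed

text \<open>The remainder \<open>r\<close> is a combination of the linear forms alone; membership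
  for every \<open>k'\<close> records this without naming their ideal.\<close>

lemma BK_split:
  assumes "p \<in> BK n k th i d" "\<And>j. j < i \<Longrightarrow> th j \<in> H (gv n) 1"
  obtains g r where "g \<in> IK n k d" "p = g + r" "\<And>k'. r \<in> BK n k' th i d"
proof -
  have "\<exists>g r. g \<in> IK n k d \<and> p = g + r \<and> (\<forall>k'. r \<in> BK n k' th i d)" using assms
  proof (induction i arbitrary: p)
    case 0
    then show ?case by (intro exI[of _ p] exI[of _ 0]) (auto simp: gid_0[OF gid_IK])
  next
    case (Suc i)
    then obtain b u where p: "p = b + th i * u" "b \<in> BK n k th i d" "u \<in> Hp (gv n) d" by (auto simp: gplus_def)
    obtain g r where "g \<in> IK n k d" "b = g + r" "\<And>k'. r \<in> BK n k' th i d"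
      using Suc.IH[OF p(2)] Suc.prems(2) by auto
    then show ?case using p by (intro exI[of _ g] exI[of _ "r + th i * u"]) (auto simp: gplus_def add_ac)
  qed
  then show ?thesis using that by blast
qed

text \<open>Fixes the pivot variable \<open>Var (r0 p)\<close> that is to be inverted. The two rows
  may be exchanged, so any variable of the matrix can be the pivot.\<close>

locale minor_rows =
  fixes n p :: nat and r0 r1 :: "nat \<Rightarrow> nat" and ty :: "'k::field itself"
  assumes p: "p < n"
    and rows: "(r0 = (\<lambda>j. j) \<and> r1 = (\<lambda>j. n + j)) \<or> (r0 = (\<lambda>j. n + j) \<and> r1 = (\<lambda>j. j))"
begin

abbreviation xp :: "(nat, 'k) mpoly" where "xp \<equiv> Var (r0 p)"

definition mnr :: "nat \<Rightarrow> nat \<Rightarrow> (nat, 'k) mpoly" where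
  "mnr i j = Var (r0 i) * Var (r1 j) - Var (r0 j) * Var (r1 i)"

definition F :: "nat \<Rightarrow> (nat, 'k) mpoly" where "F j = mnr p j"

definition Cs :: "nat set" where "Cs = {..<n} - {p}"

definition Bk :: "nat \<Rightarrow> (nat \<Rightarrow>\<^sub>0 nat) set" where
  "Bk k = {\<beta>. supp \<beta> \<subseteq> Cs \<and> monom_deg \<beta> = k}"

lemma r_less: "j < n \<Longrightarrow> r0 j < 2 * n" "j < n \<Longrightarrow> r1 j < 2 * n"
  and r_inj: "r0 i = r0 j \<longleftrightarrow> i = j" "r1 i = r1 j \<longleftrightarrow> i = j"
  and r_disj: "i < n \<Longrightarrow> j < n \<Longrightarrow> r0 i \<noteq> r1 j" "i < n \<Longrightarrow> j < n \<Longrightarrow> r1 j \<noteq> r0 i" using rows by auto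

lemma r_cases:
  assumes "v < 2 * n"
  obtains j where "j < n" "v = r0 j" | j where "j < n" "v = r1 j"
proof (cases "v < n")
  case True
  then show ?thesis using rows that by auto
next
  case False
  then have "v = n + (v - n)" "v - n < n" using assms by auto
  then show ?thesis using rows that by metis
qed

lemma mnr_gminor: "mnr i j = gminor n i j \<or> mnr i j = gminor n j i"
  using rows by (auto simp: mnr_def gminor_def mult.commute)

lemma gminor_mnr: "gminor n i j = mnr i j \<or> gminor n i j = mnr j i"
  using rows by (auto simp: mnr_def gminor_def mult.commute)

lemma mnr_IK: "i < n \<Longrightarrow> j < n \<Longrightarrow> mnr i j \<in> IK n 1 2"
  using mnr_gminor[of i j] gminor_IK[of i n j] gminor_IK[of j n i] by auto

lemma F_IK: "j < n \<Longrightarrow> F j \<in> IK n 1 2"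
  unfolding F_def by (rule mnr_IK[OF p])

lemma F_p: "F p = 0"
  by (simp add: F_def mnr_def)

lemma XH: "xp ^ s \<in> H (gv n) s"
  using H_power[OF H_Var[of "r0 p" "gv n"], of s] r_less p by simp

text \<open>Laplace expansion of a 3 x 3 determinant in which the row \<open>r0\<close> is repeated.
  After inverting the pivot, the minors \<open>F j\<close> through its column therefore generate all
  minors.\<close>

lemma X_mnr: "xp * mnr i j = Var (r0 i) * F j - Var (r0 j) * F i"
  by (simp add: F_def mnr_def algebra_simps)

lemma finite_Bk: "finite (Bk k)"
proof (rule finite_subset)
  show "Bk k \<subseteq> {m. supp m \<subseteq> Cs \<and> monom_deg m \<le> k}" by (auto simp: Bk_def)
qed (auto intro!: finite_exponents simp: Cs_def)

lemma evmF_IK: "\<beta> \<in> Bk k \<Longrightarrow> evm F \<beta> \<in> IK n k (2 * k)"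
proof (induction k arbitrary: \<beta>)
  case 0
  then show ?case by (simp add: Bk_def IK_0)
next
  case (Suc k)
  then obtain j \<beta>' where b: "j \<in> supp \<beta>" "\<beta> = expo j + \<beta>'" "monom_deg \<beta>' = k" "supp \<beta>' \<subseteq> supp \<beta>"
    by (auto simp: Bk_def elim: monom_deg_SucE)
  then have "\<beta>' \<in> Bk k" "j < n" using Suc.prems by (auto simp: Bk_def Cs_def)
  then have "F j * evm F \<beta>' \<in> IK n (1 + k) (2 + 2 * k)" by (intro IK_mult F_IK Suc.IH)
  then show ?case by (simp add: b(2) evm_add One_nat_def)
qed

definition FK :: "nat \<Rightarrow> nat \<Rightarrow> (nat, 'k) mpoly set" where
  "FK k = gen (gv n) (evm F ` Bk k) (2 * k)"

lemma gid_FK: "gid (gv n) (FK k)"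
  unfolding FK_def by (rule gid_gen) (use gid_H[OF gid_IK evmF_IK] in auto)

lemma F_FK:
  assumes "j < n" "g \<in> FK k d"
  shows "F j * g \<in> FK (Suc k) (d + 2)"
proof (cases "j = p")
  case True
  then show ?thesis by (simp add: F_p gid_0[OF gid_FK])
next
  case False
  from assms(2)[unfolded FK_def] show ?thesis
  proof (induction rule: gen_induct)
    case (mult e q g)
    then obtain \<beta> where b: "g = evm F \<beta>" "\<beta> \<in> Bk k" by blast
    have "expo j + \<beta> \<in> Bk (Suc k)" using b(2) assms(1) False by (auto simp: Bk_def Cs_def supp_add_nat)
    from gen_mult[OF mult(1) imageI[OF this]] have "q * evm F (expo j + \<beta>) \<in> FK (Suc k) (e + 2 * Suc k)"
      by (simp only: FK_def)
    then show ?case by (simp add: b(1) evm_add mult_ac)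
  qed (auto simp: distrib_left intro: gid_0[OF gid_FK] gid_add[OF gid_FK])
qed

lemma X_IK_FK: "g \<in> IK n k d \<Longrightarrow> xp ^ k * g \<in> FK k (k + d)"
  unfolding IK_def
proof (induction rule: gen_induct)
  case (mult e q g)
  have "xp ^ k * g \<in> FK k (k + 2 * k)" using mult(2)
  proof (induction k arbitrary: g)
    case 0
    have "0 \<in> Bk 0" by (simp add: Bk_def)
    then show ?case
      using gen_mult[of 1 "gv n" 0 "evm F 0" "evm F ` Bk 0" 0] 0 by (simp add: FK_def image_iff bexI[of _ 0])
  next
    case (Suc k)
    then obtain i j h where g: "g = gminor n i j * h" "i < n" "j < n" "h \<in> mprods n k" by auto
    have step: "xp ^ Suc k * (mnr i j * h) \<in> FK (Suc k) (Suc k + 2 * Suc k)" if "i < n" "j < n" for i j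
    proof -
      note h = Suc.IH[OF g(4)]
      have "xp ^ Suc k * (mnr i j * h) = (xp * mnr i j) * (xp ^ k * h)" by (simp add: mult_ac)
      also have "\<dots> = Var (r0 i) * (F j * (xp ^ k * h)) - Var (r0 j) * (F i * (xp ^ k * h))"
        by (simp only: X_mnr left_diff_distrib mult.assoc)
      also have "\<dots> \<in> FK (Suc k) (Suc (k + 2 * k + 2))"
        using that r_less by (intro gid_diff[OF gid_FK] gid_mult1[OF gid_FK] H_Var F_FK h) auto
      finally show ?thesis by (simp add: add_ac)
    qed
    then show ?case using gminor_mnr[of i j] g step[of i j] step[of j i] by auto
  qed
  from gid_mult[OF gid_FK mult(1) this] show ?case by (simp add: mult_ac add_ac)
qed (auto simp: distrib_left intro: gid_0[OF gid_FK] gid_add[OF gid_FK])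

lemma FK_rep:
  assumes "g \<in> FK k d"
  shows "\<exists>c. (\<forall>\<beta>. c \<beta> \<in> H (gv n) (d - 2 * k)) \<and> g = (\<Sum>\<beta>\<in>Bk k. evm F \<beta> * c \<beta>)" using assms unfolding FK_def
proof (induction rule: gen_induct)
  case (zero d)
  show ?case by (intro exI[of _ "\<lambda>_. 0"]) auto
next
  case (add d p q)
  then obtain c c' where "\<forall>\<beta>. c \<beta> \<in> H (gv n) (d - 2 * k)" "p = (\<Sum>\<beta>\<in>Bk k. evm F \<beta> * c \<beta>)"
    "\<forall>\<beta>. c' \<beta> \<in> H (gv n) (d - 2 * k)" "q = (\<Sum>\<beta>\<in>Bk k. evm F \<beta> * c' \<beta>)" by blast
  then show ?case
    by (intro exI[of _ "\<lambda>\<beta>. c \<beta> + c' \<beta>"]) (auto simp: distrib_left sum.distrib intro: H_add)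
next
  case (mult e q g)
  then obtain \<beta> where b: "g = evm F \<beta>" "\<beta> \<in> Bk k" by blast
  have "(\<Sum>\<gamma>\<in>Bk k. evm F \<gamma> * (if \<gamma> = \<beta> then q else 0)) = (\<Sum>\<gamma>\<in>Bk k. if \<gamma> = \<beta> then evm F \<beta> * q else 0)"
    by (intro sum.cong) auto
  also have "\<dots> = q * g" using b finite_Bk by (simp add: mult.commute)
  finally show ?case using mult(1) by (intro exI[of _ "\<lambda>\<gamma>. if \<gamma> = \<beta> then q else 0"]) auto
qed

text \<open>The degree in the second-row variables off the pivot column. After the substitution
  \<open>si\<close> the k-th power of the ideal of minors has order at least k in these
  variables.\<close>

definition Nd :: "(nat \<Rightarrow>\<^sub>0 nat) \<Rightarrow> nat" where
  "Nd m = (\<Sum>j\<in>Cs. cf m (r1 j))"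

definition NN :: "nat \<Rightarrow> (nat, 'k) mpoly set" where
  "NN k = {q. \<forall>m\<in>supp q. k \<le> Nd m}"

lemma Nd_add: "Nd (a + b) = Nd a + Nd b"
  by (simp add: Nd_def lookup_add sum.distrib)

lemma NN_0: "0 \<in> NN k" and NN_add: "q \<in> NN k \<Longrightarrow> q' \<in> NN k \<Longrightarrow> q + q' \<in> NN k"
  and NN_diff: "q \<in> NN k \<Longrightarrow> q' \<in> NN k \<Longrightarrow> q - q' \<in> NN k"
  and NN_UNIV: "q'' \<in> NN 0" using keys_add[of q q'] keys_diff[of q q'] by (auto simp: NN_def)

lemma NN_mult: "q \<in> NN k \<Longrightarrow> q' \<in> NN l \<Longrightarrow> q * q' \<in> NN (k + l)"
  using keys_mult[of q q'] by (fastforce simp: NN_def Nd_add intro: add_mono)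

lemma NN_multl: "q \<in> NN k \<Longrightarrow> r * q \<in> NN k"
  using NN_mult[OF NN_UNIV[of r], of q k] by simp

lemma NN_Var: "j \<in> Cs \<Longrightarrow> Var (r1 j) \<in> NN 1"
  by (simp add: NN_def Var_mon Nd_def lookup_expo r_inj Cs_def)

text \<open>A change of coordinates over the ring with the pivot inverted, cleared of denominators:
  it is chosen so that \<open>F j\<close> becomes \<open>xp ^ 2\<close> times a single
  variable.\<close>

definition si :: "nat \<Rightarrow> (nat, 'k) mpoly" where
  "si v = (if v \<in> r1 ` Cs then Var (r0 (inv_into UNIV r1 v)) * Var (r1 p) + Var v else xp * Var v)"

lemma si_r0: "j < n \<Longrightarrow> si (r0 j) = xp * Var (r0 j)"
  using r_disj by (auto simp: si_def Cs_def)

lemma si_r1: "j \<in> Cs \<Longrightarrow> si (r1 j) = Var (r0 j) * Var (r1 p) + Var (r1 j)"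
proof -
  have "inj r1" by (auto simp: inj_def r_inj)
  then show "j \<in> Cs \<Longrightarrow> ?thesis" by (simp add: si_def)
qed

lemma si_r1p: "si (r1 p) = xp * Var (r1 p)"
  by (auto simp: si_def Cs_def r_inj)

lemma subst_F: "j \<in> Cs \<Longrightarrow> subst si (F j) = xp ^ 2 * Var (r1 j)"
  using p by (simp add: F_def mnr_def subst.hom_minus subst.hom_mult si_r0 si_r1 si_r1p Cs_def)
    (simp add: algebra_simps power2_eq_square)

lemma subst_mnr:
  assumes "i < n" "j < n"
  shows "subst si (mnr i j) \<in> NN 1"
proof -
  have sub: "subst si (mnr i j) = si (r0 i) * si (r1 j) - si (r0 j) * si (r1 i)"
    by (simp add: mnr_def subst.hom_minus subst.hom_mult)
  consider "i = p" "j = p" | "i = p" "j \<in> Cs" | "i \<in> Cs" "j = p" | "i \<in> Cs" "j \<in> Cs"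
    using assms by (auto simp: Cs_def)
  then show ?thesis
  proof cases
    case 1
    then have "mnr i j = 0" by (simp add: mnr_def)
    then show ?thesis by (simp add: NN_0 subst.hom_zero)
  next
    case 2
    have "subst si (mnr i j) = xp ^ 2 * Var (r1 j)" using 2 subst_F[of j] by (simp add: F_def)
    then show ?thesis using NN_multl[OF NN_Var[OF 2(2)]] by simp
  next
    case 3
    have "mnr i j = - F i" using 3 by (simp add: F_def mnr_def)
    then have "subst si (mnr i j) = 0 - xp ^ 2 * Var (r1 i)" using 3 subst_F[of i] by (simp add: subst.hom_uminus)
    then show ?thesis using NN_diff[OF NN_0 NN_multl[OF NN_Var[OF 3(1)]]] by simp
  next
    case 4
    have "subst si (mnr i j) = (xp * Var (r0 i)) * Var (r1 j) - (xp * Var (r0 j)) * Var (r1 i)"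
      using 4 assms by (simp add: sub si_r0 si_r1 algebra_simps)
    then show ?thesis using NN_diff[OF NN_multl[OF NN_Var[OF 4(2)]] NN_multl[OF NN_Var[OF 4(1)]]] by simp
  qed
qed

lemma subst_IK: "g \<in> IK n k d \<Longrightarrow> subst si g \<in> NN k"
  unfolding IK_def
proof (induction rule: gen_induct)
  case (mult e q g)
  have "subst si g \<in> NN k" using mult(2)
  proof (induction k arbitrary: g)
    case 0
    then show ?case by (simp add: NN_UNIV)
  next
    case (Suc k)
    then obtain i j h where g: "g = gminor n i j * h" "i < n" "j < n" "h \<in> mprods n k" by auto
    have "subst si (gminor n i j) \<in> NN 1"
      using gminor_mnr[of i j] subst_mnr[of i j] subst_mnr[of j i] g by metis
    from NN_mult[OF this Suc.IH[OF g(4)]] show ?case by (simp add: g(1) subst.hom_mult One_nat_def)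
  qed
  then show ?case by (simp add: subst.hom_mult NN_multl)
qed (auto simp: subst.hom_add subst.hom_zero intro: NN_0 NN_add)

definition Eb :: "(nat \<Rightarrow>\<^sub>0 nat) \<Rightarrow> (nat \<Rightarrow>\<^sub>0 nat)" where
  "Eb \<beta> = (\<Sum>j\<in>supp \<beta>. Poly_Mapping.single (r1 j) (cf \<beta> j))"

lemma lookup_Eb: "cf (Eb \<beta>) (r1 j) = cf \<beta> j"
proof -
  have "cf (Eb \<beta>) (r1 j) = (\<Sum>i\<in>supp \<beta>. if i = j then cf \<beta> i else 0)"
    unfolding Eb_def lookup_sum by (intro sum.cong) (auto simp: lookup_single when_def r_inj)
  then show ?thesis by (simp add: in_keys_iff)
qed

lemma Nd_Eb: "\<beta> \<in> Bk k \<Longrightarrow> Nd (Eb \<beta>) = k"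
  using monom_deg_superset[of Cs \<beta>] by (simp add: Nd_def lookup_Eb Bk_def Cs_def)

lemma Nd_X: "Nd (Poly_Mapping.single (r0 p) s) = 0"
  using r_disj p by (auto simp: Nd_def lookup_single when_def Cs_def)

lemma subst_evmF:
  assumes "\<beta> \<in> Bk k"
  shows "subst si (evm F \<beta>) = mon (Poly_Mapping.single (r0 p) (2 * k) + Eb \<beta>)"
proof -
  have pw: "(Var v :: (nat, 'k) mpoly) ^ j = mon (Poly_Mapping.single v j)" for v j
    by (induction j) (auto simp: Var_def mon_def mult_single One_nat_def simp flip: single_add)
  have "subst si (evm F \<beta>) = (\<Prod>j\<in>supp \<beta>. subst si (F j) ^ cf \<beta> j)"
    by (simp add: evm_def subst.hom_prod subst.hom_power)
  also have "\<dots> = (\<Prod>j\<in>supp \<beta>. xp ^ (2 * cf \<beta> j) * Var (r1 j) ^ cf \<beta> j)"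
    using assms by (intro prod.cong refl) (auto simp: subst_F Bk_def power_mult_distrib power_mult)
  also have "\<dots> = xp ^ (2 * monom_deg \<beta>) * (\<Prod>j\<in>supp \<beta>. Var (r1 j) ^ cf \<beta> j)"
    by (simp add: prod.distrib monom_deg_def sum_distrib_left flip: power_sum)
  also have "(\<Prod>j\<in>supp \<beta>. (Var (r1 j) :: (nat, 'k) mpoly) ^ cf \<beta> j) = mon (Eb \<beta>)"
  proof -
    have "(\<Prod>j\<in>M. (Var (r1 j) :: (nat, 'k) mpoly) ^ cf \<beta> j) = mon (\<Sum>j\<in>M. Poly_Mapping.single (r1 j) (cf \<beta> j))" for M
      by (induction M rule: infinite_finite_induct) (auto simp: pw mon_mult)
    then show ?thesis by (simp add: Eb_def)
  qed
  finally show ?thesis using assms by (simp add: pw mon_mult Bk_def)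
qed

text \<open>Reduction modulo the variables \<open>Var (r1 j)\<close> with \<open>j \<in> Cs\<close>.
  Its composite with \<open>si\<close> is, up to powers of the pivot, the residue class map modulo
  the minors.\<close>

definition ta :: "nat \<Rightarrow> (nat, 'k) mpoly" where
  "ta v = (if v \<in> r1 ` Cs then 0 else Var v)"

lemma subst_ta_NN:
  assumes "q \<in> NN 1"
  shows "subst ta q = 0"
proof -
  have "evm ta m = (0 :: (nat, 'k) mpoly)" if "m \<in> supp q" for m
  proof -
    have "Nd m \<noteq> 0" using assms that by (force simp: NN_def)
    then obtain j where j: "j \<in> Cs" "cf m (r1 j) \<noteq> 0"
      unfolding Nd_def by (meson sum.not_neutral_contains_not_neutral)
    then have "r1 j \<in> supp m" "ta (r1 j) ^ cf m (r1 j) = (0 :: (nat, 'k) mpoly)" by (auto simp: in_keys_iff ta_def)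
    then show ?thesis unfolding evm_def by (meson finite_keys prod_zero)
  qed
  then show ?thesis by (simp add: subst_def ev_def)
qed

definition s1 :: "nat \<Rightarrow> (nat, 'k) mpoly" where
  "s1 v = subst ta (si v)"

lemma s1_r0: "j < n \<Longrightarrow> s1 (r0 j) = xp * Var (r0 j)"
  using r_disj p by (auto simp: s1_def si_r0 subst.hom_mult ta_def Cs_def)

lemma s1_r1: "j < n \<Longrightarrow> s1 (r1 j) = Var (r0 j) * Var (r1 p)"
  using r_disj p r_inj
  by (cases "j = p") (auto simp: s1_def si_r1p si_r1 subst.hom_mult subst.hom_add ta_def Cs_def)

lemma s1_IK: "v < 2 * n \<Longrightarrow> xp * Var v - s1 v \<in> IK n 1 2"
  by (erule r_cases) (use F_IK in \<open>auto simp: s1_r0 s1_r1 gid_0[OF gid_IK] F_def mnr_def\<close>)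

lemma s1_H: "v < 2 * n \<Longrightarrow> s1 v \<in> H (gv n) 2"
proof -
  have *: "Var u * Var w \<in> H (gv n) 2" if "u < 2 * n" "w < 2 * n" for u w
    using H_mult[OF H_Var H_Var, of u "gv n" w] that by simp
  show "v < 2 * n \<Longrightarrow> ?thesis"
    by (erule r_cases) (use r_less p in \<open>auto simp: s1_r0 s1_r1 intro!: *\<close>)
qed

text \<open>Modulo the minors, \<open>xp * Var v\<close> equals \<open>s1 v\<close>, because in a
  matrix of rank one all columns are proportional to the pivot column; one factor \<open>xp\<close>
  is spent per degree.\<close>

lemma X_s1:
  assumes "c \<in> H (gv n) e"
  shows "xp ^ e * c - subst s1 c \<in> IK n 1 (2 * e)" using assms
proof (induction rule: H_induct)
  case zero
  then show ?case by (simp add: subst.hom_zero gid_0[OF gid_IK])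
next
  case (add p q)
  have "xp ^ e * (p + q) - subst s1 (p + q) = (xp ^ e * p - subst s1 p) + (xp ^ e * q - subst s1 q)"
    by (simp add: subst.hom_add algebra_simps)
  then show ?case using gid_add[OF gid_IK add(3,4)] by simp
next
  case (mon c m)
  have "xp ^ e * mon m - evm s1 m \<in> IK n 1 (2 * e) \<and> evm s1 m \<in> H (gv n) (2 * e)" using mon
  proof (induction e arbitrary: m)
    case 0
    then show ?case by (simp add: gid_0[OF gid_IK])
  next
    case (Suc e)
    obtain v m' where m: "v \<in> supp m" "m = expo v + m'" "monom_deg m' = e" "supp m' \<subseteq> supp m"
      using monom_deg_SucE[OF Suc.prems(2)] .
    have v: "v < 2 * n" "supp m' \<subseteq> gv n" using m Suc.prems(1) by auto
    note IH = Suc.IH[OF v(2) m(3)]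
    have "xp ^ Suc e * mon m - evm s1 m = (Var v * xp) * (xp ^ e * mon m' - evm s1 m') + evm s1 m' * (xp * Var v - s1 v)"
      by (simp add: m(2) mon_mult evm_add Var_mon[of v] algebra_simps)
    also have "\<dots> \<in> IK n 1 (2 * e + 2)"
    proof (rule gid_add[OF gid_IK])
      have "Var v * xp \<in> H (gv n) 2" using H_mult[OF H_Var H_Var, of v "gv n" "r0 p"] v r_less p by simp
      from gid_mult[OF gid_IK this IH[THEN conjunct1]] show "Var v * xp * (xp ^ e * mon m' - evm s1 m') \<in> IK n 1 (2 * e + 2)"
        by (simp add: add.commute)
      show "evm s1 m' * (xp * Var v - s1 v) \<in> IK n 1 (2 * e + 2)"
        by (rule gid_mult[OF gid_IK IH[THEN conjunct2] s1_IK[OF v(1)]])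
    qed
    finally show ?case using H_mult[OF s1_H[OF v(1)] IH[THEN conjunct2]] by (simp add: m(2) evm_add)
  qed
  then have "Const c * (xp ^ e * mon m - evm s1 m) \<in> IK n 1 (2 * e)" by (intro gid_Const[OF gid_IK]) simp
  then show ?case by (simp add: subst.hom_mult subst_mon algebra_simps)
qed

text \<open>After inverting \<open>xp\<close>, the minors \<open>F j\<close> become independent variables over the residue class
  ring, so that their monomials of degree \<open>k\<close> are a basis of the \<open>k\<close>-th conormal module.\<close>

lemma quasi_regular_0:
  assumes c: "\<And>\<beta>. \<beta> \<in> Bk k \<Longrightarrow> c \<beta> \<in> H (gv n) e"
    and sum: "(\<Sum>\<beta>\<in>Bk k. evm F \<beta> * c \<beta>) \<in> IK n (Suc k) d"
    and \<beta>: "\<beta> \<in> Bk k"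
  shows "xp ^ e * (c \<beta> :: (nat, 'k) mpoly) \<in> IK n 1 (e + e)"
proof -
  define E where "E \<beta> = Poly_Mapping.single (r0 p) (2 * k) + Eb \<beta>" for \<beta>
  have E: "cf (E \<beta>) (r1 j) = cf \<beta> j" if "j \<in> Cs" for \<beta> j
    using that r_disj p by (auto simp: E_def lookup_add lookup_Eb lookup_single when_def Cs_def)
  let ?S = "\<Sum>\<beta>\<in>Bk k. Poly_Mapping.single (E \<beta>) 1 * subst si (c \<beta>)"
  have "subst si (\<Sum>\<beta>\<in>Bk k. evm F \<beta> * c \<beta>) = ?S"
    unfolding subst.hom_sum subst.hom_mult by (intro sum.cong refl) (simp add: subst_evmF E_def mon_def)
  then have S: "?S \<in> NN (Suc k)" using subst_IK[OF sum] by simp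
  have "subst si (c \<beta>) \<in> NN 1"
  proof (rule ccontr)
    assume "subst si (c \<beta>) \<notin> NN 1"
    \<comment> \<open>The monomial \<open>E \<beta> + m\<close> can come from no other summand:
      \<open>m\<close> is free of the variables \<open>r1 j\<close>, and the exponents in
      \<open>Bk k\<close> all have the same degree. But its order \<open>Nd\<close> is only
      \<open>k\<close>.\<close>
    then obtain m where m: "m \<in> supp (subst si (c \<beta>))" "Nd m = 0" by (auto simp: NN_def not_le less_one)
    have m0: "cf m (r1 j) = 0" if "j \<in> Cs" for j using m(2) that by (simp add: Nd_def Cs_def)
    have "cf ?S (E \<beta> + m) = (\<Sum>\<gamma>\<in>Bk k. if \<gamma> = \<beta> then cf (subst si (c \<beta>)) m else 0)" unfolding lookup_sum
    proof (rule sum.cong[OF refl])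
      fix \<gamma> assume \<gamma>: "\<gamma> \<in> Bk k"
      show "cf (Poly_Mapping.single (E \<gamma>) 1 * subst si (c \<gamma>)) (E \<beta> + m) = (if \<gamma> = \<beta> then cf (subst si (c \<beta>)) m else 0)"
      proof (cases "\<gamma> = \<beta>")
        case True
        then show ?thesis by (simp add: lookup_mult_single)
      next
        case False
        have "E \<beta> + m \<noteq> E \<gamma> + l" for l
        proof
          assume eq: "E \<beta> + m = E \<gamma> + l"
          have j: "cf \<beta> j = cf \<gamma> j + cf l (r1 j)" if "j \<in> Cs" for j
            using arg_cong[OF eq, of "\<lambda>x. cf x (r1 j)"] E[OF that] m0[OF that] by (simp add: lookup_add)
          then have "(\<Sum>j\<in>Cs. cf \<beta> j) = (\<Sum>j\<in>Cs. cf \<gamma> j) + (\<Sum>j\<in>Cs. cf l (r1 j))" by (simp add: sum.distrib)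
          moreover have "(\<Sum>j\<in>Cs. cf \<beta> j) = k" "(\<Sum>j\<in>Cs. cf \<gamma> j) = k"
            using \<beta> \<gamma> monom_deg_superset[of Cs] by (auto simp: Bk_def Cs_def)
          ultimately have "cf l (r1 j) = 0" if "j \<in> Cs" for j using that by (simp add: Cs_def)
          then have "cf \<beta> j = cf \<gamma> j" for j
            using j[of j] \<beta> \<gamma> lookup_outside[of \<beta> Cs j] lookup_outside[of \<gamma> Cs j]
            by (cases "j \<in> Cs") (auto simp: Bk_def)
          then show False using False poly_mapping_eqI[of \<beta> \<gamma>] by simp
        qed
        then show ?thesis using False by (simp add: lookup_mult_single_notin)
      qed
    qed
    then have "E \<beta> + m \<in> supp ?S" using m(1) \<beta> finite_Bk by (simp add: in_keys_iff)
    then have "Suc k \<le> Nd (E \<beta> + m)" using S by (auto simp: NN_def)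
    then show False using m(2) Nd_Eb[OF \<beta>] by (simp add: Nd_add E_def Nd_X)
  qed
  then have "subst ta (subst si (c \<beta>)) = 0" by (rule subst_ta_NN)
  then have "subst s1 (c \<beta>) = 0" by (simp add: subst_comp s1_def[abs_def])
  then show ?thesis using X_s1[OF c[OF \<beta>]] by (simp add: mult_2)
qed

context
  fixes th :: "nat \<Rightarrow> (nat, 'k) mpoly" and N :: nat
  assumes thH: "\<And>i. i < N \<Longrightarrow> th i \<in> H (gv n) 1"
    and regular: "\<And>i d f. i < N \<Longrightarrow> f \<in> H (gv n) d \<Longrightarrow> th i * f \<in> BK n 1 th i (Suc d) \<Longrightarrow> f \<in> BK n 1 th i d"
begin

lemma gB: "i \<le> N \<Longrightarrow> gid (gv n) (BK n k th i)"
  by (intro gid_BK thH) auto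

lemma XB: "i \<le> N \<Longrightarrow> f \<in> BK n k th i d \<Longrightarrow> xp ^ s * f \<in> BK n k th i (s + d)"
  by (rule gid_mult[OF gB XH])

text \<open>Quasi-regularity of the \<open>F j\<close> modulo the first \<open>i\<close> linear
  forms, up to pivot torsion: a relation between their monomials of degree \<open>k\<close> modulo
  I^(k+1) has coefficients in I.\<close>

definition QR :: "nat \<Rightarrow> nat \<Rightarrow> bool" where
  "QR k i \<longleftrightarrow> (\<forall>e c. (\<forall>\<beta>\<in>Bk k. c \<beta> \<in> H (gv n) e) \<longrightarrow>
     (\<Sum>\<beta>\<in>Bk k. evm F \<beta> * c \<beta>) \<in> BK n (Suc k) th i (2 * k + e) \<longrightarrow>
     (\<exists>s. \<forall>\<beta>\<in>Bk k. xp ^ s * c \<beta> \<in> BK n 1 th i (s + e)))"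

text \<open>Regularity of \<open>th i\<close> modulo I^k and the preceding forms, up to pivot
  torsion.\<close>

definition CO :: "nat \<Rightarrow> nat \<Rightarrow> bool" where
  "CO k i \<longleftrightarrow> (\<forall>d f. f \<in> H (gv n) d \<longrightarrow> th i * f \<in> BK n k th i (Suc d) \<longrightarrow>
     (\<exists>s. xp ^ s * f \<in> BK n k th i (s + d)))"

lemma QR_0: "QR k 0"
  unfolding QR_def BK.simps using quasi_regular_0 by blast

text \<open>A common normal form: up to a power of \<open>xp\<close>, every element is a combination of the
  monomials in the minors \<open>F j\<close> modulo the linear forms.\<close>

lemma CO_rep:
  assumes "CO k i" "i < N" "f \<in> H (gv n) d" "th i * f \<in> BK n k th i (Suc d)"
  shows "\<exists>s e c r. (\<forall>\<beta>. c \<beta> \<in> H (gv n) e) \<and> 2 * k + e = s + d \<and>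
    xp ^ s * f = (\<Sum>\<beta>\<in>Bk k. evm F \<beta> * c \<beta>) + r \<and> (\<forall>k'. r \<in> BK n k' th i (s + d))"
proof -
  obtain s where "xp ^ s * f \<in> BK n k th i (s + d)" using assms unfolding CO_def by blast
  from XB[OF _ this, of k] have "xp ^ (k + s) * f \<in> BK n k th i (k + s + d)"
    using assms(2) by (simp add: power_add mult_ac add_ac)
  then obtain g r where g: "g \<in> IK n k (k + s + d)" "xp ^ (k + s) * f = g + r" "\<And>k'. r \<in> BK n k' th i (k + s + d)"
    using thH assms(2) by (elim BK_split) (auto intro: less_trans)
  obtain c where c: "\<And>\<beta>. c \<beta> \<in> H (gv n) (k + (k + s + d) - 2 * k)" "xp ^ k * g = (\<Sum>\<beta>\<in>Bk k. evm F \<beta> * c \<beta>)"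
    using FK_rep[OF X_IK_FK[OF g(1)]] by blast
  show ?thesis
  proof (rule exI[of _ "k + (k + s)"], rule exI[of _ "s + d"], rule exI[of _ c], rule exI[of _ "xp ^ k * r"], intro conjI allI)
    show "c \<beta> \<in> H (gv n) (s + d)" for \<beta> using c(1)[of \<beta>] by simp
    show "xp ^ (k + (k + s)) * f = (\<Sum>\<beta>\<in>Bk k. evm F \<beta> * c \<beta>) + xp ^ k * r"
    proof -
      have "xp ^ (k + (k + s)) * f = xp ^ k * (xp ^ (k + s) * f)" by (simp only: power_add mult.assoc)
      then show ?thesis by (simp only: g(2) distrib_left c(2))
    qed
    show "xp ^ k * r \<in> BK n k' th i (k + (k + s) + d)" for k'
      using XB[OF _ g(3), of k] assms(2) by (simp add: add_ac)
  qed simp_all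
qed

lemma H_mult1: "h \<in> H A 1 \<Longrightarrow> q \<in> H A d \<Longrightarrow> h * q \<in> H A (Suc d)"
  using H_mult[of h A 1 q d] by (simp add: One_nat_def)

text \<open>Induction on \<open>k\<close>. The coefficients of the normal form of \<open>f\<close>,
  multiplied by \<open>th i\<close>, form a relation; \<open>QR\<close> puts them into I,
  \<open>regular\<close> cancels \<open>th i\<close>, and coefficients in I raise the power by
  one.\<close>

lemma CO_step:
  assumes i: "i < N" and Q: "\<And>k. QR k i"
  shows "CO k i"
proof (induction k)
  case 0
  have "f \<in> BK n 0 th i d" if "f \<in> H (gv n) d" for f d
    using BK_mono[of i th n 0 0 d] thH i that by (auto simp: IK_0)
  then show ?case unfolding CO_def by (metis add_0 mult_1 power_0)
next
  case (Suc k)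
  have gi: "gid (gv n) (BK n k' th i)" for k' using i by (intro gB) simp
  show ?case unfolding CO_def
  proof (intro allI impI)
    fix d f assume f: "f \<in> H (gv n) d" "th i * f \<in> BK n (Suc k) th i (Suc d)"
    have thf: "th i * f \<in> BK n k th i (Suc d)" using BK_Suc_le[of i th n k "Suc d"] thH i f(2) by auto
    obtain s e c r where c: "\<And>\<beta>. c \<beta> \<in> H (gv n) e" "2 * k + e = s + d"
      and rep: "xp ^ s * f = (\<Sum>\<beta>\<in>Bk k. evm F \<beta> * c \<beta>) + r" "\<And>k'. r \<in> BK n k' th i (s + d)"
      using CO_rep[OF Suc.IH i f(1) thf] by blast
    have "(\<Sum>\<beta>\<in>Bk k. evm F \<beta> * (th i * c \<beta>)) = xp ^ s * (th i * f) - th i * r"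
    proof -
      have "(\<Sum>\<beta>\<in>Bk k. evm F \<beta> * (th i * c \<beta>)) = th i * (xp ^ s * f - r)"
        using rep(1) by (simp add: sum_distrib_left mult.left_commute)
      then show ?thesis by (simp add: algebra_simps)
    qed
    also have "\<dots> \<in> BK n (Suc k) th i (2 * k + Suc e)"
      using XB[OF _ f(2), of s] gid_mult1[OF gi thH[OF i] rep(2)] i c(2) by (intro gid_diff[OF gi]) auto
    finally obtain t where t: "\<And>\<beta>. \<beta> \<in> Bk k \<Longrightarrow> xp ^ t * (th i * c \<beta>) \<in> BK n 1 th i (t + Suc e)"
      using Q[of k, unfolded QR_def, rule_format, of "\<lambda>\<beta>. th i * c \<beta>" "Suc e"] H_mult1[OF thH[OF i] c(1)] by blast
    have tc: "xp ^ t * c \<beta> \<in> BK n 1 th i (t + e)" if "\<beta> \<in> Bk k" for \<beta>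
    proof (rule regular[OF i])
      show "xp ^ t * c \<beta> \<in> H (gv n) (t + e)" by (rule H_mult[OF XH c(1)])
      show "th i * (xp ^ t * c \<beta>) \<in> BK n 1 th i (Suc (t + e))" using t[OF that] by (simp add: mult.left_commute)
    qed
    have td: "2 * k + (t + e) = t + s + d" using c(2) by simp
    have "evm F \<beta> * (xp ^ t * c \<beta>) \<in> BK n (Suc k) th i (t + s + d)" if "\<beta> \<in> Bk k" for \<beta>
      using BK_IK_mult[OF evmF_IK[OF that] tc[OF that]] by (simp add: td One_nat_def)
    moreover have "xp ^ t * r \<in> BK n (Suc k) th i (t + s + d)"
      using XB[OF _ rep(2), of t] i by (simp add: add.assoc)
    ultimately have "(\<Sum>\<beta>\<in>Bk k. evm F \<beta> * (xp ^ t * c \<beta>)) + xp ^ t * r \<in> BK n (Suc k) th i (t + s + d)"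
      by (intro gid_add[OF gi] gid_sum[OF gi])
    moreover have "(\<Sum>\<beta>\<in>Bk k. evm F \<beta> * (xp ^ t * c \<beta>)) + xp ^ t * r = xp ^ (t + s) * f"
    proof -
      have "xp ^ (t + s) * f = xp ^ t * (xp ^ s * f)" by (simp only: power_add mult.assoc)
      then show ?thesis by (simp only: rep(1) distrib_left sum_distrib_left mult.left_commute)
    qed
    ultimately show "\<exists>s. xp ^ s * f \<in> BK n (Suc k) th i (s + d)" by metis
  qed
qed

text \<open>In a relation modulo \<open>th i\<close> the cofactor \<open>g\<close> of
  \<open>th i\<close> has a normal form by \<open>CO\<close>. Subtracting \<open>th i\<close> times
  its coefficients leaves a relation to which \<open>QR k i\<close> applies.\<close>

lemma QR_step:
  assumes i: "i < N" and Q: "QR k i" and C: "CO k i"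
  shows "QR k (Suc i)" unfolding QR_def
proof (intro allI impI)
  have gi: "gid (gv n) (BK n k' th i)" for k' using i by (intro gB) simp
  have gSi: "gid (gv n) (BK n k' th (Suc i))" for k' using i by (intro gB) simp
  have sub: "BK n k' th i d \<subseteq> BK n k' th (Suc i) d" for k' d using gplus_left[OF gi] by auto
  fix e c assume c: "\<forall>\<beta>\<in>Bk k. c \<beta> \<in> H (gv n) e"
    and sum: "(\<Sum>\<beta>\<in>Bk k. evm F \<beta> * c \<beta>) \<in> BK n (Suc k) th (Suc i) (2 * k + e)"
  show "\<exists>s. \<forall>\<beta>\<in>Bk k. xp ^ s * c \<beta> \<in> BK n 1 th (Suc i) (s + e)"
  proof (cases "2 * k + e")
    case 0
    then have "(\<Sum>\<beta>\<in>Bk k. evm F \<beta> * c \<beta>) \<in> BK n (Suc k) th i (2 * k + e)" using sum by (auto simp: gplus_def)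
    then show ?thesis using Q c sub unfolding QR_def by blast
  next
    case (Suc d)
    obtain b g where bg: "(\<Sum>\<beta>\<in>Bk k. evm F \<beta> * c \<beta>) = b + th i * g" "b \<in> BK n (Suc k) th i (Suc d)" "g \<in> H (gv n) d"
      using sum Suc by (auto simp: gplus_def)
    have "th i * g = (\<Sum>\<beta>\<in>Bk k. evm F \<beta> * c \<beta>) - b" using bg(1) by simp
    also have "\<dots> \<in> BK n k th i (Suc d)"
    proof (rule gid_diff[OF gi])
      have "evm F \<beta> * c \<beta> \<in> IK n k (Suc d)" if "\<beta> \<in> Bk k" for \<beta>
        using gid_mult[OF gid_IK, of "c \<beta>" n e "evm F \<beta>" k "2 * k"] evmF_IK[OF that] c that Suc
        by (simp add: mult.commute add.commute)
      then have "(\<Sum>\<beta>\<in>Bk k. evm F \<beta> * c \<beta>) \<in> IK n k (Suc d)" by (intro gid_sum[OF gid_IK])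
      then show "(\<Sum>\<beta>\<in>Bk k. evm F \<beta> * c \<beta>) \<in> BK n k th i (Suc d)"
        using BK_mono[of i th n 0 k "Suc d"] thH i by auto
      show "b \<in> BK n k th i (Suc d)" using BK_Suc_le[of i th n k "Suc d"] thH i bg(2) by auto
    qed
    finally have thg: "th i * g \<in> BK n k th i (Suc d)" .
    obtain s e' c' r where c': "\<And>\<beta>. c' \<beta> \<in> H (gv n) e'" "2 * k + e' = s + d"
      and rep: "xp ^ s * g = (\<Sum>\<beta>\<in>Bk k. evm F \<beta> * c' \<beta>) + r" "\<And>k'. r \<in> BK n k' th i (s + d)"
      using CO_rep[OF C i bg(3) thg] by blast
    have e': "Suc e' = s + e" using Suc c'(2) by simp
    have "(\<Sum>\<beta>\<in>Bk k. evm F \<beta> * (xp ^ s * c \<beta> - th i * c' \<beta>)) =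
        xp ^ s * (\<Sum>\<beta>\<in>Bk k. evm F \<beta> * c \<beta>) - th i * (\<Sum>\<beta>\<in>Bk k. evm F \<beta> * c' \<beta>)"
      by (simp add: sum_subtractf sum_distrib_left right_diff_distrib mult.left_commute)
    also have "\<dots> = xp ^ s * b + th i * r"
    proof -
      have "(\<Sum>\<beta>\<in>Bk k. evm F \<beta> * c' \<beta>) = xp ^ s * g - r" using rep(1) by simp
      then show ?thesis by (simp only: bg(1)) (simp add: algebra_simps)
    qed
    also have "\<dots> \<in> BK n (Suc k) th i (2 * k + (s + e))"
    proof -
      have eq: "2 * k + (s + e) = s + Suc d" using Suc by simp
      show ?thesis unfolding eq using XB[OF _ bg(2), of s] gid_mult1[OF gi thH[OF i] rep(2), of "Suc k"] i
        by (intro gid_add[OF gi]) auto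
    qed
    finally obtain t where t: "\<And>\<beta>. \<beta> \<in> Bk k \<Longrightarrow> xp ^ t * (xp ^ s * c \<beta> - th i * c' \<beta>) \<in> BK n 1 th i (t + (s + e))"
    proof -
      assume Sum: "(\<Sum>\<beta>\<in>Bk k. evm F \<beta> * (xp ^ s * c \<beta> - th i * c' \<beta>)) \<in> BK n (Suc k) th i (2 * k + (s + e))"
      have "xp ^ s * c \<beta> - th i * c' \<beta> \<in> H (gv n) (s + e)" if "\<beta> \<in> Bk k" for \<beta>
        using H_mult[OF XH[of s]] H_mult1[OF thH[OF i] c'(1)] c that unfolding e' by (intro H_diff) auto
      then show ?thesis
        using Q[unfolded QR_def, rule_format, of "\<lambda>\<beta>. xp ^ s * c \<beta> - th i * c' \<beta>" "s + e", OF _ Sum] that by blast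
    qed
    have "xp ^ (t + s) * c \<beta> \<in> BK n 1 th (Suc i) (t + s + e)" if "\<beta> \<in> Bk k" for \<beta>
    proof -
      have "xp ^ (t + s) * c \<beta> = xp ^ t * (xp ^ s * c \<beta> - th i * c' \<beta>) + th i * (xp ^ t * c' \<beta>)"
        by (simp add: power_add algebra_simps)
      moreover have "xp ^ t * c' \<beta> \<in> Hp (gv n) (t + (s + e))"
        using H_mult[OF XH[of t] c'(1)[of \<beta>]] by (simp flip: e')
      ultimately show ?thesis using t[OF that] by (auto simp: gplus_def add.assoc)
    qed
    then show ?thesis by blast
  qed
qed

lemma CO_all: "i < N \<Longrightarrow> CO k i"
proof -
  have "\<forall>k. QR k i" if "i < N" for i using that
  proof (induction i)
    case 0
    show ?case using QR_0 by blast
  next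
    case (Suc i)
    then show ?case using QR_step CO_step by (meson Suc_lessD)
  qed
  then show "i < N \<Longrightarrow> CO k i" using CO_step by blast
qed

lemma colon_torsion:
  assumes "i < N" "f \<in> H (gv n) d" "th i * f \<in> BK n k th i (Suc d)"
  shows "\<exists>s. xp ^ s * f \<in> BK n k th i (s + d)"
  using CO_all[OF assms(1), of k] assms(2,3) unfolding CO_def by blast

end

end

theorem Reg_BK:
  fixes th :: "nat \<Rightarrow> (nat, 'k::field) mpoly"
  assumes n: "0 < n" and thH: "\<And>i. i < N \<Longrightarrow> th i \<in> H (gv n) 1"
    and regular: "\<And>i d f. i < N \<Longrightarrow> f \<in> H (gv n) d \<Longrightarrow> th i * f \<in> BK n 1 th i (Suc d) \<Longrightarrow> f \<in> BK n 1 th i d"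
  shows "i \<le> N \<Longrightarrow> Reg Var (gv n) (gv n) (2 * k) (BK n k th i)"
proof (induction i)
  case 0
  show ?case using Reg_IK[OF n] by simp
next
  case (Suc i)
  have g: "gid (gv n) (BK n k th i)" using Suc.prems by (intro gid_BK thH) auto
  \<comment> \<open>Every variable, from either row, may serve as pivot.\<close>
  have tors: "\<exists>s. Var v ^ s * f \<in> BK n k th i (s + d)"
    if f: "f \<in> H (gv n) d" "th i * f \<in> BK n k th i (Suc d)" and v: "v < 2 * n" for v f d
  proof (cases "v < n")
    case True
    interpret minor_rows n v "\<lambda>j. j" "\<lambda>j. n + j" "TYPE('k)" by unfold_locales (use True in auto)
    show ?thesis by (rule colon_torsion[where N = N]) (use thH regular f Suc.prems in auto)
  next
    case False
    interpret minor_rows n "v - n" "\<lambda>j. n + j" "\<lambda>j. j" "TYPE('k)" by unfold_locales (use False v in auto)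
    have "\<exists>s. Var (n + (v - n)) ^ s * f \<in> BK n k th i (s + d)"
      by (rule colon_torsion[where N = N]) (use thH regular f Suc.prems in auto)
    then show ?thesis using False by simp
  qed
  have "Reg Var (gv n) (gv n) (2 * k) (gplus (gv n) (BK n k th i) (th i))"
  proof (rule Reg_gplus[OF _ H_Var g])
    show "gcolon (gv n) (BK n k th i) (th i) d \<subseteq> BK n k th i d" if "2 * k \<le> d" for d
    proof
      fix f assume f: "f \<in> gcolon (gv n) (BK n k th i) (th i) d"
      show "f \<in> BK n k th i d"
        by (rule Reg_torsion[OF _ H_Var g Suc.IH that]) (use f tors Suc.prems in \<open>auto simp: gcolon_def\<close>)
    qed
  qed (use Suc thH in auto)
  then show ?case by simp
qed

subsection \<open>Points of rank at most one\<close>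

lemma hom_system:
  fixes a :: "'e \<Rightarrow> 'u \<Rightarrow> 'k::field"
  assumes "finite U" "finite E" "card E < card U"
  shows "\<exists>x. (\<exists>u\<in>U. x u \<noteq> 0) \<and> (\<forall>e\<in>E. (\<Sum>u\<in>U. a e u * x u) = 0)" using assms(2,1,3)
proof (induction E arbitrary: U a rule: finite_induct)
  case empty
  then obtain u where "u \<in> U" by (metis card.empty ex_in_conv less_irrefl)
  then show ?case by (intro exI[of _ "\<lambda>_. 1"]) auto
next
  case (insert e E)
  show ?case
  proof (cases "\<forall>u\<in>U. a e u = 0")
    case True
    then show ?thesis using insert.IH[of U a] insert.prems insert.hyps by auto
  next
    case False
    then obtain u0 where u0: "u0 \<in> U" "a e u0 \<noteq> 0" by blast
    define a' where "a' e' u = a e' u - a e' u0 * a e u / a e u0" for e' u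
    have "card E < card (U - {u0})" using insert.prems insert.hyps u0 by (simp add: card_Diff_singleton)
    then obtain x where x: "\<exists>u\<in>U - {u0}. x u \<noteq> 0" "\<And>e'. e' \<in> E \<Longrightarrow> (\<Sum>u\<in>U - {u0}. a' e' u * x u) = 0"
      using insert.IH[of "U - {u0}" a'] insert.prems by auto
    define s where "s = (\<Sum>u\<in>U - {u0}. a e u * x u)"
    define y where "y = x(u0 := - s / a e u0)"
    have split: "(\<Sum>u\<in>U. a e' u * y u) = a e' u0 * (- s / a e u0) + (\<Sum>u\<in>U - {u0}. a e' u * x u)" for e'
    proof -
      have "(\<Sum>u\<in>U. a e' u * y u) = a e' u0 * y u0 + (\<Sum>u\<in>U - {u0}. a e' u * y u)"
        using insert.prems u0 by (intro sum.remove) auto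
      also have "(\<Sum>u\<in>U - {u0}. a e' u * y u) = (\<Sum>u\<in>U - {u0}. a e' u * x u)"
        by (intro sum.cong) (auto simp: y_def)
      finally show ?thesis by (simp add: y_def)
    qed
    have "(\<Sum>u\<in>U. a e' u * y u) = 0" if "e' \<in> insert e E" for e'
    proof (cases "e' = e")
      case True
      then show ?thesis using split[of e] u0 by (simp add: s_def)
    next
      case False
      then have "0 = (\<Sum>u\<in>U - {u0}. a' e' u * x u)" using x(2) that by simp
      also have "\<dots> = (\<Sum>u\<in>U - {u0}. a e' u * x u) - (\<Sum>u\<in>U - {u0}. a e' u0 / a e u0 * (a e u * x u))"
        by (simp add: a'_def left_diff_distrib sum_subtractf mult.assoc)
      also have "\<dots> = (\<Sum>u\<in>U. a e' u * y u)" by (simp add: split s_def sum_distrib_left sum_divide_distrib)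
      finally show ?thesis by simp
    qed
    moreover have "\<exists>u\<in>U. y u \<noteq> 0" using x(1) by (auto simp: y_def)
    ultimately show ?thesis by blast
  qed
qed

lemma (in vector_space) functional_exists:
  assumes "subspace M" "q \<notin> M"
  shows "\<exists>f. (\<forall>x y. f (x + y) = f x + f y) \<and> (\<forall>c x. f (scale c x) = c * f x) \<and> (\<forall>m\<in>M. f m = (0 :: 'a)) \<and> f q = 1"
proof -
  interpret vp: vector_space_pair scale "(*) :: 'a \<Rightarrow> 'a \<Rightarrow> 'a" by unfold_locales (auto simp: algebra_simps)
  obtain B where B: "B \<subseteq> M" "independent B" "M \<subseteq> span B" using basis_exists[of M] by metis
  have "q \<notin> span B" using assms span_minimal[OF B(1) assms(1)] by blast
  then have "independent (insert q B)" using B(2) independent_insertI by blast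
  from vp.linear_independent_extend[OF this, of "\<lambda>x. if x = q then 1 else 0"]
  obtain g where g: "Vector_Spaces.linear scale ((*)) g" "\<forall>x\<in>insert q B. g x = (if x = q then 1 else 0)"
    by blast
  interpret g: Vector_Spaces.linear scale "(*)" g by (rule g(1))
  have "g m = 0" if "m \<in> M" for m
  proof -
    have "m \<in> span B" using that B(3) by blast
    then show ?thesis
    proof (induction rule: span_induct_alt)
      case (step c x y)
      have "x \<noteq> q" using step(1) B(1) assms(2) by blast
      then show ?case using step g(2) by (simp add: g.add g.scale)
    qed (simp add: g.zero)
  qed
  then show ?thesis using g(2) by (intro exI[of _ g]) (auto simp: g.add g.scale)
qed

abbreviation evp :: "('v \<Rightarrow> 'k::field) \<Rightarrow> ('v, 'k) mpoly \<Rightarrow> 'k" where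
  "evp \<equiv> ev (\<lambda>x. x)"

lemmas evp_hom = ev_add[OF comm_ring_hom_id] ev_mult[OF comm_ring_hom_id] ev_0[OF comm_ring_hom_id]
  ev_Var[OF comm_ring_hom_id] ev_Const[OF comm_ring_hom_id] ev_sum[OF comm_ring_hom_id]

lemma evp_linear:
  fixes f :: "('v, 'k::field) mpoly \<Rightarrow> 'k"
  assumes "h \<in> H A 1" "\<And>x y. f (x + y) = f x + f y" "\<And>c x. f (Const c * x) = c * f x"
  shows "evp (\<lambda>v. f (Var v)) h = f h" using assms(1)
proof (induction rule: H_induct)
  case zero
  show ?case using assms(3)[of 0 0] by (simp add: evp_hom)
next
  case (mon c m)
  obtain v m' where "m = expo v + m'" "monom_deg m' = 0" using mon(2) by (auto simp: One_nat_def elim: monom_deg_SucE)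
  then have "mon m = (Var v :: ('v, 'k) mpoly)" by (simp add: Var_mon)
  then show ?case by (simp only: evp_hom assms(3))
qed (simp add: evp_hom assms(2))

text \<open>The vectors \<open>D k\<close> act like the iterates of an endomorphism, which itself
  need not be given. A polynomial of least degree annihilating the sequence has a root
  \<open>\<mu>\<close>; its cofactor yields an eigenvector, nonzero by minimality.\<close>

lemma krylov:
  fixes D :: "nat \<Rightarrow> 'v \<Rightarrow> 'k::alg_closed_field"
  assumes "finite A" "\<exists>v\<in>A. D 0 v \<noteq> 0"
  shows "\<exists>\<mu> c N. (\<exists>v\<in>A. (\<Sum>k\<le>N. c k * D k v) \<noteq> 0) \<and>
    (\<forall>v\<in>A. (\<Sum>k\<le>N. c k * D (Suc k) v) = \<mu> * (\<Sum>k\<le>N. c k * D k v))"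
proof -
  define app where "app p v = (\<Sum>k\<le>Polynomial.degree p. Polynomial.coeff p k * D k v)" for p v
  have app_le: "app p v = (\<Sum>k\<le>N. Polynomial.coeff p k * D k v)" if "Polynomial.degree p \<le> N" for p v N
    unfolding app_def using that by (intro sum.mono_neutral_left) (auto simp: coeff_eq_0)
  have ex: "\<exists>p. p \<noteq> 0 \<and> (\<forall>v\<in>A. app p v = 0)"
  proof -
    obtain x where x: "\<exists>k\<in>{..card A}. x k \<noteq> 0" "\<forall>v\<in>A. (\<Sum>k\<in>{..card A}. D k v * x k) = 0"
      using hom_system[of "{..card A}" A "\<lambda>v k. D k v"] assms(1) by auto
    define p where "p = (\<Sum>k\<le>card A. Polynomial.monom (x k) k)"
    have cp: "Polynomial.coeff p k = (if k \<le> card A then x k else 0)" for k by (simp add: p_def coeff_sum)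
    have "p \<noteq> 0" using x(1) cp by (metis atMost_iff coeff_0)
    moreover have "Polynomial.degree p \<le> card A" by (rule degree_le) (simp add: cp)
    then have "app p v = 0" if "v \<in> A" for v using x(2) that by (simp add: app_le cp mult.commute)
    ultimately show ?thesis by blast
  qed
  define P where "P d \<longleftrightarrow> (\<exists>p. p \<noteq> 0 \<and> (\<forall>v\<in>A. app p v = 0) \<and> Polynomial.degree p = d)" for d
  obtain p where p: "p \<noteq> 0" "\<And>v. v \<in> A \<Longrightarrow> app p v = 0" "Polynomial.degree p = (LEAST d. P d)"
    using LeastI_ex[of P] ex unfolding P_def by auto
  have min: "\<exists>v\<in>A. app q v \<noteq> 0" if "q \<noteq> 0" "Polynomial.degree q < Polynomial.degree p" for q
    using not_less_Least[of "Polynomial.degree q" P] that p(3) unfolding P_def by auto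
  have "Polynomial.degree p \<noteq> 0"
  proof
    assume 0: "Polynomial.degree p = 0"
    then have "Polynomial.coeff p 0 \<noteq> 0" using p(1) leading_coeff_neq_0 by metis
    then show False using 0 assms(2) p(2) by (auto simp: app_def)
  qed
  then obtain \<mu> where "poly p \<mu> = 0" using alg_closed_imp_poly_has_root by blast
  then obtain q where q: "p = [:- \<mu>, 1:] * q" by (metis poly_eq_0_iff_dvd dvdE)
  have "q \<noteq> 0" using q p(1) by auto
  then have dp: "Polynomial.degree p = Suc (Polynomial.degree q)" unfolding q by (subst degree_mult_eq) auto
  define N where "N = Polynomial.degree q"
  have "(\<Sum>k\<le>N. Polynomial.coeff q k * D (Suc k) v) = \<mu> * (\<Sum>k\<le>N. Polynomial.coeff q k * D k v)" if "v \<in> A" for v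
  proof -
    have cp: "Polynomial.coeff p k = (case k of 0 \<Rightarrow> 0 | Suc k' \<Rightarrow> Polynomial.coeff q k') - \<mu> * Polynomial.coeff q k" for k
      by (simp add: q coeff_pCons split: nat.split)
    have "0 = (\<Sum>k\<le>Suc N. Polynomial.coeff p k * D k v)" using p(2)[OF that] by (simp add: app_def dp N_def)
    also have "\<dots> = (\<Sum>k\<le>Suc N. (case k of 0 \<Rightarrow> 0 | Suc k' \<Rightarrow> Polynomial.coeff q k') * D k v) - (\<Sum>k\<le>Suc N. \<mu> * Polynomial.coeff q k * D k v)"
      by (simp only: cp left_diff_distrib sum_subtractf)
    also have "(\<Sum>k\<le>Suc N. (case k of 0 \<Rightarrow> 0 | Suc k' \<Rightarrow> Polynomial.coeff q k') * D k v) = (\<Sum>k\<le>N. Polynomial.coeff q k * D (Suc k) v)"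
      by (subst sum.atMost_Suc_shift) simp
    also have "(\<Sum>k\<le>Suc N. \<mu> * Polynomial.coeff q k * D k v) = \<mu> * (\<Sum>k\<le>N. Polynomial.coeff q k * D k v)"
      by (simp add: sum_distrib_left mult.assoc coeff_eq_0 N_def)
    finally show ?thesis by simp
  qed
  moreover have "\<exists>v\<in>A. (\<Sum>k\<le>N. Polynomial.coeff q k * D k v) \<noteq> 0"
    using min[OF \<open>q \<noteq> 0\<close>] dp by (simp add: app_def N_def)
  ultimately show ?thesis by blast
qed

text \<open>If the linear forms \<open>th i\<close> have no nonzero common zero of rank at most one, then every quadric
  lies in the ideal generated by them and the minors. Otherwise a functional vanishing on the
  degree 2 part of this ideal is a symmetric bilinear form whose rows are points of the linear
  space; the rows belonging to the two rows of the matrix define an endomorphism, and an eigenvector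
  of it is a point of rank one.\<close>

lemma quad_of_points:
  fixes th :: "nat \<Rightarrow> (nat, 'l::alg_closed_field) mpoly"
  assumes thH: "\<And>j. j \<le> n \<Longrightarrow> th j \<in> H (gv n) 1"
    and pts: "\<And>P. (\<And>i. i \<le> n \<Longrightarrow> evp P (th i) = 0) \<Longrightarrow>
      (\<And>i j. i < n \<Longrightarrow> j < n \<Longrightarrow> P i * P (n + j) = P j * P (n + i)) \<Longrightarrow> \<forall>v<2 * n. P v = 0"
    and u: "u \<in> H (gv n) 1" "u' \<in> H (gv n) 1"
  shows "u * u' \<in> BK n 1 th (Suc n) 2"
proof (rule ccontr)
  define M where "M = BK n 1 th (Suc n) 2"
  assume "u * u' \<notin> BK n 1 th (Suc n) 2"
  then have not: "u * u' \<notin> M" by (simp add: M_def)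
  have gid: "gid (gv n) (BK n 1 th (Suc n))" by (intro gid_BK thH) simp
  then have sub: "mp.subspace M" unfolding M_def by (rule subspace_gid)
  obtain lam where lam_add: "\<And>x y. lam (x + y) = lam x + lam y" and lam_scale: "\<And>c x. lam (Const c * x) = c * lam x"
    and lam_M: "\<And>m. m \<in> M \<Longrightarrow> lam m = (0 :: 'l)" and lam_u: "lam (u * u') = 1"
    using mp.functional_exists[OF sub not] by metis
  have lam_scale': "lam (w * (Const c * x)) = c * lam (w * x)" for c w x
    by (subst mult.left_commute) (rule lam_scale)
  have lam_0: "lam 0 = 0" using lam_scale[of 0 0] by simp
  have lam_sum: "lam (sum f I) = (\<Sum>i\<in>I. lam (f i))" for f :: "nat \<Rightarrow> _" and I
    by (induction I rule: infinite_finite_induct) (auto simp: lam_0 lam_add)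
  \<comment> \<open>The row of the bilinear form that belongs to \<open>w\<close>, read as a point
    of the space of matrices.\<close>
  define D where "D w v = lam (w * Var v)" for w v
  have D_ev: "evp (D w) h = lam (w * h)" if "h \<in> H (gv n) 1" for w h
    unfolding D_def using that by (intro evp_linear) (auto simp: distrib_left lam_add lam_scale')
  have D_th: "evp (D w) (th i) = 0" if "i \<le> n" "w \<in> H (gv n) 1" for w i
  proof -
    have "th i * w \<in> BK n 1 th (Suc n) (Suc 1)" using that thH by (intro BK_th) auto
    then have "w * th i \<in> M" by (simp add: M_def mult.commute One_nat_def numeral_2_eq_2)
    then show ?thesis using D_ev[OF thH[OF that(1)]] lam_M by simp
  qed
  have evlin: "evp (\<lambda>v. \<Sum>k\<in>K. c k * D (w k) v) h = (\<Sum>k\<in>K. c k * evp (D (w k)) h)" if "h \<in> H (gv n) 1" for K c w h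
  proof -
    have "evp (\<lambda>v. \<Sum>k\<in>K. c k * lam (w k * Var v)) h = (\<Sum>k\<in>K. c k * lam (w k * h))"
      using that by (intro evp_linear[where f = "\<lambda>p. \<Sum>k\<in>K. c k * lam (w k * p)"])
        (auto simp: distrib_left lam_add lam_scale' sum.distrib sum_distrib_left mult.left_commute[where 'a = 'l] intro!: sum.cong)
    then show ?thesis using D_ev[OF that] by (simp add: D_def)
  qed
  \<comment> \<open>The forms \<open>th\<close> and the second-row variables span all linear forms:
    otherwise a functional vanishing on them would be a nonzero point with zero second row, hence of
    rank at most one.\<close>
  define Y where "Y = mp.span (th ` {..n} \<union> Var ` {n..<2 * n})"
  have H1: "H (gv n) 1 \<subseteq> Y"
  proof
    fix h :: "(nat, 'l) mpoly" assume h: "h \<in> H (gv n) 1"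
    show "h \<in> Y"
    proof (rule ccontr)
      assume "h \<notin> Y"
      then obtain f where f: "\<And>x y. f (x + y) = f x + f y" "\<And>c x. f (Const c * x) = c * f x"
        "\<And>m. m \<in> Y \<Longrightarrow> f m = (0 :: 'l)" "f h = 1"
        using mp.functional_exists[of Y h] unfolding Y_def by (metis mp.subspace_span)
      define P where "P v = f (Var v)" for v
      have Pev: "evp P g = f g" if "g \<in> H (gv n) 1" for g unfolding P_def using that f(1,2) by (rule evp_linear)
      have "P (n + j) = 0" if "j < n" for j
        unfolding P_def Y_def using that by (intro f(3)) (auto simp: Y_def intro!: mp.span_base)
      moreover have "evp P (th i) = 0" if "i \<le> n" for i
        using Pev[OF thH[OF that]] f(3)[of "th i"] that by (auto simp: Y_def intro: mp.span_base)
      ultimately have "\<forall>v<2 * n. P v = 0" by (intro pts) auto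
      then have "evp P h = evp (\<lambda>_. 0) h"
        using h unfolding ev_def by (intro sum.cong refl arg_cong2[where f = "(*)"] evm_cong) (auto simp: H_def)
      also have "\<dots> = 0" using evp_linear[OF h, of "\<lambda>_. 0"] by simp
      finally show False using Pev[OF h] f(4) by simp
    qed
  qed
  \<comment> \<open>Write \<open>w\<close> by second-row variables modulo the \<open>th\<close> and
    move them to the first row; as the functional kills the minors, the first row of
    \<open>D w\<close> is the second row of \<open>D w'\<close>. Iteration gives the sequence for
    \<open>krylov\<close>.\<close>
  have shift: "\<exists>w'. w' \<in> H (gv n) 1 \<and> (\<forall>i<n. D w i = D w' (n + i))" if w: "w \<in> H (gv n) 1" for w
  proof -
    have "w \<in> mp.span (Var ` {n..<2 * n} \<union> mp.span (th ` {..n}))"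
    proof -
      have "Y \<subseteq> mp.span (Var ` {n..<2 * n} \<union> mp.span (th ` {..n}))"
        unfolding Y_def by (intro mp.span_minimal) (auto intro: mp.span_base)
      then show ?thesis using H1 w by blast
    qed
    then obtain c where c: "w - (\<Sum>v\<in>{n..<2 * n}. Const (c v) * Var v) \<in> mp.span (th ` {..n})"
      using mp.span_family_mod[of "mp.span (th ` {..n})" "{n..<2 * n}" w Var] by auto
    define w' where "w' = (\<Sum>v\<in>{n..<2 * n}. Const (c v) * Var (v - n))"
    have w'H: "w' \<in> H (gv n) 1" unfolding w'_def by (intro H_sum H_Const_mult H_Var) auto
    define w0 where "w0 = w - (\<Sum>v\<in>{n..<2 * n}. Const (c v) * Var v)"
    have "lam (w0 * Var v) = 0" if "v < 2 * n" for v using c[folded w0_def]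
    proof (induction rule: mp.span_induct_alt)
      case (step b x y)
      then obtain i where "i \<le> n" "x = th i" by auto
      have "th i * Var v \<in> BK n 1 th (Suc n) (Suc 1)"
        using that \<open>i \<le> n\<close> thH by (intro BK_th H_Var) auto
      then have "th i * Var v \<in> M" by (simp add: M_def One_nat_def numeral_2_eq_2)
      then have "lam (x * Var v) = 0" using lam_M \<open>x = th i\<close> by simp
      then show ?case using step by (simp add: distrib_right lam_add mult.assoc lam_scale)
    qed (simp add: lam_0)
    then have Dw: "D w v = D (\<Sum>v\<in>{n..<2 * n}. Const (c v) * Var v) v" if "v < 2 * n" for v
      using that lam_add[of "w0 * Var v" "(\<Sum>v\<in>{n..<2 * n}. Const (c v) * Var v) * Var v"]
      by (simp add: D_def w0_def algebra_simps)
    have "D w i = D w' (n + i)" if i: "i < n" for i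
    proof -
      have swap: "lam (Var v * Var i) = lam (Var (v - n) * Var (n + i))" if v: "v \<in> {n..<2 * n}" for v
      proof -
        have "(gminor n i (v - n) :: (nat, 'l) mpoly) \<in> IK n 1 2" using i v by (intro gminor_IK) auto
        then have gM: "(gminor n i (v - n) :: (nat, 'l) mpoly) \<in> M"
          using BK_mono[of "Suc n" th n 0 1 2] thH by (auto simp: M_def)
        have "n + (v - n) = v" using v by auto
        then have "Var v * Var i = gminor n i (v - n) + (Var (v - n) * Var (n + i) :: (nat, 'l) mpoly)"
          by (simp add: gminor_def mult.commute)
        then show ?thesis using lam_M[OF gM] by (simp add: lam_add)
      qed
      have "D w i = (\<Sum>v\<in>{n..<2 * n}. c v * lam (Var v * Var i))"
        using Dw[of i] i by (simp add: D_def sum_distrib_right lam_sum mult.assoc lam_scale)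
      also have "\<dots> = (\<Sum>v\<in>{n..<2 * n}. c v * lam (Var (v - n) * Var (n + i)))"
        using swap by (intro sum.cong) auto
      also have "\<dots> = D w' (n + i)" by (simp add: D_def w'_def sum_distrib_right lam_sum mult.assoc lam_scale)
      finally show ?thesis .
    qed
    then show ?thesis using w'H by blast
  qed
  obtain w where w: "w 0 = u" "\<And>k. w k \<in> H (gv n) 1" "\<And>k i. i < n \<Longrightarrow> D (w k) i = D (w (Suc k)) (n + i)"
  proof -
    have "\<exists>w. \<forall>k. (w k \<in> H (gv n) 1 \<and> (k = 0 \<longrightarrow> w k = u)) \<and> (\<forall>i<n. D (w k) i = D (w (Suc k)) (n + i))"
      by (rule dependent_nat_choice) (use u shift in auto)
    then show ?thesis using that by blast
  qed
  have "\<exists>v\<in>gv n. D (w 0) v \<noteq> 0"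
  proof (rule ccontr)
    assume "\<not> ?thesis"
    then have "evp (D u) u' = evp (\<lambda>_. 0) u'"
      using u(2) w(1) unfolding ev_def by (intro sum.cong refl arg_cong2[where f = "(*)"] evm_cong) (auto simp: H_def)
    also have "\<dots> = 0" using evp_linear[OF u(2), of "\<lambda>_. 0"] by simp
    finally show False using D_ev[OF u(2)] lam_u by simp
  qed
  then obtain \<mu> c N where k: "\<exists>v\<in>gv n. (\<Sum>k\<le>N. c k * D (w k) v) \<noteq> 0"
    "\<And>v. v \<in> gv n \<Longrightarrow> (\<Sum>k\<le>N. c k * D (w (Suc k)) v) = \<mu> * (\<Sum>k\<le>N. c k * D (w k) v)"
    using krylov[of "gv n" "\<lambda>k. D (w k)"] by blast
  define P where "P v = (\<Sum>k\<le>N. c k * D (w k) v)" for v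
  have "evp P (th i) = 0" if "i \<le> n" for i
    unfolding P_def evlin[OF thH[OF that]] using D_th[OF that w(2)] by simp
  \<comment> \<open>The eigenvector relation makes the first row a multiple of the second.\<close>
  moreover have row: "P i = \<mu> * P (n + i)" if "i < n" for i
    using k(2)[of "n + i"] that w(3)[OF that] by (simp add: P_def)
  ultimately have "\<forall>v<2 * n. P v = 0" by (intro pts) (auto simp: row)
  then show False using k(1) by (auto simp: P_def)
qed

subsection \<open>Extension of scalars\<close>

lemma H1_expand:
  assumes "h \<in> H V 1" "finite V"
  shows "h = (\<Sum>u\<in>V. Const (cf h (expo u)) * Var u)" using assms(1)
proof (induction rule: H_induct)
  case zero
  show ?case by simp
next
  case (add p q)
  have "p + q = (\<Sum>u\<in>V. Const (cf p (expo u)) * Var u) + (\<Sum>u\<in>V. Const (cf q (expo u)) * Var u)"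
    using add(3,4) by simp
  then show ?case unfolding lookup_add Const_add distrib_right sum.distrib .
next
  case (mon c m)
  obtain v m' where "v \<in> supp m" "m = expo v + m'" "monom_deg m' = 0"
    using mon(2) by (auto simp: One_nat_def elim: monom_deg_SucE)
  then have m: "m = expo v" "v \<in> V" using mon(1) by auto
  have inj: "expo v = expo u \<longleftrightarrow> u = v" for u by (metis supp_expo singleton_inject)
  have "(\<Sum>u\<in>V. Const (cf (Const c * mon m) (expo u)) * Var u) = (\<Sum>u\<in>V. if u = v then Const c * Var v else 0)"
    by (intro sum.cong) (auto simp: m lookup_mon inj)
  then show ?case using m assms(2) by (simp add: Var_mon)
qed

lemma ev_H1:
  assumes "comm_ring_hom c" "h \<in> H V 1" "finite V"
  shows "ev c s h = (\<Sum>u\<in>V. c (cf h (expo u)) * s u)"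
  by (subst H1_expand[OF assms(2,3)]) (simp add: ev_sum[OF assms(1)] ev_mult[OF assms(1)] assms(1))

lemma comm_ring_hom_to_ac: "comm_ring_hom to_ac"
  by unfold_locales simp_all

definition emb :: "('v, 'k::field) mpoly \<Rightarrow> ('v, 'k alg_closure) mpoly" where
  "emb = ev (\<lambda>c. Const (to_ac c)) Var"

lemma comm_ring_hom_Const_ac: "comm_ring_hom (\<lambda>c :: 'k::field. Const (to_ac c) :: ('v, 'k alg_closure) mpoly)"
  by unfold_locales (simp_all add: Const_add Const_mult)

interpretation emb: comm_ring_hom emb
  unfolding emb_def by (rule comm_ring_hom_ev[OF comm_ring_hom_Const_ac])

lemma emb_Var [simp]: "emb (Var v) = Var v"
  and emb_Const [simp]: "emb (Const c) = Const (to_ac c)"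
  and emb_mon [simp]: "emb (mon m) = mon m" by (simp_all add: emb_def comm_ring_hom_Const_ac evm_Var)

lemma emb_H: "p \<in> H A d \<Longrightarrow> emb p \<in> H A d"
proof (induction rule: H_induct)
  case (mon c m)
  then show ?case using H_mon[of m A] by (auto simp: emb.hom_mult intro: H_Const_mult)
qed (auto simp: emb.hom_add intro: H_add)

lemma evp_emb: "evp P (emb p) = ev to_ac P p"
proof -
  have "evp P (Const (to_ac c) * mon m) = to_ac c * evm P m" for c m
    by (simp add: evp_hom ev_mon[OF comm_ring_hom_id])
  then show ?thesis by (subst mpoly_expand[of p])
      (simp add: emb.hom_sum emb.hom_mult evp_hom(6) ev_def[of to_ac])
qed

text \<open>For a K-linear retraction of the closure onto K this map is linear over polynomials with
  coefficients in K, so membership in extended ideals descends.\<close>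

definition pim :: "('l \<Rightarrow> 'k) \<Rightarrow> ('v, 'l::field) mpoly \<Rightarrow> ('v, 'k::field) mpoly" where
  "pim = Poly_Mapping.map"

lemma exists_retraction:
  "\<exists>\<pi> :: 'k::field alg_closure \<Rightarrow> 'k. (\<forall>x y. \<pi> (x + y) = \<pi> x + \<pi> y) \<and> (\<forall>c x. \<pi> (to_ac c * x) = c * \<pi> x) \<and> \<pi> 1 = 1"
proof -
  interpret vs: vector_space "\<lambda>(c :: 'k) x. to_ac c * x" by unfold_locales (simp_all add: algebra_simps)
  have "vs.subspace {0}" by (rule vs.subspace_single_0)
  from vs.functional_exists[OF this, of 1] show ?thesis by auto
qed

lemma emb_gminor [simp]: "emb (gminor n i j) = gminor n i j"
  by (simp add: gminor_def emb.hom_minus emb.hom_mult)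

lemma mprods_emb: "(mprods n k :: (nat, 'k::field alg_closure) mpoly set) = emb ` mprods n k"
proof (induction k)
  case (Suc k)
  show ?case
  proof
    show "(mprods n (Suc k) :: (nat, 'k alg_closure) mpoly set) \<subseteq> emb ` mprods n (Suc k)"
    proof
      fix g :: "(nat, 'k alg_closure) mpoly" assume "g \<in> mprods n (Suc k)"
      then obtain i j h where g: "g = gminor n i j * h" "i < n" "j < n" "h \<in> mprods n k" by auto
      then obtain h' where "h = emb h'" "h' \<in> mprods n k" using Suc by blast
      then have "g = emb (gminor n i j * h')" by (simp add: g(1) emb.hom_mult)
      then show "g \<in> emb ` mprods n (Suc k)" using g \<open>h' \<in> _\<close> by auto
    qed
    show "emb ` mprods n (Suc k) \<subseteq> (mprods n (Suc k) :: (nat, 'k alg_closure) mpoly set)"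
    proof
      fix g assume "g \<in> emb ` (mprods n (Suc k) :: (nat, 'k) mpoly set)"
      then obtain i j h where g: "g = emb (gminor n i j * h)" "i < n" "j < n" "h \<in> (mprods n k :: (nat, 'k) mpoly set)" by auto
      then have "g = gminor n i j * emb h" "emb h \<in> mprods n k" using Suc by (auto simp: emb.hom_mult)
      then show "g \<in> mprods n (Suc k)" using g by auto
    qed
  qed
qed (simp add: emb.hom_one)

lemma emb_IK: "p \<in> IK n k d \<Longrightarrow> emb p \<in> IK n k d"
  unfolding IK_def
proof (induction rule: gen_induct)
  case (mult e q g)
  then have "emb g \<in> mprods n k" using mprods_emb by blast
  from gen_mult[OF emb_H[OF mult(1)] this] show ?case by (simp add: emb.hom_mult)
qed (auto simp: emb.hom_add intro: gen_0 gen_add)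

lemma BK_cong: "(\<And>j. j < i \<Longrightarrow> th j = th' j) \<Longrightarrow> BK n k th i = BK n k th' i"
  by (induction i) auto

lemma emb_Hp: "p \<in> Hp A d \<Longrightarrow> emb p \<in> Hp A d"
  by (auto simp: Hp_def intro: emb_H)

lemma emb_BK: "p \<in> BK n k th i d \<Longrightarrow> emb p \<in> BK n k (\<lambda>j. emb (th j)) i d"
proof (induction i arbitrary: p)
  case 0
  then show ?case by (simp add: emb_IK)
next
  case (Suc i)
  then obtain b u where "p = b + th i * u" "b \<in> BK n k th i d" "u \<in> Hp (gv n) d" by (auto simp: gplus_def)
  then have "emb p = emb b + emb (th i) * emb u" "emb b \<in> BK n k (\<lambda>j. emb (th j)) i d" "emb u \<in> Hp (gv n) d"
    using Suc.IH emb_Hp[of u] by (auto simp: emb.hom_add emb.hom_mult)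
  then show ?case unfolding BK.simps gplus_def by blast
qed

context
  fixes \<pi> :: "'k::field alg_closure \<Rightarrow> 'k"
  assumes pi_add: "\<And>x y. \<pi> (x + y) = \<pi> x + \<pi> y" and pi_scale: "\<And>c x. \<pi> (to_ac c * x) = c * \<pi> x"
    and pi_1: "\<pi> 1 = 1"
begin

lemma pi_0 [simp]: "\<pi> 0 = 0"
  using pi_scale[of 0 0] by simp

lemma lookup_pim: "cf (pim \<pi> p) m = \<pi> (cf p m)"
  by (simp add: pim_def map.rep_eq when_def)

lemma pim_add: "pim \<pi> (p + q) = pim \<pi> p + pim \<pi> q"
  by (rule poly_mapping_eqI) (simp add: lookup_pim lookup_add pi_add)

lemma pim_0 [simp]: "pim \<pi> 0 = 0"
  by (rule poly_mapping_eqI) (simp add: lookup_pim)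

lemma pim_sum: "pim \<pi> (sum f I) = (\<Sum>i\<in>I. pim \<pi> (f i))"
  by (induction I rule: infinite_finite_induct) (auto simp: pim_add)

lemma pim_mult: "pim \<pi> (q * emb g) = pim \<pi> q * g"
proof -
  have 1: "pim \<pi> (q * (Const (to_ac c) * mon m)) = pim \<pi> q * (Const c * mon m)" for c m
  proof (rule poly_mapping_eqI)
    fix l
    have L: "q * (Const (to_ac c) * mon m) = Poly_Mapping.single m (to_ac c) * q"
      "pim \<pi> q * (Const c * mon m) = Poly_Mapping.single m c * pim \<pi> q" by (simp_all add: single_eq mult_ac)
    show "cf (pim \<pi> (q * (Const (to_ac c) * mon m))) l = cf (pim \<pi> q * (Const c * mon m)) l"
    proof (cases "\<exists>l'. l = m + l'")
      case True
      then show ?thesis unfolding L by (auto simp: lookup_mult_single pi_scale lookup_pim)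
    next
      case False
      then show ?thesis unfolding L by (simp add: lookup_mult_single_notin lookup_pim)
    qed
  qed
  have "q * emb g = (\<Sum>m\<in>supp g. q * (Const (to_ac (cf g m)) * mon m))"
    by (subst mpoly_expand[of g]) (simp add: emb.hom_sum emb.hom_mult sum_distrib_left)
  then have "pim \<pi> (q * emb g) = (\<Sum>m\<in>supp g. pim \<pi> q * (Const (cf g m) * mon m))" by (simp add: pim_sum 1)
  also have "\<dots> = pim \<pi> q * g" by (simp flip: mpoly_expand sum_distrib_left)
  finally show ?thesis .
qed

lemma pim_H: "p \<in> H A d \<Longrightarrow> pim \<pi> p \<in> H A d"
  by (auto simp: H_def in_keys_iff lookup_pim)

lemma pim_emb: "pim \<pi> (emb p) = (p :: ('v, 'k) mpoly)"
proof -
  have "pim \<pi> 1 = (1 :: ('v, 'k) mpoly)"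
    by (rule poly_mapping_eqI) (simp add: lookup_pim lookup_one when_def pi_1)
  then show ?thesis using pim_mult[of 1 p] by (simp only: mult_1_left)
qed

lemma pim_IK: "p \<in> IK n k d \<Longrightarrow> pim \<pi> p \<in> IK n k d"
  unfolding IK_def
proof (induction rule: gen_induct)
  case (mult e q g)
  then obtain g' where "g = emb g'" "g' \<in> mprods n k" using mprods_emb by blast
  then show ?case using gen_mult[OF pim_H[OF mult(1)]] by (simp add: pim_mult)
qed (auto simp: pim_add intro: gen_0 gen_add)

lemma pim_BK: "p \<in> BK n k (\<lambda>j. emb (th j)) i d \<Longrightarrow> pim \<pi> p \<in> BK n k th i d"
proof (induction i arbitrary: p)
  case 0
  then show ?case by (simp add: pim_IK)
next
  case (Suc i)
  then obtain b u where p: "p = b + u * emb (th i)" "b \<in> BK n k (\<lambda>j. emb (th j)) i d" "u \<in> Hp (gv n) d"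
    by (auto simp: gplus_def mult.commute)
  have "pim \<pi> u \<in> Hp (gv n) d" using p(3) pim_H by (auto simp: Hp_def)
  moreover have "pim \<pi> p = pim \<pi> b + th i * pim \<pi> u" by (simp add: p(1) pim_add pim_mult mult.commute)
  ultimately show ?case using Suc.IH[OF p(2)] unfolding BK.simps gplus_def by blast
qed

end

subsection \<open>Matrices in general position\<close>

definition low_rank :: "nat \<Rightarrow> (nat \<Rightarrow> 'r::comm_ring_1) \<Rightarrow> bool" where
  "low_rank n E \<longleftrightarrow> (\<forall>i<n. \<forall>j<n. E i * E (n + j) = E j * E (n + i))"

text \<open>The linear section by \<open>card V + 1 - n\<close> linear forms over the algebraic closure contains no
  nonzero point at which the matrix has rank at most one. Here the entries of the matrix
  are numbered like the variables of the generic matrix.\<close>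

definition gpos :: "'v set \<Rightarrow> nat \<Rightarrow> (nat \<Rightarrow> ('v, 'k::field) mpoly) \<Rightarrow> bool" where
  "gpos V n ent \<longleftrightarrow> (\<exists>hs :: ('v \<Rightarrow> 'k alg_closure) set. finite hs \<and> card hs + n \<le> card V + 1 \<and>
     (\<forall>P. (\<forall>h\<in>hs. (\<Sum>u\<in>V. h u * P u) = 0) \<longrightarrow> low_rank n (\<lambda>r. ev to_ac P (ent r)) \<longrightarrow> (\<forall>u\<in>V. P u = 0)))"

text \<open>Choose a largest set \<open>Z\<close> of entries for which the linear section contains
  dual points \<open>e z\<close>. With fewer than n - 1 of them, counting equations gives a nonzero
  point of the section where the entries in \<open>Z\<close> vanish; some other entry is nonzero
  there, as the zero matrix has low rank, and would enlarge \<open>Z\<close>. The numbers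
  \<open>q r z\<close> are the values of the entries at the dual points.\<close>

lemma gpos_coordinates:
  fixes ent :: "nat \<Rightarrow> ('v, 'k::field) mpoly"
  assumes V: "finite V" and n: "0 < n" and ent: "\<And>r. r < 2 * n \<Longrightarrow> ent r \<in> H V 1"
    and gp: "gpos V n ent" and Bs: "Bs \<subseteq> gv n"
    and lam: "\<And>r. r < 2 * n \<Longrightarrow> ent r = (\<Sum>b\<in>Bs. Const (lam r b) * ent b)"
  obtains Z :: "nat set" and q :: "nat \<Rightarrow> nat \<Rightarrow> 'k alg_closure" where "Z \<subseteq> Bs" "card Z = n - 1"
    "\<And>r z. r \<in> Z \<Longrightarrow> z \<in> Z \<Longrightarrow> q r z = (if r = z then 1 else 0)"
    "\<And>r z. r < 2 * n \<Longrightarrow> z \<in> Z \<Longrightarrow> q r z = (\<Sum>b\<in>Bs. to_ac (lam r b) * q b z)"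
    "\<And>c. low_rank n (\<lambda>r. \<Sum>z\<in>Z. q r z * c z) \<Longrightarrow> \<forall>z\<in>Z. c z = 0"
proof -
  obtain hs :: "('v \<Rightarrow> 'k alg_closure) set" where hs: "finite hs" "card hs + n \<le> card V + 1"
    "\<And>P. (\<And>h. h \<in> hs \<Longrightarrow> (\<Sum>u\<in>V. h u * P u) = 0) \<Longrightarrow> low_rank n (\<lambda>r. ev to_ac P (ent r)) \<Longrightarrow> \<forall>u\<in>V. P u = 0"
    using gp unfolding gpos_def by auto
  define E where "E P r = ev to_ac P (ent r)" for P :: "'v \<Rightarrow> 'k alg_closure" and r
  define S where "S P \<longleftrightarrow> (\<forall>h\<in>hs. (\<Sum>u\<in>V. h u * P u) = 0)" for P :: "'v \<Rightarrow> 'k alg_closure"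
  have Eev: "E P r = (\<Sum>u\<in>V. to_ac (cf (ent r) (expo u)) * P u)" if "r < 2 * n" for P r
    unfolding E_def by (rule ev_H1[OF comm_ring_hom_to_ac ent[OF that] V])
  have Elin: "E (\<lambda>u. \<Sum>k\<in>K. c k * P k u) r = (\<Sum>k\<in>K. c k * E (P k) r)" if "r < 2 * n" for K c r and P :: "nat \<Rightarrow> _"
    unfolding Eev[OF that] sum_distrib_left by (subst sum.swap) (simp add: mult.left_commute)
  have Slin: "S (\<lambda>u. \<Sum>k\<in>K. c k * P k u)" if "\<And>k. k \<in> K \<Longrightarrow> S (P k)" for K c and P :: "nat \<Rightarrow> _" unfolding S_def
  proof
    fix h assume h: "h \<in> hs"
    have "(\<Sum>u\<in>V. h u * (\<Sum>k\<in>K. c k * P k u)) = (\<Sum>k\<in>K. c k * (\<Sum>u\<in>V. h u * P k u))"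
      unfolding sum_distrib_left by (subst sum.swap) (simp add: mult.left_commute)
    also have "\<dots> = 0" using that h by (intro sum.neutral) (auto simp: S_def)
    finally show "(\<Sum>u\<in>V. h u * (\<Sum>k\<in>K. c k * P k u)) = 0" .
  qed
  have Elam: "E P r = (\<Sum>b\<in>Bs. to_ac (lam r b) * E P b)" if "r < 2 * n" for P r
    unfolding E_def by (subst lam[OF that])
      (simp add: ev_sum[OF comm_ring_hom_to_ac] ev_mult[OF comm_ring_hom_to_ac] ev_Const[OF comm_ring_hom_to_ac])
  have finB: "finite Bs" using Bs finite_subset by blast
  define good where "good Z \<longleftrightarrow> Z \<subseteq> Bs \<and> (\<exists>e. (\<forall>z\<in>Z. S (e z)) \<and> (\<forall>z\<in>Z. \<forall>z'\<in>Z. E (e z) z' = (if z' = z then 1 else 0)))" for Z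
  have ex: "\<exists>Z. good Z \<and> (\<forall>Z'. good Z' \<longrightarrow> card Z' \<le> card Z)"
  proof (rule ex_has_greatest_nat[of good "{}" card "Suc (card Bs)"])
    show "good {}" by (simp add: good_def)
    show "\<forall>Z. good Z \<longrightarrow> card Z < Suc (card Bs)" using card_mono[OF finB] by (auto simp: good_def le_imp_less_Suc)
  qed
  then obtain Z where Z: "good Z" "\<And>Z'. good Z' \<Longrightarrow> card Z' \<le> card Z" by blast
  then obtain e where e: "Z \<subseteq> Bs" "\<And>z. z \<in> Z \<Longrightarrow> S (e z)" "\<And>z z'. z \<in> Z \<Longrightarrow> z' \<in> Z \<Longrightarrow> E (e z) z' = (if z' = z then 1 else 0)"
    unfolding good_def by blast
  have finZ: "finite Z" using e(1) finB finite_subset by blast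
  have "n - 1 \<le> card Z"
  proof (rule ccontr)
    assume "\<not> n - 1 \<le> card Z"
    define eqs where "eqs = hs <+> Z"
    define a where "a x u = (case x of Inl h \<Rightarrow> h u | Inr z \<Rightarrow> to_ac (cf (ent z) (expo u)))" for x u
    have "card eqs = card hs + card Z" unfolding eqs_def using hs(1) finZ by (simp add: card_Plus)
    then have "card eqs < card V" using hs(2) \<open>\<not> n - 1 \<le> card Z\<close> by simp
    then obtain P where P: "\<exists>u\<in>V. P u \<noteq> 0" "\<forall>x\<in>eqs. (\<Sum>u\<in>V. a x u * P u) = 0"
      using hom_system[OF V, of eqs a] hs(1) finZ by (auto simp: eqs_def)
    have SP: "S P" using P(2) by (force simp: S_def eqs_def a_def)
    have EZ: "E P z = 0" if "z \<in> Z" for z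
    proof -
      have "z < 2 * n" using that e(1) Bs by auto
      then show ?thesis using P(2) that Eev by (force simp: eqs_def a_def)
    qed
    have "\<exists>r\<in>Bs. E P r \<noteq> 0"
    proof (rule ccontr)
      assume "\<not> ?thesis"
      then have "E P r = 0" if "r < 2 * n" for r using Elam[OF that] by simp
      then have "low_rank n (\<lambda>r. ev to_ac P (ent r))" by (simp add: low_rank_def flip: E_def)
      then show False using hs(3)[of P] SP P(1) by (auto simp: S_def)
    qed
    then obtain r where r: "r \<in> Bs" "E P r \<noteq> 0" by blast
    have rZ: "r \<notin> Z" using EZ r by auto
    have r2: "z < 2 * n" if "z \<in> insert r Z" for z using that r e(1) Bs by auto
    \<comment> \<open>Normalisation and elimination of the new coordinate; the sums over
      \<open>{0}\<close> and \<open>{0, 1}\<close> put them into the shape of \<open>Elin\<close>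
      and \<open>Slin\<close>.\<close>
    define er where "er u = (\<Sum>k\<in>{0 :: nat}. inverse (E P r) * P u)" for u
    define e' where "e' z = (if z = r then er else (\<lambda>u. \<Sum>k\<in>{0, 1 :: nat}. (if k = 0 then 1 else - E (e z) r) * (if k = 0 then e z else er) u))" for z
    have Eer: "E er z = inverse (E P r) * E P z" if "z < 2 * n" for z
      using Elin[OF that, where K = "{0}" and c = "\<lambda>_. inverse (E P r)" and P = "\<lambda>_. P"] by (simp add: er_def[abs_def])
    have Ser: "S er" using Slin[where K = "{0}" and P = "\<lambda>_. P" and c = "\<lambda>_. inverse (E P r)"] SP by (simp add: er_def[abs_def])
    have Ee': "E (e' z) z' = E (e z) z' - E (e z) r * E er z'" if "z \<noteq> r" "z' < 2 * n" for z z'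
      using Elin[OF that(2), where K = "{0, 1}" and c = "\<lambda>k. if k = 0 then 1 else - E (e z) r"
        and P = "\<lambda>k. if k = 0 then e z else er"] that(1) by (simp add: e'_def)
    have Se': "S (e' z)" if "z \<in> insert r Z" for z
    proof (cases "z = r")
      case True
      then show ?thesis using Ser by (simp add: e'_def)
    next
      case False
      then have "S (e z)" using that e(2) by simp
      then have "S (\<lambda>u. \<Sum>k\<in>{0, 1 :: nat}. (if k = 0 then 1 else - E (e z) r) * (if k = 0 then e z else er) u)"
        using Ser by (intro Slin) auto
      then show ?thesis using False by (simp add: e'_def)
    qed
    have "good (insert r Z)" unfolding good_def
    proof (intro conjI exI[of _ e'] ballI)
      fix z z' assume zz: "z \<in> insert r Z" "z' \<in> insert r Z"
      show "E (e' z) z' = (if z' = z then 1 else 0)"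
      proof (cases "z = r")
        case True
        then have "e' z = er" by (simp add: e'_def)
        then show ?thesis using Eer[OF r2[OF zz(2)]] zz r EZ rZ True by auto
      next
        case False
        then have z: "z \<in> Z" using zz by simp
        show ?thesis using Ee'[OF False r2[OF zz(2)]] Eer[OF r2[OF zz(2)]] e(3)[OF z] EZ zz r rZ False by auto
      qed
    qed (use Se' r e(1) in auto)
    then show False using Z(2)[of "insert r Z"] rZ finZ by simp
  qed
  then obtain Z' where Z': "Z' \<subseteq> Z" "card Z' = n - 1" using obtain_subset_with_card_n by metis
  define q where "q r z = E (e z) r" for r z
  show ?thesis
  proof (rule that[of Z' q])
    show "Z' \<subseteq> Bs" using Z' e(1) by auto
    show "card Z' = n - 1" by fact
    show "q r z = (if r = z then 1 else 0)" if "r \<in> Z'" "z \<in> Z'" for r z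
      using e(3)[of z r] subsetD[OF Z'(1) that(1)] subsetD[OF Z'(1) that(2)] by (simp add: q_def)
    show "q r z = (\<Sum>b\<in>Bs. to_ac (lam r b) * q b z)" if "r < 2 * n" "z \<in> Z'" for r z
      unfolding q_def by (rule Elam[OF that(1)])
    fix c assume lr: "low_rank n (\<lambda>r. \<Sum>z\<in>Z'. q r z * c z)"
    define P where "P u = (\<Sum>z\<in>Z'. c z * e z u)" for u
    have EP: "E P r = (\<Sum>z\<in>Z'. q r z * c z)" if "r < 2 * n" for r
      using Elin[OF that, where K = Z' and c = c and P = e] by (simp add: P_def[abs_def] q_def mult.commute)
    have "low_rank n (\<lambda>r. E P r)" using lr by (auto simp: low_rank_def EP)
    moreover have "S P" unfolding P_def using e(2) Z'(1) by (intro Slin) auto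
    ultimately have "\<forall>u\<in>V. P u = 0" using hs(3)[of P] by (auto simp: S_def E_def)
    then have E0: "E P r = 0" if "r < 2 * n" for r using Eev[OF that] by simp
    show "\<forall>z\<in>Z'. c z = 0"
    proof
      fix z assume z: "z \<in> Z'"
      have "z < 2 * n" using z Z'(1) e(1) Bs by auto
      have "0 = (\<Sum>z'\<in>Z'. q z z' * c z')" using E0 EP \<open>z < 2 * n\<close> by simp
      also have "\<dots> = (\<Sum>z'\<in>Z'. if z' = z then c z else 0)"
        using e(3)[of _ z] subsetD[OF Z'(1)] z by (intro sum.cong refl) (simp add: q_def)
      also have "\<dots> = c z" using z finite_subset[OF Z'(1) finZ] by simp
      finally show "c z = 0" by simp
    qed
  qed
qed

text \<open>The given relations number \<open>2 * n - card Bs\<close>. Relations expressing the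
  entries in \<open>Bs - Z\<close> by those in \<open>Z\<close> complete them to n + 1 forms, whose
  common zeros of rank at most one come from the section and hence vanish.
  \<open>quad_of_points\<close> and \<open>th_regular\<close> apply over the closure, and the
  retraction returns to K.\<close>

theorem regular_of_gpos:
  fixes ent :: "nat \<Rightarrow> ('v, 'k::field) mpoly"
  assumes V: "finite V" and n: "0 < n" and ent: "\<And>r. r < 2 * n \<Longrightarrow> ent r \<in> H V 1"
    and gp: "gpos V n ent" and Bs: "Bs \<subseteq> gv n"
    and lam: "\<And>r. r < 2 * n \<Longrightarrow> ent r = (\<Sum>b\<in>Bs. Const (lam r b) * ent b)"
    and rl: "distinct rl" "set rl = gv n - Bs"
    and th: "\<And>i. i < length rl \<Longrightarrow> th i = Var (rl ! i) - (\<Sum>b\<in>Bs. Const (lam (rl ! i) b) * Var b)"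
    and i: "i < length rl" and f: "f \<in> H (gv n) d" "th i * f \<in> BK n 1 th i (Suc d)"
  shows "f \<in> BK n 1 th i d"
proof -
  obtain Z and q :: "nat \<Rightarrow> nat \<Rightarrow> 'k alg_closure" where Z: "Z \<subseteq> Bs" "card Z = n - 1"
    and q1: "\<And>r z. r \<in> Z \<Longrightarrow> z \<in> Z \<Longrightarrow> q r z = (if r = z then 1 else 0)"
    and q2: "\<And>r z. r < 2 * n \<Longrightarrow> z \<in> Z \<Longrightarrow> q r z = (\<Sum>b\<in>Bs. to_ac (lam r b) * q b z)"
    and q3: "\<And>c. low_rank n (\<lambda>r. \<Sum>z\<in>Z. q r z * c z) \<Longrightarrow> \<forall>z\<in>Z. c z = 0"
    by (rule gpos_coordinates[OF V n ent gp Bs lam], assumption, assumption) (rule that; assumption)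
  have finB: "finite Bs" by (rule finite_subset[OF Bs]) simp
  have fin: "finite Bs" "finite Z" using finB finite_subset[OF Z(1)] by auto
  have Zn: "Z \<subseteq> gv n" using Z Bs by auto
  define ls where "ls = rl @ sorted_list_of_set (Bs - Z)"
  have ls: "distinct ls" "set ls = gv n - Z" using rl fin Z Bs by (auto simp: ls_def)
  have "length ls = card (gv n - Z)" using distinct_card[OF ls(1)] ls(2) by simp
  also have "\<dots> = 2 * n - (n - 1)" using fin Zn Z(2) by (subst card_Diff_subset) auto
  also have "\<dots> = Suc n" using n by simp
  finally have len: "length ls = Suc n" .
  define thL :: "nat \<Rightarrow> (nat, 'k alg_closure) mpoly" where
    "thL j = (if j < length rl then emb (th j) else Var (ls ! j) - (\<Sum>z\<in>Z. Const (q (ls ! j) z) * Var z))" for j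
  define zl where "zl = sorted_list_of_set Z"
  have zl: "set zl = Z" "length zl = n - 1" using fin Z(2) by (simp_all add: zl_def)
  define zf :: "nat \<Rightarrow> (nat, 'k alg_closure) mpoly" where "zf l = Var (zl ! (l - 1))" for l
  have thL1: "thL j = Var (ls ! j) - (\<Sum>b\<in>Bs. Const (to_ac (lam (ls ! j) b)) * Var b)" if "j < length rl" for j
    using that th[OF that] by (simp add: thL_def ls_def nth_append emb.hom_minus emb.hom_sum emb.hom_mult)
  have lsB: "ls ! j \<in> Bs - Z" if "\<not> j < length rl" "j \<le> n" for j
  proof -
    have "ls ! j = sorted_list_of_set (Bs - Z) ! (j - length rl)" using that by (simp add: ls_def nth_append)
    moreover have "j - length rl < length (sorted_list_of_set (Bs - Z))" using that len by (simp add: ls_def)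
    ultimately have "ls ! j \<in> set (sorted_list_of_set (Bs - Z))" by simp
    then show ?thesis using fin by simp
  qed
  have ls_less: "ls ! j < 2 * n" if "j \<le> n" for j using nth_mem[of j ls] that len ls(2) by auto
  have thLH: "thL j \<in> H (gv n) 1" if "j \<le> n" for j
  proof (cases "j < length rl")
    case True
    then show ?thesis unfolding thL1[OF True] using ls_less[OF that] Bs by (auto intro!: H_diff H_Var H_sum H_Const_mult)
  next
    case False
    then show ?thesis unfolding thL_def using ls_less[OF that] Zn by (auto intro!: H_diff H_Var H_sum H_Const_mult)
  qed
  let ?W = "mp.span (thL ` {..n} \<union> zf ` {1..<n})"
  have WZ: "Var z \<in> ?W" if "z \<in> Z" for z
  proof -
    have "z \<in> set zl" using that zl(1) by simp
    then obtain l where l: "l < n - 1" "zl ! l = z" unfolding in_set_conv_nth zl(2) by blast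
    then have "Var z = zf (Suc l)" "Suc l \<in> {1..<n}" by (auto simp: zf_def One_nat_def)
    then have "Var z \<in> zf ` {1..<n}" by (rule image_eqI)
    then show ?thesis by (rule mp.span_base[OF UnI2])
  qed
  have W_th: "thL j \<in> ?W" if "j \<le> n" for j using that by (intro mp.span_base) auto
  have W_add: "Var (ls ! j) \<in> ?W" if "j \<le> n" "thL j = Var (ls ! j) - s" "s \<in> ?W" for j s
    using mp.span_add[OF W_th[OF that(1)] that(3)] that(2) by simp
  have WB: "Var b \<in> ?W" if b: "b \<in> Bs" for b
  proof (cases "b \<in> Z")
    case False
    have "b \<in> gv n" using b Bs by blast
    then obtain j where j: "j \<le> n" "ls ! j = b" using False ls(2) len by (metis Diff_iff in_set_conv_nth less_Suc_eq_le)
    have "\<not> j < length rl" using j b rl(2) nth_mem[of j rl] by (auto simp: ls_def nth_append split: if_splits)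
    then have "thL j = Var (ls ! j) - (\<Sum>z\<in>Z. Const (q (ls ! j) z) * Var z)" by (simp add: thL_def)
    then show ?thesis using W_add[OF j(1)] WZ j(2) by (auto intro!: mp.span_sum mp.span_scale)
  qed (rule WZ)
  have span1: "Var v \<in> ?W" if v: "v < 2 * n" for v
  proof (cases "v \<in> Bs")
    case False
    then have "v \<in> set ls" using v Z ls(2) by auto
    then obtain j where j: "j \<le> n" "ls ! j = v" using len by (metis in_set_conv_nth less_Suc_eq_le)
    have "j < length rl" using lsB[OF _ j(1)] j False by auto
    then show ?thesis using W_add[OF j(1) thL1] WB j(2) by (auto intro!: mp.span_sum mp.span_scale)
  qed (rule WB)
  have pts: "\<forall>v<2 * n. P v = 0"
    if P: "\<And>j. j \<le> n \<Longrightarrow> evp P (thL j) = 0" "\<And>i j. i < n \<Longrightarrow> j < n \<Longrightarrow> P i * P (n + j) = P j * P (n + i)" for P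
  proof -
    have PB: "P b = (\<Sum>z\<in>Z. q b z * P z)" if b: "b \<in> Bs" for b
    proof (cases "b \<in> Z")
      case True
      have "(\<Sum>z\<in>Z. q b z * P z) = (\<Sum>z\<in>Z. if z = b then P b else 0)" using True q1 by (intro sum.cong) auto
      then show ?thesis using True fin by simp
    next
      case False
      have "b \<in> gv n" using b Bs by blast
      then obtain j where j: "j \<le> n" "ls ! j = b" using False ls(2) len by (metis Diff_iff in_set_conv_nth less_Suc_eq_le)
      have "\<not> j < length rl" using j b rl(2) nth_mem[of j rl] by (auto simp: ls_def nth_append split: if_splits)
      then have "thL j = Var b + Const (- 1) * (\<Sum>z\<in>Z. Const (q b z) * Var z)" using j by (simp add: thL_def Const_uminus)
      then have "evp P (Var b + Const (- 1) * (\<Sum>z\<in>Z. Const (q b z) * Var z)) = 0" using P(1)[OF j(1)] by (simp only:)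
      then show ?thesis by (simp only: evp_hom) simp
    qed
    have Pv: "P v = (\<Sum>z\<in>Z. q v z * P z)" if v: "v < 2 * n" for v
    proof (cases "v \<in> Bs")
      case False
      then have "v \<in> set ls" using v Z ls(2) by auto
      then obtain j where j: "j \<le> n" "ls ! j = v" using len by (metis in_set_conv_nth less_Suc_eq_le)
      have "j < length rl" using lsB[OF _ j(1)] j False by auto
      then have "thL j = Var v + Const (- 1) * (\<Sum>b\<in>Bs. Const (to_ac (lam v b)) * Var b)"
        using thL1 j by (simp add: Const_uminus)
      then have "evp P (Var v + Const (- 1) * (\<Sum>b\<in>Bs. Const (to_ac (lam v b)) * Var b)) = 0"
        using P(1)[OF j(1)] by (simp only:)
      then have "P v = (\<Sum>b\<in>Bs. to_ac (lam v b) * P b)" by (simp only: evp_hom) simp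
      also have "\<dots> = (\<Sum>b\<in>Bs. \<Sum>z\<in>Z. to_ac (lam v b) * q b z * P z)"
        by (intro sum.cong refl) (simp add: PB sum_distrib_left mult.assoc)
      also have "\<dots> = (\<Sum>z\<in>Z. q v z * P z)" by (subst sum.swap) (simp add: q2[OF v] sum_distrib_right)
      finally show ?thesis .
    qed (rule PB)
    have "low_rank n (\<lambda>r. \<Sum>z\<in>Z. q r z * P z)" using P(2) by (simp add: low_rank_def flip: Pv)
    then have "\<forall>z\<in>Z. P z = 0" by (rule q3)
    then show ?thesis using Pv by simp
  qed
  have sop: "linear_sop n thL zf"
  proof
    show "0 < n" by fact
    show zfH: "zf l \<in> H (gv n) 1" if "l \<in> {1..<n}" for l
      unfolding zf_def using nth_mem[of "l - 1" zl] zl that Zn by (intro H_Var) auto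
    show "zf l * zf l' \<in> BK n 1 thL (Suc n) 2" if "l \<in> {1..<n}" "l' \<in> {1..<n}" for l l'
      by (rule quad_of_points[OF thLH pts zfH[OF that(1)] zfH[OF that(2)]])
  qed (use thLH span1 in auto)
  have BKeq: "BK n 1 thL i = BK n 1 (\<lambda>j. emb (th j)) i" using i by (intro BK_cong) (auto simp: thL_def)
  have "emb (th i * f) \<in> BK n 1 thL i (Suc d)" unfolding BKeq by (rule emb_BK[OF f(2)])
  then have "thL i * emb f \<in> BK n 1 thL i (Suc d)" using i by (simp add: thL_def emb.hom_mult)
  moreover have "i \<le> n" using i len by (simp add: ls_def)
  ultimately have "emb f \<in> BK n 1 thL i d"
    using linear_sop.th_regular[OF sop \<open>i \<le> n\<close> emb_H[OF f(1)]] by blast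
  then have fL: "emb f \<in> BK n 1 (\<lambda>j. emb (th j)) i d" by (simp add: BKeq)
  obtain \<pi> :: "'k alg_closure \<Rightarrow> 'k" where "\<And>x y. \<pi> (x + y) = \<pi> x + \<pi> y" "\<And>c x. \<pi> (to_ac c * x) = c * \<pi> x" "\<pi> 1 = 1"
    using exists_retraction[where 'k = 'k] by (elim exE conjE) (rule that; iprover)
  note pim = this
  from pim_BK[OF pim fL] show ?thesis by (simp only: pim_emb[OF pim])
qed

subsection \<open>Change of variables in Koszul complexes\<close>

lemma Hp_0_mem [simp]: "0 \<in> Hp V d"
  by (simp add: Hp_def)

lemma Hp_sum: "(\<And>i. i \<in> I \<Longrightarrow> f i \<in> Hp V d) \<Longrightarrow> sum f I \<in> Hp V d"
  by (induction I rule: infinite_finite_induct) (auto intro: Hp_add)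

lemma Hp_Const_mult: "p \<in> Hp V d \<Longrightarrow> Const c * p \<in> Hp V d"
  by (auto simp: Hp_def intro: H_Const_mult)

lemma Hp_sg: "p \<in> Hp V d \<Longrightarrow> sg v T * p \<in> Hp V d"
  by (auto simp: Hp_def intro: H_sg)

lemma Hp_uminus: "p \<in> Hp V d \<Longrightarrow> - p \<in> Hp V d"
  by (auto simp: Hp_def intro: H_uminus)

lemma Hp_wedge:
  assumes "\<And>F. F \<subseteq> A \<Longrightarrow> u F \<in> Hp V d" "T \<subseteq> A"
  shows "wedge v u T \<in> Hp V d"
proof -
  have "T - {v} \<subseteq> A" using assms(2) by auto
  then show ?thesis using assms(1) by (auto simp: wedge_def intro!: Hp_sg)
qed

lemma bd_insert_outer:
  assumes "finite A" "r \<notin> A" "T \<subseteq> A"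
  shows "bd a (insert r A) w T = bd a A w T + sg r T * a r * w (insert r T)"
proof -
  have "insert r A - T = insert r (A - T)" using assms by auto
  then show ?thesis using assms by (simp add: bd_def add.commute)
qed

lemma bd_insert_inner:
  assumes "finite A" "r \<notin> A" "T \<subseteq> A"
  shows "sg r T * bd a (insert r A) w (insert r T) = - bd a A (\<lambda>F. sg r F * w (insert r F)) T"
proof -
  have "insert r A - insert r T = A - T" using assms by auto
  then have "sg r T * bd a (insert r A) w (insert r T) =
      (\<Sum>v\<in>A - T. sg r T * (sg v (insert r T) * a v * w (insert v (insert r T))))"
    by (simp add: bd_def sum_distrib_left)
  also have "\<dots> = (\<Sum>v\<in>A - T. - (sg v T * a v * (sg r (insert v T) * w (insert r (insert v T)))))"
  proof (rule sum.cong)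
    fix v assume v: "v \<in> A - T"
    have fin: "finite T" using assms finite_subset by auto
    have "sg r T * sg v (insert r T) = - (sg v T * sg r (insert v T) :: 'b)"
      using fin v assms by (intro sg_swap) auto
    then have "sg r T * (sg v (insert r T) * a v * w (insert v (insert r T))) =
        - (sg v T * sg r (insert v T)) * (a v * w (insert v (insert r T)))"
      by (simp only: mult.assoc flip: mult.assoc[of "sg r T"])
    then show "sg r T * (sg v (insert r T) * a v * w (insert v (insert r T))) =
        - (sg v T * a v * (sg r (insert v T) * w (insert r (insert v T))))"
      by (simp add: insert_commute mult_ac)
  qed simp
  finally show ?thesis by (simp add: bd_def sum_negf)
qed

text \<open>Extend the chain by zero to sets containing \<open>r\<close>. The part \<open>w1\<close>
  of the bounding chain at \<open>r\<close> is a cycle modulo \<open>B\<close>, and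
  \<open>a r * w1\<close> is a boundary modulo \<open>B\<close>, since \<open>a r\<close> is a
  combination of the other elements and each of these annihilates homology.\<close>

lemma Reg_drop:
  fixes a :: "'v::linorder \<Rightarrow> ('w, 'k::field) mpoly"
  assumes fin: "finite A" and r: "r \<notin> A" and B: "gid V B"
    and ar: "a r = (\<Sum>v\<in>A. Const (c v) * a v)" and R: "Reg a (insert r A) V m B"
  shows "Reg a A V m B"
proof (rule RegI)
  fix d z assume d: "m \<le> d" and z: "\<And>F. F \<subseteq> A \<Longrightarrow> z F \<in> H V d"
    and bz: "\<And>T. T \<subseteq> A \<Longrightarrow> bd a A z T \<in> B (Suc d)"
  define z' where "z' F = (if r \<in> F then 0 else z F)" for F
  have zz: "z' F = z F" if "F \<subseteq> A" for F using that r by (auto simp: z'_def)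
  have z'H: "z' F \<in> H V d" if "F \<subseteq> insert r A" for F using that z[of F] by (auto simp: z'_def)
  have bz': "bd a (insert r A) z' T \<in> B (Suc d)" if T: "T \<subseteq> insert r A" for T
  proof (cases "r \<in> T")
    case True
    then have "bd a (insert r A) z' T = 0" by (auto simp: bd_def z'_def)
    then show ?thesis using gid_0[OF B] by simp
  next
    case False
    then have "T \<subseteq> A" using T by auto
    then have "bd a (insert r A) z' T = bd a A z' T"
      using bd_insert_outer[OF fin r, of T a z'] by (simp add: z'_def)
    also have "\<dots> = bd a A z T" using \<open>T \<subseteq> A\<close> by (intro bd_cong) (auto simp: zz)
    finally show ?thesis using bz[OF \<open>T \<subseteq> A\<close>] by simp
  qed
  obtain w where w: "\<And>F. F \<subseteq> insert r A \<Longrightarrow> w F \<in> Hp V d"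
    "\<And>F. F \<subseteq> insert r A \<Longrightarrow> z' F - bd a (insert r A) w F \<in> B d" using RegD[OF R d, of z'] z'H bz' by blast
  define w1 where "w1 F = sg r F * w (insert r F)" for F
  define w' where "w' F = w F + (\<Sum>v\<in>A. Const (c v) * wedge v w1 F)" for F
  have w1: "w1 F \<in> Hp V d" if "F \<subseteq> A" for F unfolding w1_def using that by (intro Hp_sg w(1)) auto
  define D where "D F = z' F - bd a (insert r A) w F" for F
  define D1 where "D1 F = sg r F * D (insert r F)" for F
  have DB: "D F \<in> B d" if "F \<subseteq> insert r A" for F unfolding D_def using w(2) that by blast
  have D1B: "D1 F \<in> B d" if "F \<subseteq> A" for F unfolding D1_def using that by (intro gid_sg[OF B] DB) auto
  have D1_eq: "D1 F = bd a A w1 F" if "F \<subseteq> A" for F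
    using bd_insert_inner[OF fin r that, of a w] by (simp add: D1_def D_def z'_def w1_def[abs_def] right_diff_distrib)
  show "\<exists>w. (\<forall>F\<subseteq>A. w F \<in> Hp V d) \<and> (\<forall>F\<subseteq>A. z F - bd a A w F \<in> B d)"
  proof (intro exI[of _ w'] conjI allI impI)
    fix F assume F: "F \<subseteq> A"
    show "w' F \<in> Hp V d"
      unfolding w'_def using w1 F by (intro Hp_add Hp_sum Hp_Const_mult Hp_wedge[of A] w(1)) auto
    have "bd a A w' F = bd a A w F + (\<Sum>v\<in>A. Const (c v) * bd a A (wedge v w1) F)"
      by (simp add: w'_def[abs_def] bd_add bd_sum bd_mult)
    also have "(\<Sum>v\<in>A. Const (c v) * bd a A (wedge v w1) F) =
        (\<Sum>v\<in>A. Const (c v) * a v * w1 F - Const (c v) * wedge v D1 F)"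
    proof (rule sum.cong)
      fix v assume v: "v \<in> A"
      have "wedge v (bd a A w1) F = wedge v D1 F"
        using D1_eq[of "F - {v}"] subset_trans[OF Diff_subset F] by (simp add: wedge_def)
      then have "bd a A (wedge v w1) F = a v * w1 F - wedge v D1 F" using bd_wedge[OF fin F v, of a w1] by simp
      then show "Const (c v) * bd a A (wedge v w1) F = Const (c v) * a v * w1 F - Const (c v) * wedge v D1 F"
        by (simp only: right_diff_distrib mult.assoc)
    qed simp
    also have "\<dots> = a r * w1 F - (\<Sum>v\<in>A. Const (c v) * wedge v D1 F)"
      by (simp add: sum_subtractf ar sum_distrib_right)
    also have "bd a A w F + \<dots> = bd a (insert r A) w F - (\<Sum>v\<in>A. Const (c v) * wedge v D1 F)"
      using bd_insert_outer[OF fin r F, of a w] by (simp add: w1_def algebra_simps)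
    finally have "z F - bd a A w' F = D F + (\<Sum>v\<in>A. Const (c v) * wedge v D1 F)"
      using zz[OF F] by (simp add: D_def)
    also have "\<dots> \<in> B d"
      using F D1B by (intro gid_add[OF B] gid_sum[OF B] gid_Const[OF B] DB gid_wedge[OF B, of A]) auto
    finally show "z F - bd a A w' F \<in> B d" .
  qed
qed

lemma Reg_drops:
  fixes a :: "'v::linorder \<Rightarrow> ('w, 'k::field) mpoly"
  assumes "finite R" "finite A" "A \<inter> R = {}" "gid V B"
    and ar: "\<And>r. r \<in> R \<Longrightarrow> a r = (\<Sum>v\<in>A. Const (c r v) * a v)" and "Reg a (A \<union> R) V m B"
  shows "Reg a A V m B" using assms(1,3,5,6)
proof (induction R rule: finite_induct)
  case (insert r R)
  have "a r = (\<Sum>v\<in>A. Const (c r v) * a v)" using insert.prems by simp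
  also have "\<dots> = (\<Sum>v\<in>A \<union> R. Const (if v \<in> A then c r v else 0) * a v)"
    using assms(2) insert.hyps by (intro sum.mono_neutral_cong_left) auto
  finally have "Reg a (A \<union> R) V m B" using insert assms(2,4) by (intro Reg_drop[of "A \<union> R" r]) auto
  then show ?case using insert by auto
qed simp

lemma subst_bd: "subst s (bd a A z T) = bd (\<lambda>v. subst s (a v)) A (\<lambda>F. subst s (z F)) T"
proof -
  have "subst s (sg v T) = sg v T" for v by (simp add: sg_def subst.hom_power subst.hom_uminus)
  then show ?thesis by (simp add: bd_def subst.hom_sum subst.hom_mult)
qed

lemma subst_Hp:
  assumes "p \<in> Hp A d" "\<And>v. v \<in> A \<Longrightarrow> s v \<in> H B 1"
  shows "subst s p \<in> Hp B d" using assms by (auto simp: Hp_def intro: subst_H)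

lemma subst_fixes:
  assumes "p \<in> H V d" "\<And>v. v \<in> V \<Longrightarrow> s v = Var v"
  shows "subst s p = p" using assms(1)
proof (induction rule: H_induct)
  case (mon c m)
  then have "evm s m = evm Var m" using assms(2) by (intro evm_cong) auto
  then show ?case by (simp add: subst.hom_mult subst_mon evm_Var)
qed (auto simp: subst.hom_add)

text \<open>Over the larger ring \<open>a v\<close> and \<open>subst s (a v)\<close> agree modulo
  \<open>B\<close>, so cycles over the section are cycles modulo \<open>B\<close>; a bounding chain
  found there is brought back by the substitution.\<close>

lemma Reg_section:
  fixes a :: "'v::linorder \<Rightarrow> ('w, 'k::field) mpoly"
  assumes R: "Reg a A V m B" and B: "gid V B" and a: "\<And>v. v \<in> A \<Longrightarrow> a v \<in> H V 1"
    and V': "V' \<subseteq> V" "\<And>v. v \<in> V' \<Longrightarrow> s v = Var v" "\<And>v. v \<in> V \<Longrightarrow> s v \<in> H V' 1"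
    and JB: "\<And>d. J d \<subseteq> B d" and BJ: "\<And>d p. p \<in> B d \<Longrightarrow> subst s p \<in> J d"
    and as: "\<And>v. v \<in> A \<Longrightarrow> a v - subst s (a v) \<in> B 1"
  shows "Reg (\<lambda>v. subst s (a v)) A V' m J"
proof (rule RegI)
  fix d z assume d: "m \<le> d" and z: "\<And>F. F \<subseteq> A \<Longrightarrow> z F \<in> H V' d"
    and bz: "\<And>T. T \<subseteq> A \<Longrightarrow> bd (\<lambda>v. subst s (a v)) A z T \<in> J (Suc d)"
  have zV: "z F \<in> H V d" if "F \<subseteq> A" for F using z[OF that] H_mono[OF V'(1)] by blast
  have bdz: "bd a A z T \<in> B (Suc d)" if T: "T \<subseteq> A" for T
  proof -
    have "bd a A z T - bd (\<lambda>v. subst s (a v)) A z T =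
        (\<Sum>v\<in>A - T. sg v T * (z (insert v T) * (a v - subst s (a v))))"
      by (simp add: bd_def algebra_simps flip: sum_subtractf)
    also have "\<dots> \<in> B (Suc d)"
    proof (intro gid_sum[OF B] gid_sg[OF B])
      fix v assume v: "v \<in> A - T"
      then have "insert v T \<subseteq> A" using T by auto
      from gid_mult[OF B zV[OF this] as[of v]] v show "z (insert v T) * (a v - subst s (a v)) \<in> B (Suc d)"
        by (simp add: One_nat_def)
    qed
    finally show ?thesis using bz[OF T] JB gid_add[OF B] by (metis (no_types) diff_add_cancel subsetD)
  qed
  obtain w where w: "\<And>F. F \<subseteq> A \<Longrightarrow> w F \<in> Hp V d" "\<And>F. F \<subseteq> A \<Longrightarrow> z F - bd a A w F \<in> B d"
    by (rule RegD[OF R d zV bdz], assumption, assumption) (rule that; assumption)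
  show "\<exists>w. (\<forall>F\<subseteq>A. w F \<in> Hp V' d) \<and> (\<forall>F\<subseteq>A. z F - bd (\<lambda>v. subst s (a v)) A w F \<in> J d)"
  proof (intro exI[of _ "\<lambda>F. subst s (w F)"] conjI allI impI)
    fix F assume F: "F \<subseteq> A"
    show "subst s (w F) \<in> Hp V' d" using w(1)[OF F] V'(3) by (rule subst_Hp)
    have "subst s (z F - bd a A w F) \<in> J d" by (rule BJ[OF w(2)[OF F]])
    then show "z F - bd (\<lambda>v. subst s (a v)) A (\<lambda>F. subst s (w F)) F \<in> J d"
      using subst_fixes[OF z[OF F], of s] V'(2) by (simp add: subst.hom_minus subst_bd)
  qed
qed

lemma Reg_iso:
  fixes a :: "'v::linorder \<Rightarrow> ('w, 'k::field) mpoly" and s :: "'w \<Rightarrow> ('u, 'k) mpoly"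
  assumes R: "Reg a A V m B"
    and s: "\<And>v. v \<in> V \<Longrightarrow> s v \<in> H W 1" and t: "\<And>v. v \<in> W \<Longrightarrow> t v \<in> H V 1"
    and st: "\<And>d p. p \<in> H W d \<Longrightarrow> subst s (subst t p) = p"
    and ts: "\<And>v. v \<in> A \<Longrightarrow> subst t (subst s (a v)) = a v"
    and CB: "\<And>d p. p \<in> C d \<Longrightarrow> subst t p \<in> B d" and BC: "\<And>d p. p \<in> B d \<Longrightarrow> subst s p \<in> C d"
  shows "Reg (\<lambda>v. subst s (a v)) A W m C"
proof (rule RegI)
  fix d z assume d: "m \<le> d" and z: "\<And>F. F \<subseteq> A \<Longrightarrow> z F \<in> H W d"
    and bz: "\<And>T. T \<subseteq> A \<Longrightarrow> bd (\<lambda>v. subst s (a v)) A z T \<in> C (Suc d)"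
  have tz: "subst t (z F) \<in> H V d" if "F \<subseteq> A" for F using z[OF that] t by (rule subst_H)
  have bdz: "bd a A (\<lambda>F. subst t (z F)) T \<in> B (Suc d)" if T: "T \<subseteq> A" for T
  proof -
    have "subst t (bd (\<lambda>v. subst s (a v)) A z T) \<in> B (Suc d)" by (rule CB[OF bz[OF T]])
    moreover have "subst t (bd (\<lambda>v. subst s (a v)) A z T) = bd a A (\<lambda>F. subst t (z F)) T"
      unfolding subst_bd by (simp add: bd_def ts)
    ultimately show ?thesis by simp
  qed
  obtain w where w: "\<And>F. F \<subseteq> A \<Longrightarrow> w F \<in> Hp V d" "\<And>F. F \<subseteq> A \<Longrightarrow> subst t (z F) - bd a A w F \<in> B d"
    by (rule RegD[OF R d tz bdz], assumption, assumption) (rule that; assumption)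
  show "\<exists>w. (\<forall>F\<subseteq>A. w F \<in> Hp W d) \<and> (\<forall>F\<subseteq>A. z F - bd (\<lambda>v. subst s (a v)) A w F \<in> C d)"
  proof (intro exI[of _ "\<lambda>F. subst s (w F)"] conjI allI impI)
    fix F assume F: "F \<subseteq> A"
    show "subst s (w F) \<in> Hp W d" using w(1)[OF F] s by (rule subst_Hp)
    have "subst s (subst t (z F) - bd a A w F) \<in> C d" by (rule BC[OF w(2)[OF F]])
    then show "z F - bd (\<lambda>v. subst s (a v)) A (\<lambda>F. subst s (w F)) F \<in> C d"
      by (simp add: subst.hom_minus subst_bd st[OF z[OF F]])
  qed
qed

subsection \<open>Adjoining a variable\<close>

definition vdiv :: "'v \<Rightarrow> ('v, 'k::field) mpoly \<Rightarrow> ('v, 'k) mpoly" where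
  "vdiv v p = (\<Sum>m\<in>supp p. if v \<in> supp m then Const (cf p m) * mon (m - expo v) else 0)"

lemma lookup_vdiv: "cf (vdiv v p) l = cf p (expo v + l)"
proof -
  have iff: "v \<in> supp m \<and> m - expo v = l \<longleftrightarrow> m = expo v + l" for m
  proof
    assume h: "v \<in> supp m \<and> m - expo v = l"
    then show "m = expo v + l"
      by (intro poly_mapping_eqI) (auto simp: lookup_add lookup_minus lookup_expo in_keys_iff)
  qed (auto simp: supp_add_nat intro!: poly_mapping_eqI simp: lookup_minus lookup_add)
  have "cf (vdiv v p) l = (\<Sum>m\<in>supp p. if m = expo v + l then cf p m else 0)" unfolding vdiv_def lookup_sum
  proof (rule sum.cong)
    fix m
    show "cf (if v \<in> supp m then Const (cf p m) * mon (m - expo v) else 0) l = (if m = expo v + l then cf p m else 0)"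
      using iff[of m] by (cases "v \<in> supp m") (simp_all add: lookup_mon)
  qed simp
  also have "\<dots> = cf p (expo v + l)" by (simp add: sum.delta' in_keys_iff)
  finally show ?thesis .
qed

lemma vdiv_Var_mult: "vdiv v (Var v * p) = p"
  by (rule poly_mapping_eqI) (simp add: lookup_vdiv Var_mon mon_def lookup_mult_single)

lemma vdiv_add: "vdiv v (p + q) = vdiv v p + vdiv v q"
  by (rule poly_mapping_eqI) (simp add: lookup_vdiv lookup_add)

lemma vdiv_0 [simp]: "vdiv v 0 = 0"
  by (simp add: vdiv_def)

lemma vdiv_eq_0:
  assumes "p \<in> H A d" "v \<notin> A"
  shows "vdiv v p = 0"
proof (rule poly_mapping_eqI)
  fix l
  have "expo v + l \<notin> supp p" using assms by (auto simp: H_def supp_add_nat)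
  then show "cf (vdiv v p) l = cf 0 l" by (simp add: lookup_vdiv in_keys_iff)
qed

text \<open>Division by \<open>Var v\<close> passes through generators free of \<open>v\<close>, so
  \<open>Var v\<close> is a nonzerodivisor modulo the extended ideal.\<close>

lemma vdiv_gen:
  assumes G: "G \<subseteq> H A D" and v: "v \<notin> A" and p: "p \<in> gen (insert v A) G D d"
  shows "vdiv v p \<in> gen (insert v A) G D (d - 1)" using p
proof (induction rule: gen_induct)
  case (mult e q g)
  from mult(1) show ?case
  proof (induction rule: H_induct)
    case (mon c m)
    show ?case
    proof (cases "v \<in> supp m")
      case True
      define m' where "m' = m - expo v"
      have m: "m = expo v + m'" unfolding m'_def by (rule expo_split[OF True])
      have e: "e = Suc (monom_deg m')" using mon(2) by (simp add: m One_nat_def)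
      have "Const c * mon m * g = Var v * (Const c * mon m' * g)" by (simp add: m mon_mult Var_mon mult_ac)
      then have "vdiv v (Const c * mon m * g) = Const c * mon m' * g" by (simp add: vdiv_Var_mult)
      also have "\<dots> \<in> gen (insert v A) G D (monom_deg m' + D)"
        using mon(1) by (intro gen_mult H_Const_mult H_mon mult(2)) (auto simp: m supp_add_nat)
      finally show ?thesis by (simp add: e)
    next
      case False
      then have "supp m \<subseteq> A" using mon(1) by auto
      then have "Const c * mon m * g \<in> H A (monom_deg m + D)"
        using G mult(2) by (intro H_mult H_Const_mult H_mon) auto
      then show ?thesis using vdiv_eq_0 v gen_0 by metis
    qed
  qed (auto simp: distrib_right vdiv_add intro: gen_0 gen_add)
qed (auto simp: vdiv_add intro: gen_0 gen_add)

text \<open>Modulo \<open>Var v\<close> the old ring returns and the new element of the sequence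
  acts as zero, so a chain splits into two chains over \<open>A\<close>, by sets without and with
  \<open>v\<close>. \<open>Reg_regular\<close> then removes the extra relation.\<close>

lemma Reg_insert_var:
  fixes G :: "('v::linorder, 'k::field) mpoly set"
  assumes fin: "finite A" and v: "v \<notin> A" and G: "G \<subseteq> H A D" and R: "Reg Var A A (Suc m) (gen A G D)"
  shows "Reg Var (insert v A) (insert v A) (Suc m) (gen (insert v A) G D)"
proof -
  let ?A = "insert v A"
  have G': "G \<subseteq> H ?A D" using G H_mono[of A ?A D] by blast
  have gA: "gid A (gen A G D)" and gA': "gid ?A (gen ?A G D)" using G G' by (simp_all add: gid_gen)
  let ?P = "gplus ?A (gen ?A G D) (Var v)"
  have gP: "gid ?A ?P" by (intro gid_gplus gA' H_Var) simp
  define s where "s u = (if u = v then 0 else Var u :: ('v, 'k) mpoly)" for u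
  have sH: "s u \<in> H A 1" if "u \<in> ?A" for u using that v by (auto simp: s_def intro: H_Var)
  have s_fix: "subst s p = p" if "p \<in> H A e" for p e
    using that by (rule subst_fixes) (use v in \<open>auto simp: s_def\<close>)
  have s_gen: "subst s p \<in> gen A G D e" if "p \<in> gen ?A G D e" for p e using that
  proof (induction rule: gen_induct)
    case (mult e q g)
    have "subst s g = g" using G mult(2) by (intro s_fix) auto
    then show ?case using gen_mult[OF subst_H[OF mult(1) sH] mult(2)] by (simp add: subst.hom_mult)
  qed (auto simp: subst.hom_add intro: gen_0 gen_add)
  have gen_sub: "gen A G D e \<subseteq> gen ?A G D e" for e
  proof
    fix p assume "p \<in> gen A G D e"
    then show "p \<in> gen ?A G D e"
    proof (induction rule: gen_induct)
      case (mult e q g)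
      then have "q \<in> H ?A e" using H_mono[of A ?A e] by blast
      then show ?case by (rule gen_mult) fact
    qed (auto intro: gen_0 gen_add)
  qed
  have vH: "Var v * u \<in> ?P e" if "u \<in> Hp ?A e" for u e
  proof -
    have "0 + Var v * u \<in> ?P e" unfolding gplus_def using that gen_0 by blast
    then show ?thesis by simp
  qed
  have s_P: "subst s p \<in> gen A G D e" if "p \<in> ?P e" for p e
    using that s_gen by (auto simp: gplus_def subst.hom_add subst.hom_mult s_def[of v])
  have red: "p - subst s p \<in> ?P e" if "p \<in> H ?A e" for p e using that
  proof (induction rule: H_induct)
    case zero
    show ?case using gid_0[OF gP] by simp
  next
    case (add p q)
    have "p + q - subst s (p + q) = (p - subst s p) + (q - subst s q)" by (simp add: subst.hom_add)
    then show ?case using gid_add[OF gP add(3,4)] by (simp only:)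
  next
    case (mon c m)
    show ?case
    proof (cases "v \<in> supp m")
      case True
      define m' where "m' = m - expo v"
      have m: "m = expo v + m'" unfolding m'_def by (rule expo_split[OF True])
      have e: "e = Suc (monom_deg m')" using mon(2) by (simp add: m One_nat_def)
      have "Const c * mon m = Var v * (Const c * mon m')" by (simp add: m mon_mult Var_mon mult_ac)
      moreover have "Const c * mon m' \<in> Hp ?A e"
        unfolding e Hp_Suc using mon(1) by (intro H_Const_mult H_mon) (auto simp: m supp_add_nat)
      moreover have "subst s (Var v * (Const c * mon m')) = 0" by (simp add: subst.hom_mult s_def[of v])
      ultimately show ?thesis using vH by (simp only: diff_0_right)
    next
      case False
      then have "Const c * mon m \<in> H A (monom_deg m)" using mon(1) by (intro H_Const_mult H_mon) auto
      then show ?thesis using s_fix gid_0[OF gP] by simp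
    qed
  qed
  have P_I: "p \<in> ?P e" if "p \<in> H ?A e" "subst s p \<in> gen A G D e" for p e
  proof -
    have "subst s p \<in> ?P e" using that(2) gen_sub gplus_left[OF gA'] by blast
    from gid_add[OF gP red[OF that(1)] this] show ?thesis by simp
  qed
  have "Reg Var ?A ?A (Suc m) ?P"
  proof (rule RegI)
    fix d z assume d: "Suc m \<le> d" and z: "\<And>F. F \<subseteq> ?A \<Longrightarrow> z F \<in> H ?A d"
      and bz: "\<And>T. T \<subseteq> ?A \<Longrightarrow> bd Var ?A z T \<in> ?P (Suc d)"
    define z0 where "z0 F = subst s (z F)" for F
    define z1 where "z1 F = sg v F * z0 (insert v F)" for F
    have z0H: "z0 F \<in> H A d" if "F \<subseteq> ?A" for F unfolding z0_def using z[OF that] sH by (rule subst_H)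
    have z1H: "z1 F \<in> H A d" if "F \<subseteq> A" for F unfolding z1_def using that by (intro H_sg z0H) auto
    have bs: "bd s ?A z0 T \<in> gen A G D (Suc d)" if "T \<subseteq> ?A" for T
      using s_P[OF bz[OF that]] unfolding subst_bd by (simp add: z0_def[abs_def])
    have sV: "bd s A x T = bd Var A x T" for x :: "'v set \<Rightarrow> ('v, 'k) mpoly" and T
      unfolding bd_def using v by (intro sum.cong) (auto simp: s_def)
    have bz0: "bd Var A z0 T \<in> gen A G D (Suc d)" if "T \<subseteq> A" for T
      using bs[of T] that bd_insert_outer[OF fin v that, of s z0] by (simp add: s_def[of v] sV subset_insertI2)
    have bz1: "bd Var A z1 T \<in> gen A G D (Suc d)" if "T \<subseteq> A" for T
    proof -
      have "sg v T * bd s ?A z0 (insert v T) \<in> gen A G D (Suc d)" using that by (intro gid_sg[OF gA] bs) auto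
      from gid_uminus[OF gA this] show ?thesis
        unfolding bd_insert_inner[OF fin v that] by (simp add: sV z1_def[abs_def])
    qed
    obtain w0 where w0: "\<And>F. F \<subseteq> A \<Longrightarrow> w0 F \<in> Hp A d" "\<And>F. F \<subseteq> A \<Longrightarrow> z0 F - bd Var A w0 F \<in> gen A G D d"
      by (rule RegD[OF R d z0H[OF subset_insertI2] bz0], assumption, assumption) (rule that; assumption)
    obtain w1 where w1: "\<And>F. F \<subseteq> A \<Longrightarrow> w1 F \<in> Hp A d" "\<And>F. F \<subseteq> A \<Longrightarrow> z1 F - bd Var A w1 F \<in> gen A G D d"
      by (rule RegD[OF R d z1H bz1], assumption, assumption) (rule that; assumption)
    \<comment> \<open>The sign undoes the one in \<open>z1\<close>, and the minus comes from
      \<open>bd_insert_inner\<close>.\<close>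
    define w where "w F = (if v \<in> F then - (sg v (F - {v}) * w1 (F - {v})) else w0 F)" for F
    have HpA: "p \<in> Hp ?A d" if "p \<in> Hp A d" for p :: "('v, 'k) mpoly"
      using that H_mono[of A ?A] by (auto simp: Hp_def split: if_splits)
    have w_out: "w F = w0 F" and w_in: "w (insert v F) = - (sg v F * w1 F)" if "F \<subseteq> A" for F
    proof -
      have "insert v F - {v} = F" "v \<notin> F" using that v by auto
      then show "w F = w0 F" "w (insert v F) = - (sg v F * w1 F)" by (simp_all add: w_def)
    qed
    have wHp: "w F \<in> Hp ?A d" if "F \<subseteq> ?A" for F
    proof (cases "v \<in> F")
      case True
      then show ?thesis using that by (auto simp: w_def intro!: HpA Hp_uminus Hp_sg w1(1))
    next
      case False
      then show ?thesis using that by (auto simp: w_def intro!: HpA w0(1))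
    qed
    have s_w: "subst s (w F) = w F" if "F \<subseteq> ?A" for F
    proof -
      have "w F \<in> Hp A d" using that by (auto simp: w_def intro!: Hp_uminus Hp_sg w1(1) w0(1))
      then show ?thesis using s_fix by (auto simp: Hp_def split: if_splits)
    qed
    show "\<exists>w. (\<forall>F\<subseteq>?A. w F \<in> Hp ?A d) \<and> (\<forall>F\<subseteq>?A. z F - bd Var ?A w F \<in> ?P d)"
    proof (intro exI[of _ w] conjI allI impI)
      fix F assume F: "F \<subseteq> ?A"
      show "w F \<in> Hp ?A d" by (rule wHp[OF F])
      have bsw: "subst s (bd Var ?A w F) = bd s ?A w F"
        unfolding subst_bd subst_Var using F by (intro bd_cong) (auto simp: s_w)
      show "z F - bd Var ?A w F \<in> ?P d"
      proof (rule P_I)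
        show "z F - bd Var ?A w F \<in> H ?A d"
          using bd_Hp[of ?A Var ?A "gen ?A G D" w d F] fin gA' wHp F z by (intro H_diff) (auto intro: H_Var)
        have "z0 F - bd s ?A w F \<in> gen A G D d"
        proof (cases "v \<in> F")
          case False
          then have F': "F \<subseteq> A" using F by auto
          have "bd s ?A w F = bd Var A w F" unfolding bd_insert_outer[OF fin v F'] by (simp add: sV s_def[of v])
          also have "\<dots> = bd Var A w0 F" using F' by (intro bd_cong) (auto simp: w_out)
          finally show ?thesis using w0(2)[OF F'] by simp
        next
          case True
          define T where "T = F - {v}"
          have T: "T \<subseteq> A" "F = insert v T" using True F by (auto simp: T_def)
          have "sg v T * bd s ?A w F = - bd Var A (\<lambda>F. sg v F * w (insert v F)) T"
            unfolding T(2) bd_insert_inner[OF fin v T(1)] by (simp add: sV)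
          also have "bd Var A (\<lambda>F. sg v F * w (insert v F)) T = bd Var A (\<lambda>F. - 1 * w1 F) T"
            using T(1) by (intro bd_cong) (auto simp: w_in)
          also have "\<dots> = - bd Var A w1 T" unfolding bd_mult by simp
          finally have "sg v T * (z0 F - bd s ?A w F) = z1 T - bd Var A w1 T"
            by (simp add: right_diff_distrib z1_def T(2))
          then have "sg v T * (sg v T * (z0 F - bd s ?A w F)) \<in> gen A G D d"
            using gid_sg[OF gA w1(2)[OF T(1)]] by simp
          then show ?thesis by (simp only: sg_sq)
        qed
        then show "subst s (z F - bd Var ?A w F) \<in> gen A G D d" by (simp add: subst.hom_minus bsw z0_def)
      qed
    qed
  qed
  moreover have "gcolon ?A (gen ?A G D) (Var v) d \<subseteq> gen ?A G D d" for d
  proof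
    fix p assume "p \<in> gcolon ?A (gen ?A G D) (Var v) d"
    then have "Var v * p \<in> gen ?A G D (Suc d)" by (simp add: gcolon_def)
    from vdiv_gen[OF G v this] show "p \<in> gen ?A G D d" by (simp add: vdiv_Var_mult)
  qed
  ultimately show ?thesis using fin gA' by (intro Reg_regular[of ?A Var ?A "gen ?A G D" v]) (auto intro: H_Var)
qed

lemma Reg_adjoin_vars:
  fixes G :: "('v::linorder, 'k::field) mpoly set"
  assumes "finite A" "finite F" "A \<inter> F = {}" "G \<subseteq> H A D" "Reg Var A A (Suc m) (gen A G D)"
  shows "Reg Var (A \<union> F) (A \<union> F) (Suc m) (gen (A \<union> F) G D)" using assms(2,3)
proof (induction F rule: finite_induct)
  case (insert v F)
  have "G \<subseteq> H (A \<union> F) D" using assms(4) H_mono[of A "A \<union> F" D] by blast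
  then have "Reg Var (insert v (A \<union> F)) (insert v (A \<union> F)) (Suc m) (gen (insert v (A \<union> F)) G D)"
    using insert assms(1) by (intro Reg_insert_var) auto
  then show ?case by simp
qed (use assms in simp)

text \<open>Exactness of the Koszul complex of the variables in positive coefficient degree,
  obtained by adjoining the variables one by one to the ground field.\<close>

lemma Reg_zero_ideal:
  assumes "finite (A :: 'v::linorder set)"
  shows "Reg Var A A (Suc 0) (\<lambda>d. {0 :: ('v, 'k::field) mpoly})"
proof -
  have gen_empty: "gen B ({} :: ('v, 'k) mpoly set) 0 = (\<lambda>d. {0})" for B :: "'v set"
  proof
    fix d
    have "p = 0" if "p \<in> gen B ({} :: ('v, 'k) mpoly set) 0 d" for p
      using that by (induction rule: gen_induct) auto
    then show "gen B ({} :: ('v, 'k) mpoly set) 0 d = {0}" using gen_0 by blast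
  qed
  have H_empty: "p = 0" if "p \<in> H {} d" "Suc 0 \<le> d" for p :: "('v, 'k) mpoly" and d
  proof (rule poly_mapping_eqI)
    fix m
    have "m \<notin> supp p" using that by (auto simp: H_def)
    then show "cf p m = cf 0 m" by (simp add: in_keys_iff)
  qed
  have "Reg Var {} {} (Suc 0) (gen {} ({} :: ('v, 'k) mpoly set) 0)"
    by (rule RegI, rule exI[of _ "\<lambda>_. 0"]) (use H_empty in \<open>auto simp: gen_empty\<close>)
  from Reg_adjoin_vars[OF _ assms _ _ this] show ?thesis by (simp add: gen_empty)
qed

subsection \<open>Linear resolutions\<close>

lemma (in vector_space) finite_basis_family:
  assumes N: "subspace N" and T: "finite T" "N \<subseteq> span T"
  shows "\<exists>(n :: nat) g. (\<forall>j<n. g j \<in> N) \<and> (\<forall>f\<in>N. \<exists>c. f = (\<Sum>j<n. scale (c j) (g j))) \<and>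
    (\<forall>c. (\<Sum>j<n. scale (c j) (g j)) = 0 \<longrightarrow> (\<forall>j<n. c j = 0))"
proof -
  obtain B where B: "B \<subseteq> N" "independent B" "N \<subseteq> span B" using basis_exists[of N] by metis
  have "B \<subseteq> span T" using B(1) T(2) by blast
  then have finB: "finite B" using independent_span_bound[OF T(1) B(2)] by blast
  then obtain xs where xs: "set xs = B" "distinct xs" using finite_distinct_list by blast
  have bij: "bij_betw ((!) xs) {..<length xs} B" using bij_betw_nth[OF xs(2) refl] xs(1) by simp
  have sum_eq: "(\<Sum>j<length xs. scale (u (xs ! j)) (xs ! j)) = (\<Sum>v\<in>B. scale (u v) v)" for u
    by (rule sum.reindex_bij_betw[OF bij])
  show ?thesis
  proof (intro exI[of _ "length xs"] exI[of _ "(!) xs"] conjI ballI allI impI)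
    show "xs ! j \<in> N" if "j < length xs" for j using that xs(1) B(1) nth_mem by blast
  next
    fix f assume "f \<in> N"
    then obtain u where "f = (\<Sum>v\<in>B. scale (u v) v)" using B(3) span_finite[OF finB] by blast
    then show "\<exists>c. f = (\<Sum>j<length xs. scale (c j) (xs ! j))"
      by (intro exI[of _ "\<lambda>j. u (xs ! j)"]) (simp add: sum_eq)
  next
    fix c j assume c: "(\<Sum>j<length xs. scale (c j) (xs ! j)) = 0" and j: "j < length xs"
    define u where "u = c \<circ> the_inv_into {..<length xs} ((!) xs)"
    have uc: "u (xs ! i) = c i" if "i < length xs" for i
      using that bij by (simp add: u_def the_inv_into_f_f bij_betw_def)
    have "(\<Sum>v\<in>B. scale (u v) v) = (\<Sum>j<length xs. scale (c j) (xs ! j))"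
      unfolding sum_eq[symmetric] by (intro sum.cong) (auto simp: uc)
    then have "(\<Sum>v\<in>B. scale (u v) v) = 0" using c by simp
    from independentD[OF B(2) finB subset_refl this, of "xs ! j"] show "c j = 0"
      using uc[OF j] xs(1) nth_mem[OF j] by simp
  qed
qed

definition fscale :: "'k \<Rightarrow> (nat \<Rightarrow> ('v, 'k::field) mpoly) \<Rightarrow> nat \<Rightarrow> ('v, 'k) mpoly" where
  "fscale c f = (\<lambda>q. Const c * f q)"

interpretation fv: vector_space "fscale :: 'k::field \<Rightarrow> (nat \<Rightarrow> ('v, 'k) mpoly) \<Rightarrow> _"
  by unfold_locales (auto simp: fscale_def fun_eq_iff Const_add Const_mult algebra_simps)

lemma fv_sum_apply: "(\<Sum>j\<in>I. fscale (c j) (g j)) q = (\<Sum>j\<in>I. Const (c j) * g j q)"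
  by (induction I rule: infinite_finite_induct) (auto simp: fscale_def)

definition ker :: "'w set \<Rightarrow> nat \<Rightarrow> nat \<Rightarrow> (nat \<Rightarrow> nat \<Rightarrow> ('w, 'k::field) mpoly) \<Rightarrow> nat \<Rightarrow> (nat \<Rightarrow> ('w, 'k) mpoly) set" where
  "ker V m n g d = {h. (\<forall>j<n. h j \<in> H V d) \<and> (\<forall>q<m. (\<Sum>j<n. h j * g j q) = 0)}"

text \<open>A graded submodule of the free module of rank \<open>m\<close> whose Koszul homology with respect to \<open>a\<close>
  lives in the single coefficient degree \<open>d0\<close>.\<close>

definition linm :: "('v::linorder \<Rightarrow> ('w, 'k::field) mpoly) \<Rightarrow> 'v set \<Rightarrow> nat \<Rightarrow> nat \<Rightarrow> (nat \<Rightarrow> (nat \<Rightarrow> ('w, 'k) mpoly) set) \<Rightarrow> bool" where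
  "linm a A m d0 N \<longleftrightarrow> (\<forall>d>d0. \<forall>z. (\<forall>F\<subseteq>A. z F \<in> N d) \<longrightarrow> (\<forall>T\<subseteq>A. \<forall>q<m. bd a A (\<lambda>F. z F q) T = 0) \<longrightarrow>
     (\<exists>w. (\<forall>F\<subseteq>A. w F \<in> N (d - 1)) \<and> (\<forall>F\<subseteq>A. \<forall>q<m. z F q = bd a A (\<lambda>F. w F q) F)))"

definition basis_of :: "nat \<Rightarrow> (nat \<Rightarrow> ('w, 'k::field) mpoly) set \<Rightarrow> nat \<Rightarrow> (nat \<Rightarrow> nat \<Rightarrow> ('w, 'k) mpoly) \<Rightarrow> bool" where
  "basis_of m N n g \<longleftrightarrow> (\<forall>j<n. g j \<in> N) \<and> (\<forall>f\<in>N. \<exists>c. \<forall>q<m. f q = (\<Sum>j<n. Const (c j) * g j q)) \<and>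
     (\<forall>c. (\<forall>q<m. (\<Sum>j<n. Const (c j) * g j q) = 0) \<longrightarrow> (\<forall>j<n. c j = 0))"

text \<open>Vectors are functions on \<open>nat\<close> of which only the components below
  \<open>m\<close> count; the last clause makes membership independent of the rest.\<close>

definition submod :: "'w set \<Rightarrow> nat \<Rightarrow> (nat \<Rightarrow> (nat \<Rightarrow> ('w, 'k::field) mpoly) set) \<Rightarrow> bool" where
  "submod V m N \<longleftrightarrow> (\<forall>d f. f \<in> N d \<longrightarrow> (\<forall>q<m. f q \<in> H V d)) \<and> (\<forall>d. (\<lambda>_. 0) \<in> N d) \<and>
     (\<forall>d f f'. f \<in> N d \<longrightarrow> f' \<in> N d \<longrightarrow> (\<lambda>q. f q + f' q) \<in> N d) \<and>
     (\<forall>d e r f. r \<in> H V e \<longrightarrow> f \<in> N d \<longrightarrow> (\<lambda>q. r * f q) \<in> N (e + d)) \<and>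
     (\<forall>d f f'. f \<in> N d \<longrightarrow> (\<forall>q<m. f q = f' q) \<longrightarrow> f' \<in> N d)"

lemma linmE:
  assumes "linm a A m d0 N" "d0 < d" "\<And>F. F \<subseteq> A \<Longrightarrow> z F \<in> N d"
    "\<And>T q. T \<subseteq> A \<Longrightarrow> q < m \<Longrightarrow> bd a A (\<lambda>F. z F q) T = 0"
  obtains w where "\<And>F. F \<subseteq> A \<Longrightarrow> w F \<in> N (d - 1)"
    "\<And>F q. F \<subseteq> A \<Longrightarrow> q < m \<Longrightarrow> z F q = bd a A (\<lambda>F. w F q) F"
proof -
  have "\<forall>F\<subseteq>A. z F \<in> N d" "\<forall>T\<subseteq>A. \<forall>q<m. bd a A (\<lambda>F. z F q) T = 0" using assms(3,4) by auto
  then have "\<exists>w. (\<forall>F\<subseteq>A. w F \<in> N (d - 1)) \<and> (\<forall>F\<subseteq>A. \<forall>q<m. z F q = bd a A (\<lambda>F. w F q) F)"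
    using assms(1,2) unfolding linm_def by (elim allE[of _ d] allE[of _ z] impE) auto
  then show ?thesis by (elim exE conjE) (rule that; iprover)
qed

lemma submod_sum:
  assumes "submod V m N" "\<And>i. i \<in> I \<Longrightarrow> f i \<in> N d"
  shows "(\<lambda>q. \<Sum>i\<in>I. f i q) \<in> N d" using assms(2)
proof (induction I rule: infinite_finite_induct)
  case (insert i I)
  then have "f i \<in> N d" "(\<lambda>q. \<Sum>i\<in>I. f i q) \<in> N d" by auto
  then have "(\<lambda>q. f i q + (\<Sum>i\<in>I. f i q)) \<in> N d" using assms(1) by (auto simp: submod_def)
  then show ?case using insert.hyps by simp
qed (use assms(1) in \<open>auto simp: submod_def\<close>)

lemma submod_ker: "submod V n (ker V m n g)"
  unfolding submod_def ker_def
  by (auto simp: H_add H_mult distrib_right sum.distrib mult.assoc simp flip: sum_distrib_left)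

lemma exists_basis:
  assumes V: "finite V" and N: "submod V m N"
  shows "\<exists>n g. basis_of m (N d) n (g :: nat \<Rightarrow> nat \<Rightarrow> ('w, 'k::field) mpoly)"
proof -
  \<comment> \<open>Clearing the components from \<open>m\<close> on turns equality below
    \<open>m\<close> into equality of functions, as a vector space basis requires.\<close>
  define N' where "N' = {f \<in> N d. \<forall>q\<ge>m. f q = 0}"
  define T where "T = (\<lambda>(p, \<mu>) q. if q = p then mon \<mu> else (0 :: ('w, 'k) mpoly)) ` ({..<m} \<times> {\<mu>. supp \<mu> \<subseteq> V \<and> monom_deg \<mu> \<le> d})"
  have "fv.subspace N'"
  proof (rule fv.subspaceI)
    show "0 \<in> N'" using N by (auto simp: N'_def submod_def zero_fun_def)
    show "x + y \<in> N'" if "x \<in> N'" "y \<in> N'" for x y using that N by (auto simp: N'_def submod_def plus_fun_def)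
    show "fscale c x \<in> N'" if "x \<in> N'" for c x
    proof -
      have "\<forall>d e r f. r \<in> H V e \<longrightarrow> f \<in> N d \<longrightarrow> (\<lambda>q. r * f q) \<in> N (e + d)" using N by (simp add: submod_def)
      moreover have "Const c \<in> H V 0" "x \<in> N d" using that by (auto simp: N'_def)
      ultimately have "(\<lambda>q. Const c * x q) \<in> N (0 + d)" by (elim allE impE) assumption+
      then show ?thesis using that by (auto simp: N'_def fscale_def)
    qed
  qed
  moreover have "finite T" unfolding T_def by (intro finite_imageI finite_cartesian_product finite_exponents[OF V]) simp
  moreover have "N' \<subseteq> fv.span T"
  proof
    fix f assume f: "f \<in> N'"
    have *: "f p \<in> H V d" if "p < m" for p using f N that by (auto simp: N'_def submod_def)
    have "f = (\<Sum>p<m. \<Sum>\<mu>\<in>supp (f p). fscale (cf (f p) \<mu>) (\<lambda>q. if q = p then mon \<mu> else 0))"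
    proof
      fix q
      have 1: "(\<Sum>p<m. \<Sum>\<mu>\<in>supp (f p). fscale (cf (f p) \<mu>) (\<lambda>q. if q = p then mon \<mu> else 0)) q =
          (\<Sum>p<m. \<Sum>\<mu>\<in>supp (f p). Const (cf (f p) \<mu>) * (if q = p then mon \<mu> else 0))"
        by (induction m) (simp_all add: fv_sum_apply)
      also have "\<dots> = (\<Sum>p<m. if p = q then f q else 0)" by (intro sum.cong) (auto simp flip: mpoly_expand)
      also have "\<dots> = f q" using f by (auto simp: N'_def)
      finally show "f q = (\<Sum>p<m. \<Sum>\<mu>\<in>supp (f p). fscale (cf (f p) \<mu>) (\<lambda>q. if q = p then mon \<mu> else 0)) q" ..
    qed
    also have "\<dots> \<in> fv.span T"
      using * by (intro fv.span_sum fv.span_scale fv.span_base) (force simp: T_def H_def)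
    finally show "f \<in> fv.span T" .
  qed
  ultimately have "\<exists>(n :: nat) g. (\<forall>j<n. g j \<in> N') \<and> (\<forall>f\<in>N'. \<exists>c. f = (\<Sum>j<n. fscale (c j) (g j))) \<and>
    (\<forall>c. (\<Sum>j<n. fscale (c j) (g j)) = 0 \<longrightarrow> (\<forall>j<n. c j = 0))"
    by (rule fv.finite_basis_family)
  then obtain n :: nat and g where g: "\<And>j. j < n \<Longrightarrow> g j \<in> N'" "\<And>f. f \<in> N' \<Longrightarrow> \<exists>c. f = (\<Sum>j<n. fscale (c j) (g j))"
    "\<And>c. (\<Sum>j<n. fscale (c j) (g j)) = 0 \<Longrightarrow> \<forall>j<n. c j = 0" by (elim exE conjE) (rule that; iprover elim: bspec)
  have "basis_of m (N d) n g" unfolding basis_of_def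
  proof (intro conjI ballI allI impI)
    show "g j \<in> N d" if "j < n" for j using g(1)[OF that] by (simp add: N'_def)
  next
    fix f assume f: "f \<in> N d"
    define f' where "f' q = (if q < m then f q else 0)" for q
    have "f' \<in> N d" using N f unfolding submod_def by (metis f'_def)
    then have "f' \<in> N'" by (simp add: N'_def f'_def)
    then obtain c where c: "f' = (\<Sum>j<n. fscale (c j) (g j))" using g(2) by blast
    show "\<exists>c. \<forall>q<m. f q = (\<Sum>j<n. Const (c j) * g j q)"
    proof (intro exI[of _ c] allI impI)
      fix q assume "q < m"
      then show "f q = (\<Sum>j<n. Const (c j) * g j q)" using fun_cong[OF c, of q] by (simp add: f'_def fv_sum_apply)
    qed
  next
    fix c j assume c: "\<forall>q<m. (\<Sum>j<n. Const (c j) * g j q) = 0" and "j < n"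
    have "(\<Sum>j<n. fscale (c j) (g j)) = 0"
    proof
      fix q
      show "(\<Sum>j<n. fscale (c j) (g j)) q = 0 q" using c g(1) by (cases "q < m") (auto simp: fv_sum_apply N'_def)
    qed
    then show "c j = 0" using g(3) \<open>j < n\<close> by blast
  qed
  then show ?thesis by blast
qed

context
  fixes a :: "'v::linorder \<Rightarrow> ('w, 'k::field) mpoly" and A V
  assumes finA: "finite A" and finV: "finite V" and aH: "\<And>v. v \<in> A \<Longrightarrow> a v \<in> H V 1"
    and R0: "Reg a A V (Suc 0) (\<lambda>d. {0})"
begin

lemma bd_exact:
  assumes "0 < d" "\<And>F. F \<subseteq> A \<Longrightarrow> z F \<in> H V d" "\<And>T. T \<subseteq> A \<Longrightarrow> bd a A z T = 0"
  shows "\<exists>w. (\<forall>F\<subseteq>A. w F \<in> H V (d - 1)) \<and> (\<forall>F\<subseteq>A. z F = bd a A w F)"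
proof -
  have d: "Suc 0 \<le> d" using assms(1) by simp
  have 0: "bd a A z T \<in> {0}" if "T \<subseteq> A" for T using assms(3)[OF that] by simp
  obtain w where w: "\<And>F. F \<subseteq> A \<Longrightarrow> w F \<in> Hp V d" "\<And>F. F \<subseteq> A \<Longrightarrow> z F - bd a A w F \<in> {0}"
    by (rule RegD[OF R0 d assms(2) 0], assumption, assumption) (rule that; assumption)
  then show ?thesis using assms(1) by (intro exI[of _ w]) (auto simp: Hp_def)
qed

text \<open>The connecting map of 0 -> B -> S -> S/B: a cycle in \<open>B\<close> bounds in the
  polynomial ring, its bounding chain is a cycle modulo \<open>B\<close> one degree lower, and
  \<open>R\<close> corrects that chain into \<open>B\<close>.\<close>

lemma linm_ideal:
  assumes B: "gid V B" and R: "Reg a A V M B" and M: "0 < M"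
  shows "linm a A 1 M (\<lambda>d. {f. f 0 \<in> B d})" unfolding linm_def
proof (intro allI impI)
  fix d and z :: "'v set \<Rightarrow> nat \<Rightarrow> ('w, 'k) mpoly" assume d: "M < d" and z: "\<forall>F\<subseteq>A. z F \<in> {f. f 0 \<in> B d}"
    and bz: "\<forall>T\<subseteq>A. \<forall>q<1. bd a A (\<lambda>F. z F q) T = 0"
  have z0: "z F 0 \<in> B d" if "F \<subseteq> A" for F using z that by simp
  obtain w where w: "\<And>F. F \<subseteq> A \<Longrightarrow> w F \<in> H V (d - 1)" "\<And>F. F \<subseteq> A \<Longrightarrow> z F 0 = bd a A w F"
  proof -
    have "\<exists>w. (\<forall>F\<subseteq>A. w F \<in> H V (d - 1)) \<and> (\<forall>F\<subseteq>A. z F 0 = bd a A w F)"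
      by (rule bd_exact) (use d z0 gid_H[OF B] bz in auto)
    then show ?thesis by (elim exE conjE) (rule that; iprover)
  qed
  have d1: "M \<le> d - 1" "Suc (d - 1) = d" using d by auto
  have bw: "bd a A w T \<in> B (Suc (d - 1))" if "T \<subseteq> A" for T using w(2)[OF that] z0[OF that] d1 by simp
  obtain w' where w': "\<And>F. F \<subseteq> A \<Longrightarrow> w' F \<in> Hp V (d - 1)" "\<And>F. F \<subseteq> A \<Longrightarrow> w F - bd a A w' F \<in> B (d - 1)"
    by (rule RegD[OF R d1(1) w(1) bw], assumption, assumption) (rule that; assumption)
  show "\<exists>w. (\<forall>F\<subseteq>A. w F \<in> {f. f 0 \<in> B (d - 1)}) \<and> (\<forall>F\<subseteq>A. \<forall>q<1. z F q = bd a A (\<lambda>F. w F q) F)"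
    by (intro exI[of _ "\<lambda>F _. w F - bd a A w' F"])
      (use w w' in \<open>auto simp: One_nat_def less_Suc0 bd_diff bd_bd[OF finA]\<close>)
qed

text \<open>An element placed at the empty set is trivially a cycle; that it bounds makes it a
  combination of elements one degree lower with coefficients \<open>a v\<close>. So \<open>N\<close>
  is generated in degree \<open>d0\<close>.\<close>

lemma linm_generated:
  assumes N: "submod V m N" and L: "linm a A m d0 N" and g: "basis_of m (N d0) n g"
  shows "f \<in> N (d0 + d) \<Longrightarrow> \<exists>h. (\<forall>j<n. h j \<in> H V d) \<and> (\<forall>q<m. f q = (\<Sum>j<n. h j * g j q))"
proof (induction d arbitrary: f)
  case 0
  then have "f \<in> N d0" by simp
  then obtain c where "\<forall>q<m. f q = (\<Sum>j<n. Const (c j) * g j q)" using g unfolding basis_of_def by blast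
  then show ?case by (intro exI[of _ "\<lambda>j. Const (c j)"]) auto
next
  case (Suc d)
  define z where "z F = (if F = {} then f else (\<lambda>_. 0))" for F :: "'v set"
  have "z F \<in> N (d0 + Suc d)" for F using Suc.prems N by (auto simp: z_def submod_def)
  moreover have "bd a A (\<lambda>F. z F q) T = 0" for T q by (simp add: bd_def z_def)
  ultimately obtain w where w: "\<And>F. F \<subseteq> A \<Longrightarrow> w F \<in> N (d0 + d)"
      "\<And>F q. F \<subseteq> A \<Longrightarrow> q < m \<Longrightarrow> z F q = bd a A (\<lambda>F. w F q) F"
  proof -
    assume *: "\<And>F. z F \<in> N (d0 + Suc d)" "\<And>q T. bd a A (\<lambda>F. z F q) T = 0"
    have "d0 < d0 + Suc d" "d0 + Suc d - 1 = d0 + d" by (simp_all add: One_nat_def)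
    note d = this
    show ?thesis
    proof (rule linmE[OF L d(1), of z])
      fix w assume "\<And>F. F \<subseteq> A \<Longrightarrow> w F \<in> N (d0 + Suc d - 1)"
        "\<And>F q. F \<subseteq> A \<Longrightarrow> q < m \<Longrightarrow> z F q = bd a A (\<lambda>F. w F q) F"
      then show ?thesis using that[of w] unfolding d(2) by blast
    qed (use * in auto)
  qed
  have "\<forall>v\<in>A. \<exists>h. (\<forall>j<n. h j \<in> H V d) \<and> (\<forall>q<m. w {v} q = (\<Sum>j<n. h j * g j q))"
    using w(1) by (intro ballI Suc.IH) auto
  then obtain h where h: "\<And>v j. v \<in> A \<Longrightarrow> j < n \<Longrightarrow> h v j \<in> H V d"
      "\<And>v q. v \<in> A \<Longrightarrow> q < m \<Longrightarrow> w {v} q = (\<Sum>j<n. h v j * g j q)" by (metis (no_types))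
  show ?case
  proof (intro exI[of _ "\<lambda>j. \<Sum>v\<in>A. a v * h v j"] conjI allI impI)
    fix j assume "j < n"
    then show "(\<Sum>v\<in>A. a v * h v j) \<in> H V (Suc d)"
      using H_mult[OF aH h(1)] by (intro H_sum) (auto simp: One_nat_def)
  next
    fix q assume q: "q < m"
    have "f q = (\<Sum>v\<in>A. a v * w {v} q)" using w(2)[of "{}" q] q by (simp add: z_def bd_def)
    also have "\<dots> = (\<Sum>v\<in>A. \<Sum>j<n. a v * h v j * g j q)"
      by (intro sum.cong) (simp_all add: h(2) q sum_distrib_left mult.assoc)
    finally show "f q = (\<Sum>j<n. (\<Sum>v\<in>A. a v * h v j) * g j q)"
      by (subst (asm) sum.swap) (simp add: sum_distrib_right)
  qed
qed

lemma basis_comb_bd: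
  "(\<Sum>j<n. bd a A (\<lambda>F. u F j) T * g j q) = bd a A (\<lambda>F. \<Sum>j<n. u F j * g j q) T"
  by (simp add: bd_def sum_distrib_left sum_distrib_right mult.assoc) (rule sum.swap)

text \<open>Dimension shift along the presentation of \<open>N\<close> by the basis
  \<open>g\<close>: a cycle of syzygies bounds by some \<open>w\<close> in the free module, the
  image of \<open>w\<close> in \<open>N\<close> is a cycle and bounds, and lifting its bounding
  chain by \<open>linm_generated\<close> corrects \<open>w\<close> to consist of syzygies.\<close>

lemma linm_ker:
  assumes N: "submod V m N" and L: "linm a A m d0 N" and g: "basis_of m (N d0) n g"
  shows "linm a A n 1 (ker V m n g)" unfolding linm_def
proof (intro allI impI)
  fix d z assume d: "1 < d" and z: "\<forall>F\<subseteq>A. z F \<in> ker V m n g d"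
    and bz: "\<forall>T\<subseteq>A. \<forall>j<n. bd a A (\<lambda>F. z F j) T = 0"
  have comb: "(\<lambda>q. \<Sum>j<n. h j * g j q) \<in> N (e + d0)" if "\<And>j. j < n \<Longrightarrow> h j \<in> H V e" for h e
    using N g that by (intro submod_sum[OF N]) (auto simp: submod_def basis_of_def)
  have "\<forall>j. \<exists>w. j < n \<longrightarrow> (\<forall>F\<subseteq>A. w F \<in> H V (d - 1)) \<and> (\<forall>F\<subseteq>A. z F j = bd a A w F)"
  proof
    fix j
    show "\<exists>w. j < n \<longrightarrow> (\<forall>F\<subseteq>A. w F \<in> H V (d - 1)) \<and> (\<forall>F\<subseteq>A. z F j = bd a A w F)"
      using bd_exact[of d "\<lambda>F. z F j"] d z bz by (cases "j < n") (auto simp: ker_def)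
  qed
  then obtain w where "\<forall>j. j < n \<longrightarrow> (\<forall>F\<subseteq>A. w j F \<in> H V (d - 1)) \<and> (\<forall>F\<subseteq>A. z F j = bd a A (w j) F)"
    by (rule choice[THEN exE])
  then have w: "\<And>j F. j < n \<Longrightarrow> F \<subseteq> A \<Longrightarrow> w j F \<in> H V (d - 1)"
    "\<And>j F. j < n \<Longrightarrow> F \<subseteq> A \<Longrightarrow> z F j = bd a A (w j) F" by blast+
  define y where "y F q = (\<Sum>j<n. w j F * g j q)" for F q
  have yN: "y F \<in> N (d - 1 + d0)" if "F \<subseteq> A" for F unfolding y_def[abs_def] using w(1) that by (intro comb) auto
  have by0: "bd a A (\<lambda>F. y F q) T = 0" if "T \<subseteq> A" "q < m" for q T
  proof -
    have "bd a A (\<lambda>F. y F q) T = (\<Sum>j<n. bd a A (w j) T * g j q)"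
      unfolding y_def by (rule basis_comb_bd[symmetric])
    also have "\<dots> = (\<Sum>j<n. z T j * g j q)" using w(2) that by (intro sum.cong) auto
    finally show ?thesis using z that by (simp add: ker_def)
  qed
  have dd: "d - 1 + d0 - 1 = d0 + (d - 2)" "d0 < d - 1 + d0" using d by auto
  obtain y' where y': "\<And>F. F \<subseteq> A \<Longrightarrow> y' F \<in> N (d0 + (d - 2))"
      "\<And>F q. F \<subseteq> A \<Longrightarrow> q < m \<Longrightarrow> y F q = bd a A (\<lambda>F. y' F q) F"
    by (rule linmE[OF L dd(2), of y, OF yN by0, unfolded dd(1)], assumption+) (rule that; assumption)
  have "\<forall>F. \<exists>u. F \<subseteq> A \<longrightarrow> (\<forall>j<n. u j \<in> H V (d - 2)) \<and> (\<forall>q<m. y' F q = (\<Sum>j<n. u j * g j q))"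
    using linm_generated[OF N L g y'(1)] by blast
  then obtain u where u: "\<forall>F. F \<subseteq> A \<longrightarrow> (\<forall>j<n. u F j \<in> H V (d - 2)) \<and> (\<forall>q<m. y' F q = (\<Sum>j<n. u F j * g j q))"
    by (rule choice[THEN exE])
  have d2: "Suc (d - 2) = d - 1" using d by auto
  define w' where "w' F j = w j F - bd a A (\<lambda>F. u F j) F" for F j
  show "\<exists>w. (\<forall>F\<subseteq>A. w F \<in> ker V m n g (d - 1)) \<and> (\<forall>F\<subseteq>A. \<forall>j<n. z F j = bd a A (\<lambda>F. w F j) F)"
  proof (intro exI[of _ w'] conjI allI impI)
    fix F assume F: "F \<subseteq> A"
    have "w' F j \<in> H V (d - 1)" if j: "j < n" for j
    proof -
      have "bd a A (\<lambda>F. u F j) F \<in> H V (Suc (d - 2))" using u j F by (intro bd_H[OF finA aH gid_H_self]) auto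
      then show ?thesis unfolding w'_def d2 by (intro H_diff w(1)[OF j F])
    qed
    moreover have "(\<Sum>j<n. w' F j * g j q) = 0" if q: "q < m" for q
    proof -
      have "(\<Sum>j<n. w' F j * g j q) = y F q - bd a A (\<lambda>F. \<Sum>j<n. u F j * g j q) F"
        by (simp add: w'_def left_diff_distrib sum_subtractf y_def basis_comb_bd)
      also have "bd a A (\<lambda>F. \<Sum>j<n. u F j * g j q) F = bd a A (\<lambda>F. y' F q) F" using u q F by (intro bd_cong) auto
      finally show ?thesis using y'(2)[OF F q] by simp
    qed
    ultimately show "w' F \<in> ker V m n g (d - 1)" by (simp add: ker_def)
    fix j assume "j < n"
    then show "z F j = bd a A (\<lambda>F. w' F j) F" using w(2) F by (simp add: w'_def bd_diff bd_bd[OF finA])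
  qed
qed

lemma ker_0:
  assumes "basis_of m N n g" "h \<in> ker V m n g 0" "j < n"
  shows "h j = 0"
proof -
  define c where "c j = cf (h j) 0" for j
  have h: "h j = Const (c j)" if "j < n" for j
    unfolding c_def using assms(2) that by (intro H_0_Const) (auto simp: ker_def)
  have "\<forall>q<m. (\<Sum>j<n. Const (c j) * g j q) = 0" using assms(2) h by (simp add: ker_def)
  then have "c j = 0" using assms(1,3) by (auto simp: basis_of_def)
  then show ?thesis using h assms(3) by simp
qed

text \<open>Iterates the passage to syzygies. Truncated subtraction in the last clause is harmless
  for \<open>d = 0\<close>, because a basis admits no syzygies of degree 0.\<close>

lemma exists_kernel_sequence:
  assumes N: "submod V m0 N" and L: "linm a A m0 d0 N"
  shows "\<exists>(m :: nat \<Rightarrow> nat) (g :: nat \<Rightarrow> nat \<Rightarrow> nat \<Rightarrow> ('w, 'k) mpoly).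
    m 0 = m0 \<and> basis_of m0 (N d0) (m 1) (g 0) \<and>
    (\<forall>i. basis_of (m (Suc i)) (ker V (m i) (m (Suc i)) (g i) 1) (m (Suc (Suc i))) (g (Suc i))) \<and>
    (\<forall>i d h. h \<in> ker V (m i) (m (Suc i)) (g i) d \<longrightarrow>
       (\<exists>y. (\<forall>l<m (Suc (Suc i)). y l \<in> H V (d - 1)) \<and>
            (\<forall>j<m (Suc i). h j = (\<Sum>l<m (Suc (Suc i)). y l * g (Suc i) l j))))"
proof -
  obtain n0 g0 where g0: "basis_of m0 (N d0) n0 g0" using exists_basis[OF finV N] by blast
  define P where "P i s = (case s of (m, n, g) \<Rightarrow> linm a A n 1 (ker V m n g) \<and>
      (\<forall>h\<in>ker V m n g 0. \<forall>j<n. h j = 0) \<and> (i = 0 \<longrightarrow> s = (m0, n0, g0)))" for i :: nat and s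
  define Q where "Q s s' = (case s of (m, n, g) \<Rightarrow> case s' of (m', n', g') \<Rightarrow>
      m' = n \<and> basis_of n (ker V m n g 1) n' g')" for s s' :: "nat \<times> nat \<times> (nat \<Rightarrow> nat \<Rightarrow> ('w, 'k) mpoly)"
  have "\<exists>f. \<forall>i. P i (f i) \<and> Q (f i) (f (Suc i))"
  proof (rule dependent_nat_choice)
    have "P 0 (m0, n0, g0)" using linm_ker[OF N L g0] ker_0[OF g0] by (auto simp: P_def)
    then show "\<exists>s. P 0 s" by blast
  next
    fix s i assume s: "P i s"
    obtain m n g where [simp]: "s = (m, n, g)" by (cases s)
    have Ls: "linm a A n 1 (ker V m n g)" using s by (simp add: P_def)
    obtain n' g' where g': "basis_of n (ker V m n g 1) n' g'" using exists_basis[OF finV submod_ker] by blast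
    have "P (Suc i) (n, n', g')" using linm_ker[OF submod_ker Ls g'] ker_0[OF g'] by (auto simp: P_def)
    moreover have "Q s (n, n', g')" using g' by (simp add: Q_def)
    ultimately show "\<exists>s'. P (Suc i) s' \<and> Q s s'" by blast
  qed
  then obtain f where f: "\<And>i. P i (f i)" "\<And>i. Q (f i) (f (Suc i))" by blast
  define m where "m i = fst (f i)" for i
  define g where "g i = snd (snd (f i))" for i
  have n: "fst (snd (f i)) = m (Suc i)" for i using f(2)[of i] by (auto simp: Q_def m_def split: prod.splits)
  have fi: "f i = (m i, m (Suc i), g i)" for i using n[of i] by (simp add: m_def g_def prod_eq_iff)
  have f0: "f 0 = (m0, n0, g0)" using f(1)[of 0] by (auto simp: P_def split: prod.splits)
  show ?thesis
  proof (intro exI[of _ m] exI[of _ g] conjI allI impI)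
    show "m 0 = m0" by (simp add: m_def f0)
    show "basis_of m0 (N d0) (m 1) (g 0)" using g0 fi[of 0] f0 by (simp add: One_nat_def)
    show bas: "basis_of (m (Suc i)) (ker V (m i) (m (Suc i)) (g i) 1) (m (Suc (Suc i))) (g (Suc i))" for i
      using f(2)[of i] by (simp add: Q_def fi)
    fix i d h assume h: "h \<in> ker V (m i) (m (Suc i)) (g i) d"
    have P: "linm a A (m (Suc i)) 1 (ker V (m i) (m (Suc i)) (g i))" "\<forall>h\<in>ker V (m i) (m (Suc i)) (g i) 0. \<forall>j<m (Suc i). h j = 0"
      using f(1)[of i] by (simp_all add: P_def fi)
    show "\<exists>y. (\<forall>l<m (Suc (Suc i)). y l \<in> H V (d - 1)) \<and> (\<forall>j<m (Suc i). h j = (\<Sum>l<m (Suc (Suc i)). y l * g (Suc i) l j))"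
    proof (cases d)
      case 0
      then show ?thesis using P(2) h by (intro exI[of _ "\<lambda>_. 0"]) auto
    next
      case (Suc e)
      then have "h \<in> ker V (m i) (m (Suc i)) (g i) (1 + e)" using h by (simp add: One_nat_def)
      from linm_generated[OF submod_ker P(1) bas this] show ?thesis using Suc by (simp add: One_nat_def)
    qed
  qed
qed

end

subsection \<open>Homogeneous components\<close>

definition hc :: "nat \<Rightarrow> ('v, 'k::field) mpoly \<Rightarrow> ('v, 'k) mpoly" where
  "hc d p = (\<Sum>m\<in>supp p. if monom_deg m = d then Const (cf p m) * mon m else 0)"

lemma lookup_hc: "cf (hc d p) m = (if monom_deg m = d then cf p m else 0)"
proof -
  have "cf (hc d p) m = (\<Sum>l\<in>supp p. if l = m then (if monom_deg m = d then cf p m else 0) else 0)"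
    unfolding hc_def lookup_sum by (intro sum.cong) (auto simp: lookup_mon)
  then show ?thesis by (auto simp: in_keys_iff)
qed

lemma hc_add: "hc d (p + q) = hc d p + hc d q"
  by (rule poly_mapping_eqI) (simp add: lookup_hc lookup_add)

lemma hc_0 [simp]: "hc d 0 = 0"
  by (simp add: hc_def)

lemma hc_sum: "hc d (sum f I) = (\<Sum>i\<in>I. hc d (f i))"
  by (induction I rule: infinite_finite_induct) (auto simp: hc_add)

lemma hc_H: "p \<in> polys V \<Longrightarrow> hc d p \<in> H V d"
  by (auto simp: H_def polys_def in_keys_iff lookup_hc split: if_splits)

lemma hc_form: "p \<in> H V e \<Longrightarrow> hc d p = (if d = e then p else 0)"
  by (rule poly_mapping_eqI) (auto simp: H_def lookup_hc in_keys_iff)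

lemma hc_decompose:
  assumes "\<And>m. m \<in> supp p \<Longrightarrow> monom_deg m \<le> D"
  shows "p = (\<Sum>d\<le>D. hc d p)"
proof (rule poly_mapping_eqI)
  fix m
  show "cf p m = cf (\<Sum>d\<le>D. hc d p) m"
  proof (cases "m \<in> supp p")
    case True
    then show ?thesis using assms[of m] by (simp add: lookup_sum lookup_hc)
  next
    case False
    then show ?thesis by (simp add: lookup_sum lookup_hc in_keys_iff)
  qed
qed

lemma hc_mult_form:
  assumes "p \<in> polys V" "q \<in> H V e"
  shows "hc (d + e) (p * q) = hc d p * q"
proof -
  define D where "D = Max (insert d (monom_deg ` supp p))"
  have "p = (\<Sum>d\<le>D. hc d p)" by (rule hc_decompose) (simp add: D_def)
  then have "p * q = (\<Sum>d'\<le>D. hc d' p * q)" by (simp flip: sum_distrib_right)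
  then have "hc (d + e) (p * q) = (\<Sum>d'\<le>D. hc (d + e) (hc d' p * q))" by (simp add: hc_sum)
  also have "\<dots> = (\<Sum>d'\<le>D. if d' = d then hc d p * q else 0)"
  proof (rule sum.cong)
    fix d'
    show "hc (d + e) (hc d' p * q) = (if d' = d then hc d p * q else 0)"
      using hc_form[OF H_mult[OF hc_H[OF assms(1)] assms(2)], of "d + e" d'] by auto
  qed simp
  also have "\<dots> = hc d p * q" by (simp add: D_def)
  finally show ?thesis .
qed

inductive_set idl :: "'w set \<Rightarrow> ('w, 'k::field) mpoly set \<Rightarrow> ('w, 'k) mpoly set" for V G where
  idl_0: "0 \<in> idl V G"
| idl_add: "p \<in> idl V G \<Longrightarrow> q \<in> idl V G \<Longrightarrow> p + q \<in> idl V G"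
| idl_mult: "q \<in> polys V \<Longrightarrow> g \<in> G \<Longrightarrow> q * g \<in> idl V G"

lemma polys_mult: "p \<in> polys V \<Longrightarrow> q \<in> polys V \<Longrightarrow> p * q \<in> polys V"
  and polys_add: "p \<in> polys V \<Longrightarrow> q \<in> polys V \<Longrightarrow> p + q \<in> polys V"
  and polys_0 [simp]: "0 \<in> polys V" and polys_1 [simp]: "1 \<in> polys V"
proof -
  show "p \<in> polys V \<Longrightarrow> q \<in> polys V \<Longrightarrow> p * q \<in> polys V"
    using keys_mult[of p q] by (fastforce simp: polys_def supp_add_nat)
  show "p \<in> polys V \<Longrightarrow> q \<in> polys V \<Longrightarrow> p + q \<in> polys V" using keys_add[of p q] by (fastforce simp: polys_def)
qed (auto simp: polys_def)

lemma polys_sum: "(\<And>i. i \<in> I \<Longrightarrow> f i \<in> polys V) \<Longrightarrow> sum f I \<in> polys V"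
  by (induction I rule: infinite_finite_induct) (auto intro: polys_add)

lemma idl_mult_left: "p \<in> idl V G \<Longrightarrow> r \<in> polys V \<Longrightarrow> r * p \<in> idl V G"
proof (induction rule: idl.induct)
  case (idl_mult q g)
  then show ?case using idl.idl_mult[OF polys_mult[of r V q]] by (simp add: mult.assoc)
qed (auto simp: distrib_left intro: idl.intros)

lemma gen_idl: "p \<in> gen V G D d \<Longrightarrow> p \<in> idl V G"
  by (induction rule: gen_induct) (auto intro: idl.intros H_polys)

lemma mat_mult_vec_index:
  assumes "v \<in> carrier_vec n" "q < m"
  shows "(mat m n (\<lambda>(q, j). g j q) *\<^sub>v v) $ q = (\<Sum>j<n. v $ j * (g j q :: 'r::comm_ring_1))"
proof -
  have "(mat m n (\<lambda>(q, j). g j q) *\<^sub>v v) $ q = (\<Sum>j\<in>{0..<n}. g j q * v $ j)"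
    using assms by (simp add: scalar_prod_def)
  then show ?thesis by (simp add: mult.commute lessThan_atLeast0)
qed

text \<open>The matrices of successive linear syzygies form the resolution, with all generators of
  the i-th module in degree \<open>M + i\<close>. The kernel sequence speaks of forms only;
  exactness for arbitrary vectors follows by splitting into homogeneous components.\<close>

theorem has_regularity_of_Reg:
  fixes a :: "'v::linorder \<Rightarrow> ('w, 'k::field) mpoly"
  assumes finA: "finite A" and finV: "finite V" and aH: "\<And>v. v \<in> A \<Longrightarrow> a v \<in> H V 1"
    and R0: "Reg a A V (Suc 0) (\<lambda>d. {0})" and R: "Reg a A V M (gen V G M)" and M: "0 < M"
    and G: "G \<subseteq> H V M" "\<exists>g\<in>G. g \<noteq> 0"
  shows "has_regularity V (idl V G) (int M)"
proof -
  define N where "N d = {f :: nat \<Rightarrow> ('w, 'k) mpoly. f 0 \<in> gen V G M d}" for d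
  have gG: "gid V (gen V G M)" by (rule gid_gen[OF G(1)])
  have N: "submod V 1 N"
    unfolding submod_def N_def by (auto simp: One_nat_def intro: gid_H[OF gG] gen_0 gen_add gid_mult[OF gG])
  have L: "linm a A 1 M N" unfolding N_def by (rule linm_ideal[OF finA finV aH R0 gG R M])
  obtain m and g :: "nat \<Rightarrow> nat \<Rightarrow> nat \<Rightarrow> ('w, 'k) mpoly" where m0: "m 0 = 1"
    and g0: "basis_of 1 (N M) (m 1) (g 0)"
    and gS: "\<And>i. basis_of (m (Suc i)) (ker V (m i) (m (Suc i)) (g i) 1) (m (Suc (Suc i))) (g (Suc i))"
    and ex: "\<And>i d h. h \<in> ker V (m i) (m (Suc i)) (g i) d \<Longrightarrow>
       \<exists>y. (\<forall>l<m (Suc (Suc i)). y l \<in> H V (d - 1)) \<and> (\<forall>j<m (Suc i). h j = (\<Sum>l<m (Suc (Suc i)). y l * g (Suc i) l j))"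
    using exists_kernel_sequence[OF finA finV aH R0 N L] by blast
  define b where "b i = replicate (m (Suc i)) (int (M + i))" for i
  define \<phi> where "\<phi> i = mat (m i) (m (Suc i)) (\<lambda>(q, j). g i j q)" for i
  have tb: "target_shifts b i = replicate (m i) (if i = 0 then 0 else int (M + i - 1))" for i
    using m0 by (cases i) (auto simp: target_shifts_def b_def One_nat_def)
  have gH: "g i j q \<in> H V (if i = 0 then M else 1)" if "j < m (Suc i)" "q < m i" for i j q
  proof (cases i)
    case 0
    then have "g 0 j \<in> N M" using g0 that by (simp add: basis_of_def One_nat_def)
    then show ?thesis using 0 that m0 gid_H[OF gG] by (simp add: N_def One_nat_def)
  next
    case (Suc i')
    then have "g (Suc i') j \<in> ker V (m i') (m (Suc i')) (g i') 1" using gS[of i'] that by (simp add: basis_of_def)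
    then show ?thesis using Suc that by (simp add: ker_def)
  qed
  have bl: "length (b i) = m (Suc i)" "length (target_shifts b i) = m i" for i by (simp_all add: b_def tb)
  have free: "v \<in> free_module V l \<longleftrightarrow> v \<in> carrier_vec l \<and> (\<forall>j<l. v $ j \<in> polys V)" for v :: "('w, 'k) mpoly vec" and l
    by (auto simp: free_module_def vec_set_def carrier_mpoly_ring)
  have free_vec: "vec l f \<in> free_module V l" if "\<And>j. j < l \<Longrightarrow> f j \<in> polys V" for l and f :: "nat \<Rightarrow> ('w, 'k) mpoly"
    using that by (simp add: free)
  have \<phi>v: "(\<phi> i *\<^sub>v v) $ q = (\<Sum>j<m (Suc i). v $ j * g i j q)" if "v \<in> carrier_vec (m (Suc i))" "q < m i" for i v q
    unfolding \<phi>_def by (rule mat_mult_vec_index[OF that])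
  have \<phi>c: "\<phi> i *\<^sub>v v \<in> carrier_vec (m i)" for i v by (simp add: \<phi>_def carrier_vecI)
  have image: "(\<lambda>v. (\<phi> 0 *\<^sub>v v) $ 0) ` free_module V (length (b 0)) = idl V G" (is "?im = _")
  proof
    show "?im \<subseteq> idl V G"
    proof
      fix p assume "p \<in> ?im"
      then obtain v where v: "v \<in> free_module V (m 1)" "p = (\<phi> 0 *\<^sub>v v) $ 0" by (auto simp: bl One_nat_def)
      then have "p = (\<Sum>j<m 1. v $ j * g 0 j 0)" using \<phi>v[of v 0 0] m0 by (simp add: free One_nat_def)
      moreover have "v $ j * g 0 j 0 \<in> idl V G" if "j < m 1" for j
      proof (rule idl_mult_left)
        show "v $ j \<in> polys V" using v(1) that by (simp add: free)
        have "g 0 j \<in> N M" using g0 that by (simp add: basis_of_def)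
        then show "g 0 j 0 \<in> idl V G" by (auto simp: N_def intro: gen_idl)
      qed
      then have "(\<Sum>j\<in>J. v $ j * g 0 j 0) \<in> idl V G" if "J \<subseteq> {..<m 1}" for J
        using that by (induction J rule: infinite_finite_induct) (auto intro: idl.intros)
      ultimately show "p \<in> idl V G" by simp
    qed
    show "idl V G \<subseteq> ?im"
    proof
      fix p assume "p \<in> idl V G"
      then have "\<exists>u. (\<forall>j<m 1. u j \<in> polys V) \<and> p = (\<Sum>j<m 1. u j * g 0 j 0)"
      proof (induction rule: idl.induct)
        case idl_0
        show ?case by (intro exI[of _ "\<lambda>_. 0"]) simp
      next
        case (idl_add p q)
        then obtain u u' where "\<forall>j<m 1. u j \<in> polys V" "p = (\<Sum>j<m 1. u j * g 0 j 0)"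
          "\<forall>j<m 1. u' j \<in> polys V" "q = (\<Sum>j<m 1. u' j * g 0 j 0)" by blast
        then show ?case
          by (intro exI[of _ "\<lambda>j. u j + u' j"]) (auto simp: distrib_right sum.distrib intro: polys_add)
      next
        case (idl_mult q h)
        have "1 * h \<in> gen V G M (0 + M)" using idl_mult by (intro gen_mult) auto
        then have "(\<lambda>_. h) \<in> N M" by (simp add: N_def)
        then obtain c where c: "h = (\<Sum>j<m 1. Const (c j) * g 0 j 0)"
          using g0 by (auto simp: basis_of_def One_nat_def)
        show ?case
        proof (intro exI[of _ "\<lambda>j. q * Const (c j)"] conjI allI impI)
          show "q * Const (c j) \<in> polys V" for j using idl_mult(1) H_polys[OF H_Const] by (rule polys_mult)
          show "q * h = (\<Sum>j<m 1. q * Const (c j) * g 0 j 0)"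
            by (subst c) (simp add: sum_distrib_left mult.assoc)
        qed
      qed
      then obtain u where u: "\<forall>j<m 1. u j \<in> polys V" "p = (\<Sum>j<m 1. u j * g 0 j 0)" by blast
      define v where "v = vec (m 1) u"
      have "v \<in> free_module V (m 1)" unfolding v_def using u(1) by (intro free_vec) auto
      moreover have "p = (\<phi> 0 *\<^sub>v v) $ 0" using \<phi>v[of v 0 0] m0 u(2) by (simp add: v_def One_nat_def)
      ultimately show "p \<in> ?im" by (simp add: bl One_nat_def)
    qed
  qed
  have exact: "{v \<in> free_module V (length (b i)). \<phi> i *\<^sub>v v = 0\<^sub>v (length (target_shifts b i))} =
      (\<lambda>v. \<phi> (Suc i) *\<^sub>v v) ` free_module V (length (b (Suc i)))" (is "?K = ?im") for i
  proof
    show "?im \<subseteq> ?K"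
    proof
      fix v assume "v \<in> ?im"
      then obtain y where y: "y \<in> free_module V (m (Suc (Suc i)))" "v = \<phi> (Suc i) *\<^sub>v y" by (auto simp: bl)
      have vc: "v \<in> carrier_vec (m (Suc i))" unfolding y(2) by (rule \<phi>c)
      have vj: "v $ j = (\<Sum>l<m (Suc (Suc i)). y $ l * g (Suc i) l j)" if "j < m (Suc i)" for j
        unfolding y(2) using y(1) that by (intro \<phi>v) (auto simp: free)
      have "v $ j \<in> polys V" if "j < m (Suc i)" for j unfolding vj[OF that] using y(1) gH[of _ "Suc i" j] that
        by (intro polys_sum polys_mult) (auto simp: free intro: H_polys)
      then have 1: "v \<in> free_module V (m (Suc i))" using vc by (simp add: free)
      have "\<phi> i *\<^sub>v v = 0\<^sub>v (m i)"
      proof (rule eq_vecI)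
        fix q assume q: "q < dim_vec (0\<^sub>v (m i))"
        have "(\<phi> i *\<^sub>v v) $ q = (\<Sum>j<m (Suc i). (\<Sum>l<m (Suc (Suc i)). y $ l * g (Suc i) l j) * g i j q)"
          using q by (simp add: \<phi>v[OF vc] vj)
        also have "\<dots> = (\<Sum>l<m (Suc (Suc i)). y $ l * (\<Sum>j<m (Suc i). g (Suc i) l j * g i j q))"
          unfolding sum_distrib_left sum_distrib_right by (subst sum.swap) (simp add: mult.assoc)
        also have "\<dots> = 0"
        proof (intro sum.neutral ballI)
          fix l assume "l \<in> {..<m (Suc (Suc i))}"
          then have "g (Suc i) l \<in> ker V (m i) (m (Suc i)) (g i) 1" using gS[of i] by (simp add: basis_of_def)
          then show "y $ l * (\<Sum>j<m (Suc i). g (Suc i) l j * g i j q) = 0" using q by (simp add: ker_def)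
        qed
        finally show "(\<phi> i *\<^sub>v v) $ q = 0\<^sub>v (m i) $ q" using q by simp
      qed (simp add: \<phi>_def)
      then show "v \<in> ?K" using 1 by (simp add: bl)
    qed
    show "?K \<subseteq> ?im"
    proof
      fix v assume "v \<in> ?K"
      then have v: "v \<in> free_module V (m (Suc i))" "\<phi> i *\<^sub>v v = 0\<^sub>v (m i)" by (simp_all add: bl)
      then have vc: "v \<in> carrier_vec (m (Suc i))" and vp: "\<And>j. j < m (Suc i) \<Longrightarrow> v $ j \<in> polys V" by (auto simp: free)
      have v0: "(\<Sum>j<m (Suc i). v $ j * g i j q) = 0" if "q < m i" for q
        using \<phi>v[OF vc that] v(2) that by simp
      define D where "D = Max (insert 0 (\<Union>j<m (Suc i). monom_deg ` supp (v $ j)))"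
      have D: "monom_deg \<mu> \<le> D" if "j < m (Suc i)" "\<mu> \<in> supp (v $ j)" for j \<mu>
        unfolding D_def using that by (intro Max_ge) auto
      \<comment> \<open>All entries of one matrix have the same degree, so taking components
        commutes with multiplication by it up to that shift.\<close>
      have hk: "(\<lambda>j. hc d (v $ j)) \<in> ker V (m i) (m (Suc i)) (g i) d" for d
      proof -
        have "(\<Sum>j<m (Suc i). hc d (v $ j) * g i j q) = 0" if q: "q < m i" for q
        proof -
          have "(\<Sum>j<m (Suc i). hc d (v $ j) * g i j q) =
              (\<Sum>j<m (Suc i). hc (d + (if i = 0 then M else 1)) (v $ j * g i j q))"
            using vp gH[OF _ q] by (intro sum.cong refl hc_mult_form[symmetric]) auto
          also have "\<dots> = hc (d + (if i = 0 then M else 1)) (\<Sum>j<m (Suc i). v $ j * g i j q)"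
            by (simp add: hc_sum)
          finally show ?thesis using v0[OF q] by simp
        qed
        then show ?thesis using vp by (auto simp: ker_def intro: hc_H)
      qed
      have "\<forall>d. \<exists>y. (\<forall>l<m (Suc (Suc i)). y l \<in> H V (d - 1)) \<and>
          (\<forall>j<m (Suc i). hc d (v $ j) = (\<Sum>l<m (Suc (Suc i)). y l * g (Suc i) l j))"
        using ex[OF hk] by blast
      then obtain y where y: "\<forall>d. (\<forall>l<m (Suc (Suc i)). y d l \<in> H V (d - 1)) \<and>
          (\<forall>j<m (Suc i). hc d (v $ j) = (\<Sum>l<m (Suc (Suc i)). y d l * g (Suc i) l j))"
        by (rule choice[THEN exE])
      define u where "u = vec (m (Suc (Suc i))) (\<lambda>l. \<Sum>d\<le>D. y d l)"
      have "u \<in> free_module V (m (Suc (Suc i)))"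
        unfolding u_def using y by (intro free_vec polys_sum) (blast intro: H_polys)
      moreover have "v = \<phi> (Suc i) *\<^sub>v u"
      proof (rule eq_vecI)
        fix j assume "j < dim_vec (\<phi> (Suc i) *\<^sub>v u)"
        then have j: "j < m (Suc i)" by (simp add: \<phi>_def)
        have "v $ j = (\<Sum>d\<le>D. hc d (v $ j))" by (rule hc_decompose) (rule D[OF j])
        also have "\<dots> = (\<Sum>d\<le>D. \<Sum>l<m (Suc (Suc i)). y d l * g (Suc i) l j)" using y j by (intro sum.cong) auto
        also have "\<dots> = (\<Sum>l<m (Suc (Suc i)). u $ l * g (Suc i) l j)"
          by (subst sum.swap) (simp add: u_def sum_distrib_right)
        also have "\<dots> = (\<phi> (Suc i) *\<^sub>v u) $ j" using j by (intro \<phi>v[symmetric]) (simp_all add: u_def)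
        finally show "v $ j = (\<phi> (Suc i) *\<^sub>v u) $ j" .
      qed (use vc in \<open>simp add: \<phi>_def\<close>)
      ultimately show "v \<in> ?im" by (simp add: bl)
    qed
  qed
  have elem: "e \<in> elements_mat (\<phi> i) \<Longrightarrow> \<exists>q<m i. \<exists>j<m (Suc i). e = g i j q" for e i
    unfolding elements_mat_def \<phi>_def by fastforce
  have res: "minimal_graded_free_resolution V (idl V G) b \<phi>"
    unfolding minimal_graded_free_resolution_def graded_free_resolution_def
  proof (intro conjI allI impI ballI)
    fix i
    show "\<phi> i \<in> carrier_mat (length (target_shifts b i)) (length (b i))" by (simp add: bl \<phi>_def)
    show "elements_mat (\<phi> i) \<subseteq> carrier (mpoly_ring V)" unfolding carrier_mpoly_ring
    proof
      fix e assume "e \<in> elements_mat (\<phi> i)"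
      then obtain q j where "q < m i" "j < m (Suc i)" "e = g i j q" using elem by blast
      then show "e \<in> polys V" using H_polys[OF gH] by simp
    qed
    fix q j assume qj: "q < length (target_shifts b i)" "j < length (b i)"
    have "g i j q \<in> H V (if i = 0 then M else 1)" using qj by (intro gH) (simp_all add: bl)
    then have "homogeneous (int (if i = 0 then M else 1)) (g i j q)" unfolding H_iff by (rule conjunct2)
    moreover have "b i ! j - target_shifts b i ! q = int (if i = 0 then M else 1)"
      using qj M unfolding tb by (simp add: b_def of_nat_diff)
    moreover have "\<phi> i $$ (q, j) = g i j q" using qj by (simp add: bl \<phi>_def)
    ultimately show "homogeneous (b i ! j - target_shifts b i ! q) (\<phi> i $$ (q, j))" by simp
  next
    fix i e assume i: "1 \<le> i" and "e \<in> elements_mat (\<phi> i)"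
    then obtain q j where "q < m i" "j < m (Suc i)" "e = g i j q" using elem by blast
    then have "e \<in> H V 1" using gH[of j i q] i by (auto simp: One_nat_def)
    then have "0 \<notin> supp e" by (auto simp: H_def)
    then show "cf e 0 = 0" by (simp add: in_keys_iff)
  qed (use image exact in auto)
  \<comment> \<open>A nonzero generator makes the first module nonzero, so the regularity is
    attained and not merely bounded.\<close>
  have "m 1 \<noteq> 0"
  proof
    assume "m 1 = 0"
    obtain h where h: "h \<in> G" "h \<noteq> 0" using G(2) by blast
    have "1 * h \<in> gen V G M (0 + M)" using h by (intro gen_mult) auto
    then have "(\<lambda>_. h) \<in> N M" by (simp add: N_def)
    then obtain c where "h = (\<Sum>j<m 1. Const (c j) * g 0 j 0)" using g0 by (auto simp: basis_of_def One_nat_def)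
    then show False using h \<open>m 1 = 0\<close> by simp
  qed
  show ?thesis unfolding has_regularity_def
  proof (intro exI[of _ b] exI[of _ \<phi>] conjI)
    show "\<exists>i. \<exists>j\<in>set (b i). int M = j - int i"
      using \<open>m 1 \<noteq> 0\<close> by (intro exI[of _ 0]) (simp add: b_def One_nat_def)
    show "\<forall>i. \<forall>j\<in>set (b i). j - int i \<le> int M" by (auto simp: b_def)
  qed (rule res)
qed

subsection \<open>Powers of ideals of minors in general position\<close>

lemma Reg_cong: "(\<And>v. v \<in> A \<Longrightarrow> a v = a' v) \<Longrightarrow> Reg a A V m B \<longleftrightarrow> Reg a' A V m B"
proof -
  assume eq: "\<And>v. v \<in> A \<Longrightarrow> a v = a' v"
  have "bd a A = bd a' A" by (intro ext) (auto simp: bd_def eq intro: sum.cong)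
  then show ?thesis by (simp add: Reg_def)
qed

lemma mprods_subst_H:
  assumes "\<And>v. v \<in> gv n \<Longrightarrow> s v \<in> H V 1"
  shows "subst s ` mprods n k \<subseteq> H V (2 * k)"
proof
  fix p assume "p \<in> subst s ` mprods n k"
  then obtain g where "p = subst s g" "g \<in> H (gv n) (2 * k)" using mprods_H by blast
  then show "p \<in> H V (2 * k)" using subst_H[of g "gv n" "2 * k" s V] assms by blast
qed

lemma subst_gen:
  assumes s: "\<And>v. v \<in> A \<Longrightarrow> s v \<in> H B 1" and G: "\<And>g. g \<in> G \<Longrightarrow> subst s g \<in> G'" and "p \<in> gen A G D d"
  shows "subst s p \<in> gen B G' D d" using assms(3)
proof (induction rule: gen_induct)
  case (mult e q g)
  from gen_mult[OF subst_H[OF mult(1) s] G[OF mult(2)]] show ?case by (simp add: subst.hom_mult)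
qed (auto simp: subst.hom_add intro: gen_0 gen_add)

lemma minus_subst_mem:
  assumes B: "gid A B" and s: "\<And>v. v \<in> A \<Longrightarrow> s v \<in> H A 1" and 1: "\<And>v. v \<in> A \<Longrightarrow> Var v - s v \<in> B 1"
    and p: "p \<in> H A d"
  shows "p - subst s p \<in> B d" using p
proof (induction rule: H_induct)
  case zero
  show ?case using gid_0[OF B] by simp
next
  case (add p q)
  have "p + q - subst s (p + q) = (p - subst s p) + (q - subst s q)" by (simp add: subst.hom_add)
  then show ?case using gid_add[OF B add(3,4)] by (simp only:)
next
  case (mon c m)
  have "mon m - subst s (mon m) \<in> B d" using mon
  proof (induction d arbitrary: m)
    case 0
    then show ?case using gid_0[OF B] by simp
  next
    case (Suc d)
    obtain v m' where m: "v \<in> supp m" "m = expo v + m'" "monom_deg m' = d" "supp m' \<subseteq> supp m"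
      using monom_deg_SucE[OF Suc.prems(2)] .
    have m': "supp m' \<subseteq> A" and v: "v \<in> A" using m Suc.prems(1) by auto
    have "mon m - subst s (mon m) = mon m' * (Var v - s v) + s v * (mon m' - subst s (mon m'))"
      by (simp add: m(2) mon_mult Var_mon[symmetric] subst.hom_mult algebra_simps)
    moreover have "mon m' * (Var v - s v) \<in> B (Suc d)"
      using gid_mult[OF B H_mon[OF m'] 1[OF v]] m(3) by (simp add: One_nat_def)
    moreover have "s v * (mon m' - subst s (mon m')) \<in> B (Suc d)"
      by (intro gid_mult1[OF B s[OF v]] Suc.IH m' m(3))
    ultimately show ?case using gid_add[OF B] by metis
  qed
  from gid_Const[OF B this, of c] show ?case by (simp add: subst.hom_mult right_diff_distrib)
qed

text \<open>\<open>fm\<close> lists the entries and then the variables; \<open>Bs\<close> is a basis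
  of the span of the entries, and \<open>A\<close> enlarges it to one of all linear forms. The bound
  passes from the generic powers to the ring in \<open>Bs\<close> by the section, to the ring in
  \<open>A\<close> by adjoining variables, and to \<open>V\<close> by the linear isomorphism
  \<open>fm\<close>.\<close>

lemma Reg_gpos:
  fixes ent :: "nat \<Rightarrow> ('v, 'k::field) mpoly"
  assumes V: "finite V" and n: "0 < n" and ent: "\<And>r. r < 2 * n \<Longrightarrow> ent r \<in> H V 1" and gp: "gpos V n ent"
  shows "\<exists>A (fm :: nat \<Rightarrow> ('v, 'k) mpoly). finite A \<and> (\<forall>a\<in>A. fm a \<in> H V 1) \<and> Reg fm A V (Suc 0) (\<lambda>d. {0}) \<and>
    (\<forall>k>0. Reg fm A V (2 * k) (gen V (subst ent ` mprods n k) (2 * k)))"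
proof -
  obtain vs where vs: "set vs = V" "distinct vs" using finite_distinct_list[OF V] by blast
  define fm where "fm r = (if r < 2 * n then ent r else Var (vs ! (r - 2 * n)))" for r
  have comb: "\<exists>c. fm r = (\<Sum>b\<in>B. Const (c b) * fm b)" if "finite B" "fm r \<in> mp.span (fm ` B \<union> {0})" for r B
    using mp.span_family_mod[OF mp.subspace_single_0 that] by simp
  have "indep_mod {0} fm {}" by (simp add: indep_mod_def)
  from indep_mod_extend[OF mp.subspace_single_0 _ _ this, of "gv n"] obtain Bs where
    Bs: "Bs \<subseteq> gv n" "indep_mod {0} fm Bs" "\<And>r. r \<in> gv n \<Longrightarrow> fm r \<in> mp.span (fm ` Bs \<union> {0})" by auto
  have finB: "finite Bs" using finite_subset[OF Bs(1)] by simp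
  let ?F = "{2 * n..<2 * n + length vs}"
  obtain A where A: "Bs \<subseteq> A" "A \<subseteq> Bs \<union> ?F" "indep_mod {0} fm A"
    "\<And>r. r \<in> ?F \<Longrightarrow> fm r \<in> mp.span (fm ` A \<union> {0})"
    using indep_mod_extend[OF mp.subspace_single_0 finite_atLeastLessThan[of "2 * n" "2 * n + length vs"] finB Bs(2)] by blast
  have finA: "finite A" using A(2) finB finite_subset by blast
  have fmH: "fm r \<in> H V 1" if "r < 2 * n + length vs" for r
    using that ent vs(1) nth_mem[of "r - 2 * n" vs] by (auto simp: fm_def intro!: H_Var)
  have A_less: "r < 2 * n + length vs" if "r \<in> A" for r using that A(2) Bs(1) by fastforce
  have "\<forall>r. \<exists>c. r < 2 * n \<longrightarrow> fm r = (\<Sum>b\<in>Bs. Const (c b) * fm b)" using comb[OF finB Bs(3)] by auto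
  then obtain lam where lam: "\<And>r. r < 2 * n \<Longrightarrow> fm r = (\<Sum>b\<in>Bs. Const (lam r b) * fm b)" by metis
  have fmB: "fm b = ent b" if "b \<in> Bs" for b using that Bs(1) by (auto simp: fm_def)
  have lam': "ent r = (\<Sum>b\<in>Bs. Const (lam r b) * ent b)" if "r < 2 * n" for r
  proof -
    have "ent r = fm r" using that by (simp add: fm_def)
    also have "\<dots> = (\<Sum>b\<in>Bs. Const (lam r b) * ent b)" unfolding lam[OF that] by (intro sum.cong) (auto simp: fmB)
    finally show ?thesis .
  qed
  define rl where "rl = sorted_list_of_set (gv n - Bs)"
  have rl: "distinct rl" "set rl = gv n - Bs" by (simp_all add: rl_def)
  \<comment> \<open>Eliminates the redundant entries; on linear forms its kernel is spanned by the
    \<open>th\<close>.\<close>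
  define \<rho> where "\<rho> v = (if v \<in> Bs then Var v else \<Sum>b\<in>Bs. Const (lam v b) * Var b :: (nat, 'k) mpoly)" for v
  define th where "th i = Var (rl ! i) - \<rho> (rl ! i)" for i
  have \<rho>H: "\<rho> v \<in> H Bs 1" for v by (auto simp: \<rho>_def intro!: H_Var H_sum H_Const_mult)
  have \<rho>H': "\<rho> v \<in> H (gv n) 1" for v using \<rho>H[of v] H_mono[OF Bs(1)] by blast
  have rl_mem: "rl ! i \<in> gv n - Bs" if "i < length rl" for i using that rl(2) nth_mem by metis
  have th_eq: "th i = Var (rl ! i) - (\<Sum>b\<in>Bs. Const (lam (rl ! i) b) * Var b)" if "i < length rl" for i
    using rl_mem[OF that] by (simp add: th_def \<rho>_def)
  have thH: "th i \<in> H (gv n) 1" if "i < length rl" for i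
    unfolding th_def using rl_mem[OF that] by (intro H_diff H_Var \<rho>H') auto
  have \<rho>_th: "subst \<rho> (th i) = 0" if "i < length rl" for i
  proof -
    have "subst \<rho> (\<rho> (rl ! i)) = \<rho> (rl ! i)" by (rule subst_fixes[OF \<rho>H]) (simp add: \<rho>_def)
    then show ?thesis by (simp add: th_def subst.hom_minus)
  qed
  define G where "G k = subst \<rho> ` mprods n k" for k
  have GH: "G k \<subseteq> H Bs (2 * k)" for k unfolding G_def by (rule mprods_subst_H[OF \<rho>H])
  have RegB: "Reg Var A A (2 * k) (gen A (G k) (2 * k))" if k: "0 < k" for k
  proof -
    let ?B = "BK n k th (length rl)"
    have R: "Reg Var (gv n) (gv n) (2 * k) ?B"
      by (rule Reg_BK[OF n thH regular_of_gpos[OF V n ent gp Bs(1) lam' rl th_eq]]) auto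
    have B: "gid (gv n) ?B" by (rule gid_BK[OF thH])
    have th1: "Var v - \<rho> v \<in> BK n k th (length rl) 1" if v: "v \<in> gv n" for v
    proof (cases "v \<in> Bs")
      case True
      then show ?thesis using gid_0[OF B] by (simp add: \<rho>_def)
    next
      case False
      then obtain i where i: "i < length rl" "rl ! i = v" using v rl(2) by (metis DiffI in_set_conv_nth)
      have "th i * 1 \<in> BK n k th (length rl) (Suc 0)" by (rule BK_th[OF thH i(1) H_one])
      then show ?thesis using i by (simp add: th_def One_nat_def)
    qed
    have \<rho>B: "p - subst \<rho> p \<in> ?B d" if "p \<in> H (gv n) d" for p d
      by (rule minus_subst_mem[OF B \<rho>H' th1 that])
    have GB: "gen Bs (G k) (2 * k) d \<subseteq> ?B d" for d
    proof
      fix p assume "p \<in> gen Bs (G k) (2 * k) d"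
      then show "p \<in> ?B d"
      proof (induction rule: gen_induct)
        case (mult e q g)
        then obtain g' where g': "g = subst \<rho> g'" "g' \<in> mprods n k" by (auto simp: G_def)
        have "1 * g' \<in> IK n k (0 + 2 * k)" unfolding IK_def by (rule gen_mult[OF H_one g'(2)])
        then have "g' \<in> ?B (2 * k)" using BK_mono[of "length rl" th n 0 k] thH by auto
        moreover have "g' - g \<in> ?B (2 * k)" unfolding g'(1) using \<rho>B g'(2) mprods_H by blast
        ultimately have "g' - (g' - g) \<in> ?B (2 * k)" by (rule gid_diff[OF B])
        then have "g \<in> ?B (2 * k)" by simp
        moreover have "q \<in> H (gv n) e" using mult(1) H_mono[OF Bs(1)] by blast
        ultimately show ?case using gid_mult[OF B] by blast
      qed (auto intro: gid_0[OF B] gid_add[OF B])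
    qed
    have BG: "subst \<rho> p \<in> gen Bs (G k) (2 * k) d" if "p \<in> ?B d" for p d
    proof -
      have "subst \<rho> p \<in> gen Bs (G k) (2 * k) d" if "i \<le> length rl" "p \<in> BK n k th i d" for i using that
      proof (induction i arbitrary: p)
        case 0
        then show ?case unfolding BK.simps IK_def by (intro subst_gen[OF \<rho>H]) (auto simp: G_def)
      next
        case (Suc i)
        then obtain b u where "p = b + th i * u" "b \<in> BK n k th i d" by (auto simp: gplus_def)
        then show ?case using Suc.IH[of b] Suc.prems(1) \<rho>_th[of i] by (simp add: subst.hom_add subst.hom_mult)
      qed
      then show ?thesis using that by blast
    qed
    have "Reg (\<lambda>v. subst \<rho> (Var v)) (gv n) Bs (2 * k) (gen Bs (G k) (2 * k))"
    proof (rule Reg_section[OF R B _ Bs(1)])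
      show "Var v - subst \<rho> (Var v) \<in> ?B 1" if "v \<in> gv n" for v using th1[OF that] by simp
    qed (use GB BG \<rho>H in \<open>auto simp: \<rho>_def intro: H_Var\<close>)
    then have "Reg \<rho> (Bs \<union> (gv n - Bs)) Bs (2 * k) (gen Bs (G k) (2 * k))" using Bs(1) by (simp add: Un_absorb1)
    then have "Reg \<rho> Bs Bs (2 * k) (gen Bs (G k) (2 * k))"
    proof (rule Reg_drops[rotated -1])
      show "\<rho> r = (\<Sum>v\<in>Bs. Const (lam r v) * \<rho> v)" if "r \<in> gv n - Bs" for r
        using that by (auto simp: \<rho>_def intro: sum.cong)
    qed (use finB gid_gen[OF GH] in auto)
    then have "Reg Var Bs Bs (2 * k) (gen Bs (G k) (2 * k))"
      using Reg_cong[of Bs \<rho> Var] by (simp add: \<rho>_def)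
    moreover obtain k' where k': "2 * k = Suc k'" using k by (cases "2 * k") auto
    ultimately have "Reg Var (Bs \<union> (A - Bs)) (Bs \<union> (A - Bs)) (2 * k) (gen (Bs \<union> (A - Bs)) (G k) (2 * k))"
      unfolding k' using finB finA GH[of k, unfolded k'] by (intro Reg_adjoin_vars) auto
    then show ?thesis using A(1) by (simp add: Un_absorb1)
  qed
  have "\<forall>u. \<exists>c. u \<in> V \<longrightarrow> Var u = (\<Sum>a\<in>A. Const (c a) * fm a)"
  proof
    fix u
    show "\<exists>c. u \<in> V \<longrightarrow> Var u = (\<Sum>a\<in>A. Const (c a) * fm a)"
    proof (cases "u \<in> V")
      case True
      then obtain i where i: "i < length vs" "vs ! i = u" using vs(1) by (metis in_set_conv_nth)
      then show ?thesis using comb[OF finA A(4)[of "2 * n + i"]] by (simp add: fm_def)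
    qed simp
  qed
  then obtain \<tau> where \<tau>: "\<And>u. u \<in> V \<Longrightarrow> Var u = (\<Sum>a\<in>A. Const (\<tau> u a) * fm a)" by metis
  define t where "t u = (\<Sum>a\<in>A. Const (\<tau> u a) * Var a :: (nat, 'k) mpoly)" for u
  have tH: "t u \<in> H A 1" for u unfolding t_def by (intro H_sum H_Const_mult H_Var)
  have fmA: "fm a \<in> H V 1" if "a \<in> A" for a using fmH A_less that by blast
  have st: "subst fm (subst t p) = p" if "p \<in> H V d" for p d unfolding subst_comp
  proof (rule subst_fixes[OF that])
    show "subst fm (t u) = Var u" if "u \<in> V" for u
      using \<tau>[OF that] by (simp add: t_def subst.hom_sum subst.hom_mult)
  qed
  have inj: "p = 0" if p: "p \<in> H A 1" "subst fm p = 0" for p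
  proof -
    have "p = (\<Sum>a\<in>A. Const (cf p (expo a)) * Var a)" by (rule H1_expand[OF p(1) finA])
    moreover from arg_cong[OF this, of "subst fm"] have "subst fm p = (\<Sum>a\<in>A. Const (cf p (expo a)) * fm a)"
      by (simp only: subst.hom_mult subst.hom_sum subst_Const subst_Var)
    then have "\<forall>a\<in>A. cf p (expo a) = 0" using A(3) p(2) unfolding indep_mod_def by (metis singletonI)
    ultimately show ?thesis by simp
  qed
  have ts: "subst t (subst fm (Var a)) = Var a" if "a \<in> A" for a
  proof -
    have "subst t (fm a) - Var a = 0"
    proof (rule inj)
      show "subst t (fm a) - Var a \<in> H A 1" using subst_H[OF fmA[OF that] tH] that by (intro H_diff H_Var)
      show "subst fm (subst t (fm a) - Var a) = 0" using st[OF fmA[OF that]] by (simp add: subst.hom_minus)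
    qed
    then show ?thesis by simp
  qed
  have ts': "subst t (subst fm p) = p" if "p \<in> H A d" for p d
    unfolding subst_comp by (rule subst_fixes[OF that]) (use ts in simp)
  have fm_G: "subst fm ` G k = subst ent ` mprods n k" for k
  proof -
    have "subst fm (subst \<rho> g) = subst ent g" if g: "g \<in> mprods n k" for g
    proof -
      have "subst fm (\<rho> v) = ent v" if "v \<in> gv n" for v
        using that fmB lam'[of v] by (auto simp: \<rho>_def subst.hom_sum subst.hom_mult intro!: sum.cong)
      moreover have "g \<in> H (gv n) (2 * k)" using g mprods_H by blast
      ultimately show ?thesis unfolding subst_comp
        by (intro subst_cong[of _ "gv n"]) (auto simp: H_def polys_def)
    qed
    then show ?thesis by (auto simp: G_def image_image)
  qed
  have GA: "G k \<subseteq> H A (2 * k)" for k using GH[of k] H_mono[OF A(1)] by blast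
  have "Reg (\<lambda>v. subst fm (Var v)) A V (2 * k) (gen V (subst ent ` mprods n k) (2 * k))" if k: "0 < k" for k
  proof (rule Reg_iso[OF RegB[OF k] fmA tH st ts])
    fix d p
    assume "p \<in> gen V (subst ent ` mprods n k) (2 * k) d"
    then show "subst t p \<in> gen A (G k) (2 * k) d"
    proof (rule subst_gen[OF tH, rotated])
      fix g assume "g \<in> subst ent ` mprods n k"
      then obtain g' where "g = subst fm g'" "g' \<in> G k" using fm_G by blast
      then show "subst t g \<in> G k" using ts' GA by (metis subsetD)
    qed
  next
    fix d p
    assume "p \<in> gen A (G k) (2 * k) d"
    then show "subst fm p \<in> gen V (subst ent ` mprods n k) (2 * k) d"
      using fm_G by (intro subst_gen[OF fmA]) auto
  qed
  moreover have "Reg (\<lambda>v. subst fm (Var v)) A V (Suc 0) (\<lambda>d. {0})"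
    by (rule Reg_iso[OF Reg_zero_ideal[OF finA] fmA tH st ts]) auto
  ultimately show ?thesis using finA fmA by (intro exI[of _ A] exI[of _ fm]) simp
qed

section \<open>Zero divisors, generated ideals and powers of ideals\<close>

lemma subst_fixes_polys:
  assumes "p \<in> polys V" "\<And>v. v \<in> V \<Longrightarrow> s v = Var v"
  shows "subst s p = p"
proof -
  have "subst s p = subst Var p" by (rule subst_cong) (use assms in \<open>auto simp: polys_def\<close>)
  then show ?thesis by (simp add: subst_id)
qed

text \<open>Only finitely many indeterminates occur; renamed to natural numbers they are ordered,
  and a compatible order on exponents excludes zero divisors.\<close>

lemma mpoly_no_zero_divisors:
  fixes p q :: "('v, 'k::field) mpoly"
  assumes "p * q = 0"
  shows "p = 0 \<or> q = 0"
proof -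
  define W where "W = (\<Union>m\<in>supp p \<union> supp q. supp m)"
  have "finite W" unfolding W_def by auto
  then obtain f :: "'v \<Rightarrow> nat" where f: "inj_on f W" using finite_imp_inj_to_nat_seg by metis
  define s where "s v = (Var (f v) :: (nat, 'k) mpoly)" for v
  define t where "t i = (Var (inv_into W f i) :: ('v, 'k) mpoly)" for i
  have ts: "subst t (subst s r) = r" if "r \<in> polys W" for r
    unfolding subst_comp by (rule subst_fixes_polys[OF that]) (simp add: s_def t_def f)
  have "p \<in> polys W" "q \<in> polys W" by (auto simp: W_def polys_def)
  then have pq: "subst t (subst s p) = p" "subst t (subst s q) = q" using ts by auto
  have "subst s p * subst s q = 0" using assms by (simp flip: subst.hom_mult)
  then have "subst s p = 0 \<or> subst s q = 0" by simp
  then show ?thesis using pq subst.hom_zero by metis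
qed

lemma genideal_idl:
  assumes "G \<subseteq> polys V"
  shows "genideal (mpoly_ring V) G = idl V (G :: ('v, 'k::field) mpoly set)"
proof -
  interpret R: cring "mpoly_ring V :: ('v, 'k) mpoly ring" by (rule cring_mpoly_ring)
  have sub: "p \<in> polys V" if "p \<in> idl V G" for p
    using that by (induction rule: idl.induct) (use assms in \<open>auto intro: polys_add polys_mult\<close>)
  have id: "ideal (idl V G) (mpoly_ring V)"
  proof (rule idealI)
    show "ring (mpoly_ring V :: ('v, 'k) mpoly ring)" by (rule R.ring_axioms)
    have "\<ominus>\<^bsub>mpoly_ring V\<^esub> p \<in> idl V G" if p: "p \<in> idl V G" for p
    proof -
      have "Const (- 1) * p \<in> idl V G" by (rule idl_mult_left[OF p H_polys[OF H_Const]])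
      moreover have "\<ominus>\<^bsub>mpoly_ring V\<^esub> p = Const (- 1) * p"
      proof (rule R.minus_equality)
        have "Const (- 1) * p + p = 0" by (simp add: Const_uminus)
        then show "Const (- 1) * p \<oplus>\<^bsub>mpoly_ring V\<^esub> p = \<zero>\<^bsub>mpoly_ring V\<^esub>" by (simp only: mpoly_ring_simps)
        show "p \<in> carrier (mpoly_ring V)" "Const (- 1) * p \<in> carrier (mpoly_ring V)"
          unfolding carrier_mpoly_ring using sub p polys_mult[OF H_polys[OF H_Const]] by blast+
      qed
      ultimately show ?thesis by simp
    qed
    then show "subgroup (idl V G) (add_monoid (mpoly_ring V))" using sub idl.idl_0 idl.idl_add
      by (intro subgroup.intro) (auto simp: carrier_mpoly_ring a_inv_def simp del: mpoly_ring_simps(1))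
  qed (use idl_mult_left in \<open>auto simp: carrier_mpoly_ring mult.commute simp del: mpoly_ring_simps(1)\<close>)
  have "G \<subseteq> idl V G"
  proof
    fix g assume "g \<in> G"
    from idl.idl_mult[OF polys_1 this] show "g \<in> idl V G" by simp
  qed
  then have "genideal (mpoly_ring V) G \<subseteq> idl V G" by (rule R.genideal_minimal[OF id])
  moreover have "p \<in> genideal (mpoly_ring V) G" if "p \<in> idl V G" for p
  proof -
    have Gc: "G \<subseteq> carrier (mpoly_ring V)" using assms unfolding carrier_mpoly_ring .
    interpret I: ideal "genideal (mpoly_ring V) G" "mpoly_ring V" by (rule R.genideal_ideal[OF Gc])
    from that show ?thesis
    proof (induction rule: idl.induct)
      case idl_0
      then show ?case using I.zero_closed by simp
    next
      case (idl_add p q)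
      then show ?case using I.a_closed[of p q] by simp
    next
      case (idl_mult q g)
      then show ?case using I.I_l_closed[of g q] R.genideal_self[OF Gc] unfolding carrier_mpoly_ring by auto
    qed
  qed
  ultimately show ?thesis by blast
qed

lemma ideal_prod_idl:
  assumes "G \<subseteq> polys V"
  shows "ideal_prod (mpoly_ring V) (idl V G) (idl V G') = idl V {g * g' | g g'. g \<in> G \<and> g' \<in> (G' :: ('v, 'k::field) mpoly set)}"
    (is "?P = idl V ?G")
proof
  have mult: "p * q \<in> idl V ?G" if "p \<in> idl V G" "q \<in> idl V G'" for p q using that
  proof (induction rule: idl.induct)
    case (idl_mult r g)
    from idl_mult(3) have "g * q \<in> idl V ?G"
    proof (induction rule: idl.induct)
      case (idl_mult r' g')
      then have "r' * (g * g') \<in> idl V ?G" using \<open>g \<in> G\<close> by (intro idl.idl_mult) auto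
      then show ?case by (simp add: mult_ac)
    qed (auto simp: distrib_left intro: idl.intros)
    from idl_mult_left[OF this idl_mult(1)] show ?case by (simp add: mult.assoc)
  qed (auto simp: distrib_right intro: idl.intros)
  show "?P \<subseteq> idl V ?G"
  proof
    fix p assume "p \<in> ?P"
    then show "p \<in> idl V ?G" by (induction rule: ideal_prod.induct) (auto intro: mult idl.idl_add)
  qed
  have prod: "p * q \<in> ?P" if "p \<in> idl V G" "q \<in> idl V G'" for p q
    using ideal_prod.prod[OF that, of "mpoly_ring V"] by simp
  show "idl V ?G \<subseteq> ?P"
  proof
    fix p assume "p \<in> idl V ?G"
    then show "p \<in> ?P"
    proof (induction rule: idl.induct)
      case idl_0
      show ?case using prod[OF idl.idl_0 idl.idl_0] by simp
    next
      case (idl_add p q)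
      then show ?case using ideal_prod.sum[OF idl_add(3,4)] by simp
    next
      case (idl_mult r h)
      then obtain g g' where "h = g * g'" "g \<in> G" "g' \<in> G'" by auto
      then have "r * g * (1 * g') \<in> ?P" using idl_mult(1) by (intro prod idl.idl_mult) auto
      then show ?case by (simp add: \<open>h = g * g'\<close> mult.assoc)
    qed
  qed
qed

lemma idl_mprods_pow:
  assumes ent: "\<And>r. r \<in> gv n \<Longrightarrow> ent r \<in> H V 1"
  shows "idl V (subst ent ` mprods n 1) [^]\<^bsub>ideals_set (mpoly_ring V)\<^esub> k =
    idl V (subst ent ` mprods n k :: ('v, 'k::field) mpoly set)"
proof (induction k)
  case 0
  have "idl V {1 :: ('v, 'k) mpoly} = polys V"
  proof
    show "idl V {1 :: ('v, 'k) mpoly} \<subseteq> polys V"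
    proof
      fix p :: "('v, 'k) mpoly" assume "p \<in> idl V {1}"
      then show "p \<in> polys V" by (induction rule: idl.induct) (auto intro: polys_add)
    qed
    show "polys V \<subseteq> idl V {1 :: ('v, 'k) mpoly}"
    proof
      fix p :: "('v, 'k) mpoly" assume "p \<in> polys V"
      from idl.idl_mult[OF this, of 1 "{1}"] show "p \<in> idl V {1}" by simp
    qed
  qed
  then show ?case
    by (simp add: nat_pow_def ideals_set_def carrier_mpoly_ring subst.hom_one del: mpoly_ring_simps(1))
next
  case (Suc k)
  have pol: "subst ent ` mprods n k \<subseteq> polys V" for k using mprods_subst_H[of n ent V k] ent H_polys by blast
  have "{g * g' | g g'. g \<in> subst ent ` mprods n k \<and> g' \<in> subst ent ` mprods n 1} = subst ent ` mprods n (Suc k)" (is "?L = ?R")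
  proof
    show "?L \<subseteq> ?R"
    proof
      fix p assume "p \<in> ?L"
      then obtain g i j where g: "p = subst ent g * subst ent (gminor n i j * 1)" "g \<in> mprods n k" "i < n" "j < n"
        by (auto simp: One_nat_def)
      then have "p = subst ent (gminor n i j * g)" by (simp add: subst.hom_mult mult.commute)
      then show "p \<in> ?R" using g by auto
    qed
    show "?R \<subseteq> ?L"
    proof
      fix p assume "p \<in> ?R"
      then obtain g i j where g: "p = subst ent (gminor n i j * g)" "g \<in> mprods n k" "i < n" "j < n" by auto
      then have "p = subst ent g * subst ent (gminor n i j * 1)" by (simp add: subst.hom_mult mult.commute)
      moreover have "gminor n i j * 1 \<in> mprods n 1" using g by (auto simp: One_nat_def)
      ultimately show "p \<in> ?L" using g(2) by blast
    qed
  qed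
  then show ?case using Suc ideal_prod_idl[OF pol, of k "subst ent ` mprods n 1"]
    by (simp add: nat_pow_def ideals_set_def)
qed

section \<open>Minors of a matrix with two rows\<close>

lemma det_2x2:
  fixes A :: "'a::comm_ring_1 mat"
  assumes A: "A \<in> carrier_mat 2 2"
  shows "det A = A $$ (0, 0) * A $$ (1, 1) - A $$ (0, 1) * A $$ (1, 0)"
proof -
  have d: "det (mat_delete A 0 j) = A $$ (1, if j = 0 then 1 else 0)" if "j < 2" for j
  proof -
    have "mat_delete A 0 j \<in> carrier_mat 1 1" using A mat_delete_carrier[OF A] by (simp add: One_nat_def)
    then have "det (mat_delete A 0 j) = mat_delete A 0 j $$ (0, 0)" by (rule det_single)
    also have "\<dots> = A $$ (1, if j = 0 then 1 else 0)" using A that by (auto simp: mat_delete_def One_nat_def)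
    finally show ?thesis .
  qed
  have "det A = (\<Sum>j<2. A $$ (0, j) * cofactor A 0 j)" by (rule laplace_expansion_row[OF A]) simp
  also have "{..<2 :: nat} = {0, 1}" by auto
  finally show ?thesis by (simp add: cofactor_def d)
qed

lemma minors_2:
  assumes X: "ent \<in> carrier_mat 2 n"
  shows "minors 2 ent = {ent $$ (0, i) * ent $$ (1, j) - ent $$ (0, j) * ent $$ (1, i) | i j. i < j \<and> j < n}"
proof -
  have sub: "det (submatrix ent {..<2} {i, j}) = ent $$ (0, i) * ent $$ (1, j) - ent $$ (0, j) * ent $$ (1, i)"
    if ij: "i < j" "j < n" for i j
  proof -
    let ?S = "submatrix ent {..<2} {i, j}"
    have 1: "{k. k < n \<and> k \<in> {i, j}} = {i, j}" using ij by auto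
    have 2: "{k. k < 2 \<and> k \<in> {..<2 :: nat}} = {0, 1}" by auto
    have 3: "dim_row ent = 2" "dim_col ent = n" using X by simp_all
    have S: "?S \<in> carrier_mat 2 2"
      by (rule carrier_matI) (use ij in \<open>simp_all only: dim_submatrix 1 2 3, simp_all\<close>)
    have r: "card {a \<in> {..<2 :: nat}. a < 0} = 0" "card {a \<in> {..<2 :: nat}. a < 1} = 1"
    proof -
      have "{a \<in> {..<2 :: nat}. a < 1} = {0}" by auto
      then show "card {a \<in> {..<2 :: nat}. a < 1} = 1" by (simp only:) simp
    qed simp
    have c: "card {a \<in> {i, j}. a < i} = 0" "card {a \<in> {i, j}. a < j} = 1"
    proof -
      have "{a \<in> {i, j}. a < i} = {}" "{a \<in> {i, j}. a < j} = {i}" using ij by auto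
      then show "card {a \<in> {i, j}. a < i} = 0" "card {a \<in> {i, j}. a < j} = 1" by simp_all
    qed
    have e: "?S $$ (card {a \<in> {..<2}. a < p}, card {a \<in> {i, j}. a < q}) = ent $$ (p, q)" if "p < 2" "q \<in> {i, j}" for p q
      using X ij that by (intro submatrix_index_card) auto
    show ?thesis unfolding det_2x2[OF S] using e[of 0 i] e[of 0 j] e[of 1 i] e[of 1 j] unfolding r c by simp
  qed
  show ?thesis
  proof
    show "minors 2 ent \<subseteq> {ent $$ (0, i) * ent $$ (1, j) - ent $$ (0, j) * ent $$ (1, i) | i j. i < j \<and> j < n}"
    proof
      fix p assume "p \<in> minors 2 ent"
      then obtain A B where p: "p = det (submatrix ent A B)" "A \<subseteq> {..<2}" "B \<subseteq> {..<n}" "card A = 2" "card B = 2"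
        using X by (auto simp: minors_def)
      have "A = {..<2}" using p(2,4) by (intro card_subset_eq) auto
      obtain x y where xy: "B = {x, y}" "x \<noteq> y" using p(5) by (auto simp: card_2_iff)
      have "\<exists>i j. B = {i, j} \<and> i < j"
      proof (cases "x < y")
        case True
        then show ?thesis using xy by blast
      next
        case False
        then have "B = {y, x}" "y < x" using xy by auto
        then show ?thesis by blast
      qed
      then obtain i j where ij: "B = {i, j}" "i < j" by blast
      then have "j < n" using p(3) by auto
      then show "p \<in> {ent $$ (0, i) * ent $$ (1, j) - ent $$ (0, j) * ent $$ (1, i) | i j. i < j \<and> j < n}"
        using sub[OF ij(2)] p(1) ij \<open>A = {..<2}\<close> by blast
    qed
    show "{ent $$ (0, i) * ent $$ (1, j) - ent $$ (0, j) * ent $$ (1, i) | i j. i < j \<and> j < n} \<subseteq> minors 2 ent"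
    proof
      fix p assume "p \<in> {ent $$ (0, i) * ent $$ (1, j) - ent $$ (0, j) * ent $$ (1, i) | i j. i < j \<and> j < n}"
      then obtain i j where ij: "p = ent $$ (0, i) * ent $$ (1, j) - ent $$ (0, j) * ent $$ (1, i)" "i < j" "j < n" by blast
      have "p = det (submatrix ent {..<2} {i, j})" using sub ij by simp
      moreover have "{..<2} \<subseteq> {..<dim_row ent}" "{i, j} \<subseteq> {..<dim_col ent}" "card {..<2 :: nat} = 2" "card {i, j} = 2"
        using X ij by auto
      ultimately show "p \<in> minors 2 ent" unfolding minors_def by blast
    qed
  qed
qed

definition entries :: "nat \<Rightarrow> ('v, 'k::field) mpoly mat \<Rightarrow> nat \<Rightarrow> ('v, 'k) mpoly" where
  "entries n M r = M $$ (if r < n then (0, r) else (1, r - n))"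

lemma entries_H1:
  assumes "M \<in> carrier_mat 2 n" "\<forall>e \<in> elements_mat M. linear_form V e" "r < 2 * n"
  shows "entries n M r \<in> H V 1"
proof -
  have "entries n M r \<in> elements_mat M"
    unfolding entries_def using assms by (intro elements_matI[of M 2 n "if r < n then 0 else 1" "if r < n then r else r - n"]) auto
  then have "linear_form V (entries n M r)" using assms(2) by blast
  then show ?thesis by (simp add: linear_form_def H_iff carrier_mpoly_ring del: mpoly_ring_simps(1))
qed

lemma subst_entries_gminor:
  assumes "i < n" "j < n"
  shows "subst (entries n M) (gminor n i j) = M $$ (0, i) * M $$ (1, j) - M $$ (0, j) * M $$ (1, i)"
  using assms by (simp add: gminor_def entries_def subst.hom_minus subst.hom_mult)

lemma minors_2_gminor:
  assumes "M \<in> carrier_mat 2 n" "p \<in> minors 2 M"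
  shows "\<exists>i j. p = subst (entries n M) (gminor n i j) \<and> i < n \<and> j < n"
proof -
  obtain i j where "p = M $$ (0, i) * M $$ (1, j) - M $$ (0, j) * M $$ (1, i)" "i < j" "j < n"
    using assms(2) unfolding minors_2[OF assms(1)] by blast
  then show ?thesis using subst_entries_gminor[of i n j M] by (intro exI[of _ i] exI[of _ j]) simp
qed

lemma idl_minors:
  assumes "M \<in> carrier_mat 2 n"
  shows "idl V (minors 2 M) = idl V (subst (entries n M) ` mprods n 1)"
proof
  have m1: "mprods n 1 = {gminor n i j | i j. i < n \<and> j < n}" by (auto simp: One_nat_def)
  show "idl V (minors 2 M) \<subseteq> idl V (subst (entries n M) ` mprods n 1)"
  proof
    fix p assume "p \<in> idl V (minors 2 M)"
    then show "p \<in> idl V (subst (entries n M) ` mprods n 1)"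
    proof (induction rule: idl.induct)
      case (idl_mult q g)
      then obtain i j where "g = subst (entries n M) (gminor n i j)" "i < n" "j < n"
        using minors_2_gminor[OF assms] by blast
      then show ?case using idl_mult(1) m1 by (intro idl.idl_mult) auto
    qed (auto intro: idl.intros)
  qed
  show "idl V (subst (entries n M) ` mprods n 1) \<subseteq> idl V (minors 2 M)"
  proof
    fix p assume "p \<in> idl V (subst (entries n M) ` mprods n 1)"
    then show "p \<in> idl V (minors 2 M)"
    proof (induction rule: idl.induct)
      case (idl_mult q g)
      then obtain i j where g: "g = M $$ (0, i) * M $$ (1, j) - M $$ (0, j) * M $$ (1, i)" "i < n" "j < n"
        unfolding m1 using subst_entries_gminor[of _ n] by fastforce
      consider "i < j" | "i = j" | "j < i" by linarith
      then show ?case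
      proof cases
        case 1
        then show ?thesis using g idl_mult(1) by (intro idl.idl_mult) (auto simp: minors_2[OF assms])
      next
        case 2
        then show ?thesis using g by (simp add: idl.idl_0)
      next
        case 3
        then have "M $$ (0, j) * M $$ (1, i) - M $$ (0, i) * M $$ (1, j) \<in> minors 2 M"
          using g unfolding minors_2[OF assms] by blast
        from idl.idl_mult[OF polys_mult[OF H_polys[OF H_Const[of "- 1"]] idl_mult(1)] this]
        show ?thesis by (simp add: g(1) Const_uminus algebra_simps)
      qed
    qed (auto intro: idl.intros)
  qed
qed

section \<open>Degrees of minimal generators\<close>

lemma hc_polys: "p \<in> polys V \<Longrightarrow> hc d p \<in> polys V"
  by (rule H_polys[OF hc_H])

lemma hc_mult_low:
  assumes "q \<in> H V e" "d < e" "p \<in> polys V"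
  shows "hc d (p * q) = 0"
proof (rule poly_mapping_eqI)
  fix m
  have "m \<notin> supp (p * q)" if "monom_deg m = d"
  proof
    assume "m \<in> supp (p * q)"
    then obtain a b where "m = a + b" "b \<in> supp q" using keys_mult[of p q] by auto
    then show False using assms(1,2) that by (auto simp: H_def)
  qed
  then show "cf (hc d (p * q)) m = cf 0 m" by (simp add: lookup_hc in_keys_iff)
qed

text \<open>The ideal starts in degree \<open>D\<close>, so generators of smaller degree are zero,
  and its component of degree \<open>D\<close> involves only generators of that degree. These
  already generate everything, so minimality leaves no others.\<close>

lemma minimal_generators_degree:
  fixes G G0 :: "('v, 'k::field) mpoly set"
  assumes G0: "G0 \<subseteq> H V D" and G: "minimal_homogeneous_generators V (idl V G0) G" and g: "g \<in> G"
  shows "homogeneous (int D) g"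
proof (rule ccontr)
  assume g_deg: "\<not> homogeneous (int D) g"
  have Gp: "G \<subseteq> polys V" and hom: "\<And>g. g \<in> G \<Longrightarrow> \<exists>d. homogeneous d g"
    and gen: "idl V G = idl V G0" and min: "\<And>G'. G' \<subset> G \<Longrightarrow> genideal (mpoly_ring V) G' \<noteq> idl V G0"
    using G genideal_idl[of G V] unfolding minimal_homogeneous_generators_def carrier_mpoly_ring by auto
  have formG: "\<exists>d. h \<in> H V d" if h: "h \<in> G" for h
  proof (cases "h = 0")
    case False
    obtain d where d: "homogeneous d h" using hom[OF h] by blast
    obtain m where "m \<in> supp h" using False by (metis keys_eq_empty ex_in_conv)
    then have "d = int (monom_deg m)" using d by (auto simp: homogeneous_def)
    then show ?thesis using d h Gp by (auto simp: H_iff)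
  qed auto
  define G2 where "G2 = {h \<in> G. h \<in> H V D}"
  have sub: "G2 \<subset> G" using g g_deg by (auto simp: G2_def H_iff)
  have low: "hc d p = 0" if "p \<in> idl V G0" "d < D" for p d using that
  proof (induction rule: idl.induct)
    case (idl_mult q h)
    then show ?case using G0 by (intro hc_mult_low) auto
  qed (auto simp: hc_add)
  have hcD: "hc D p \<in> idl V G2" if "p \<in> idl V G" for p using that
  proof (induction rule: idl.induct)
    case (idl_mult q h)
    obtain d where d: "h \<in> H V d" using formG[OF idl_mult(2)] by blast
    consider "d < D" | "d = D" | "D < d" by linarith
    then show ?case
    proof cases
      case 1
      have "1 * h \<in> idl V G" by (rule idl.idl_mult[OF polys_1 idl_mult(2)])
      then have "hc d h = 0" using low[of h d] 1 gen by simp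
      then have "h = 0" using hc_form[OF d, of d] by simp
      then show ?thesis by (simp add: idl.idl_0)
    next
      case 2
      then have "hc (0 + D) (q * h) = hc 0 q * h" using d idl_mult(1) by (intro hc_mult_form) auto
      moreover have "hc 0 q * h \<in> idl V G2"
        using idl_mult d 2 by (intro idl.idl_mult hc_polys) (auto simp: G2_def)
      ultimately show ?thesis by simp
    next
      case 3
      then show ?thesis using hc_mult_low[OF d 3 idl_mult(1)] by (simp add: idl.idl_0)
    qed
  qed (auto simp: hc_add intro: idl.intros)
  have "idl V G0 \<subseteq> idl V G2"
  proof
    fix p assume "p \<in> idl V G0"
    then show "p \<in> idl V G2"
    proof (induction rule: idl.induct)
      case (idl_mult q h)
      have "1 * h \<in> idl V G0" by (rule idl.idl_mult[OF polys_1 idl_mult(2)])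
      then have "hc D h \<in> idl V G2" using hcD gen by simp
      moreover have "hc D h = h" using hc_form[of h V D D] idl_mult(2) G0 by auto
      ultimately show ?case using idl_mult_left idl_mult(1) by metis
    qed (auto intro: idl.intros)
  qed
  moreover have "idl V G2 \<subseteq> idl V G"
  proof
    fix p assume "p \<in> idl V G2"
    then show "p \<in> idl V G" by (induction rule: idl.induct) (auto simp: G2_def intro: idl.intros)
  qed
  ultimately have "idl V G2 = idl V G0" using gen by auto
  moreover have "genideal (mpoly_ring V) G2 = idl V G2" using sub Gp by (intro genideal_idl) auto
  ultimately show False using min[OF sub] by simp
qed

text \<open>If all minors vanish the ideal is zero; otherwise powers of a nonzero minor show that no
  power of the ideal vanishes, so that each has a regularity.\<close>

theorem linear_powers_of_gpos:
  fixes M :: "('v, 'k::field) mpoly mat"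
  assumes V: "finite V" and n: "0 < n" and M: "M \<in> carrier_mat 2 n" "\<forall>e \<in> elements_mat M. linear_form V e"
    and gp: "gpos V n (entries n M)"
  shows "has_linear_powers V (minors_ideal V 2 M)"
proof -
  define G where "G k = subst (entries n M) ` mprods n k" for k
  have ent: "entries n M r \<in> H V 1" if "r \<in> gv n" for r using entries_H1[OF M] that by simp
  have GH: "G k \<subseteq> H V (2 * k)" for k unfolding G_def by (rule mprods_subst_H) (rule ent)
  have mult_id: "2 * (1 :: nat) = 2" by simp
  have mp: "minors 2 M \<subseteq> polys V"
  proof
    fix p assume "p \<in> minors 2 M"
    then obtain i j where "p = subst (entries n M) (gminor n i j)" "i < n" "j < n"
      using minors_2_gminor[OF M(1)] by blast
    then have "p \<in> G 1" by (auto simp: G_def One_nat_def)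
    then show "p \<in> polys V" using GH H_polys by blast
  qed
  have I: "minors_ideal V 2 M = idl V (G 1)"
    unfolding minors_ideal_def genideal_idl[OF mp] G_def by (rule idl_minors[OF M(1)])
  show ?thesis
  proof (cases "\<exists>i<n. \<exists>j<n. subst (entries n M) (gminor n i j) \<noteq> 0")
    case False
    have "p = 0" if "p \<in> idl V (G 1)" for p
      using that by (induction rule: idl.induct) (use False in \<open>auto simp: G_def One_nat_def\<close>)
    then have "idl V (G 1) = {0}" using idl.idl_0 by blast
    then show ?thesis by (simp add: has_linear_powers_def I)
  next
    case True
    then obtain i j where ij: "i < n" "j < n" "subst (entries n M) (gminor n i j) \<noteq> 0" by blast
    have nz: "\<exists>g\<in>G k. g \<noteq> 0" for k
    proof (induction k)
      case (Suc k)
      then obtain h where h: "h \<in> mprods n k" "subst (entries n M) h \<noteq> 0" by (auto simp: G_def)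
      then have "subst (entries n M) (gminor n i j * h) \<noteq> 0"
        using ij(3) mpoly_no_zero_divisors by (auto simp: subst.hom_mult)
      moreover have "gminor n i j * h \<in> mprods n (Suc k)" using ij h by auto
      ultimately show ?case unfolding G_def by blast
    qed (simp add: G_def subst.hom_one)
    obtain A and fm :: "nat \<Rightarrow> ('v, 'k) mpoly" where fm: "finite A" "\<And>a. a \<in> A \<Longrightarrow> fm a \<in> H V 1"
      "Reg fm A V (Suc 0) (\<lambda>d. {0})" "\<And>k. 0 < k \<Longrightarrow> Reg fm A V (2 * k) (gen V (G k) (2 * k))"
      using Reg_gpos[OF V n _ gp] ent unfolding G_def by auto
    have reg: "has_regularity V (idl V (G k)) (int (2 * k))" if "0 < k" for k
      using that fm(4)[OF that] GH nz by (intro has_regularity_of_Reg[OF fm(1) V fm(2,3)]) auto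
    show ?thesis unfolding has_linear_powers_def I
    proof (intro disjI2 exI[of _ 2] conjI allI impI ballI)
      fix G' g assume "minimal_homogeneous_generators V (idl V (G 1)) G'" "g \<in> G'"
      then show "homogeneous (int 2) g" using GH[of 1] unfolding mult_id by (intro minimal_generators_degree)
    next
      fix k :: nat assume k: "1 \<le> k"
      have "idl V (G 1) [^]\<^bsub>ideals_set (mpoly_ring V)\<^esub> k = idl V (G k)"
        unfolding G_def by (rule idl_mprods_pow) (rule ent)
      moreover have "has_regularity V (idl V (G k)) (int (2 * k))" using k by (intro reg) (simp add: One_nat_def)
      ultimately show "has_regularity V (idl V (G 1) [^]\<^bsub>ideals_set (mpoly_ring V)\<^esub> k) (int (k * 2))"
        by (simp add: mult.commute)
    qed
  qed
qed

subsection \<open>Zeros of polynomials over infinite fields\<close>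

lemma infinite_alg_closed: "infinite (UNIV :: 'a::alg_closed_field set)"
proof
  assume fin: "finite (UNIV :: 'a set)"
  \<comment> \<open>One more than the product of all linear factors has no root.\<close>
  define q where "q = (\<Prod>a\<in>(UNIV :: 'a set). [:- a, 1:])"
  have "Polynomial.degree q = card (UNIV :: 'a set)"
    unfolding q_def by (subst degree_prod_eq_sum_degree) (auto simp: One_nat_def)
  moreover have "0 < card (UNIV :: 'a set)" using fin by (simp add: card_gt_0_iff)
  ultimately have "0 < Polynomial.degree (q + 1)" by (simp add: degree_add_eq_left)
  then obtain x where "poly (q + 1) x = 0" using alg_closed_imp_poly_has_root by blast
  moreover have "poly q x = 0" unfolding q_def poly_prod using fin by (auto intro!: prod_zero bexI[of _ x])
  ultimately show False by simp
qed

lemma evp_subst: "evp c (subst s p) = evp (\<lambda>u. evp c (s u)) p"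
proof -
  have m: "evp c (evm s m) = evm (\<lambda>u. evp c (s u)) m" for m
  proof -
    interpret e: comm_ring_hom "evp c" by (rule comm_ring_hom_ev[OF comm_ring_hom_id])
    show ?thesis by (simp add: evm_def e.hom_prod e.hom_power)
  qed
  show ?thesis by (simp add: subst_def ev_def[of Const] evp_hom m) (simp add: ev_def)
qed

lemma evp_cong: "p \<in> polys W \<Longrightarrow> (\<And>u. u \<in> W \<Longrightarrow> c u = c' u) \<Longrightarrow> evp c p = evp c' p"
  unfolding ev_def by (intro sum.cong refl arg_cong2[where f = "(*)"] evm_cong) (auto simp: polys_def)

lemma evp_along_line:
  fixes p :: "('v, 'l::field) mpoly"
  shows "\<exists>R. \<forall>t. poly R t = evp (c(v := t)) p"
proof -
  define s where "s u = (if u = v then [:0, 1:] else [:c u:])" for u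
  have "poly (ev (\<lambda>a. [:a:]) s p) t = evp (c(v := t)) p" for t
  proof -
    have "poly (evm s m) t = evm (c(v := t)) m" for m
      unfolding evm_def poly_prod poly_power by (intro prod.cong) (auto simp: s_def)
    then show ?thesis by (simp add: ev_def poly_sum)
  qed
  then show ?thesis by blast
qed

text \<open>Setting \<open>v\<close> to zero shows, by induction on the variables, that
  \<open>Var v\<close> divides \<open>p\<close>. The quotient vanishes wherever \<open>v\<close> is
  nonzero, hence everywhere since a line has infinitely many points, and its degree is
  smaller.\<close>

lemma mpoly_eq_0_of_evp:
  fixes p :: "('v, 'l::field) mpoly"
  assumes inf: "infinite (UNIV :: 'l set)" and W: "finite W" and p: "p \<in> polys W" "\<And>c. evp c p = 0"
  shows "p = 0" using W p
proof (induction W arbitrary: p rule: finite_induct)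
  case empty
  have "p \<in> H {} 0" using empty(1) by (auto simp: polys_def H_def)
  from H_0_Const[OF this] have "p = Const (cf p 0)" .
  moreover from this have "cf p 0 = 0" using empty(2)[of "\<lambda>_. 0"] evp_hom(5)[of "\<lambda>_. 0" "cf p 0"] by metis
  ultimately show ?case by simp
next
  case (insert v W)
  define s where "s u = (if u = v then 0 else Var u :: ('v, 'l) mpoly)" for u
  have red: "p = Var v * vdiv v p" if p: "p \<in> polys (insert v W)" "\<And>c. evp c p = 0" for p :: "('v, 'l) mpoly"
  proof -
    have lp: "evm s m = (if v \<in> supp m then 0 else mon m)" for m
    proof (cases "v \<in> supp m")
      case True
      then have "s v ^ cf m v = 0" by (simp add: s_def in_keys_iff zero_power)
      then show ?thesis using True by (auto simp: evm_def intro!: prod_zero)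
    next
      case False
      then have "evm s m = evm Var m" by (intro evm_cong) (auto simp: s_def)
      then show ?thesis using False by (simp add: evm_Var)
    qed
    have cfs: "cf (subst s p) m = (if v \<in> supp m then 0 else cf p m)" for m
    proof -
      have "cf (subst s p) m = (\<Sum>l\<in>supp p. if l = m then (if v \<in> supp m then 0 else cf p m) else 0)"
        unfolding subst_def ev_def lp lookup_sum by (intro sum.cong) (auto simp: lookup_mon)
      then show ?thesis by (simp add: in_keys_iff)
    qed
    have "subst s p = 0"
    proof (rule insert.IH)
      show "subst s p \<in> polys W" unfolding polys_def
      proof (intro CollectI ballI)
        fix m assume "m \<in> supp (subst s p)"
        then have "cf (subst s p) m \<noteq> 0" by (simp add: in_keys_iff)
        then have "v \<notin> supp m" "m \<in> supp p" unfolding cfs by (auto simp: in_keys_iff split: if_splits)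
        then show "supp m \<subseteq> W" using p(1) by (auto simp: polys_def)
      qed
      show "evp c (subst s p) = 0" for c unfolding evp_subst by (rule p(2))
    qed
    then have v: "v \<in> supp m" if "m \<in> supp p" for m
      using cfs[of m] that by (auto simp: in_keys_iff split: if_splits)
    show ?thesis
    proof (rule poly_mapping_eqI)
      fix m
      show "cf p m = cf (Var v * vdiv v p) m"
      proof (cases "\<exists>l. m = expo v + l")
        case True
        then show ?thesis by (auto simp: Var_mon mon_def lookup_mult_single lookup_vdiv)
      next
        case False
        have "m \<notin> supp p"
        proof
          assume "m \<in> supp p"
          then show False using False expo_split[OF v] by blast
        qed
        then show ?thesis using False by (simp add: Var_mon mon_def lookup_mult_single_notin in_keys_iff)
      qed
    qed
  qed
  have "p = 0" if "\<And>m. m \<in> supp p \<Longrightarrow> monom_deg m < D" "p \<in> polys (insert v W)" "\<And>c. evp c p = 0"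
    for D and p :: "('v, 'l) mpoly" using that
  proof (induction D arbitrary: p)
    case 0
    then show ?case by (metis ex_in_conv keys_eq_empty not_less0)
  next
    case (Suc D)
    have pv: "p = Var v * vdiv v p" by (rule red[OF Suc.prems(2,3)])
    have supp_q: "expo v + m \<in> supp p" if "m \<in> supp (vdiv v p)" for m
      using that by (simp add: in_keys_iff lookup_vdiv)
    have "vdiv v p = 0"
    proof (rule Suc.IH)
      show "monom_deg m < D" if "m \<in> supp (vdiv v p)" for m
        using Suc.prems(1)[OF supp_q[OF that]] by (simp add: One_nat_def)
      show "vdiv v p \<in> polys (insert v W)" unfolding polys_def
      proof (intro CollectI ballI)
        fix m assume "m \<in> supp (vdiv v p)"
        then have "supp (expo v + m) \<subseteq> insert v W" using supp_q Suc.prems(2) unfolding polys_def by blast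
        then show "supp m \<subseteq> insert v W" by (simp add: supp_add_nat)
      qed
      have ne: "evp c (vdiv v p) = 0" if "c v \<noteq> 0" for c
      proof -
        have "evp c (Var v * vdiv v p) = 0" using Suc.prems(3)[of c] pv by simp
        then show ?thesis using that by (simp add: evp_hom)
      qed
      show "evp c (vdiv v p) = 0" for c
      proof -
        obtain R where R: "\<And>t. poly R t = evp (c(v := t)) (vdiv v p)"
          using evp_along_line[of c v "vdiv v p"] by blast
        have "UNIV - {0} \<subseteq> {t. poly R t = 0}" using R ne by auto
        moreover have "infinite (UNIV - {0 :: 'l})" using inf by simp
        ultimately have "R = 0" using poly_roots_finite finite_subset by blast
        then show ?thesis using R[of "c v"] by simp
      qed
    qed
    then show ?case using pv by simp
  qed
  moreover have "monom_deg m < Suc (Max (monom_deg ` supp p))" if "m \<in> supp p" for m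
    using that by (simp add: less_Suc_eq_le)
  ultimately show ?case using insert.prems by blast
qed

subsection \<open>Chains of primes\<close>

definition isid :: "'v set \<Rightarrow> ('v, 'k::field) mpoly set \<Rightarrow> bool" where
  "isid V Q \<longleftrightarrow> Q \<subseteq> polys V \<and> 0 \<in> Q \<and> (\<forall>p\<in>Q. \<forall>q\<in>Q. p + q \<in> Q) \<and> (\<forall>r\<in>polys V. \<forall>p\<in>Q. r * p \<in> Q)"

lemma polys_Const [simp]: "Const c \<in> polys V"
  by (rule H_polys[OF H_Const])

lemma isidD:
  assumes "isid V Q"
  shows "p \<in> Q \<Longrightarrow> p \<in> polys V" "0 \<in> Q" "p \<in> Q \<Longrightarrow> q \<in> Q \<Longrightarrow> p + q \<in> Q"
    "r \<in> polys V \<Longrightarrow> p \<in> Q \<Longrightarrow> r * p \<in> Q" "p \<in> Q \<Longrightarrow> q \<in> Q \<Longrightarrow> p - q \<in> Q"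
proof -
  show add: "p \<in> Q \<Longrightarrow> q \<in> Q \<Longrightarrow> p + q \<in> Q" and mult: "r \<in> polys V \<Longrightarrow> p \<in> Q \<Longrightarrow> r * p \<in> Q" for p q r
    using assms by (auto simp: isid_def)
  assume "p \<in> Q" "q \<in> Q"
  then have "p + Const (- 1) * q \<in> Q" by (intro add mult) simp_all
  then show "p - q \<in> Q" by (simp add: Const_uminus)
qed (use assms in \<open>auto simp: isid_def\<close>)

lemma isid_subspace: "isid V Q \<Longrightarrow> mp.subspace Q"
  by (rule mp.subspaceI) (auto intro: isidD)

lemma polys_power: "p \<in> polys V \<Longrightarrow> p ^ j \<in> polys V"
  by (induction j) (auto intro: polys_mult)

definition prime_isid :: "'v set \<Rightarrow> ('v, 'k::field) mpoly set \<Rightarrow> bool" where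
  "prime_isid V Q \<longleftrightarrow> isid V Q \<and> 1 \<notin> Q \<and> (\<forall>x\<in>polys V. \<forall>y\<in>polys V. x * y \<in> Q \<longrightarrow> x \<in> Q \<or> y \<in> Q)"

lemma isid_idl: "G \<subseteq> polys V \<Longrightarrow> isid V (idl V G)"
proof -
  assume G: "G \<subseteq> polys V"
  have "p \<in> polys V" if "p \<in> idl V G" for p
    using that by (induction rule: idl.induct) (use G in \<open>auto intro: polys_add polys_mult\<close>)
  then show ?thesis by (auto simp: isid_def intro: idl.intros idl_mult_left)
qed

lemma isid_idl_self: "isid V Q \<Longrightarrow> idl V Q = Q"
proof
  assume Q: "isid V Q"
  show "Q \<subseteq> idl V Q"
  proof
    fix p assume "p \<in> Q"
    from idl.idl_mult[OF polys_1 this] show "p \<in> idl V Q" by simp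
  qed
  show "idl V Q \<subseteq> Q"
  proof
    fix p assume "p \<in> idl V Q"
    then show "p \<in> Q" by (induction rule: idl.induct) (auto intro: isidD[OF Q])
  qed
qed

lemma primeideal_iff: "primeideal C (mpoly_ring V) \<longleftrightarrow> prime_isid V (C :: ('v, 'k::field) mpoly set)"
proof
  interpret R: cring "mpoly_ring V :: ('v, 'k) mpoly ring" by (rule cring_mpoly_ring)
  note [simp del] = mpoly_ring_simps(1)
  {
    assume "primeideal C (mpoly_ring V)"
    then interpret C: primeideal C "mpoly_ring V" .
    have "isid V C" unfolding isid_def
    proof (intro conjI ballI subsetI)
      show "p \<in> polys V" if "p \<in> C" for p using C.a_Hcarr[OF that] by (simp add: carrier_mpoly_ring)
      show "0 \<in> C" using C.zero_closed by simp
      show "p + q \<in> C" if "p \<in> C" "q \<in> C" for p q using C.a_closed[OF that] by simp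
      show "r * p \<in> C" if "r \<in> polys V" "p \<in> C" for r p
        using C.I_l_closed[OF that(2), of r] that(1) by (simp add: carrier_mpoly_ring)
    qed
    moreover have "1 \<notin> C" using C.one_imp_carrier C.I_notcarr by auto
    ultimately show "prime_isid V C" using C.I_prime by (auto simp: prime_isid_def carrier_mpoly_ring)
  next
    assume C: "prime_isid V C"
    then have id: "isid V C" by (simp add: prime_isid_def)
    have sub: "C \<subseteq> carrier (mpoly_ring V)" unfolding carrier_mpoly_ring using isidD(1)[OF id] by blast
    have "ideal C (mpoly_ring V)"
      using R.genideal_ideal[OF sub] genideal_idl[of C V] sub isid_idl_self[OF id] by (simp add: carrier_mpoly_ring)
    then show "primeideal C (mpoly_ring V)"
    proof (rule primeidealI)
      show "carrier (mpoly_ring V) \<noteq> C" using C polys_1[of V] unfolding carrier_mpoly_ring prime_isid_def by blast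
    qed (use C R.is_cring in \<open>auto simp: prime_isid_def carrier_mpoly_ring\<close>)
  }
qed

text \<open>Krull's argument: maximality among the ideals avoiding a multiplicative set forces
  primality.\<close>

lemma exists_prime_disjoint:
  fixes I0 S :: "('v, 'k::field) mpoly set"
  assumes I0: "isid V I0" and S: "1 \<in> S" "S \<subseteq> polys V" "\<And>x y. x \<in> S \<Longrightarrow> y \<in> S \<Longrightarrow> x * y \<in> S" "I0 \<inter> S = {}"
  shows "\<exists>Q. prime_isid V Q \<and> I0 \<subseteq> Q \<and> Q \<inter> S = {}"
proof -
  define \<A> where "\<A> = {Q. isid V Q \<and> I0 \<subseteq> Q \<and> Q \<inter> S = {}}"
  have "\<exists>Q\<in>\<A>. \<forall>T\<in>\<A>. Q \<subseteq> T \<longrightarrow> T = Q"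
  proof (rule subset_Zorn_nonempty)
    show "\<A> \<noteq> {}" using I0 S(4) by (auto simp: \<A>_def)
    fix \<C> assume ne: "\<C> \<noteq> {}" and ch: "subset.chain \<A> \<C>"
    have sub: "\<C> \<subseteq> \<A>" and lin: "\<And>T Y. T \<in> \<C> \<Longrightarrow> Y \<in> \<C> \<Longrightarrow> T \<subseteq> Y \<or> Y \<subseteq> T" using ch by (auto simp: subset_chain_def)
    have id: "isid V T" if "T \<in> \<C>" for T using that sub by (auto simp: \<A>_def)
    have "isid V (\<Union>\<C>)" unfolding isid_def
    proof (intro conjI ballI subsetI)
      show "p \<in> polys V" if "p \<in> \<Union>\<C>" for p using that isidD(1)[OF id] by blast
      show "0 \<in> \<Union>\<C>" using ne isidD(2)[OF id] by blast
      fix p q assume "p \<in> \<Union>\<C>" "q \<in> \<Union>\<C>"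
      then obtain T Y where XY: "T \<in> \<C>" "Y \<in> \<C>" "p \<in> T" "q \<in> Y" by blast
      then show "p + q \<in> \<Union>\<C>" using lin[OF XY(1,2)] isidD(3)[OF id] by blast
    next
      fix r p :: "('v, 'k) mpoly" assume "r \<in> polys V" "p \<in> \<Union>\<C>"
      then show "r * p \<in> \<Union>\<C>" using isidD(4)[OF id] by blast
    qed
    then show "\<Union>\<C> \<in> \<A>" using sub ne by (auto simp: \<A>_def)
  qed
  then obtain Q where Q: "Q \<in> \<A>" and max: "\<And>T. T \<in> \<A> \<Longrightarrow> Q \<subseteq> T \<Longrightarrow> T = Q" by blast
  have id: "isid V Q" and QI: "I0 \<subseteq> Q" and QS: "Q \<inter> S = {}" using Q by (auto simp: \<A>_def)
  have meets: "\<exists>q\<in>Q. \<exists>r\<in>polys V. q + r * x \<in> S" if x: "x \<in> polys V" "x \<notin> Q" for x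
  proof (rule ccontr)
    assume no: "\<not> ?thesis"
    define T where "T = {q + r * x | q r. q \<in> Q \<and> r \<in> polys V}"
    have XI: "q + r * x \<in> T" if "q \<in> Q" "r \<in> polys V" for q r using that by (auto simp: T_def)
    have "isid V T" unfolding isid_def
    proof (intro conjI ballI subsetI)
      show "p \<in> polys V" if "p \<in> T" for p
        using that isidD(1)[OF id] x(1) by (auto simp: T_def intro: polys_add polys_mult)
      show "0 \<in> T" using XI[OF isidD(2)[OF id] polys_0] by simp
      fix p p' assume "p \<in> T" "p' \<in> T"
      then obtain q r q' r' where *: "p = q + r * x" "q \<in> Q" "r \<in> polys V" "p' = q' + r' * x" "q' \<in> Q" "r' \<in> polys V"
        unfolding T_def by blast
      have "(q + q') + (r + r') * x \<in> T" using * by (intro XI isidD(3)[OF id] polys_add)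
      then show "p + p' \<in> T" by (simp add: * algebra_simps)
    next
      fix t p :: "('v, 'k) mpoly" assume t: "t \<in> polys V" "p \<in> T"
      then obtain q r where *: "p = q + r * x" "q \<in> Q" "r \<in> polys V" unfolding T_def by blast
      have "t * q + (t * r) * x \<in> T" using * t by (intro XI isidD(4)[OF id] polys_mult)
      then show "t * p \<in> T" by (simp add: * algebra_simps)
    qed
    moreover have QX: "Q \<subseteq> T"
    proof
      fix q assume "q \<in> Q"
      from XI[OF this polys_0] show "q \<in> T" by simp
    qed
    moreover have "T \<inter> S = {}" using no by (auto simp: T_def)
    ultimately have "T = Q" using QI by (intro max) (auto simp: \<A>_def)
    moreover have "x \<in> T" using XI[OF isidD(2)[OF id] polys_1] by simp
    ultimately show False using x(2) by simp
  qed
  have "x \<in> Q \<or> y \<in> Q" if xy: "x \<in> polys V" "y \<in> polys V" "x * y \<in> Q" for x y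
  proof (rule ccontr)
    assume "\<not> ?thesis"
    then obtain q r q' r' where *: "q \<in> Q" "r \<in> polys V" "q + r * x \<in> S" "q' \<in> Q" "r' \<in> polys V" "q' + r' * y \<in> S"
      using meets[OF xy(1)] meets[OF xy(2)] by blast
    have "(q' + r' * y) * q \<in> Q"
      using *(1,5) xy isidD(1)[OF id *(4)] by (intro isidD(4)[OF id] polys_add polys_mult)
    moreover have "(r * x) * q' \<in> Q" using *(2,4) xy by (intro isidD(4)[OF id] polys_mult)
    moreover have "(r * r') * (x * y) \<in> Q" using *(2,5) xy(3) by (rule isidD(4)[OF id polys_mult])
    ultimately have "(q' + r' * y) * q + (r * x) * q' + (r * r') * (x * y) \<in> Q" by (intro isidD(3)[OF id])
    then have "(q + r * x) * (q' + r' * y) \<in> Q" by (simp add: algebra_simps)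
    then show False using S(3)[OF *(3,6)] QS by blast
  qed
  moreover have "1 \<notin> Q" using S(1) QS by blast
  ultimately show ?thesis using id QI QS by (auto simp: prime_isid_def)
qed

lemma indep_mod_reindex:
  assumes g: "bij_betw g I B" and B: "indep_mod J y B"
  shows "indep_mod J (\<lambda>i. y (g i)) I" unfolding indep_mod_def
proof (intro allI impI ballI)
  fix c i assume c: "(\<Sum>i\<in>I. Const (c i) * y (g i)) \<in> J" and i: "i \<in> I"
  define c' where "c' = c \<circ> the_inv_into I g"
  have inj: "inj_on g I" using g by (rule bij_betw_imp_inj_on)
  have cc: "c' (g i) = c i" if "i \<in> I" for i using the_inv_into_f_f[OF inj that] by (simp add: c'_def)
  have "(\<Sum>b\<in>B. Const (c' b) * y b) = (\<Sum>i\<in>I. Const (c' (g i)) * y (g i))"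
    by (rule sum.reindex_bij_betw[OF g, symmetric])
  also have "\<dots> = (\<Sum>i\<in>I. Const (c i) * y (g i))" by (intro sum.cong) (auto simp: cc)
  finally have "\<forall>b\<in>B. c' b = 0" using B c by (simp add: indep_mod_def)
  moreover have "g i \<in> B" using g i by (rule bij_betwE[THEN bspec])
  ultimately show "c i = 0" using cc[OF i] by auto
qed

section \<open>Growth of Hilbert functions along chains of primes\<close>

definition Pd :: "'v set \<Rightarrow> nat \<Rightarrow> ('v, 'k::field) mpoly set" where
  "Pd V d = {p \<in> polys V. \<forall>m\<in>supp p. monom_deg m \<le> d}"

lemma Pd_polys: "p \<in> Pd V d \<Longrightarrow> p \<in> polys V"
  by (simp add: Pd_def)

lemma Pd_mono: "p \<in> Pd V d \<Longrightarrow> d \<le> d' \<Longrightarrow> p \<in> Pd V d'"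
  by (auto simp: Pd_def)

lemma Pd_mult: "p \<in> Pd V d \<Longrightarrow> q \<in> Pd V e \<Longrightarrow> p * q \<in> Pd V (d + e)"
  using keys_mult[of p q] by (fastforce simp: Pd_def intro: polys_mult add_mono)

lemma Pd_power: "p \<in> Pd V d \<Longrightarrow> p ^ j \<in> Pd V (j * d)"
proof (induction j)
  case 0
  show ?case by (auto simp: Pd_def)
next
  case (Suc j)
  then show ?case using Pd_mult[of p V d "p ^ j" "j * d"] by simp
qed

lemma H_Pd: "p \<in> H V d \<Longrightarrow> p \<in> Pd V d"
  by (auto simp: Pd_def H_def polys_def)

abbreviation exps :: "'v set \<Rightarrow> nat \<Rightarrow> ('v \<Rightarrow>\<^sub>0 nat) set" where
  "exps V d \<equiv> {m. supp m \<subseteq> V \<and> monom_deg m \<le> d}"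

lemma Pd_span: "p \<in> Pd V d \<Longrightarrow> p \<in> mp.span (mon ` exps V d)"
proof -
  assume p: "p \<in> Pd V d"
  have "(\<Sum>m\<in>supp p. Const (cf p m) * mon m) \<in> mp.span (mon ` exps V d)"
    using p by (intro mp.span_sum mp.span_scale mp.span_base) (auto simp: Pd_def polys_def)
  then show ?thesis by (simp flip: mpoly_expand)
qed

lemma card_exps:
  assumes "finite V"
  shows "card (exps V d) \<le> (d + 1) ^ card V"
proof -
  have "card (exps V d) \<le> card (PiE V (\<lambda>_. {..d}))"
  proof (rule card_inj_on_le[where f = "\<lambda>m. restrict (cf m) V"])
    show "inj_on (\<lambda>m. restrict (cf m) V) (exps V d)"
    proof (rule inj_onI)
      fix m m' assume m: "m \<in> exps V d" "m' \<in> exps V d" "restrict (cf m) V = restrict (cf m') V"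
      show "m = m'"
      proof (rule poly_mapping_eqI)
        fix v
        show "cf m v = cf m' v"
        proof (cases "v \<in> V")
          case True
          then show ?thesis using fun_cong[OF m(3), of v] by simp
        next
          case False
          then have "v \<notin> supp m" "v \<notin> supp m'" using m by auto
          then show ?thesis by (simp add: in_keys_iff)
        qed
      qed
    qed
    show "(\<lambda>m. restrict (cf m) V) ` exps V d \<subseteq> PiE V (\<lambda>_. {..d})"
    proof (rule image_subsetI)
      fix m assume m: "m \<in> exps V d"
      have "cf m v \<le> d" if "v \<in> V" for v
      proof -
        have "cf m v \<le> (\<Sum>v\<in>V. cf m v)" using that assms by (intro member_le_sum) auto
        then show ?thesis using m monom_deg_superset[OF assms, of m] by auto
      qed
      then show "restrict (cf m) V \<in> PiE V (\<lambda>_. {..d})" by auto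
    qed
    show "finite (PiE V (\<lambda>_. {..d}))" using assms by (intro finite_PiE) auto
  qed
  then show ?thesis by (simp add: card_PiE[OF assms] Suc_eq_plus1)
qed

lemma indep_mod_card:
  assumes V: "finite V" and I: "finite I" "indep_mod J x I" "\<And>i. i \<in> I \<Longrightarrow> x i \<in> Pd V d" and J: "0 \<in> J"
  shows "card I \<le> (d + 1) ^ card V"
proof -
  have "card I \<le> card (exps V d)"
  proof (rule mp.indep_mod_bound[where J = "{0}" and b = mon and x = x])
    show "x i \<in> mp.span (mon ` exps V d \<union> {0})" if "i \<in> I" for i
      using Pd_span[OF I(3)[OF that]] mp.span_mono[of "mon ` exps V d" "mon ` exps V d \<union> {0}"] by blast
    show "\<forall>i\<in>I. c i = 0" if "(\<Sum>i\<in>I. Const (c i) * x i) \<in> {0}" for c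
      using that I(2) J by (auto simp: indep_mod_def)
  qed (use I finite_exponents[OF V] in auto)
  then show ?thesis using card_exps[OF V] le_trans by blast
qed

text \<open>In a relation modulo \<open>C\<close>, reduction modulo \<open>C'\<close> kills the
  terms with positive powers of \<open>f\<close>, so the terms with \<open>j = 0\<close> have zero
  coefficients; then \<open>f\<close> can be cancelled, because \<open>C\<close> is prime and does
  not contain it.\<close>

lemma indep_mod_chain_step:
  assumes C: "prime_isid V C" and C': "isid V C'" "C \<subseteq> C'" and f: "f \<in> C'" "f \<notin> C"
    and x: "\<And>i. i \<in> I \<Longrightarrow> x i \<in> polys V" and ind: "indep_mod C' x I"
  shows "indep_mod C (\<lambda>(j, i). f ^ j * x i) ({..m} \<times> I)"
proof -
  have idC: "isid V C" using C by (simp add: prime_isid_def)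
  have fV: "f \<in> polys V" using isidD(1)[OF C'(1)] f(1) .
  define g where "g c j = (\<Sum>i\<in>I. Const (c j i) * x i)" for c :: "nat \<Rightarrow> 'c \<Rightarrow> 'b" and j :: nat
  have gV: "g c j \<in> polys V" for c j unfolding g_def using x by (intro polys_sum polys_mult) auto
  have g0: "\<forall>i\<in>I. c j i = 0" if "g c j \<in> C'" for c j
    using ind[unfolded indep_mod_def, THEN spec, of "c j"] that by (simp add: g_def)
  have main: "\<forall>j\<le>m. \<forall>i\<in>I. c j i = 0" if "(\<Sum>j\<le>m. f ^ j * g c j) \<in> C" for c using that
  proof (induction m arbitrary: c)
    case 0
    then show ?case using g0[of c 0] C'(2) by auto
  next
    case (Suc m)
    define T where "T = (\<Sum>j\<le>m. f ^ j * g c (Suc j))"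
    have TV: "T \<in> polys V" unfolding T_def using gV polys_power[OF fV] by (intro polys_sum polys_mult) auto
    have eq: "(\<Sum>j\<le>Suc m. f ^ j * g c j) = g c 0 + f * T"
      by (simp add: sum.atMost_Suc_shift T_def sum_distrib_left mult.assoc del: sum.atMost_Suc)
    have tot: "g c 0 + f * T \<in> C" using Suc.prems eq by simp
    have fT: "f * T \<in> C'" using isidD(4)[OF C'(1) TV f(1)] by (simp add: mult.commute)
    have "g c 0 + f * T - f * T \<in> C'" using tot C'(2) by (intro isidD(5)[OF C'(1)] fT) auto
    then have c0: "\<forall>i\<in>I. c 0 i = 0" using g0 by simp
    then have "g c 0 = 0" by (simp add: g_def)
    then have "f * T \<in> C" using tot by simp
    then have "T \<in> C" using C f(2) fV TV by (auto simp: prime_isid_def)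
    then have "\<forall>j\<le>m. \<forall>i\<in>I. c (Suc j) i = 0" using Suc.IH[of "\<lambda>j. c (Suc j)"] by (simp add: T_def g_def)
    then show ?case using c0 by (metis Suc_le_mono not0_implies_Suc)
  qed
  show ?thesis unfolding indep_mod_def
  proof (intro allI impI)
    fix c assume "(\<Sum>p\<in>{..m} \<times> I. Const (c p) * (case p of (j, i) \<Rightarrow> f ^ j * x i)) \<in> C"
    also have "(\<Sum>p\<in>{..m} \<times> I. Const (c p) * (case p of (j, i) \<Rightarrow> f ^ j * x i)) = (\<Sum>j\<le>m. f ^ j * g (\<lambda>j i. c (j, i)) j)"
      by (simp add: sum.cartesian_product' g_def sum_distrib_left mult_ac)
    finally show "\<forall>p\<in>{..m} \<times> I. c p = 0" using main[of "\<lambda>j i. c (j, i)"] by auto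
  qed
qed

lemma power_le_imp_exponent_le:
  fixes A K N :: nat
  assumes "\<And>m. (m + 1) ^ K \<le> (A * m + 1) ^ N"
  shows "K \<le> N"
proof (rule ccontr)
  assume "\<not> K \<le> N"
  \<comment> \<open>Large enough for one more factor \<open>m + 1\<close> to beat the constant
    \<open>(A + 1) ^ N\<close>.\<close>
  define m where "m = (A + 1) ^ N"
  have "(m + 1) ^ (N + 1) \<le> (m + 1) ^ K" using \<open>\<not> K \<le> N\<close> by (intro power_increasing) auto
  also have "\<dots> \<le> (A * m + 1) ^ N" by (rule assms)
  also have "\<dots> \<le> ((A + 1) * (m + 1)) ^ N" by (intro power_mono) (auto simp: algebra_simps)
  also have "\<dots> = m * (m + 1) ^ N" by (simp only: power_mult_distrib m_def)
  finally have "(m + 1) ^ (N + 1) \<le> m * (m + 1) ^ N" .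
  moreover have "(m + 1) ^ (N + 1) = m * (m + 1) ^ N + (m + 1) ^ N" by (simp add: One_nat_def)
  moreover have "0 < (m + 1) ^ N" by simp
  ultimately show False by linarith
qed

text \<open>The Hilbert function of the quotient by \<open>J\<close> grows at least like \<open>m\<^sup>e\<close>.\<close>

definition growth :: "'v set \<Rightarrow> ('v, 'k::field) mpoly set \<Rightarrow> nat \<Rightarrow> nat \<Rightarrow> bool" where
  "growth V J e A \<longleftrightarrow> (\<forall>m. \<exists>(I :: nat set) x. finite I \<and> (m + 1) ^ e \<le> card I \<and> (\<forall>i\<in>I. x i \<in> Pd V (A * m)) \<and>
     indep_mod J x I)"

text \<open>Each step down the chain gains a factor \<open>m + 1\<close> in the number of
  independent elements, from the powers of a single \<open>f\<close>; at the bottom the number of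
  monomials limits the exponent to \<open>card V\<close>.\<close>

lemma chain_length_bound:
  fixes C :: "nat \<Rightarrow> ('v, 'k::field) mpoly set"
  assumes V: "finite V" and C: "\<And>i. i \<le> k \<Longrightarrow> prime_isid V (C i)" "\<And>i. i < k \<Longrightarrow> C i \<subset> C (Suc i)"
    and base: "growth V (C k) e A"
  shows "e + k \<le> card V"
proof -
  have "\<exists>A. growth V (C (k - j)) (e + j) A" if "j \<le> k" for j using that
  proof (induction j)
    case 0
    show ?case using base by auto
  next
    case (Suc j)
    then obtain A where A: "growth V (C (k - j)) (e + j) A" by auto
    have kj: "Suc (k - Suc j) = k - j" using Suc.prems by simp
    have CC: "C (k - Suc j) \<subset> C (k - j)" using C(2)[of "k - Suc j"] Suc.prems kj by simp
    then obtain f where f: "f \<in> C (k - j)" "f \<notin> C (k - Suc j)" by blast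
    have id: "isid V (C (k - j))" using C(1)[of "k - j"] by (simp add: prime_isid_def)
    define a where "a = Max (insert 0 (monom_deg ` supp f))"
    have fP: "f \<in> Pd V a" using isidD(1)[OF id f(1)] by (auto simp: Pd_def a_def)
    show ?case unfolding growth_def
    proof (intro exI[of _ "A + a"] allI)
      fix m
      obtain I :: "nat set" and x where I: "finite I" "(m + 1) ^ (e + j) \<le> card I" "\<And>i. i \<in> I \<Longrightarrow> x i \<in> Pd V (A * m)"
        "indep_mod (C (k - j)) x I" using A[unfolded growth_def, THEN spec, of m] by blast
      define y where "y = (\<lambda>(j, i). f ^ j * x i)"
      define I' where "I' = prod_encode ` ({..m} \<times> I)"
      have bij: "bij_betw prod_decode I' ({..m} \<times> I)"
        unfolding I'_def by (rule bij_betwI[where g = prod_encode]) auto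
      have pC: "prime_isid V (C (k - Suc j))" by (rule C(1)) simp
      have "indep_mod (C (k - Suc j)) y ({..m} \<times> I)"
        unfolding y_def using CC Pd_polys[OF I(3)] by (intro indep_mod_chain_step[OF pC id _ f _ I(4)]) auto
      then have "indep_mod (C (k - Suc j)) (\<lambda>i. y (prod_decode i)) I'" by (rule indep_mod_reindex[OF bij])
      moreover have "finite I'" using I(1) by (simp add: I'_def)
      moreover have "(m + 1) ^ (e + Suc j) \<le> card I'"
      proof -
        have "card I' = (m + 1) * card I"
          unfolding I'_def by (subst card_image) (auto simp: card_cartesian_product One_nat_def inj_prod_encode)
        then show ?thesis using mult_le_mono2[OF I(2), of "m + 1"] by simp
      qed
      moreover have "y (prod_decode i) \<in> Pd V ((A + a) * m)" if "i \<in> I'" for i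
      proof -
        have "prod_decode i \<in> {..m} \<times> I" using bij_betwE[OF bij] that by blast
        then obtain j' l where jl: "prod_decode i = (j', l)" "j' \<le> m" "l \<in> I" by auto
        have "f ^ j' * x l \<in> Pd V (j' * a + A * m)" by (intro Pd_mult Pd_power fP I(3) jl)
        moreover have "j' * a + A * m \<le> (A + a) * m" using jl(2) by (simp add: algebra_simps)
        ultimately show ?thesis using Pd_mono by (simp add: y_def jl(1)) blast
      qed
      ultimately show "\<exists>(I :: nat set) x. finite I \<and> (m + 1) ^ (e + Suc j) \<le> card I \<and> (\<forall>i\<in>I. x i \<in> Pd V ((A + a) * m)) \<and>
          indep_mod (C (k - Suc j)) x I"
        by (intro exI[of _ I'] exI[of _ "\<lambda>i. y (prod_decode i)"] conjI ballI)
    qed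
  qed
  from this[of k] obtain A where A: "growth V (C 0) (e + k) A" by auto
  have C0: "0 \<in> C 0" using C(1)[of 0] isidD(2) by (auto simp: prime_isid_def)
  show ?thesis
  proof (rule power_le_imp_exponent_le)
    fix m
    obtain I :: "nat set" and x where I: "finite I" "(m + 1) ^ (e + k) \<le> card I" "\<And>i. i \<in> I \<Longrightarrow> x i \<in> Pd V (A * m)"
      "indep_mod (C 0) x I" using A[unfolded growth_def, THEN spec, of m] by blast
    show "(m + 1) ^ (e + k) \<le> (A * m + 1) ^ card V" using indep_mod_card[OF V I(1,4,3) C0] I(2) by simp
  qed
qed

definition linf :: "'v set \<Rightarrow> ('v \<Rightarrow> 'l) \<Rightarrow> ('v, 'l::field) mpoly" where
  "linf V h = (\<Sum>u\<in>V. Const (h u) * Var u)"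

lemma linf_H: "linf V h \<in> H V 1"
  unfolding linf_def by (intro H_sum H_Const_mult H_Var)

lemma emb_polys:
  fixes p :: "('v, 'k::field) mpoly"
  assumes "p \<in> polys V"
  shows "emb p \<in> polys V"
proof -
  have "emb (Const (cf p m) * mon m) \<in> polys V" if "m \<in> supp p" for m
  proof -
    have "mon m \<in> (polys V :: ('v, 'k alg_closure) mpoly set)" using assms that by (intro H_polys[OF H_mon]) (simp add: polys_def)
    then show ?thesis by (simp add: emb.hom_mult polys_mult)
  qed
  then have "(\<Sum>m\<in>supp p. emb (Const (cf p m) * mon m)) \<in> polys V" by (rule polys_sum)
  then show ?thesis by (simp flip: mpoly_expand emb.hom_sum)
qed

text \<open>Monomials spanning modulo the contraction over K also span modulo \<open>Q\<close> over
  the closure. So they are at least as many as the monomials with exponents up to \<open>m\<close>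
  in the forms of \<open>hs\<close>, which are algebraically independent modulo
  \<open>Q\<close>.\<close>

lemma growth_contraction:
  fixes Q :: "('v, 'k::field alg_closure) mpoly set" and hs :: "('v \<Rightarrow> 'k alg_closure) set"
  assumes V: "finite V" and Q: "isid V Q" and hs: "finite hs"
    and disj: "\<And>F. F \<in> polys hs \<Longrightarrow> subst (linf V) F \<in> Q \<Longrightarrow> F = 0"
  shows "growth V {p \<in> polys V. emb p \<in> Q} (card hs) (card hs)" unfolding growth_def
proof
  fix m
  let ?P = "{p \<in> polys V. emb p \<in> Q}" and ?M = "exps V (card hs * m)"
  have P: "isid V ?P"
    by (auto simp: isid_def emb.hom_add emb.hom_mult polys_add polys_mult intro: isidD[OF Q] emb_polys)
  have finM: "finite ?M" by (rule finite_exponents[OF V])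
  have "indep_mod ?P mon {}" by (simp add: indep_mod_def)
  from indep_mod_extend[OF isid_subspace[OF P] finM finite.emptyI this] obtain B where
    "B \<subseteq> {} \<union> ?M" and B: "indep_mod ?P mon B" "\<forall>\<mu>\<in>?M. mon \<mu> \<in> mp.span (mon ` B \<union> ?P)"
    by (elim exE conjE) (rule that)
  then have BM: "B \<subseteq> ?M" by simp
  have finB: "finite B" using BM finM finite_subset by blast
  define \<alpha> where "\<alpha> f = (\<Sum>h\<in>hs. Poly_Mapping.single h (f h))" for f :: "('v \<Rightarrow> 'k alg_closure) \<Rightarrow> nat"
  have cf\<alpha>: "cf (\<alpha> f) h = (if h \<in> hs then f h else 0)" for f h
    using hs by (simp add: \<alpha>_def lookup_sum lookup_single when_def)
  have supp\<alpha>: "supp (\<alpha> f) \<subseteq> hs" for f by (auto simp: in_keys_iff cf\<alpha> split: if_splits)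
  let ?I = "PiE hs (\<lambda>_. {..m})"
  have "card ?I \<le> card B"
  proof (rule mp.indep_mod_bound[where J = Q and x = "\<lambda>f. subst (linf V) (mon (\<alpha> f))" and b = mon])
    show "mp.subspace Q" by (rule isid_subspace[OF Q])
    show "finite ?I" using hs by (intro finite_PiE) auto
    show "subst (linf V) (mon (\<alpha> f)) \<in> mp.span (mon ` B \<union> Q)" if f: "f \<in> ?I" for f
    proof -
      have "monom_deg (\<alpha> f) = (\<Sum>h\<in>hs. f h)" by (subst monom_deg_superset[OF hs supp\<alpha>]) (simp add: cf\<alpha>)
      also have "\<dots> \<le> (\<Sum>h\<in>hs. m)" using f by (intro sum_mono) auto
      finally have deg: "monom_deg (\<alpha> f) \<le> card hs * m" by simp
      have "subst (linf V) (mon (\<alpha> f)) \<in> H V (monom_deg (\<alpha> f))"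
        using H_mon[OF supp\<alpha>] linf_H by (rule subst_H)
      then have "subst (linf V) (mon (\<alpha> f)) \<in> mp.span (mon ` ?M)" by (rule Pd_span[OF Pd_mono[OF H_Pd deg]])
      also have "mp.span (mon ` ?M) \<subseteq> mp.span (mon ` B \<union> Q)"
      proof (rule mp.span_minimal[OF image_subsetI mp.subspace_span])
        fix \<mu> assume "\<mu> \<in> ?M"
        from bspec[OF B(2) this] obtain c where c: "mon \<mu> - (\<Sum>b\<in>B. Const (c b) * mon b) \<in> ?P"
          using mp.span_family_mod[OF isid_subspace[OF P] finB] by blast
        then have "emb (mon \<mu> - (\<Sum>b\<in>B. Const (c b) * mon b)) \<in> Q" by simp
        then have "mon \<mu> - (\<Sum>b\<in>B. Const (to_ac (c b)) * mon b) \<in> Q"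
          by (simp add: emb.hom_minus emb.hom_sum emb.hom_mult)
        then have "mon \<mu> - (\<Sum>b\<in>B. Const (to_ac (c b)) * mon b) \<in> mp.span (mon ` B \<union> Q)"
          by (intro mp.span_base) blast
        moreover have "(\<Sum>b\<in>B. Const (to_ac (c b)) * mon b) \<in> mp.span (mon ` B \<union> Q)"
          by (intro mp.span_sum mp.span_scale mp.span_base) auto
        ultimately show "mon \<mu> \<in> mp.span (mon ` B \<union> Q)" using mp.span_add by fastforce
      qed
      finally show ?thesis .
    qed
    show "\<forall>f\<in>?I. c f = 0" if c: "(\<Sum>f\<in>?I. Const (c f) * subst (linf V) (mon (\<alpha> f))) \<in> Q" for c
    proof
      fix f assume f: "f \<in> ?I"
      define F where "F = (\<Sum>f\<in>?I. Const (c f) * mon (\<alpha> f))"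
      have "subst (linf V) F \<in> Q" using c by (simp add: F_def subst.hom_sum subst.hom_mult)
      moreover have "F \<in> polys hs"
        unfolding F_def using H_polys[OF H_mon[OF supp\<alpha>]] by (intro polys_sum polys_mult) auto
      ultimately have "F = 0" by (rule disj[rotated])
      have "cf F (\<alpha> f) = (\<Sum>f'\<in>?I. if f' = f then c f else 0)" unfolding F_def lookup_sum
      proof (rule sum.cong)
        fix f' assume f': "f' \<in> ?I"
        have "\<alpha> f' = \<alpha> f \<longleftrightarrow> f' = f"
        proof
          assume eq: "\<alpha> f' = \<alpha> f"
          show "f' = f"
          proof (rule PiE_ext[OF f' f])
            fix h assume "h \<in> hs"
            then show "f' h = f h" using arg_cong[OF eq, of "\<lambda>a. cf a h"] by (simp add: cf\<alpha>)
          qed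
        qed simp
        then show "cf (Const (c f') * mon (\<alpha> f')) (\<alpha> f) = (if f' = f then c f else 0)" by (simp add: lookup_mon)
      qed simp
      also have "\<dots> = c f" using f hs finite_PiE[of hs "\<lambda>_. {..m}"] by simp
      finally show "c f = 0" using \<open>F = 0\<close> by simp
    qed
  qed (rule finB)
  then have card: "(m + 1) ^ card hs \<le> card B" by (simp add: card_PiE[OF hs] Suc_eq_plus1)
  obtain g where g: "bij_betw g {0..<card B} B" using ex_bij_betw_nat_finite[OF finB] by blast
  have "indep_mod ?P (\<lambda>i. mon (g i)) {0..<card B}" by (rule indep_mod_reindex[OF g B(1)])
  moreover have "(mon (g i) :: ('v, 'k) mpoly) \<in> Pd V (card hs * m)" if "i \<in> {0..<card B}" for i
  proof -
    have "g i \<in> ?M" using bij_betwE[OF g] that BM by blast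
    then show ?thesis using H_Pd[OF H_mon[of "g i" V]] Pd_mono by blast
  qed
  ultimately show "\<exists>(I :: nat set) x. finite I \<and> (m + 1) ^ card hs \<le> card I \<and>
      (\<forall>i\<in>I. x i \<in> Pd V (card hs * m)) \<and> indep_mod ?P x I"
    using card by (intro exI[of _ "{0..<card B}"] exI[of _ "\<lambda>i. mon (g i)"]) simp
qed

subsection \<open>The height condition\<close>

lemma evp_scale: "p \<in> H W d \<Longrightarrow> evp (\<lambda>u. s * c u) p = s ^ d * evp c p"
proof (induction rule: H_induct)
  case (mon a m)
  have "evm (\<lambda>u. s * c u) m = s ^ monom_deg m * evm c m"
    by (simp add: evm_def power_mult_distrib prod.distrib monom_deg_def power_sum)
  then show ?case using mon(2) by (simp add: evp_hom ev_mon[OF comm_ring_hom_id])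
qed (simp_all add: evp_hom distrib_left)

lemma evp_linf: "evp P (linf V h) = (\<Sum>u\<in>V. h u * P u)"
  by (simp add: linf_def evp_hom)

text \<open>Suppose a homogeneous relation \<open>F\<close> between the forms in \<open>hs\<close> holds on the cone and choose \<open>c\<close>
  with \<open>F(c) \<noteq> 0\<close>, say \<open>c j \<noteq> 0\<close>. Then the forms \<open>h - (c h / c j) j\<close> already suffice to cut out the
  origin, because on their common zeros all values of the \<open>h\<close> are proportional to \<open>c\<close>.\<close>

lemma minimal_section_independent:
  fixes Z :: "('v \<Rightarrow> 'l::alg_closed_field) set" and hs :: "('v \<Rightarrow> 'l) set"
  assumes V: "finite V" and hs: "finite hs"
    and cone: "\<And>P t. P \<in> Z \<Longrightarrow> (\<lambda>u. t * P u) \<in> Z" and Z0: "(\<lambda>_. 0) \<in> Z"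
    and good: "\<And>P. P \<in> Z \<Longrightarrow> (\<And>h. h \<in> hs \<Longrightarrow> evp P (linf V h) = 0) \<Longrightarrow> \<forall>u\<in>V. P u = 0"
    and min: "\<And>hs'. finite hs' \<Longrightarrow> card hs' < card hs \<Longrightarrow>
      \<exists>P\<in>Z. (\<forall>h\<in>hs'. evp P (linf V h) = 0) \<and> (\<exists>u\<in>V. P u \<noteq> 0)"
    and F: "F \<in> polys hs" "\<And>P. P \<in> Z \<Longrightarrow> evp P (subst (linf V) F) = 0"
  shows "F = 0"
proof (rule ccontr)
  assume "F \<noteq> 0"
  define val where "val P h = evp P (linf V h)" for P h :: "'v \<Rightarrow> 'l"
  have FP: "evp (val P) F = 0" if "P \<in> Z" for P using F(2)[OF that] by (simp add: evp_subst val_def[abs_def])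
  have val_scale: "val (\<lambda>u. t * P u) = (\<lambda>h. t * val P h)" for t P
    by (rule ext) (simp add: val_def evp_linf sum_distrib_left mult.left_commute)
  define D where "D = Max (insert 0 (monom_deg ` supp F))"
  have Fsum: "F = (\<Sum>d\<le>D. hc d F)" by (rule hc_decompose) (simp add: D_def)
  \<comment> \<open>The zero set is a cone, so along a line through the origin the values form a
    polynomial in \<open>t\<close> with infinitely many zeros; hence every homogeneous component of
    \<open>F\<close> vanishes.\<close>
  have hcP: "evp (val P) (hc d F) = 0" if P: "P \<in> Z" and d: "d \<le> D" for P d
  proof -
    define R where "R = (\<Sum>d\<le>D. Polynomial.monom (evp (val P) (hc d F)) d)"
    have "poly R t = 0" for t
    proof -
      have "0 = evp (val (\<lambda>u. t * P u)) F" using FP[OF cone[OF P]] by simp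
      also have "\<dots> = (\<Sum>d\<le>D. evp (\<lambda>h. t * val P h) (hc d F))" by (subst Fsum) (simp add: evp_hom val_scale)
      also have "\<dots> = (\<Sum>d\<le>D. t ^ d * evp (val P) (hc d F))" by (intro sum.cong refl evp_scale[OF hc_H[OF F(1)]])
      also have "\<dots> = poly R t" by (simp add: R_def poly_sum poly_monom mult.commute)
      finally show ?thesis by simp
    qed
    then have "{t. poly R t = 0} = UNIV" by simp
    then have "R = 0" using poly_roots_finite[of R] infinite_alg_closed[where 'a = 'l] by auto
    then have "Polynomial.coeff R d = 0" by simp
    then show ?thesis using d by (simp add: R_def coeff_sum)
  qed
  have "\<exists>d\<le>D. hc d F \<noteq> 0"
  proof (rule ccontr)
    assume "\<not> ?thesis"
    then have "(\<Sum>d\<le>D. hc d F) = 0" by (intro sum.neutral) auto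
    then show False using Fsum \<open>F \<noteq> 0\<close> by simp
  qed
  then obtain d where d: "d \<le> D" "hc d F \<noteq> 0" by blast
  have FH: "hc d F \<in> H hs d" by (rule hc_H[OF F(1)])
  obtain c where c: "evp c (hc d F) \<noteq> 0"
    using mpoly_eq_0_of_evp[OF infinite_alg_closed hs H_polys[OF FH]] d(2) by blast
  have "\<exists>j\<in>hs. c j \<noteq> 0"
  proof (rule ccontr)
    assume "\<not> ?thesis"
    then have "evp c (hc d F) = evp (val (\<lambda>_. 0)) (hc d F)"
      by (intro evp_cong[OF H_polys[OF FH]]) (simp add: val_def evp_linf)
    then show False using c hcP[OF Z0 d(1)] by simp
  qed
  then obtain j where j: "j \<in> hs" "c j \<noteq> 0" by blast
  define hs' where "hs' = (\<lambda>h u. h u - c h / c j * j u) ` (hs - {j})"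
  have "card hs' \<le> card (hs - {j})" unfolding hs'_def using hs by (intro card_image_le) simp
  also have "\<dots> < card hs" using hs j(1) by (intro psubset_card_mono) auto
  finally have "card hs' < card hs" .
  moreover have "finite hs'" using hs by (simp add: hs'_def)
  ultimately obtain P where P: "P \<in> Z" "\<And>h. h \<in> hs' \<Longrightarrow> evp P (linf V h) = 0" "\<exists>u\<in>V. P u \<noteq> 0" using min by blast
  define s where "s = val P j / c j"
  have vprop: "val P h = s * c h" if h: "h \<in> hs" for h
  proof (cases "h = j")
    case True
    then show ?thesis using j by (simp add: s_def)
  next
    case False
    have "evp P (linf V (\<lambda>u. h u - c h / c j * j u)) = val P h - c h / c j * val P j"
      by (simp add: val_def evp_linf left_diff_distrib sum_subtractf sum_distrib_left mult.assoc)
    then show ?thesis using P(2)[of "\<lambda>u. h u - c h / c j * j u"] h False by (simp add: hs'_def s_def)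
  qed
  have "evp (val P) (hc d F) = evp (\<lambda>h. s * c h) (hc d F)" by (rule evp_cong[OF H_polys[OF FH]]) (rule vprop)
  also have "\<dots> = s ^ d * evp c (hc d F)" by (rule evp_scale[OF FH])
  finally have "s ^ d = 0" using hcP[OF P(1) d(1)] c by simp
  then have "s = 0" by simp
  then have "\<forall>u\<in>V. P u = 0" using good[OF P(1)] vprop by (simp add: val_def)
  then show False using P(3) by blast
qed

text \<open>Take a smallest set \<open>hs\<close> of linear forms cutting out the origin on the rank
  locus. By minimality they stay algebraically independent there, so some prime contains the minors
  and avoids all nonzero polynomials in these forms; its contraction \<open>P\<close> has height at
  most \<open>card V - card hs\<close>. Failure of \<open>gpos\<close> makes this smaller than n -
  1.\<close>

theorem gpos_of_height:
  fixes M :: "('v, 'k::field) mpoly mat"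
  assumes V: "finite V" and n: "0 < n" and M: "M \<in> carrier_mat 2 n" "\<forall>e \<in> elements_mat M. linear_form V e"
    and height: "enat (n - 1) \<le> ideal_height (mpoly_ring V) (minors_ideal V 2 M)"
  shows "gpos V n (entries n M)"
proof (rule ccontr)
  assume no: "\<not> ?thesis"
  have ent: "entries n M r \<in> H V 1" if "r < 2 * n" for r using entries_H1[OF M that] .
  define Z where "Z = {P. low_rank n (\<lambda>r. ev to_ac P (entries n M r))}"
  have event: "ev to_ac P (entries n M r) = (\<Sum>u\<in>V. to_ac (cf (entries n M r) (expo u)) * P u)" if "r < 2 * n" for P r
    by (rule ev_H1[OF comm_ring_hom_to_ac ent[OF that] V])
  have cone: "(\<lambda>u. t * P u) \<in> Z" if P: "P \<in> Z" for P t
  proof -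
    have "ev to_ac (\<lambda>u. t * P u) (entries n M r) = t * ev to_ac P (entries n M r)" if "r < 2 * n" for r
      unfolding event[OF that] by (simp add: sum_distrib_left mult.left_commute)
    moreover have "i < 2 * n" "n + i < 2 * n" if "i < n" for i using that by auto
    ultimately show ?thesis using P by (simp add: Z_def low_rank_def)
  qed
  have Z0: "(\<lambda>_. 0) \<in> Z" using event[of _ "\<lambda>_. 0"] by (auto simp: Z_def low_rank_def)
  define good where "good hs \<longleftrightarrow> finite hs \<and> (\<forall>P\<in>Z. (\<forall>h\<in>hs. evp P (linf V h) = 0) \<longrightarrow> (\<forall>u\<in>V. P u = 0))"
    for hs :: "('v \<Rightarrow> 'k alg_closure) set"
  have "good ((\<lambda>v u. if u = v then 1 else 0) ` V)" (is "good ?cs")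
  proof -
    have "P v = 0" if "\<forall>h\<in>?cs. evp P (linf V h) = 0" "v \<in> V" for P v
    proof -
      have "(\<Sum>u\<in>V. (if u = v then 1 else 0) * P u) = 0" using that by (auto simp: evp_linf)
      moreover have "(\<Sum>u\<in>V. (if u = v then 1 else 0) * P u) = (\<Sum>u\<in>V. if u = v then P v else 0)"
        by (intro sum.cong) auto
      ultimately show ?thesis using V that(2) by simp
    qed
    then show ?thesis using V by (auto simp: good_def)
  qed
  then obtain hs where hs: "good hs" "\<And>hs'. good hs' \<Longrightarrow> card hs \<le> card hs'"
    using ex_has_least_nat[of good ?cs card] by blast
  have finhs: "finite hs" using hs(1) by (simp add: good_def)
  have big: "card V + 1 < card hs + n"
  proof (rule ccontr)
    assume "\<not> ?thesis"
    then have "gpos V n (entries n M)"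
      using hs(1) unfolding gpos_def good_def Z_def evp_linf by (intro exI[of _ hs]) auto
    then show False using no by contradiction
  qed
  define I0 where "I0 = idl V (emb ` minors 2 M)"
  have mH: "minors 2 M \<subseteq> polys V"
  proof
    fix p assume "p \<in> minors 2 M"
    then obtain i j where p: "p = subst (entries n M) (gminor n i j)" "i < n" "j < n" using minors_2_gminor[OF M(1)] by blast
    have "gminor n i j \<in> H (gv n) 2" using p by (intro gminor_H)
    then have "subst (entries n M) (gminor n i j) \<in> H V 2" by (rule subst_H) (use ent in auto)
    then show "p \<in> polys V" unfolding p(1) by (rule H_polys)
  qed
  have mE: "emb ` minors 2 M \<subseteq> polys V"
  proof
    fix p assume "p \<in> emb ` minors 2 M"
    then obtain i j where p: "p = emb (subst (entries n M) (gminor n i j))" "i < n" "j < n" using minors_2_gminor[OF M(1)] by blast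
    have "gminor n i j \<in> H (gv n) 2" using p by (intro gminor_H)
    then have "subst (entries n M) (gminor n i j) \<in> H V 2" by (rule subst_H) (use ent in auto)
    then show "p \<in> polys V" unfolding p(1) by (intro H_polys[OF emb_H])
  qed
  have I0: "isid V I0" unfolding I0_def by (rule isid_idl[OF mE])
  have I0Z: "evp P p = 0" if "p \<in> I0" "P \<in> Z" for p P using that(1) unfolding I0_def
  proof (induction rule: idl.induct)
    case (idl_mult q g)
    then obtain i j where g: "g = emb (subst (entries n M) (gminor n i j))" "i < n" "j < n" using minors_2_gminor[OF M(1)] by blast
    have "subst (entries n M) (gminor n i j) = entries n M i * entries n M (n + j) - entries n M j * entries n M (n + i)"
      by (simp add: gminor_def subst.hom_minus subst.hom_mult)
    also have "ev to_ac P \<dots> = 0"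
    proof -
      interpret e: comm_ring_hom "ev to_ac P" by (rule comm_ring_hom_ev[OF comm_ring_hom_to_ac])
      show ?thesis using that(2) g by (simp add: e.hom_minus e.hom_mult Z_def low_rank_def)
    qed
    finally show ?case by (simp add: g(1) evp_hom evp_emb)
  qed (simp_all add: evp_hom)
  have key: "F = 0" if "F \<in> polys hs" "subst (linf V) F \<in> I0" for F
  proof (rule minimal_section_independent[OF V finhs cone Z0 _ _ that(1)])
    show "\<forall>u\<in>V. P u = 0" if "P \<in> Z" "\<And>h. h \<in> hs \<Longrightarrow> evp P (linf V h) = 0" for P
      using hs(1) that by (auto simp: good_def)
    show "\<exists>P\<in>Z. (\<forall>h\<in>hs'. evp P (linf V h) = 0) \<and> (\<exists>u\<in>V. P u \<noteq> 0)" if "finite hs'" "card hs' < card hs" for hs'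
      using hs(2)[of hs'] that by (auto simp: good_def not_le)
    show "evp P (subst (linf V) F) = 0" if "P \<in> Z" for P by (rule I0Z[OF _ that]) fact
  qed
  define S where "S = subst (linf V) ` (polys hs - {0})"
  have subst_polys: "subst (linf V) p \<in> polys V" if "p \<in> polys hs" for p
  proof -
    define D where "D = Max (insert 0 (monom_deg ` supp p))"
    have "p = (\<Sum>d\<le>D. hc d p)" by (rule hc_decompose) (simp add: D_def)
    then have "subst (linf V) p = (\<Sum>d\<le>D. subst (linf V) (hc d p))" by (metis subst.hom_sum)
    also have "\<dots> \<in> polys V" by (intro polys_sum H_polys[OF subst_H[OF hc_H[OF that] linf_H]])
    finally show ?thesis .
  qed
  have "\<exists>Q. prime_isid V Q \<and> I0 \<subseteq> Q \<and> Q \<inter> S = {}"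
  proof (rule exists_prime_disjoint[OF I0])
    have "subst (linf V) 1 \<in> S" unfolding S_def by (intro imageI) simp
    then show "1 \<in> S" by (simp add: subst.hom_one)
    show "S \<subseteq> polys V" unfolding S_def using subst_polys by blast
    show "x * y \<in> S" if xy: "x \<in> S" "y \<in> S" for x y
    proof -
      obtain F where F: "x = subst (linf V) F" "F \<in> polys hs" "F \<noteq> 0" using xy(1) unfolding S_def by blast
      obtain F' where F': "y = subst (linf V) F'" "F' \<in> polys hs" "F' \<noteq> 0" using xy(2) unfolding S_def by blast
      from F F' have "F * F' \<in> polys hs - {0}" using mpoly_no_zero_divisors polys_mult by blast
      moreover have "x * y = subst (linf V) (F * F')" by (simp add: F F' subst.hom_mult)
      ultimately show ?thesis by (auto simp: S_def)
    qed
    show "I0 \<inter> S = {}" using key by (auto simp: S_def)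
  qed
  then obtain Q where Q: "prime_isid V Q" "I0 \<subseteq> Q" "Q \<inter> S = {}" by blast
  have Qid: "isid V Q" using Q(1) by (simp add: prime_isid_def)
  define P where "P = {p \<in> polys V. emb p \<in> Q}"
  have P: "prime_isid V P" unfolding prime_isid_def
  proof (intro conjI ballI impI)
    show "isid V P"
      by (auto simp: P_def isid_def emb.hom_add emb.hom_mult polys_add polys_mult intro: isidD[OF Qid] emb_polys)
    show "1 \<notin> P" using Q(1) by (simp add: P_def prime_isid_def emb.hom_one)
    fix x y assume xy: "x \<in> polys V" "y \<in> polys V" "x * y \<in> P"
    have "emb x * emb y \<in> Q" using xy(3) by (simp add: P_def emb.hom_mult)
    then have "emb x \<in> Q \<or> emb y \<in> Q" using Q(1) emb_polys[OF xy(1)] emb_polys[OF xy(2)] unfolding prime_isid_def by blast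
    then show "x \<in> P \<or> y \<in> P" using xy(1,2) by (auto simp: P_def)
  qed
  have disj: "F = 0" if "F \<in> polys hs" "subst (linf V) F \<in> Q" for F using Q(3) that by (auto simp: S_def)
  have kbound: "card hs + k \<le> card V" if "\<And>i. i \<le> k \<Longrightarrow> prime_isid V (C i)" "\<And>i. i < k \<Longrightarrow> C i \<subset> C (Suc i)" "C k = P" for k C
  proof (rule chain_length_bound[OF V])
    show "growth V (C k) (card hs) (card hs)"
      unfolding that(3) P_def by (rule growth_contraction[OF V Qid finhs disj])
  qed (fact that)+
  have e: "card hs \<le> card V" using kbound[of 0 "\<lambda>_. P"] P by simp
  have "primeideal P (mpoly_ring V)" using P by (simp add: primeideal_iff)
  moreover have "minors_ideal V 2 M \<subseteq> P"
  proof -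
    have "minors 2 M \<subseteq> P"
    proof
      fix p assume p: "p \<in> minors 2 M"
      have "1 * emb p \<in> I0" unfolding I0_def using p by (intro idl.idl_mult) auto
      then show "p \<in> P" using Q(2) p mH by (auto simp: P_def)
    qed
    have Pid: "isid V P" using P by (simp add: prime_isid_def)
    have "p \<in> P" if "p \<in> idl V (minors 2 M)" for p
      using that by (induction rule: idl.induct) (use \<open>minors 2 M \<subseteq> P\<close> in \<open>auto intro: isidD[OF Pid]\<close>)
    then show ?thesis by (auto simp: minors_ideal_def genideal_idl[OF mH])
  qed
  ultimately have "ideal_height (mpoly_ring V) (minors_ideal V 2 M) \<le> prime_height (mpoly_ring V) P"
    unfolding ideal_height_def by (intro INF_lower) simp
  also have "\<dots> \<le> enat (card V - card hs)" unfolding prime_height_def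
  proof (rule SUP_least)
    fix k assume "k \<in> {k. \<exists>C. (\<forall>i\<le>k. primeideal (C i) (mpoly_ring V)) \<and> (\<forall>i<k. C i \<subset> C (Suc i)) \<and> C k = P}"
    then obtain C where "\<forall>i\<le>k. prime_isid V (C i)" "\<forall>i<k. C i \<subset> C (Suc i)" "C k = P" by (auto simp: primeideal_iff)
    then have "card hs + k \<le> card V" by (intro kbound[of k C]) auto
    then show "enat k \<le> enat (card V - card hs)" by simp
  qed
  finally have "n - 1 \<le> card V - card hs" using height order_trans by fastforce
  then show False using big e n by simp
qed

subsection \<open>Rational normal scrolls\<close>

definition scroll_index :: "nat list \<Rightarrow> (nat \<times> nat) list" where
  "scroll_index a = concat (map (\<lambda>i. map (Pair i) [0..<a ! i]) [0..<length a])"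

lemma set_scroll_index: "set (scroll_index a) = {(i, j). i < length a \<and> j < a ! i}"
  by (auto simp: scroll_index_def)

lemma length_scroll_index: "length (scroll_index a) = (\<Sum>i<length a. a ! i)"
proof -
  have "length (scroll_index a) = sum_list (map (\<lambda>i. a ! i) [0..<length a])"
    by (simp add: scroll_index_def length_concat comp_def)
  then show ?thesis by (simp add: sum_list_sum_nth lessThan_atLeast0)
qed

lemma scroll_matrix_index:
  "scroll_matrix a = mat_of_cols_list 2 (map (\<lambda>(i, j). [Var (i, j), Var (i, Suc j)]) (scroll_index a))"
  by (simp add: scroll_matrix_def scroll_index_def map_concat comp_def)

lemma scroll_matrix_carrier: "scroll_matrix a \<in> carrier_mat 2 (length (scroll_index a))"
  by (simp add: scroll_matrix_index mat_of_cols_list_def)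

lemma scroll_matrix_nth:
  assumes "c < length (scroll_index a)" "scroll_index a ! c = (i, j)"
  shows "scroll_matrix a $$ (0, c) = Var (i, j)" "scroll_matrix a $$ (1, c) = Var (i, Suc j)"
  using assms by (simp_all add: scroll_matrix_index mat_of_cols_list_def One_nat_def)

lemma scroll_vars_Sigma: "scroll_vars a = Sigma {..<length a} (\<lambda>i. {..a ! i})"
  by (auto simp: scroll_vars_def)

lemma finite_scroll_vars: "finite (scroll_vars a)"
  by (simp add: scroll_vars_Sigma)

lemma card_scroll_vars: "card (scroll_vars a) = length (scroll_index a) + length a"
  by (simp add: scroll_vars_Sigma length_scroll_index sum.distrib Suc_eq_plus1 del: sum.lessThan_Suc)

lemma scroll_matrix_linear:
  assumes "e \<in> elements_mat (scroll_matrix a :: (nat \<times> nat, 'k::field) mpoly mat)"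
  shows "linear_form (scroll_vars a) e"
proof -
  obtain p c where pc: "e = scroll_matrix a $$ (p, c)" "p < 2" "c < length (scroll_index a)"
    using assms scroll_matrix_carrier[of a, where 'a = 'k] unfolding elements_mat_def by fastforce
  obtain i j where ij: "scroll_index a ! c = (i, j)" by fastforce
  then have "i < length a" "j < a ! i" using nth_mem[OF pc(3)] set_scroll_index[of a] by auto
  then have v: "(i, j) \<in> scroll_vars a" "(i, Suc j) \<in> scroll_vars a" by (auto simp: scroll_vars_def)
  have "p = 0 \<or> p = 1" using pc(2) by auto
  then have "e = Var (i, j) \<or> e = Var (i, Suc j)" using pc(1) scroll_matrix_nth[OF pc(3) ij] by auto
  then have "e \<in> H (scroll_vars a) 1" using H_Var v by auto
  then show ?thesis by (simp add: linear_form_def H_iff carrier_mpoly_ring del: mpoly_ring_simps(1))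
qed

text \<open>On the section by \<open>x\<^sub>0\<^sub>,\<^sub>0\<close>, the differences of the last variable of a block and the first one of
  the next block, and the very last variable, the matrix becomes a Hankel matrix, whose rank
  condition propagates the vanishing of the first variable.\<close>

lemma gpos_scroll:
  assumes a: "a \<noteq> []" "\<forall>c\<in>set a. 0 < c"
  shows "gpos (scroll_vars a) (length (scroll_index a)) (entries (length (scroll_index a)) (scroll_matrix a :: (nat \<times> nat, 'k::field) mpoly mat))"
proof -
  let ?n = "length (scroll_index a)" and ?V = "scroll_vars a" and ?r = "length a"
  define \<delta> where "\<delta> v u = (if u = v then 1 else 0 :: 'k alg_closure)" for v u :: "nat \<times> nat"
  \<comment> \<open>Two end variables and \<open>?r - 1\<close> gluing forms: at most
    \<open>?r + 1\<close>, which is the permitted number \<open>card ?V + 1 - ?n\<close>.\<close>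
  define hs where "hs = insert (\<delta> (0, 0)) (insert (\<delta> (?r - 1, a ! (?r - 1)))
    ((\<lambda>i u. \<delta> (i, a ! i) u - \<delta> (Suc i, 0) u) ` {..<?r - 1}))"
  have pos: "0 < a ! i" if "i < ?r" for i using a(2) that by auto
  have r: "0 < ?r" using a(1) by simp
  have \<delta>: "(\<Sum>u\<in>?V. \<delta> v u * P u) = P v" if "v \<in> ?V" for v P
  proof -
    have "(\<Sum>u\<in>?V. \<delta> v u * P u) = (\<Sum>u\<in>?V. if u = v then P v else 0)" by (intro sum.cong) (auto simp: \<delta>_def)
    then show ?thesis using that finite_scroll_vars by simp
  qed
  have "card hs \<le> Suc (Suc (?r - 1))"
  proof -
    have "card ((\<lambda>i u. \<delta> (i, a ! i) u - \<delta> (Suc i, 0) u) ` {..<?r - 1}) \<le> ?r - 1"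
      using card_image_le[of "{..<?r - 1}"] by simp
    then show ?thesis unfolding hs_def by (simp add: card_insert_if)
  qed
  then have card: "card hs + ?n \<le> card ?V + 1" using r by (simp add: card_scroll_vars)
  have zero: "\<forall>u\<in>?V. P u = 0"
    if h: "\<forall>h\<in>hs. (\<Sum>u\<in>?V. h u * P u) = 0" and lr: "low_rank ?n (\<lambda>r. ev to_ac P (entries ?n (scroll_matrix a :: (nat \<times> nat, 'k) mpoly mat) r))"
    for P
  proof -
    have rel: "P (i, j) * P (i', Suc j') = P (i', j') * P (i, Suc j)"
      if ij: "i < ?r" "j < a ! i" "i' < ?r" "j' < a ! i'" for i j i' j'
    proof -
      have "(i, j) \<in> set (scroll_index a)" "(i', j') \<in> set (scroll_index a)" using ij by (auto simp: set_scroll_index)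
      then obtain c c' where c: "c < ?n" "scroll_index a ! c = (i, j)" "c' < ?n" "scroll_index a ! c' = (i', j')"
        by (auto simp: in_set_conv_nth)
      have e: "ev to_ac P (entries ?n (scroll_matrix a :: (nat \<times> nat, 'k) mpoly mat) c) = P (i, j)"
        "ev to_ac P (entries ?n (scroll_matrix a :: (nat \<times> nat, 'k) mpoly mat) (?n + c)) = P (i, Suc j)"
        if "c < ?n" "scroll_index a ! c = (i, j)" for c i j
      proof -
        have "scroll_matrix a $$ (0, c) = (Var (i, j) :: (nat \<times> nat, 'k) mpoly)"
          "scroll_matrix a $$ (1, c) = (Var (i, Suc j) :: (nat \<times> nat, 'k) mpoly)"
          by (rule scroll_matrix_nth[OF that])+
        then show "ev to_ac P (entries ?n (scroll_matrix a :: (nat \<times> nat, 'k) mpoly mat) c) = P (i, j)"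
          "ev to_ac P (entries ?n (scroll_matrix a :: (nat \<times> nat, 'k) mpoly mat) (?n + c)) = P (i, Suc j)"
          using that(1) ev_Var[OF comm_ring_hom_to_ac] by (simp_all add: entries_def)
      qed
      show ?thesis using lr[unfolded low_rank_def, rule_format, OF c(1,3)] unfolding e[OF c(1,2)] e[OF c(3,4)] .
    qed
    have first: "P (0, 0) = 0" using h \<delta>[of "(0, 0)" P] r by (auto simp: hs_def scroll_vars_def)
    have last: "P (?r - 1, a ! (?r - 1)) = 0" using h \<delta>[of "(?r - 1, a ! (?r - 1))" P] r by (auto simp: hs_def scroll_vars_def)
    have glue: "P (i, a ! i) = P (Suc i, 0)" if i: "Suc i < ?r" for i
    proof -
      have "i < ?r - 1" using i by simp
      then have "(\<lambda>u. \<delta> (i, a ! i) u - \<delta> (Suc i, 0) u) \<in> hs" unfolding hs_def by blast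
      from bspec[OF h this] have "(\<Sum>u\<in>?V. (\<delta> (i, a ! i) u - \<delta> (Suc i, 0) u) * P u) = 0" .
      moreover have "(i, a ! i) \<in> ?V" "(Suc i, 0) \<in> ?V" using i by (auto simp: scroll_vars_def)
      ultimately show ?thesis using \<delta>[of _ P] by (simp add: left_diff_distrib sum_subtractf)
    qed
    have block: "P (i, j) = 0" if b: "P (i, 0) = 0" "i < ?r" "j \<le> a ! i" for i j using b(3)
    proof (induction j)
      case 0
      show ?case by (rule b)
    next
      case (Suc j)
      then have IH: "P (i, j) = 0" and j: "j < a ! i" by simp_all
      consider "Suc j < a ! i" | "Suc j = a ! i" "Suc i < ?r" | "Suc j = a ! i" "i = ?r - 1"
        using Suc.prems b(2) by linarith
      then show ?case
      proof cases
        case 1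
        \<comment> \<open>Two neighbouring columns: the product of the outer variables is the square
          of the middle one.\<close>
        then show ?thesis using rel[of i j i "Suc j"] b(2) IH j by simp
      next
        case 2
        \<comment> \<open>The last column of this block against the first of the next: by gluing,
          the right-hand side is the square of the value in question.\<close>
        then have "P (i, j) * P (Suc i, Suc 0) = P (Suc i, 0) * P (i, Suc j)"
          using pos b(2) j by (intro rel) auto
        then show ?thesis using glue[OF 2(2)] 2(1) IH by simp
      next
        case 3
        then show ?thesis using last by simp
      qed
    qed
    have start: "P (i, 0) = 0" if "i < ?r" for i using that
    proof (induction i)
      case (Suc i)
      then show ?case using block[of i "a ! i"] glue[of i] by simp
    qed (rule first)
    show ?thesis using block start by (auto simp: scroll_vars_def)
  qed
  show ?thesis unfolding gpos_def using card zero by (intro exI[of _ hs]) (auto simp: hs_def)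
qed

theorem corollary3p9:
  shows "(\<forall>(V :: 'v set) (n :: nat) (X :: ('v, 'k::field) mpoly mat).
            finite V \<longrightarrow> 2 \<le> n \<longrightarrow> X \<in> carrier_mat 2 n \<longrightarrow>
            (\<forall>e \<in> elements_mat X. linear_form V e) \<longrightarrow>
            ideal_height (mpoly_ring V) (minors_ideal V 2 X) = enat (n - 1) \<longrightarrow>
            has_linear_powers V (minors_ideal V 2 X)) \<and>
         (\<forall>a :: nat list. a \<noteq> [] \<longrightarrow> (\<forall>c \<in> set a. 0 < c) \<longrightarrow>
            has_linear_powers (scroll_vars a) (scroll_ideal a :: (nat \<times> nat, 'k) mpoly set))"
proof (intro conjI allI impI)
  fix V :: "'v set" and n and M :: "('v, 'k) mpoly mat"
  assume V: "finite V" and n: "2 \<le> n" and M: "M \<in> carrier_mat 2 n" "\<forall>e \<in> elements_mat M. linear_form V e"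
    and height: "ideal_height (mpoly_ring V) (minors_ideal V 2 M) = enat (n - 1)"
  have "gpos V n (entries n M)" using n height by (intro gpos_of_height[OF V _ M]) auto
  then show "has_linear_powers V (minors_ideal V 2 M)" using n by (intro linear_powers_of_gpos[OF V _ M]) auto
next
  \<comment> \<open>For scrolls the section condition is verified directly instead of computing a
    height.\<close>
  fix a :: "nat list" assume a: "a \<noteq> []" "\<forall>c \<in> set a. 0 < c"
  have "(0, 0) \<in> set (scroll_index a)" using a by (cases a) (auto simp: set_scroll_index)
  then have "0 < length (scroll_index a)" by (rule length_pos_if_in_set)
  then show "has_linear_powers (scroll_vars a) (scroll_ideal a :: (nat \<times> nat, 'k) mpoly set)"
    unfolding scroll_ideal_def using gpos_scroll[OF a] scroll_matrix_linear
    by (intro linear_powers_of_gpos[OF finite_scroll_vars _ scroll_matrix_carrier]) auto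
qed

end
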